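(* Let $M$ be a manifold and $\mathfrak{L}=\Omega^{\bullet\ge1}(M)[3]\oplus\chi^\bullet(M)[2]$ with the $L_\infty[1]$-algebra structure given in the context, whose Maurer-Cartan set is $MC(\mathfrak{L})=\{(H,\pi)\in\Omega^3_{closed}(M)\oplus\chi^2(M):\pi\text{ is an }H\text{-twisted Poisson structure}\}$. The leaves of the involutive singular distribution $$\mathrm{span}\{\mathcal{Y}^{(B,X)}:(B,X)\in\mathfrak{L}_{-1}=\Omega^2(M)\oplus\chi(M)\}$$ on $MC(\mathfrak{L})$ coincide with the orbits of the partial action of $\Omega^2(M)\rtimes\mathrm{Diff}(M)_\circ$ on $MC(\mathfrak{L})$ given by $(B,\phi)\cdot(H,\pi)=((\phi^{-1})^*(H)-dB,\ e^B\phi_*\pi)$.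
   Context: $V[n]_i=V_{i+n}$. $\chi^a(M)$ denotes $a$-vector fields, $\chi(M)=\chi^1(M)$, $[\cdot,\cdot]$ the Schouten bracket ($[X,\cdot]=\mathcal{L}_X$ for a vector field $X$). For $\pi\in\wedge^aTM$, $a\ge1$: $\pi^\sharp:T^*M\to\wedge^{a-1}TM$, $\xi\mapsto\iota_\xi\pi$; for $\pi_i\in\wedge^{a_i}TM$, $a_i\ge1$: $(\pi_1^\sharp\wedge\dots\wedge\pi_n^\sharp)(\xi_1\wedge\dots\wedge\xi_n)=\sum_{\sigma\in S_n}(-1)^\sigma\pi_1^\sharp(\xi_{\sigma(1)})\wedge\dots\wedge\pi_n^\sharp(\xi_{\sigma(n)})$. For closed $H\in\Omega^3(M)$, a bivector field $\pi$ is an $H$-twisted Poisson structure if $[\pi,\pi]=\frac13(\pi^\sharp\wedge\pi^\sharp\wedge\pi^\sharp)H$. An $L_\infty[1]$-algebra is a graded vector space with graded symmetric degree $1$ multibrackets $m_k=\{\cdots\}$, $k\ge1$, satisfying the relations $\sum_{i+j=n+1,\,i,j\ge1}\sum_{\sigma\in S_{(i,n-i)}}\epsilon(\sigma)m_j(m_i(v_{\sigma(1)},\dots,v_{\sigma(i)}),v_{\sigma(i+1)},\dots,v_{\sigma(n)})=0$ ($\epsilon$ Koszul sign, unshuffles); Maurer-Cartan elements are degree $0$ elements $\alpha$ with $\sum_{n\ge1}\frac1{n!}\{\alpha,\dots,\alpha\}=0$. The structure on $\mathfrak{L}$ has as only non-vanishing multibrackets (up to permutation of entries): minus the de Rham differential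 on forms; $\{\pi_1,\pi_2\}=(-1)^{a_1+1}[\pi_1,\pi_2]$ for $\pi_i\in\chi^{a_i}(M)$; $\{H,\pi_1,\dots,\pi_n\}=(-1)^{\sum_ia_i(n-i)}(\pi_1^\sharp\wedge\dots\wedge\pi_n^\sharp)H$ for $n\ge1$, $H\in\Omega^n(M)$, $\pi_i\in\chi^{a_i}(M)$, $a_i\ge1$. For an $L_\infty[1]$-algebra $W$, each $z\in W_{-1}$ defines a vector field $\mathcal{Y}^z$ on $W_0$, $\mathcal{Y}^z|_m:=dz+\{z,m\}+\frac1{2!}\{z,m,m\}+\frac1{3!}\{z,m,m,m\}+\cdots$ (with $d=m_1$), which is tangent to $MC(W)$; the singular distribution on $MC(W)$ at $m$ is $\{\mathcal{Y}^z|_m:z\in W_{-1}\}$. Here $W=\mathfrak{L}$, $\mathfrak{L}_0=\Omega^3(M)\oplus\chi^2(M)$ and the sum is finite. $\mathrm{Diff}(M)_\circ$ is the group of diffeomorphisms isotopic to the identity; the product in $\Omega^2(M)\rtimes\mathrm{Diff}(M)_\circ$ is $(B_1,\phi_1)\cdot(B_2,\phi_2)=(B_1+(\phi_1^{-1})^*B_2,\phi_1\circ\phi_2)$. For $B\in\Omega^2(M)$, $e^B:TM\oplus T^*M\to TM\oplus T^*M$, $Y+\eta\mapsto Y+(\eta+\iota_YB)$, and $B^\flat:TM\to T^*M$ is $Y\mapsto\iota_YB$. For a bivector field $\pi$ with $1+B^\flat\pi^\sharp:T^*M\to T^*M$ invertible, $e^B\pi$ is the unique bivector field whose graph is $e^B(\mathrm{graph}(\pi))$,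 $\mathrm{graph}(\pi)=\{\pi^\sharp\xi+\xi\}$. The action is partial: $(B,\phi)\cdot(H,\pi)$ is defined whenever $1+B^\flat(\phi_*\pi)^\sharp$ is invertible.
   Formalization: Orbits use only group elements joined to the identity by a smooth path on which the action on the point is defined; leaves are traced by smooth tangent paths in MC whose time-dependent field -X_t has a global flow (automatic for compact M). The literal readings fail on T^2 and on noncompact M. *)

theory Defs
  imports "HOL-Analysis.Analysis"
begin

section \<open>Smooth manifolds\<close>

text \<open>\<open>S\<close> is meant to be open. On the finite-dimensional spaces used here, a map is of class
  \<open>C\<^sup>k\<^sup>+\<^sup>1\<close> iff it is differentiable and all its directional derivatives are of class \<open>C\<^sup>k\<close>.\<close>

primrec Ck_on :: "nat \<Rightarrow> 'a::real_normed_vector set \<Rightarrow> ('a \<Rightarrow> 'b::real_normed_vector) \<Rightarrow> bool" where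
  "Ck_on 0 S f \<longleftrightarrow> continuous_on S f"
| "Ck_on (Suc k) S f \<longleftrightarrow> (\<forall>x\<in>S. f differentiable (at x)) \<and>
     (\<forall>v. Ck_on k S (\<lambda>x. frechet_derivative f (at x) v))"

definition smooth_on :: "'a::real_normed_vector set \<Rightarrow> ('a \<Rightarrow> 'b::real_normed_vector) \<Rightarrow> bool" where
  "smooth_on S f \<longleftrightarrow> (\<forall>k. Ck_on k S f)"

type_synonym ('m, 'e) chart = "'m set \<times> ('m \<Rightarrow> 'e)"
type_synonym ('m, 'e) atlas = "('m, 'e) chart set"

definition cimage :: "('m, 'e) chart \<Rightarrow> 'e set" where
  "cimage c = snd c ` fst c"

definition cinv :: "('m, 'e) chart \<Rightarrow> 'e \<Rightarrow> 'm" where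
  "cinv c = inv_into (fst c) (snd c)"

text \<open>The manifold is the whole type \<open>'m\<close> (Hausdorff and second countable by its sort in the theorem),
  modelled on \<open>'e\<close>.\<close>

definition smooth_atlas :: "('m::topological_space, 'e::euclidean_space) atlas \<Rightarrow> bool" where
  "smooth_atlas A \<longleftrightarrow> (\<Union>c\<in>A. fst c) = UNIV \<and>
     (\<forall>c\<in>A. open (fst c) \<and> open (cimage c) \<and> homeomorphism (fst c) (cimage c) (snd c) (cinv c)) \<and>
     (\<forall>c\<in>A. \<forall>c'\<in>A. smooth_on (snd c ` (fst c \<inter> fst c')) (snd c' \<circ> cinv c))"

text \<open>The tangent space at \<open>p\<close> is represented by the model space \<open>'e\<close>, via the differential of one
  selected chart around \<open>p\<close>, and the cotangent space by the dual of \<open>'e\<close>. Smoothness, the de Rham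
  differential and the Schouten bracket are therefore always computed after rewriting a field in the
  coordinates of a single chart; the results do not depend on the selection.\<close>

definition chart_at :: "('m, 'e) atlas \<Rightarrow> 'm \<Rightarrow> ('m, 'e) chart" where
  "chart_at A p = (SOME c. c \<in> A \<and> p \<in> fst c)"

definition coord :: "('m, 'e) atlas \<Rightarrow> 'm \<Rightarrow> 'm \<Rightarrow> 'e" where
  "coord A p = snd (chart_at A p)"

text \<open>The isomorphism from coordinate vectors of the chart \<open>c\<close> at \<open>q\<close> to the tangent space at \<open>q\<close>,
  and its inverse.\<close>

definition from_chart :: "('m, 'e::euclidean_space) atlas \<Rightarrow> ('m, 'e) chart \<Rightarrow> 'm \<Rightarrow> 'e \<Rightarrow> 'e" where
  "from_chart A c q = frechet_derivative (coord A q \<circ> cinv c) (at (snd c q))"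

definition to_chart :: "('m, 'e::euclidean_space) atlas \<Rightarrow> ('m, 'e) chart \<Rightarrow> 'm \<Rightarrow> 'e \<Rightarrow> 'e" where
  "to_chart A c q = frechet_derivative (snd c \<circ> cinv (chart_at A q)) (at (coord A q q))"

definition tangent_map :: "('m, 'e::euclidean_space) atlas \<Rightarrow> ('m \<Rightarrow> 'm) \<Rightarrow> 'm \<Rightarrow> 'e \<Rightarrow> 'e" where
  "tangent_map A \<phi> p =
     frechet_derivative (coord A (\<phi> p) \<circ> \<phi> \<circ> cinv (chart_at A p)) (at (coord A p p))"

definition smooth_map :: "('m::topological_space, 'e::euclidean_space) atlas \<Rightarrow> ('m \<Rightarrow> 'm) \<Rightarrow> bool" where
  "smooth_map A \<phi> \<longleftrightarrow> continuous_on UNIV \<phi> \<and>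
     (\<forall>c\<in>A. \<forall>c'\<in>A. smooth_on (snd c ` (fst c \<inter> \<phi> -` fst c')) (snd c' \<circ> \<phi> \<circ> cinv c))"

definition diffeo :: "('m::topological_space, 'e::euclidean_space) atlas \<Rightarrow> ('m \<Rightarrow> 'm) \<Rightarrow> bool" where
  "diffeo A \<phi> \<longleftrightarrow> bij \<phi> \<and> smooth_map A \<phi> \<and> smooth_map A (inv \<phi>)"

text \<open>Smooth one-parameter families are indexed by all of \<open>\<real>\<close>. A family over \<open>[0,1]\<close> can be
  reparametrized by a smooth monotone step function, which is 0 near \<open>t \<le> 0\<close> and 1 near \<open>t \<ge> 1\<close>,
  so this loses nothing when only the values at \<open>t = 0\<close> and \<open>t = 1\<close> matter.\<close>

definition smooth_map_family ::
    "('m::topological_space, 'e::euclidean_space) atlas \<Rightarrow> (real \<Rightarrow> 'm \<Rightarrow> 'm) \<Rightarrow> bool" where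
  "smooth_map_family A \<Phi> \<longleftrightarrow> continuous_on UNIV (\<lambda>(p, t). \<Phi> t p) \<and>
     (\<forall>c\<in>A. \<forall>c'\<in>A. smooth_on {(x, t). x \<in> cimage c \<and> \<Phi> t (cinv c x) \<in> fst c'}
        (\<lambda>(x, t). snd c' (\<Phi> t (cinv c x))))"

definition isotopy ::
    "('m::topological_space, 'e::euclidean_space) atlas \<Rightarrow> (real \<Rightarrow> 'm \<Rightarrow> 'm) \<Rightarrow> bool" where
  "isotopy A \<Phi> \<longleftrightarrow> \<Phi> 0 = id \<and> (\<forall>t. diffeo A (\<Phi> t)) \<and> smooth_map_family A \<Phi>"

definition Diff0 :: "('m::topological_space, 'e::euclidean_space) atlas \<Rightarrow> ('m \<Rightarrow> 'm) set" where
  "Diff0 A = {\<phi>. \<exists>\<Phi>. isotopy A \<Phi> \<and> \<Phi> 1 = \<phi>}"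


section \<open>Exterior algebra of a fibre\<close>

text \<open>A possibly inhomogeneous element of the exterior algebra over \<open>V\<^sup>*\<close> is a function on lists over
  \<open>V\<close>; its component of degree \<open>k\<close> is the restriction to lists of length \<open>k\<close>. Multivectors are treated
  in the same way, as functions on lists of covectors.\<close>

type_synonym 'e covec = "'e \<Rightarrow>\<^sub>L real"
type_synonym ('m, 'e) form_field = "'m \<Rightarrow> 'e list \<Rightarrow> real"
type_synonym ('m, 'e) mvec_field = "'m \<Rightarrow> 'e covec list \<Rightarrow> real"

definition alternating :: "nat \<Rightarrow> ('v::real_vector list \<Rightarrow> real) \<Rightarrow> bool" where
  "alternating k F \<longleftrightarrow> (\<forall>vs. length vs \<noteq> k \<longrightarrow> F vs = 0) \<and>
     (\<forall>us ws. length us + 1 + length ws = k \<longrightarrow> linear (\<lambda>v. F (us @ v # ws))) \<and>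
     (\<forall>vs. \<not> distinct vs \<longrightarrow> F vs = 0)"

definition comp :: "nat \<Rightarrow> ('m \<Rightarrow> 'v list \<Rightarrow> real) \<Rightarrow> 'm \<Rightarrow> 'v list \<Rightarrow> real" where
  "comp k F p vs = (if length vs = k then F p vs else 0)"

definition remove_nth :: "nat \<Rightarrow> 'v list \<Rightarrow> 'v list" where
  "remove_nth i vs = take i vs @ drop (Suc i) vs"

text \<open>The sign of the unshuffle of \<open>0,\<dots>,n-1\<close> that puts the elements of \<open>I\<close> first.\<close>

definition unshuffle_sign :: "nat \<Rightarrow> nat set \<Rightarrow> real" where
  "unshuffle_sign n I = (- 1) ^ card {(i, j). i \<in> I \<and> j \<in> {..<n} - I \<and> j < i}"

text \<open>Conventions: \<open>(\<xi>\<^sub>1 \<and> \<dots> \<and> \<xi>\<^sub>n)(v\<^sub>1,\<dots>,v\<^sub>n) = det (\<xi>\<^sub>i(v\<^sub>j))\<close>, and contraction inserts into the first slot.\<close>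

definition wedge :: "('v list \<Rightarrow> real) \<Rightarrow> ('v list \<Rightarrow> real) \<Rightarrow> 'v list \<Rightarrow> real" where
  "wedge F G vs = (\<Sum>I\<in>Pow {..<length vs}.
     unshuffle_sign (length vs) I * F (nths vs I) * G (nths vs (- I)))"

definition wedge_list :: "('v list \<Rightarrow> real) list \<Rightarrow> 'v list \<Rightarrow> real" where
  "wedge_list Fs = foldr wedge Fs (\<lambda>vs. if vs = [] then 1 else 0)"

definition dual :: "'e::euclidean_space \<Rightarrow> 'e covec" where
  "dual b = Blinfun (\<lambda>w. w \<bullet> b)"

text \<open>The vector given by the degree 1 component of a multivector.\<close>

definition vec :: "('e::euclidean_space covec list \<Rightarrow> real) \<Rightarrow> 'e" where
  "vec P = (\<Sum>b\<in>Basis. P [dual b] *\<^sub>R b)"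

definition sharp :: "('e::euclidean_space covec list \<Rightarrow> real) \<Rightarrow> 'e covec \<Rightarrow> 'e covec list \<Rightarrow> real" where
  "sharp P \<xi> = (\<lambda>\<eta>s. P (\<xi> # \<eta>s))"

definition flat :: "('e::euclidean_space list \<Rightarrow> real) \<Rightarrow> 'e \<Rightarrow> 'e covec" where
  "flat B Y = Blinfun (\<lambda>w. B [Y, w])"

text \<open>The value of \<open>P\<^sub>1\<^sup>\<sharp> \<and> \<dots> \<and> P\<^sub>n\<^sup>\<sharp>\<close> on \<open>\<xi>\<^sub>1 \<and> \<dots> \<and> \<xi>\<^sub>n\<close>, and its linear extension to an arbitrary
  \<open>n\<close>-covector \<open>h = 1/n! \<cdot> \<Sum> h(b\<^sub>1,\<dots>,b\<^sub>n) b\<^sub>1\<^sup>* \<and> \<dots> \<and> b\<^sub>n\<^sup>*\<close>.\<close>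

definition sharp_wedge_dec ::
    "('e::euclidean_space covec list \<Rightarrow> real) list \<Rightarrow> 'e covec list \<Rightarrow> 'e covec list \<Rightarrow> real" where
  "sharp_wedge_dec Ps \<xi>s \<eta>s = (\<Sum>\<sigma> | \<sigma> permutes {..<length Ps}.
     of_int (sign \<sigma>) *
     wedge_list (map (\<lambda>i. sharp (Ps ! i) (\<xi>s ! \<sigma> i)) [0..<length Ps]) \<eta>s)"

definition sharp_wedge ::
    "('e::euclidean_space covec list \<Rightarrow> real) list \<Rightarrow> ('e list \<Rightarrow> real) \<Rightarrow> 'e covec list \<Rightarrow> real" where
  "sharp_wedge Ps h \<eta>s = 1 / fact (length Ps) *
     (\<Sum>bs | length bs = length Ps \<and> set bs \<subseteq> Basis.
        h bs * sharp_wedge_dec Ps (map dual bs) \<eta>s)"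


section \<open>Differential forms and multivector fields\<close>

definition form_in ::
    "('m, 'e::euclidean_space) atlas \<Rightarrow> ('m, 'e) chart \<Rightarrow> ('m, 'e) form_field \<Rightarrow> 'e \<Rightarrow> 'e list \<Rightarrow> real" where
  "form_in A c \<omega> x vs = \<omega> (cinv c x) (map (from_chart A c (cinv c x)) vs)"

definition mvec_in ::
    "('m, 'e::euclidean_space) atlas \<Rightarrow> ('m, 'e) chart \<Rightarrow> ('m, 'e) mvec_field \<Rightarrow> 'e \<Rightarrow> 'e covec list \<Rightarrow> real" where
  "mvec_in A c P x \<xi>s =
     P (cinv c x) (map (\<lambda>\<xi>. \<xi> o\<^sub>L Blinfun (to_chart A c (cinv c x))) \<xi>s)"

definition forms :: "('m, 'e::euclidean_space) atlas \<Rightarrow> nat \<Rightarrow> ('m, 'e) form_field set" where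
  "forms A k = {\<omega>. (\<forall>p. alternating k (\<omega> p)) \<and>
     (\<forall>c\<in>A. \<forall>vs. smooth_on (cimage c) (\<lambda>x. form_in A c \<omega> x vs))}"

definition mvecs :: "('m, 'e::euclidean_space) atlas \<Rightarrow> nat \<Rightarrow> ('m, 'e) mvec_field set" where
  "mvecs A k = {P. (\<forall>p. alternating k (P p)) \<and>
     (\<forall>c\<in>A. \<forall>\<xi>s. smooth_on (cimage c) (\<lambda>x. mvec_in A c P x \<xi>s))}"

definition smooth_form_family ::
    "('m, 'e::euclidean_space) atlas \<Rightarrow> nat \<Rightarrow> (real \<Rightarrow> ('m, 'e) form_field) \<Rightarrow> bool" where
  "smooth_form_family A k \<omega> \<longleftrightarrow> (\<forall>t. \<omega> t \<in> forms A k) \<and>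
     (\<forall>c\<in>A. \<forall>vs. smooth_on (cimage c \<times> UNIV) (\<lambda>(x, t). form_in A c (\<omega> t) x vs))"

definition smooth_mvec_family ::
    "('m, 'e::euclidean_space) atlas \<Rightarrow> nat \<Rightarrow> (real \<Rightarrow> ('m, 'e) mvec_field) \<Rightarrow> bool" where
  "smooth_mvec_family A k P \<longleftrightarrow> (\<forall>t. P t \<in> mvecs A k) \<and>
     (\<forall>c\<in>A. \<forall>\<xi>s. smooth_on (cimage c \<times> UNIV) (\<lambda>(x, t). mvec_in A c (P t) x \<xi>s))"

definition pullback ::
    "('m, 'e::euclidean_space) atlas \<Rightarrow> ('m \<Rightarrow> 'm) \<Rightarrow> ('m, 'e) form_field \<Rightarrow> ('m, 'e) form_field" where
  "pullback A \<phi> \<omega> p vs = \<omega> (\<phi> p) (map (tangent_map A \<phi> p) vs)"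

definition pushforward ::
    "('m, 'e::euclidean_space) atlas \<Rightarrow> ('m \<Rightarrow> 'm) \<Rightarrow> ('m, 'e) mvec_field \<Rightarrow> ('m, 'e) mvec_field" where
  "pushforward A \<phi> P q \<xi>s =
     P (inv \<phi> q) (map (\<lambda>\<xi>. \<xi> o\<^sub>L Blinfun (tangent_map A \<phi> (inv \<phi> q))) \<xi>s)"

definition de_rham :: "('m, 'e::euclidean_space) atlas \<Rightarrow> ('m, 'e) form_field \<Rightarrow> ('m, 'e) form_field" where
  "de_rham A \<omega> p vs = (\<Sum>i<length vs. (- 1) ^ i *
     frechet_derivative (\<lambda>x. form_in A (chart_at A p) \<omega> x (remove_nth i vs)) (at (coord A p p)) (vs ! i))"

text \<open>The Schouten bracket of \<open>P\<close> of degree \<open>a\<close> and \<open>Q\<close> of degree \<open>b\<close>. As multiderivations,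
  \<open>[P,Q] = (-1)\<^bsup>(a-1)(b-1)\<^esup> P \<circ> Q - Q \<circ> P\<close> with
  \<open>(P \<circ> Q)(f\<^sub>1,\<dots>) = \<Sum> \<plusminus> P(Q(f\<^sub>\<sigma>\<^sub>1,\<dots>,f\<^sub>\<sigma>\<^sub>b), f\<^sub>\<sigma>\<^sub>b\<^sub>+\<^sub>1,\<dots>)\<close> over unshuffles; below this is evaluated on the
  differentials of functions that are linear in the chart. It satisfies \<open>[X,\<cdot>] = L\<^sub>X\<close> and
  \<open>[P, Q \<and> R] = [P,Q] \<and> R + (-1)\<^bsup>(a-1)b\<^esup> Q \<and> [P,R]\<close>.\<close>

definition insertion ::
    "('m, 'e::euclidean_space) atlas \<Rightarrow> ('m, 'e) mvec_field \<Rightarrow> ('m, 'e) mvec_field \<Rightarrow> ('m, 'e) mvec_field" where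
  "insertion A P Q p \<xi>s = (\<Sum>I\<in>Pow {..<length \<xi>s}. unshuffle_sign (length \<xi>s) I *
     P p (Blinfun (frechet_derivative
            (\<lambda>x. mvec_in A (chart_at A p) Q x (nths \<xi>s I)) (at (coord A p p)))
          # nths \<xi>s (- I)))"

definition schouten ::
    "('m, 'e::euclidean_space) atlas \<Rightarrow> nat \<Rightarrow> nat \<Rightarrow> ('m, 'e) mvec_field \<Rightarrow> ('m, 'e) mvec_field
      \<Rightarrow> ('m, 'e) mvec_field" where
  "schouten A a b P Q p \<xi>s =
     (- 1) ^ ((a + 1) * (b + 1)) * insertion A P Q p \<xi>s - insertion A Q P p \<xi>s"


section \<open>The \<open>L\<^sub>\<infinity>[1]\<close>-algebra\<close>

text \<open>An element is a pair of an inhomogeneous form (of degrees \<open>\<ge> 1\<close>) and an inhomogeneous multivector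
  field. Forms of degree \<open>n\<close> have degree \<open>n - 3\<close>, multivector fields of degree \<open>a\<close> have degree \<open>a - 2\<close>.\<close>

type_synonym ('m, 'e) Lelem = "('m, 'e) form_field \<times> ('m, 'e) mvec_field"

text \<open>\<open>{v\<^sub>0,\<dots>,v\<^sub>n}\<close> restricted to the form component \<open>H\<close> of \<open>v\<^sub>i\<close> and the multivector components of all
  other entries. Moving \<open>H\<close> to the front gives the Koszul sign with exponent
  \<open>(n-3) \<cdot> \<Sum>\<^sub>j\<^sub><\<^sub>i (a\<^sub>j - 2)\<close>, which has the parity of \<open>(n+1) \<cdot> \<Sum>\<^sub>j\<^sub><\<^sub>i a\<^sub>j\<close>.\<close>

definition mixed_bracket ::
    "nat \<Rightarrow> ('m, 'e::euclidean_space) Lelem list \<Rightarrow> ('m, 'e) mvec_field" where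
  "mixed_bracket i vs p \<eta>s =
     (let n = length vs - 1; H = comp n (fst (vs ! i)); Ps = map snd (remove_nth i vs) in
      \<Sum>as | length as = n \<and> set as \<subseteq> {1..DIM('e)}.
        (- 1) ^ ((n + 1) * (\<Sum>j<i. as ! j)) *
        (- 1) ^ (\<Sum>j<n. as ! j * (n - Suc j)) *
        sharp_wedge (map (\<lambda>j. comp (as ! j) (Ps ! j) p) [0..<n]) (H p) \<eta>s)"

text \<open>The multibracket \<open>m\<^sub>k\<close> applied to a list of \<open>k\<close> elements. All sums over degrees stop at the
  dimension, above which forms and multivector fields vanish.\<close>

definition multibracket ::
    "('m, 'e::euclidean_space) atlas \<Rightarrow> ('m, 'e) Lelem list \<Rightarrow> ('m, 'e) Lelem" where
  "multibracket A vs =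
     ((\<lambda>p ws. if length vs = 1 then - de_rham A (fst (vs ! 0)) p ws else 0),
      (\<lambda>p \<eta>s.
         (if length vs = 2 then
            \<Sum>a\<le>DIM('e). \<Sum>b\<le>DIM('e). (- 1) ^ (a + 1) *
              schouten A a b (comp a (snd (vs ! 0))) (comp b (snd (vs ! 1))) p \<eta>s
          else 0) +
         (if length vs \<ge> 2 then \<Sum>i<length vs. mixed_bracket i vs p \<eta>s else 0)))"

definition twisted_poisson ::
    "('m, 'e::euclidean_space) atlas \<Rightarrow> ('m, 'e) form_field \<Rightarrow> ('m, 'e) mvec_field \<Rightarrow> bool" where
  "twisted_poisson A H P \<longleftrightarrow>
     (\<forall>p \<eta>s. schouten A 2 2 P P p \<eta>s = 1 / 3 * sharp_wedge [P p, P p, P p] (H p) \<eta>s)"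

definition MC :: "('m, 'e::euclidean_space) atlas \<Rightarrow> ('m, 'e) Lelem set" where
  "MC A = {(H, P). H \<in> forms A 3 \<and> (\<forall>p vs. de_rham A H p vs = 0) \<and> P \<in> mvecs A 2 \<and>
     twisted_poisson A H P}"

text \<open>The vector field \<open>\<Y>\<^sup>z\<close>. The terms with \<open>k > DIM('e)\<close> vanish, since \<open>m\<^sub>k\<^sub>+\<^sub>1\<close> involves forms of
  degree \<open>k\<close>.\<close>

definition gauge_field ::
    "('m, 'e::euclidean_space) atlas \<Rightarrow> ('m, 'e) Lelem \<Rightarrow> ('m, 'e) Lelem \<Rightarrow> ('m, 'e) Lelem" where
  "gauge_field A z m =
     ((\<lambda>p vs. \<Sum>k\<le>DIM('e). 1 / fact k * fst (multibracket A (z # replicate k m)) p vs),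
      (\<lambda>p \<eta>s. \<Sum>k\<le>DIM('e). 1 / fact k * snd (multibracket A (z # replicate k m)) p \<eta>s))"


section \<open>Leaves\<close>

text \<open>A time-dependent vector field is complete if it generates a global flow.\<close>

definition complete_vf ::
    "('m::topological_space, 'e::euclidean_space) atlas \<Rightarrow> (real \<Rightarrow> ('m, 'e) mvec_field) \<Rightarrow> bool" where
  "complete_vf A W \<longleftrightarrow> (\<exists>\<Phi>. isotopy A \<Phi> \<and>
     (\<forall>t p. ((\<lambda>s. coord A (\<Phi> t p) (\<Phi> s p)) has_vector_derivative vec (W t (\<Phi> t p))) (at t)))"

text \<open>A smooth path in the Maurer-Cartan set which is tangent to the distribution: its velocity at time
  \<open>t\<close> is \<open>\<Y>\<^bsup>(B\<^sub>t,X\<^sub>t)\<^esup>\<close>, for a smooth family \<open>(B\<^sub>t,X\<^sub>t)\<close> in degree -1. Since \<open>{X,P} = L\<^sub>X P\<close>, such a path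
  transports tensors along the flow of \<open>-X\<^sub>t\<close>, which is required to exist. This is automatic on a compact
  manifold. On other manifolds the paths of incomplete fields are not determined by their starting point,
  as tensors can flow in from infinity. Every vector field is a sum of complete ones, so the distribution
  is spanned by the \<open>\<Y>\<^bsup>(B,X)\<^esup>\<close> with \<open>X\<close> complete.\<close>

definition tangent_path ::
    "('m::topological_space, 'e::euclidean_space) atlas \<Rightarrow> (real \<Rightarrow> ('m, 'e) Lelem) \<Rightarrow> bool" where
  "tangent_path A c \<longleftrightarrow>
     (\<forall>t. c t \<in> MC A) \<and>
     smooth_form_family A 3 (\<lambda>t. fst (c t)) \<and> smooth_mvec_family A 2 (\<lambda>t. snd (c t)) \<and>
     (\<exists>B X. smooth_form_family A 2 B \<and> smooth_mvec_family A 1 X \<and>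
        complete_vf A (\<lambda>t p \<eta>s. - X t p \<eta>s) \<and>
        (\<forall>t p vs. ((\<lambda>s. fst (c s) p vs) has_real_derivative
                     fst (gauge_field A (B t, X t) (c t)) p vs) (at t)) \<and>
        (\<forall>t p \<eta>s. ((\<lambda>s. snd (c s) p \<eta>s) has_real_derivative
                     snd (gauge_field A (B t, X t) (c t)) p \<eta>s) (at t)))"

definition leaf ::
    "('m::topological_space, 'e::euclidean_space) atlas \<Rightarrow> ('m, 'e) Lelem \<Rightarrow> ('m, 'e) Lelem set" where
  "leaf A m = {c 1 |c. tangent_path A c \<and> c 0 = m}"


section \<open>The partial action\<close>

definition graph :: "('e::euclidean_space covec list \<Rightarrow> real) \<Rightarrow> ('e \<times> 'e covec) set" where
  "graph P = {(vec (sharp P \<xi>), \<xi>) |\<xi>. True}"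

definition exp_form :: "('e::euclidean_space list \<Rightarrow> real) \<Rightarrow> 'e \<times> 'e covec \<Rightarrow> 'e \<times> 'e covec" where
  "exp_form B = (\<lambda>(Y, \<eta>). (Y, \<eta> + flat B Y))"

definition gauge_invertible ::
    "('m, 'e::euclidean_space) form_field \<Rightarrow> ('m, 'e) mvec_field \<Rightarrow> bool" where
  "gauge_invertible B P \<longleftrightarrow> (\<forall>p. bij (\<lambda>\<xi>. \<xi> + flat (B p) (vec (sharp (P p) \<xi>))))"

definition gauge_transform ::
    "('m, 'e::euclidean_space) atlas \<Rightarrow> ('m, 'e) form_field \<Rightarrow> ('m, 'e) mvec_field \<Rightarrow> ('m, 'e) mvec_field" where
  "gauge_transform A B P =
     (THE P'. P' \<in> mvecs A 2 \<and> (\<forall>p. graph (P' p) = exp_form (B p) ` graph (P p)))"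

type_synonym ('m, 'e) group_elem = "('m, 'e) form_field \<times> ('m \<Rightarrow> 'm)"

definition gauge_group ::
    "('m::topological_space, 'e::euclidean_space) atlas \<Rightarrow> ('m, 'e) group_elem set" where
  "gauge_group A = forms A 2 \<times> Diff0 A"

definition act_defined ::
    "('m, 'e::euclidean_space) atlas \<Rightarrow> ('m, 'e) group_elem \<Rightarrow> ('m, 'e) Lelem \<Rightarrow> bool" where
  "act_defined A = (\<lambda>(B, \<phi>) (H, P). gauge_invertible B (pushforward A \<phi> P))"

definition act ::
    "('m, 'e::euclidean_space) atlas \<Rightarrow> ('m, 'e) group_elem \<Rightarrow> ('m, 'e) Lelem \<Rightarrow> ('m, 'e) Lelem" where
  "act A = (\<lambda>(B, \<phi>) (H, P).
     ((\<lambda>p vs. pullback A (inv \<phi>) H p vs - de_rham A B p vs),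
      gauge_transform A B (pushforward A \<phi> P)))"

text \<open>The orbits are those of a partial action of a connected group: a group element counts if it is
  joined to the identity by a smooth path along which the action on \<open>m\<close> is defined. Without this
  condition, on a surface the elements \<open>(0, P)\<close> and \<open>(0, -P)\<close> with \<open>P\<close> nowhere vanishing would always lie
  in one orbit, although no path in the Maurer-Cartan set tangent to the distribution joins them on the
  2-torus.\<close>

definition group_path ::
    "('m::topological_space, 'e::euclidean_space) atlas \<Rightarrow> (real \<Rightarrow> ('m, 'e) group_elem) \<Rightarrow> bool" where
  "group_path A g \<longleftrightarrow> (\<forall>t. g t \<in> gauge_group A) \<and> g 0 = ((\<lambda>p vs. 0), id) \<and>
     smooth_form_family A 2 (\<lambda>t. fst (g t)) \<and> smooth_map_family A (\<lambda>t. snd (g t))"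

definition orbit ::
    "('m::topological_space, 'e::euclidean_space) atlas \<Rightarrow> ('m, 'e) Lelem \<Rightarrow> ('m, 'e) Lelem set" where
  "orbit A m = {act A (g 1) m |g. group_path A g \<and> (\<forall>t. act_defined A (g t) m)}"

end

theory Submission
  imports Defs
begin

text \<open>At a Maurer-Cartan element \<open>(H, P)\<close> the vector field is
  \<open>\<Y>\<^bsup>(B,X)\<^esup> = (- dB, L\<^sub>X P + \<beta>(P\<^sup>\<sharp>\<cdot>, P\<^sup>\<sharp>\<cdot>))\<close> with \<open>\<beta> = B + \<iota>\<^sub>X H\<close>, and \<open>- dB = L\<^sub>X H - d\<beta>\<close> since
  \<open>H\<close> is closed. Let \<open>\<Phi>\<close> be the flow of \<open>- X\<^sub>t\<close>. Transporting a tangent path \<open>(H\<^sub>t, P\<^sub>t)\<close> back along \<open>\<Phi>\<^sub>t\<close>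
  removes the Lie derivatives: with \<open>\<beta>'\<^sub>t = \<Phi>\<^sub>t\<^sup>* \<beta>\<^sub>t\<close>, the pulled back path \<open>(K\<^sub>t, Q\<^sub>t)\<close> satisfies
  \<open>K' = - d\<beta>'\<close> and, pointwise on the manifold, \<open>Q' = \<beta>'(Q\<^sup>\<sharp>\<cdot>, Q\<^sup>\<sharp>\<cdot>)\<close>. For \<open>b\<^sub>t = \<integral>\<^sub>0\<^sup>t \<beta>'\<close> this forces
  \<open>K\<^sub>t = H\<^sub>0 - db\<^sub>t\<close> and \<open>Q\<^sub>t = e\<^sup>b P\<^sub>0\<close>: the relation \<open>Q\<^sup>\<sharp> (1 + b\<^sup>\<flat> P\<^sub>0\<^sup>\<sharp>) = P\<^sub>0\<^sup>\<sharp>\<close> propagates from \<open>t = 0\<close> by a linear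
  differential equation and makes \<open>1 + b\<^sup>\<flat> P\<^sub>0\<^sup>\<sharp>\<close> invertible. So the path is the orbit curve of
  \<open>((\<Phi>\<^sub>t\<^sup>-\<^sup>1)\<^sup>* b\<^sub>t, \<Phi>\<^sub>t)\<close>. Conversely, the same computation, read backwards, shows that an orbit curve is
  tangent to the distribution; it stays in the Maurer-Cartan set because \<open>e\<^sup>b\<close> changes the Jacobiator of
  a bivector field by \<open>db\<close>.\<close>

section \<open>Calculus of smooth maps\<close>

text \<open>The equation for Q is quadratic, but no space derivatives are left in it, so its
  solution is identified fibre by fibre: with Q given, the defect in the relation defining e^b P
  satisfies a linear equation and vanishes by Gronwall's estimate. No existence theorem for flows is
  used; the isotopy comes from \<open>complete_vf\<close> or from the group path. Pullback along a
  flow of W produces +L_W, so the term L_X P is removed by a flow of -X. The obstacle is that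
  tangent spaces are represented through selected charts, which do not vary continuously: no field
  can be differentiated as it stands. Identities are proved for coordinate expressions in one chart,
  with time as one more coordinate, and carried over by naturality; a change of charts is treated as
  pullback along the identity. Pushing fields forward along \<Phi>_t evaluates them at preimages, so
  the inverse family must be jointly smooth. Constants: [P, P] is twice the Jacobiator and the
  triple sharp map gives -6 H on the anchors, so the twisted condition reads: Jacobiator = -H on the
  anchors.\<close>

abbreviation D :: "('a::real_normed_vector \<Rightarrow> 'b::real_normed_vector) \<Rightarrow> 'a \<Rightarrow> 'a \<Rightarrow> 'b" where
  "D f x \<equiv> frechet_derivative f (at x)"

section \<open>Closure properties of the classes C^k\<close>

lemma D_eqI: "(f has_derivative f') (at x) \<Longrightarrow> D f x = f'"
  by (metis frechet_derivative_at)

text \<open>Functions that agree near x have the same derivatives there, so the choice operator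
  inside \<open>frechet_derivative\<close> returns the same map for both, even where no derivative
  exists.\<close>

lemma D_cong:
  assumes "open S" "x \<in> S" "\<And>y. y \<in> S \<Longrightarrow> f y = g y"
  shows "D f x = D g x"
proof -
  have "(f has_derivative f') (at x) \<longleftrightarrow> (g has_derivative f') (at x)" for f'
    using has_derivative_transform_within_open[OF _ assms(1,2)] assms(3) by metis
  then show ?thesis unfolding frechet_derivative_def by simp
qed

lemma differentiable_cong_open:
  assumes "open S" "x \<in> S" "\<And>y. y \<in> S \<Longrightarrow> f y = g y"
  shows "f differentiable (at x) \<longleftrightarrow> g differentiable (at x)"
  unfolding differentiable_def
  using has_derivative_transform_within_open[OF _ assms(1,2)] assms(3) by metis

lemma Ck_on_cong:
  assumes "open S" "\<And>x. x \<in> S \<Longrightarrow> f x = g x"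
  shows "Ck_on k S f \<longleftrightarrow> Ck_on k S g"
  using assms(2)
proof (induction k arbitrary: f g)
  case 0
  then show ?case by (simp cong: continuous_on_cong)
next
  case (Suc k)
  have "D f x = D g x" if "x \<in> S" for x
    using D_cong[OF assms(1) that Suc.prems] by auto
  then have "Ck_on k S (\<lambda>x. D f x v) \<longleftrightarrow> Ck_on k S (\<lambda>x. D g x v)" for v
    by (intro Suc.IH) auto
  moreover have "f differentiable (at x) \<longleftrightarrow> g differentiable (at x)" if "x \<in> S" for x
    by (rule differentiable_cong_open[OF assms(1) that Suc.prems])
  ultimately show ?case by auto
qed

lemma Ck_on_subset: "Ck_on k S f \<Longrightarrow> T \<subseteq> S \<Longrightarrow> Ck_on k T f"
  by (induction k arbitrary: f) (auto intro: continuous_on_subset)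

lemma Ck_on_imp_continuous: "Ck_on k S f \<Longrightarrow> continuous_on S f"
  by (cases k) (auto intro!: continuous_at_imp_continuous_on differentiable_imp_continuous_within)

lemma Ck_on_SucD: "Ck_on (Suc k) S f \<Longrightarrow> Ck_on k S f"
  by (induction k arbitrary: f)
    (auto intro!: continuous_at_imp_continuous_on differentiable_imp_continuous_within)

text \<open>Replaces the chosen derivative by an explicit one. The closure rules for C^k are
  inductions in which this rule is fed the formula of the corresponding differentiation
  rule.\<close>

lemma Ck_on_SucI:
  assumes "open S" "\<And>x. x \<in> S \<Longrightarrow> (f has_derivative f' x) (at x)"
    "\<And>v. Ck_on k S (\<lambda>x. f' x v)"
  shows "Ck_on (Suc k) S f"
proof -
  have "D f x = f' x" if "x \<in> S" for x using D_eqI assms(2) that by blast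
  then have "Ck_on k S (\<lambda>x. D f x v)" for v
    using Ck_on_cong[OF assms(1), of "\<lambda>x. D f x v" "\<lambda>x. f' x v"] assms(3) by auto
  with assms(2) show ?thesis by (auto simp: differentiable_def)
qed

lemma Ck_on_Suc_derivative:
  "Ck_on (Suc k) S f \<Longrightarrow> x \<in> S \<Longrightarrow> (f has_derivative D f x) (at x)"
  using frechet_derivative_works by auto

lemma Ck_on_const: "open S \<Longrightarrow> Ck_on k S (\<lambda>x. c)"
proof (induction k arbitrary: c)
  case (Suc k)
  show ?case by (rule Ck_on_SucI[where f' = "\<lambda>x v. 0"]) (use Suc in auto)
qed auto

lemma Ck_on_bounded_linear_compose:
  assumes "open S" "bounded_linear h"
  shows "Ck_on k S f \<Longrightarrow> Ck_on k S (\<lambda>x. h (f x))"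
proof (induction k arbitrary: f)
  case 0
  then show ?case using bounded_linear.continuous_on[OF assms(2)] by auto
next
  case (Suc k)
  show ?case
    by (rule Ck_on_SucI[OF assms(1), where f' = "\<lambda>x v. h (D f x v)"])
      (use Suc bounded_linear.has_derivative[OF assms(2) Ck_on_Suc_derivative[OF Suc.prems]] in auto)
qed

lemma Ck_on_add:
  assumes "open S" shows "Ck_on k S f \<Longrightarrow> Ck_on k S g \<Longrightarrow> Ck_on k S (\<lambda>x. f x + g x)"
proof (induction k arbitrary: f g)
  case 0
  then show ?case by (auto intro: continuous_intros)
next
  case (Suc k)
  show ?case
    by (rule Ck_on_SucI[OF assms(1), where f' = "\<lambda>x v. D f x v + D g x v"])
      (use Suc has_derivative_add[OF Ck_on_Suc_derivative[OF Suc.prems(1)] Ck_on_Suc_derivative[OF Suc.prems(2)]] in auto)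
qed

lemma Ck_on_sum:
  assumes "open S" "\<And>i. i \<in> I \<Longrightarrow> Ck_on k S (f i)"
  shows "Ck_on k S (\<lambda>x. \<Sum>i\<in>I. f i x)"
  using assms(2)
  by (induction I rule: infinite_finite_induct) (auto intro!: Ck_on_const Ck_on_add assms(1))

lemma Ck_on_bilinear:
  assumes "open S" "bounded_bilinear h"
  shows "Ck_on k S f \<Longrightarrow> Ck_on k S g \<Longrightarrow> Ck_on k S (\<lambda>x. h (f x) (g x))"
proof (induction k arbitrary: f g)
  case 0
  then show ?case using bounded_bilinear.continuous_on[OF assms(2)] by auto
next
  case (Suc k)
  show ?case
  proof (rule Ck_on_SucI[OF assms(1), where f' = "\<lambda>x v. h (f x) (D g x v) + h (D f x v) (g x)"])
    show "((\<lambda>x. h (f x) (g x)) has_derivative (\<lambda>v. h (f x) (D g x v) + h (D f x v) (g x))) (at x)"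
      if "x \<in> S" for x
      using bounded_bilinear.FDERIV[OF assms(2) Ck_on_Suc_derivative[OF Suc.prems(1) that] Ck_on_Suc_derivative[OF Suc.prems(2) that]] .
    show "Ck_on k S (\<lambda>x. h (f x) (D g x v) + h (D f x v) (g x))" for v
      using Suc.prems Ck_on_SucD[OF Suc.prems(1)] Ck_on_SucD[OF Suc.prems(2)]
      by (intro Ck_on_add assms(1) Suc.IH) auto
  qed
qed

lemma euclidean_linear_sum:
  fixes L :: "'a::euclidean_space \<Rightarrow> 'b::real_vector"
  assumes "linear L" shows "L v = (\<Sum>b\<in>Basis. (v \<bullet> b) *\<^sub>R L b)"
proof -
  have "L v = L (\<Sum>b\<in>Basis. (v \<bullet> b) *\<^sub>R b)" by (simp add: euclidean_representation)
  then show ?thesis using assms by (simp add: linear_sum linear_scale)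
qed

text \<open>In the chain rule \<open>D g (f x) (D f x v)\<close> both the base point and the
  direction move, while \<open>Ck_on\<close> speaks of fixed directions. Expanding the direction
  over \<open>Basis\<close> gives a sum of products of C^k functions; this is why the intermediate
  space is Euclidean.\<close>

lemma Ck_on_compose:
  fixes f :: "'a::real_normed_vector \<Rightarrow> 'b::euclidean_space"
  assumes "open S" "open T" "f ` S \<subseteq> T"
  shows "Ck_on k S f \<Longrightarrow> Ck_on k T g \<Longrightarrow> Ck_on k S (\<lambda>x. g (f x))"
proof (induction k arbitrary: g)
  case 0
  then show ?case using assms(3) by (auto intro: continuous_on_compose2)
next
  case (Suc k)
  show ?case
  proof (rule Ck_on_SucI[OF assms(1), where f' = "\<lambda>x v. \<Sum>b\<in>Basis. (D f x v \<bullet> b) *\<^sub>R D g (f x) b"])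
    fix x assume x: "x \<in> S"
    then have "f x \<in> T" using assms(3) by auto
    then have g: "(g has_derivative D g (f x)) (at (f x))" using Ck_on_Suc_derivative[OF Suc.prems(2)] by auto
    have "((\<lambda>x. g (f x)) has_derivative (\<lambda>v. D g (f x) (D f x v))) (at x)"
      using has_derivative_compose[OF Ck_on_Suc_derivative[OF Suc.prems(1) x] g] .
    moreover have "D g (f x) (D f x v) = (\<Sum>b\<in>Basis. (D f x v \<bullet> b) *\<^sub>R D g (f x) b)" for v
      using euclidean_linear_sum has_derivative_linear[OF g] by blast
    ultimately show "((\<lambda>x. g (f x)) has_derivative (\<lambda>v. \<Sum>b\<in>Basis. (D f x v \<bullet> b) *\<^sub>R D g (f x) b)) (at x)"
      by simp
  next
    fix v
    have "Ck_on k S (\<lambda>x. D g (f x) b)" for b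
      using Suc.prems(2) by (intro Suc.IH[OF Ck_on_SucD[OF Suc.prems(1)]]) auto
    moreover have "Ck_on k S (\<lambda>x. D f x v \<bullet> b)" for b
      using Suc.prems(1) by (intro Ck_on_bounded_linear_compose[OF assms(1) bounded_linear_inner_left]) auto
    ultimately show "Ck_on k S (\<lambda>x. \<Sum>b\<in>Basis. (D f x v \<bullet> b) *\<^sub>R D g (f x) b)"
      by (intro Ck_on_sum assms(1) Ck_on_bilinear[OF _ bounded_bilinear_scaleR]) auto
  qed
qed

section \<open>The same rules for smooth maps, and locality of smoothness\<close>

lemma smooth_on_cong:
  "open S \<Longrightarrow> (\<And>x. x \<in> S \<Longrightarrow> f x = g x) \<Longrightarrow> smooth_on S f \<longleftrightarrow> smooth_on S g"
  unfolding smooth_on_def using Ck_on_cong by blast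

lemma smooth_on_eqI:
  "open S \<Longrightarrow> smooth_on S g \<Longrightarrow> (\<And>x. x \<in> S \<Longrightarrow> f x = g x) \<Longrightarrow> smooth_on S f"
  using smooth_on_cong by blast

lemma smooth_on_subset: "smooth_on S f \<Longrightarrow> T \<subseteq> S \<Longrightarrow> smooth_on T f"
  unfolding smooth_on_def using Ck_on_subset by blast

lemma smooth_on_continuous: "smooth_on S f \<Longrightarrow> continuous_on S f"
  unfolding smooth_on_def using Ck_on_imp_continuous by blast

lemma smooth_on_has_derivative: "smooth_on S f \<Longrightarrow> x \<in> S \<Longrightarrow> (f has_derivative D f x) (at x)"
  unfolding smooth_on_def using Ck_on_Suc_derivative by blast

lemma smooth_on_D: "smooth_on S f \<Longrightarrow> smooth_on S (\<lambda>x. D f x v)"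
  unfolding smooth_on_def by (metis Ck_on.simps(2))

lemma smooth_on_linear_D: "smooth_on S f \<Longrightarrow> x \<in> S \<Longrightarrow> linear (D f x)"
  using smooth_on_has_derivative has_derivative_linear by blast

lemma smooth_on_const: "open S \<Longrightarrow> smooth_on S (\<lambda>x. c)"
  unfolding smooth_on_def using Ck_on_const by blast

lemma smooth_on_bounded_linear_compose:
  "open S \<Longrightarrow> bounded_linear h \<Longrightarrow> smooth_on S f \<Longrightarrow> smooth_on S (\<lambda>x. h (f x))"
  unfolding smooth_on_def using Ck_on_bounded_linear_compose by blast

lemma smooth_on_add:
  "open S \<Longrightarrow> smooth_on S f \<Longrightarrow> smooth_on S g \<Longrightarrow> smooth_on S (\<lambda>x. f x + g x)"
  unfolding smooth_on_def using Ck_on_add by blast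

lemma smooth_on_minus: "open S \<Longrightarrow> smooth_on S f \<Longrightarrow> smooth_on S (\<lambda>x. - f x)"
  by (rule smooth_on_bounded_linear_compose[OF _ bounded_linear_minus[OF bounded_linear_ident]])

lemma smooth_on_sum:
  "open S \<Longrightarrow> (\<And>i. i \<in> I \<Longrightarrow> smooth_on S (f i)) \<Longrightarrow> smooth_on S (\<lambda>x. \<Sum>i\<in>I. f i x)"
  unfolding smooth_on_def using Ck_on_sum[of S I _ f] by auto

lemma smooth_on_bilinear:
  "open S \<Longrightarrow> bounded_bilinear h \<Longrightarrow> smooth_on S f \<Longrightarrow> smooth_on S g \<Longrightarrow> smooth_on S (\<lambda>x. h (f x) (g x))"
  unfolding smooth_on_def using Ck_on_bilinear by blast

lemmas smooth_on_scaleR = smooth_on_bilinear[OF _ bounded_bilinear_scaleR]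
lemmas smooth_on_mult = smooth_on_bilinear[OF _ bounded_bilinear_mult]
lemmas smooth_on_inner = smooth_on_bilinear[OF _ bounded_bilinear_inner]

lemma smooth_on_compose:
  fixes f :: "'a::real_normed_vector \<Rightarrow> 'b::euclidean_space"
  assumes "open S" "open T" "f ` S \<subseteq> T" "smooth_on S f" "smooth_on T g"
  shows "smooth_on S (\<lambda>x. g (f x))"
  using assms Ck_on_compose unfolding smooth_on_def by blast

lemma smooth_on_id: "open S \<Longrightarrow> smooth_on S (\<lambda>x. x)"
  unfolding smooth_on_def
proof
  fix k assume S: "open S"
  show "Ck_on k S (\<lambda>x. x)"
  proof (cases k)
    case (Suc j)
    show ?thesis unfolding Suc
      by (rule Ck_on_SucI[where f' = "\<lambda>x v. v"]) (auto intro!: Ck_on_const S)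
  qed (auto intro: continuous_on_id)
qed

lemma smooth_on_linear: "open S \<Longrightarrow> bounded_linear h \<Longrightarrow> smooth_on S h"
  using smooth_on_bounded_linear_compose[OF _ _ smooth_on_id] by blast

lemma smooth_on_fst: "open S \<Longrightarrow> smooth_on S (\<lambda>z. fst z)"
  and smooth_on_snd: "open S \<Longrightarrow> smooth_on S (\<lambda>z. snd z)"
  by (auto intro: smooth_on_linear bounded_linear_fst bounded_linear_snd)

lemma smooth_on_Pair:
  assumes "open S" "smooth_on S f" "smooth_on S g"
  shows "smooth_on S (\<lambda>x. (f x, g x))"
proof -
  have "bounded_linear (\<lambda>a::'b. (a, 0::'c))" "bounded_linear (\<lambda>a::'c. (0::'b, a))"
    by (auto intro: bounded_linear_Pair bounded_linear_ident bounded_linear_zero)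
  then have "smooth_on S (\<lambda>x. (f x, 0) + (0, g x))"
    using assms by (intro smooth_on_add) (auto intro: smooth_on_bounded_linear_compose)
  then show ?thesis by simp
qed

lemma smooth_on_local:
  assumes "\<And>x. x \<in> S \<Longrightarrow> \<exists>U. open U \<and> x \<in> U \<and> smooth_on U f"
  shows "smooth_on S f"
proof -
  have "Ck_on k S f" if "\<And>x. x \<in> S \<Longrightarrow> \<exists>U. open U \<and> x \<in> U \<and> Ck_on k U f" for k
    using that
  proof (induction k arbitrary: f)
    case 0
    show ?case unfolding Ck_on.simps
    proof (rule continuous_at_imp_continuous_on, rule ballI)
      fix x assume "x \<in> S"
      then obtain U where "open U" "x \<in> U" "continuous_on U f" using 0 by auto
      then show "isCont f x" by (simp add: continuous_on_eq_continuous_at)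
    qed
  next
    case (Suc k)
    have "f differentiable (at x)" if "x \<in> S" for x
      using Suc.prems[OF that] by auto
    moreover have "Ck_on k S (\<lambda>x. D f x v)" for v
      using Suc.prems by (intro Suc.IH) fastforce
    ultimately show ?case by simp
  qed
  then show ?thesis using assms unfolding smooth_on_def by blast
qed

lemma D_compose:
  assumes "smooth_on S f" "x \<in> S" "smooth_on T g" "f x \<in> T"
  shows "D (\<lambda>x. g (f x)) x v = D g (f x) (D f x v)"
  using D_eqI[OF has_derivative_compose[OF smooth_on_has_derivative[OF assms(1,2)] smooth_on_has_derivative[OF assms(3,4)]]]
  by simp

lemma smooth_on_D_apply:
  fixes g :: "'b::euclidean_space \<Rightarrow> 'c::real_normed_vector"
  assumes "open S" "open T" "f ` S \<subseteq> T" "smooth_on S f" "smooth_on T g" "smooth_on S u"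
  shows "smooth_on S (\<lambda>x. D g (f x) (u x))"
proof -
  have "D g (f x) (u x) = (\<Sum>b\<in>Basis. (u x \<bullet> b) *\<^sub>R D g (f x) b)" if "x \<in> S" for x
    using euclidean_linear_sum smooth_on_linear_D[OF assms(5)] assms(3) that by blast
  moreover have "smooth_on S (\<lambda>x. \<Sum>b\<in>Basis. (u x \<bullet> b) *\<^sub>R D g (f x) b)"
    using assms(1,6)
    by (intro smooth_on_sum smooth_on_scaleR smooth_on_inner smooth_on_const
        smooth_on_compose[OF assms(1-4) smooth_on_D[OF assms(5)]])
  ultimately show ?thesis by (rule smooth_on_eqI[OF assms(1), rotated])
qed

subsection \<open>Multilinear expressions\<close>

text \<open>A finite coordinate system of a finite-dimensional normed space; it allows to treat vectors and
  covectors alike, since \<open>'e covec\<close> is not of sort \<open>euclidean_space\<close>.\<close>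

definition coords :: "'i set \<Rightarrow> ('i \<Rightarrow> 'v::real_normed_vector) \<Rightarrow> ('i \<Rightarrow> 'v \<Rightarrow> real) \<Rightarrow> bool" where
  "coords I e l \<longleftrightarrow> finite I \<and> (\<forall>i\<in>I. bounded_linear (l i)) \<and> (\<forall>v. v = (\<Sum>i\<in>I. l i v *\<^sub>R e i))"

lemma coords_euclidean: "coords Basis (\<lambda>b. b) (\<lambda>b v. v \<bullet> (b::'a::euclidean_space))"
  unfolding coords_def by (auto intro: bounded_linear_inner_left simp: euclidean_representation)

lemma coords_functional: "coords I e l \<Longrightarrow> i \<in> I \<Longrightarrow> bounded_linear (l i)"
  unfolding coords_def by blast

lemma coords_linear:
  fixes e :: "'i \<Rightarrow> 'v::real_normed_vector" and f :: "'v \<Rightarrow> 'w::real_vector"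
  assumes "coords I e l" "linear f" shows "f v = (\<Sum>i\<in>I. l i v *\<^sub>R f (e i))"
proof -
  have "f v = f (\<Sum>i\<in>I. l i v *\<^sub>R e i)" using assms(1) unfolding coords_def by metis
  then show ?thesis using assms(2) by (simp add: linear_sum linear_scale)
qed

lemma coords_bounded_linear:
  fixes e :: "'i \<Rightarrow> 'v::real_normed_vector" and f :: "'v \<Rightarrow> 'w::real_normed_vector"
  assumes "coords I e l" "linear f" shows "bounded_linear f"
proof -
  have "bounded_linear (\<lambda>v. \<Sum>i\<in>I. l i v *\<^sub>R f (e i))"
    by (intro bounded_linear_sum bounded_linear_scaleR_const coords_functional[OF assms(1)])
  moreover have "(\<lambda>v. \<Sum>i\<in>I. l i v *\<^sub>R f (e i)) = f"
    by (rule ext) (rule coords_linear[OF assms, symmetric])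
  ultimately show ?thesis by (rule back_subst)
qed

text \<open>Linearity and a finite coordinate system reduce a moving argument to finitely many fixed
  ones: the coordinates of \<open>g x\<close> become factors in front of
  \<open>F x (e i)\<close>.\<close>

lemma smooth_on_slot:
  fixes e :: "'i \<Rightarrow> 'v::real_normed_vector" and F :: "'a::real_normed_vector \<Rightarrow> 'v \<Rightarrow> 'w::real_normed_vector"
  assumes c: "coords I e l" and S: "open S" and lin: "\<And>x. x \<in> S \<Longrightarrow> linear (F x)"
    and F: "\<And>v. smooth_on S (\<lambda>x. F x v)" and g: "smooth_on S g"
  shows "smooth_on S (\<lambda>x. F x (g x))"
proof -
  have "F x (g x) = (\<Sum>i\<in>I. l i (g x) *\<^sub>R F x (e i))" if "x \<in> S" for x
    using coords_linear[OF c lin[OF that]] .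
  moreover have "smooth_on S (\<lambda>x. \<Sum>i\<in>I. l i (g x) *\<^sub>R F x (e i))"
    by (intro smooth_on_sum S smooth_on_scaleR F smooth_on_bounded_linear_compose[OF S coords_functional[OF c] g])
  ultimately show ?thesis by (rule smooth_on_eqI[OF S, rotated])
qed

lemma has_derivative_slot:
  fixes e :: "'i \<Rightarrow> 'v::real_normed_vector" and F :: "'a::real_normed_vector \<Rightarrow> 'v \<Rightarrow> 'w::real_normed_vector"
  assumes c: "coords I e l" and S: "open S" "x \<in> S" and lin: "\<And>y. y \<in> S \<Longrightarrow> linear (F y)"
    and F: "\<And>v. ((\<lambda>y. F y v) has_derivative F' v) (at x)" and g: "(g has_derivative g') (at x)"
  shows "((\<lambda>y. F y (g y)) has_derivative (\<lambda>h. F' (g x) h + F x (g' h))) (at x)"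
proof -
  note l = coords_functional[OF c]
  have "((\<lambda>y. \<Sum>i\<in>I. l i v *\<^sub>R F y (e i)) has_derivative (\<lambda>h. \<Sum>i\<in>I. l i v *\<^sub>R F' (e i) h)) (at x)" for v
    by (intro has_derivative_sum has_derivative_scaleR_right F)
  then have "((\<lambda>y. F y v) has_derivative (\<lambda>h. \<Sum>i\<in>I. l i v *\<^sub>R F' (e i) h)) (at x)" for v
    by (rule has_derivative_transform_within_open[OF _ S]) (use coords_linear[OF c lin] in auto)
  \<comment> \<open>\<open>F'\<close> is an arbitrary choice of derivatives; its linear expansion in
    v is forced by uniqueness of derivatives, applied to the expansion of
    \<open>F y v\<close>.\<close>
  then have F': "F' v = (\<lambda>h. \<Sum>i\<in>I. l i v *\<^sub>R F' (e i) h)" for v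
    using has_derivative_unique[OF F] by blast
  have "((\<lambda>y. \<Sum>i\<in>I. l i (g y) *\<^sub>R F y (e i)) has_derivative
      (\<lambda>h. \<Sum>i\<in>I. l i (g x) *\<^sub>R F' (e i) h + l i (g' h) *\<^sub>R F x (e i))) (at x)"
    by (intro has_derivative_sum has_derivative_scaleR F bounded_linear.has_derivative[OF l g])
  then have "((\<lambda>y. F y (g y)) has_derivative
      (\<lambda>h. \<Sum>i\<in>I. l i (g x) *\<^sub>R F' (e i) h + l i (g' h) *\<^sub>R F x (e i))) (at x)"
    by (rule has_derivative_transform_within_open[OF _ S]) (use coords_linear[OF c lin] in auto)
  moreover have "(\<Sum>i\<in>I. l i (g x) *\<^sub>R F' (e i) h + l i (g' h) *\<^sub>R F x (e i)) = F' (g x) h + F x (g' h)" for h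
    using coords_linear[OF c lin[OF S(2)], of "g' h"] F'[of "g x"] by (simp add: sum.distrib)
  ultimately show ?thesis by (simp only:)
qed

definition multilinear :: "nat \<Rightarrow> ('v::real_vector list \<Rightarrow> real) \<Rightarrow> bool" where
  "multilinear k F \<longleftrightarrow> (\<forall>us ws. length us + 1 + length ws = k \<longrightarrow> linear (\<lambda>v. F (us @ v # ws)))"

text \<open>The prefix \<open>us\<close> holds frozen slots. Freezing the first moving slot at v
  reduces to the induction hypothesis, and \<open>smooth_on_slot\<close> then lets v move.\<close>

lemma smooth_on_multilinear_aux:
  fixes e :: "'i \<Rightarrow> 'v::real_normed_vector" and F :: "'a::real_normed_vector \<Rightarrow> 'v list \<Rightarrow> real"
  assumes c: "coords I e l" and S: "open S" and lin: "\<And>x. x \<in> S \<Longrightarrow> multilinear k (F x)"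
    and F: "\<And>vs. smooth_on S (\<lambda>x. F x vs)"
  shows "length us + length gs = k \<Longrightarrow> \<forall>g\<in>set gs. smooth_on S g \<Longrightarrow>
    smooth_on S (\<lambda>x. F x (us @ map (\<lambda>g. g x) gs))"
proof (induction gs arbitrary: us)
  case Nil
  then show ?case using F by simp
next
  case (Cons g gs)
  have "smooth_on S (\<lambda>x. F x (us @ v # map (\<lambda>g. g x) gs))" for v
    using Cons.IH[of "us @ [v]"] Cons.prems by simp
  moreover have "linear (\<lambda>v. F x (us @ v # map (\<lambda>g. g x) gs))" if "x \<in> S" for x
    using lin[OF that] Cons.prems(1) unfolding multilinear_def by simp
  moreover have "smooth_on S g" using Cons.prems by simp
  ultimately show ?case
    using smooth_on_slot[OF c S, of "\<lambda>x v. F x (us @ v # map (\<lambda>g. g x) gs)" g] by simp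
qed

lemma smooth_on_multilinear:
  fixes e :: "'i \<Rightarrow> 'v::real_normed_vector" and F :: "'a::real_normed_vector \<Rightarrow> 'v list \<Rightarrow> real"
  assumes "coords I e l" "open S" "\<And>x. x \<in> S \<Longrightarrow> multilinear (length gs) (F x)"
    "\<And>vs. smooth_on S (\<lambda>x. F x vs)" "\<And>g. g \<in> set gs \<Longrightarrow> smooth_on S g"
  shows "smooth_on S (\<lambda>x. F x (map (\<lambda>g. g x) gs))"
  using smooth_on_multilinear_aux[OF assms(1-4), of "[]" gs] assms(5) by auto

lemma has_derivative_multilinear_aux:
  fixes e :: "'i \<Rightarrow> 'v::real_normed_vector" and F :: "'a::real_normed_vector \<Rightarrow> 'v list \<Rightarrow> real"
  assumes c: "coords I e l" and S: "open S" "x \<in> S" and lin: "\<And>x. x \<in> S \<Longrightarrow> multilinear k (F x)"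
    and F: "\<And>vs. ((\<lambda>x. F x vs) has_derivative F' vs) (at x)"
    and g: "\<And>g. g \<in> set gs \<Longrightarrow> (g has_derivative g' g) (at x)"
  shows "length us + length gs = k \<Longrightarrow>
    ((\<lambda>x. F x (us @ map (\<lambda>g. g x) gs)) has_derivative (\<lambda>h. F' (us @ map (\<lambda>g. g x) gs) h +
       (\<Sum>i<length gs. F x (us @ (map (\<lambda>g. g x) gs)[i := g' (gs ! i) h])))) (at x)"
  using g
proof (induction gs arbitrary: us)
  case Nil
  then show ?case using F by simp
next
  case (Cons a gs)
  let ?m = "\<lambda>x. map (\<lambda>g. g x) gs"
  have IH: "((\<lambda>x. F x (us @ v # ?m x)) has_derivative (\<lambda>h. F' (us @ v # ?m x) h +
       (\<Sum>i<length gs. F x (us @ v # (?m x)[i := g' (gs ! i) h])))) (at x)" for v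
    using Cons.IH[of "us @ [v]"] Cons.prems by simp
  have lin': "linear (\<lambda>v. F x (us @ v # ?m x))" if "x \<in> S" for x
    using lin[OF that] Cons.prems(1) unfolding multilinear_def by simp
  have a: "(a has_derivative g' a) (at x)" using Cons.prems by simp
  have "((\<lambda>x. F x (us @ a x # ?m x)) has_derivative (\<lambda>h. (F' (us @ a x # ?m x) h +
       (\<Sum>i<length gs. F x (us @ a x # (?m x)[i := g' (gs ! i) h]))) + F x (us @ g' a h # ?m x))) (at x)"
    by (rule has_derivative_slot[OF c S lin' IH a])
  then show ?case
    by (simp only: length_Cons sum.lessThan_Suc_shift list.map nth_Cons_0 nth_Cons_Suc
        list_update_code add_ac)
qed

lemma has_derivative_multilinear:
  fixes e :: "'i \<Rightarrow> 'v::real_normed_vector" and F :: "'a::real_normed_vector \<Rightarrow> 'v list \<Rightarrow> real"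
  assumes "coords I e l" "open S" "x \<in> S" "\<And>x. x \<in> S \<Longrightarrow> multilinear (length gs) (F x)"
    "\<And>vs. ((\<lambda>x. F x vs) has_derivative F' vs) (at x)"
    "\<And>g. g \<in> set gs \<Longrightarrow> (g has_derivative g' g) (at x)"
  shows "((\<lambda>x. F x (map (\<lambda>g. g x) gs)) has_derivative (\<lambda>h. F' (map (\<lambda>g. g x) gs) h +
       (\<Sum>i<length gs. F x ((map (\<lambda>g. g x) gs)[i := g' (gs ! i) h])))) (at x)"
  using has_derivative_multilinear_aux[where us = "[]", OF assms(1-6)] by simp

subsection \<open>Integrals depending on a parameter\<close>

lemma bounded_linear_Pair_left: "bounded_linear (\<lambda>v::'a::real_normed_vector. (v, 0::'b::real_normed_vector))"
  by (intro bounded_linear_Pair bounded_linear_ident bounded_linear_zero)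

lemma has_derivative_smooth_compose:
  assumes "smooth_on S g" "f x \<in> S" "(f has_derivative f') (at x within T)"
  shows "((\<lambda>x. g (f x)) has_derivative (\<lambda>v. D g (f x) (f' v))) (at x within T)"
  by (rule has_derivative_compose[OF assms(3) smooth_on_has_derivative[OF assms(1,2)]])

lemma has_derivative_slice:
  assumes "smooth_on S g" "(x, s) \<in> S"
  shows "((\<lambda>y. g (y, s)) has_derivative (\<lambda>v. D g (x, s) (v, 0))) (at x)"
proof -
  have "((\<lambda>y. (y, s)) has_derivative (\<lambda>v. (v, 0))) (at x)"
    by (intro has_derivative_Pair has_derivative_ident has_derivative_const)
  then show ?thesis
    using has_derivative_smooth_compose[OF assms(1), of "\<lambda>y. (y, s)" x] assms(2) by blast
qed

lemma has_derivative_integral_param: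
  fixes g :: "'a::euclidean_space \<times> real \<Rightarrow> 'b::euclidean_space"
  assumes U: "open U" and g: "smooth_on (U \<times> UNIV) g" and x: "x \<in> U"
  shows "((\<lambda>x. integral {0..1} (\<lambda>s. g (x, s))) has_derivative
    (\<lambda>v. integral {0..1} (\<lambda>s. D g (x, s) (v, 0)))) (at x)"
proof -
  obtain r where r: "r > 0" "ball x r \<subseteq> U" using U x openE by blast
  \<comment> \<open>\<open>leibniz_rule\<close> wants the partial derivative as a bounded operator
    that depends continuously on (y, s); continuity in operator norm is checked on basis
    vectors.\<close>
  define fx where "fx y s = Blinfun (\<lambda>v. D g (y, s) (v, 0))" for y s
  have fx: "blinfun_apply (fx y s) = (\<lambda>v. D g (y, s) (v, 0))" if "y \<in> U" for y s
  proof -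
    have "bounded_linear (D g (y, s))"
      using smooth_on_has_derivative[OF g] that has_derivative_bounded_linear by fastforce
    then have "bounded_linear (\<lambda>v. D g (y, s) (v, 0))"
      using bounded_linear_compose bounded_linear_Pair_left by blast
    then show ?thesis unfolding fx_def by (rule bounded_linear_Blinfun_apply)
  qed
  have contD: "continuous_on (U \<times> UNIV) (\<lambda>z. D g z v)" for v
    using smooth_on_continuous[OF smooth_on_D[OF g]] .
  have cont: "continuous_on (U \<times> UNIV) (\<lambda>(y, s). fx y s)"
  proof (rule continuous_on_blinfun_componentwise)
    fix i :: 'a
    show "continuous_on (U \<times> UNIV) (\<lambda>z. blinfun_apply (case z of (y, s) \<Rightarrow> fx y s) i)"
      using contD[of "(i, 0)"] by (rule continuous_on_eq) (auto simp: fx)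
  qed
  have contg: "continuous_on (cbox 0 1) (\<lambda>s. g (y, s))" if "y \<in> U" for y
    by (rule continuous_on_compose2[OF smooth_on_continuous[OF g]])
      (use that in \<open>auto intro!: continuous_intros\<close>)
  have "((\<lambda>x. integral (cbox 0 1) (\<lambda>s. g (x, s))) has_derivative
    blinfun_apply (integral (cbox 0 1) (fx x))) (at x within ball x r)"
  proof (rule leibniz_rule)
    show "((\<lambda>x. g (x, t)) has_derivative blinfun_apply (fx y t)) (at y within ball x r)"
      if "y \<in> ball x r" for y t
    proof -
      have "y \<in> U" using that r(2) by auto
      then show ?thesis
        using has_derivative_at_withinI[OF has_derivative_slice[OF g, of y t]] fx[of y t] by simp
    qed
    show "(\<lambda>s. g (y, s)) integrable_on cbox 0 1" if "y \<in> ball x r" for y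
      using contg r(2) that by (intro integrable_continuous) auto
    show "continuous_on (ball x r \<times> cbox 0 1) (\<lambda>(x, t). fx x t)"
      by (rule continuous_on_subset[OF cont]) (use r(2) in auto)
  qed (use r in auto)
  then have *: "((\<lambda>x. integral {0..1} (\<lambda>s. g (x, s))) has_derivative
    blinfun_apply (integral {0..1} (fx x))) (at x)"
    using at_within_open[of x "ball x r"] r by simp
  have "continuous_on {0..1} (fx x)"
  proof -
    have "continuous_on {0..1} (\<lambda>s::real. (x, s))" by (intro continuous_intros)
    then show ?thesis using continuous_on_compose2[OF cont, of "{0..1}" "\<lambda>s. (x, s)"] x by auto
  qed
  then have "fx x integrable_on {0..1}"
    using integrable_continuous_interval by blast
  then have "blinfun_apply (integral {0..1} (fx x)) = (\<lambda>v. integral {0..1} (\<lambda>s. D g (x, s) (v, 0)))"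
    using fx[OF x] by (simp add: blinfun_apply_integral fun_eq_iff)
  then show ?thesis using * by simp
qed

text \<open>The derivative is again an integral of the same shape, with \<open>D g\<close> in a
  direction (v, 0) as integrand, so the induction on k runs over all integrands.\<close>

lemma smooth_on_integral_param:
  fixes g :: "'a::euclidean_space \<times> real \<Rightarrow> 'b::euclidean_space"
  assumes U: "open U" and g: "smooth_on (U \<times> UNIV) g"
  shows "smooth_on U (\<lambda>x. integral {0..1} (\<lambda>s. g (x, s)))"
proof -
  have "Ck_on k U (\<lambda>x. integral {0..1} (\<lambda>s. g (x, s)))" for k
    using g
  proof (induction k arbitrary: g)
    case 0
    show ?case unfolding Ck_on.simps
      using has_derivative_integral_param[OF U 0] has_derivative_continuous
      by (blast intro: continuous_at_imp_continuous_on)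
  next
    case (Suc k)
    show ?case
    proof (rule Ck_on_SucI[OF U has_derivative_integral_param[OF U Suc.prems]])
      show "Ck_on k U (\<lambda>x. integral {0..1} (\<lambda>s. D g (x, s) (v, 0)))" for v
        using Suc.IH[OF smooth_on_D[OF Suc.prems]] .
    qed
  qed
  then show ?thesis unfolding smooth_on_def by blast
qed

text \<open>The product rule gives I + J t, with J the integral of s h'(t s). That this equals h t
  is seen by integrating the derivative of s h(t s) over s in [0, 1], an argument that treats all
  signs of t alike.\<close>

lemma has_real_derivative_scaled_integral:
  fixes h :: "real \<Rightarrow> real"
  assumes h: "smooth_on UNIV h"
  shows "((\<lambda>t. t * integral {0..1} (\<lambda>s. h (t * s))) has_real_derivative h t) (at t)"
proof -
  define g where "g = (\<lambda>z::real \<times> real. h (fst z * snd z))"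
  have mult: "smooth_on UNIV (\<lambda>z::real \<times> real. fst z * snd z)"
    by (intro smooth_on_mult smooth_on_fst smooth_on_snd) auto
  have g: "smooth_on (UNIV \<times> UNIV) g"
    unfolding g_def by (rule smooth_on_compose[OF _ _ _ _ h]) (use mult in auto)
  have h': "(h has_real_derivative D h s 1) (at s)" for s
  proof -
    have "D h s = (*) (D h s 1)"
    proof
      show "D h s v = D h s 1 * v" for v
        using linear_scale[OF smooth_on_linear_D[OF h], of s v 1] by simp
    qed
    then show ?thesis
      using smooth_on_has_derivative[OF h, of s] unfolding has_field_derivative_def by simp
  qed
  have Dg: "D g (t, s) (v, 0) = D h (t * s) 1 * (v * s)" for s v
  proof -
    have "(g has_derivative (\<lambda>w. D h (t * s) (fst w * s + t * snd w))) (at (t, s))"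
    proof -
      have "((\<lambda>z. fst z * snd z) has_derivative (\<lambda>w. fst w * s + t * snd w)) (at (t, s))"
        by (auto intro!: derivative_eq_intros)
      then show ?thesis
        using has_derivative_smooth_compose[OF h, of "\<lambda>z. fst z * snd z" "(t, s)"]
        unfolding g_def by simp
    qed
    then have "D g (t, s) (v, 0) = D h (t * s) ((v * s) *\<^sub>R 1)" by (simp add: D_eqI)
    also have "\<dots> = (v * s) * D h (t * s) 1"
      using linear_scale[OF smooth_on_linear_D[OF h], of "t * s" "v * s" 1] by simp
    finally show ?thesis by simp
  qed
  define I where "I = integral {0..1} (\<lambda>s. h (t * s))"
  define J where "J = integral {0..1} (\<lambda>s. D h (t * s) 1 * s)"
  have "((\<lambda>t. integral {0..1} (\<lambda>s. g (t, s))) has_derivative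
    (\<lambda>v. integral {0..1} (\<lambda>s. D g (t, s) (v, 0)))) (at t)"
    by (rule has_derivative_integral_param[OF _ g]) auto
  moreover have "integral {0..1} (\<lambda>s. D g (t, s) (v, 0)) = J * v" for v
    using integral_mult_left[of "{0..1}" "\<lambda>s. D h (t * s) 1 * s" v] unfolding J_def Dg
    by (simp add: mult_ac)
  ultimately have "((\<lambda>t. integral {0..1} (\<lambda>s. h (t * s))) has_real_derivative J) (at t)"
    unfolding has_field_derivative_def g_def by simp
  then have "((\<lambda>t. t * integral {0..1} (\<lambda>s. h (t * s))) has_real_derivative (I + J * t)) (at t)"
    unfolding I_def by (auto intro!: derivative_eq_intros)
  moreover have "I + J * t = h t"
  proof -
    have c: "continuous_on {0..1} (\<lambda>s. h (t * s))" "continuous_on {0..1} (\<lambda>s. D h (t * s) 1)"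
      by (rule continuous_on_compose2[OF smooth_on_continuous[OF h]]; auto intro!: continuous_intros)
        (rule continuous_on_compose2[OF smooth_on_continuous[OF smooth_on_D[OF h, of 1]]]; auto intro!: continuous_intros)
    have "((\<lambda>s. s * h (t * s)) has_vector_derivative (h (t * s) + D h (t * s) 1 * s * t)) (at s within {0..1})" for s
    proof -
      have "((\<lambda>s. h (t * s)) has_real_derivative D h (t * s) 1 * t) (at s)"
        by (rule DERIV_chain2[OF h']) (auto intro!: derivative_eq_intros)
      then have "((\<lambda>s. s * h (t * s)) has_real_derivative (s * (D h (t * s) 1 * t) + 1 * h (t * s))) (at s)"
        using DERIV_mult'[OF DERIV_ident] by blast
      moreover have "s * (D h (t * s) 1 * t) + 1 * h (t * s) = h (t * s) + D h (t * s) 1 * s * t"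
        by (simp only: mult_ac add_ac mult_1_left)
      ultimately show ?thesis
        unfolding has_real_derivative_iff_has_vector_derivative[symmetric]
        by (metis has_field_derivative_at_within)
    qed
    then have 1: "((\<lambda>s. h (t * s) + D h (t * s) 1 * s * t) has_integral (1 * h (t * 1) - 0 * h (t * 0))) {0..1}"
      by (intro fundamental_theorem_of_calculus) auto
    have "((\<lambda>s. h (t * s) + D h (t * s) 1 * s * t) has_integral (I + J * t)) {0..1}"
      unfolding I_def J_def using c
      by (intro has_integral_add has_integral_mult_left integrable_integral integrable_continuous_interval continuous_intros)
    then show ?thesis using has_integral_unique[OF 1] by simp
  qed
  ultimately show ?thesis by simp
qed

subsection \<open>Symmetry of second derivatives\<close>

lemma has_vector_derivative_line:
  assumes "smooth_on S f" "x + s *\<^sub>R u \<in> S"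
  shows "((\<lambda>s. f (x + s *\<^sub>R u)) has_vector_derivative D f (x + s *\<^sub>R u) u) (at s within T)"
proof -
  have "((\<lambda>s. x + s *\<^sub>R u) has_derivative (\<lambda>h. h *\<^sub>R u)) (at s within T)"
    by (auto intro!: derivative_eq_intros)
  then have "((\<lambda>s. f (x + s *\<^sub>R u)) has_derivative (\<lambda>h. D f (x + s *\<^sub>R u) (h *\<^sub>R u))) (at s within T)"
    using has_derivative_compose smooth_on_has_derivative[OF assms] by blast
  then show ?thesis
    using linear_scale[OF smooth_on_linear_D[OF assms], of _ u] unfolding has_vector_derivative_def by simp
qed

text \<open>The increment f(x + su + tv) - f(x + tv) is the integral of the u-derivative over
  [0, s]. Differentiating in t under the integral and then in s at 0 gives the mixed derivative in
  one order, differentiating the increment itself gives it in the other.\<close>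

lemma D_commute:
  fixes f :: "'a::euclidean_space \<Rightarrow> 'b::euclidean_space"
  assumes S: "open S" and f: "smooth_on S f" and x: "x \<in> S"
  shows "D (\<lambda>y. D f y u) x v = D (\<lambda>y. D f y v) x u"
proof -
  obtain r where r: "r > 0" "ball x r \<subseteq> S" using S x openE by blast
  \<comment> \<open>The factor 2 keeps the points with |s|, |t| at most d strictly inside the ball,
    and the summand 1 keeps the denominator positive when u and v vanish.\<close>
  define d where "d = r / (2 * (norm u + norm v + 1))"
  have d: "d > 0" using r(1) by (simp add: d_def add_nonneg_pos)
  have in_S: "x + s *\<^sub>R u + t *\<^sub>R v \<in> S" if "\<bar>s\<bar> \<le> d" "\<bar>t\<bar> \<le> d" for s t
  proof -
    have "norm (s *\<^sub>R u + t *\<^sub>R v) \<le> d * norm u + d * norm v"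
      using that by (intro norm_triangle_le add_mono) (auto intro!: mult_right_mono)
    also have "\<dots> \<le> d * (norm u + norm v + 1)" using d by (simp add: algebra_simps)
    also have "\<dots> < r" using r(1) unfolding d_def
      by (simp add: divide_simps add_nonneg_pos) (simp add: algebra_simps add_pos_nonneg)
    finally have "x + (s *\<^sub>R u + t *\<^sub>R v) \<in> ball x r" unfolding mem_ball dist_commute[of x] by (simp add: dist_norm)
    then show ?thesis using r(2) by (auto simp: add.assoc)
  qed
  define a where "a = (\<lambda>y. D f y u)"
  have a: "smooth_on S a" unfolding a_def by (rule smooth_on_D[OF f])
  have Dfv: "smooth_on S (\<lambda>y. D f y v)" by (rule smooth_on_D[OF f])
  define c where "c = (\<lambda>\<sigma>. D a (x + \<sigma> *\<^sub>R u) v)"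
  have int: "f (x + s *\<^sub>R u + t *\<^sub>R v) - f (x + t *\<^sub>R v) = integral (cbox 0 s) (\<lambda>\<sigma>. a (x + \<sigma> *\<^sub>R u + t *\<^sub>R v))"
    if "0 \<le> s" "s \<le> d" "\<bar>t\<bar> \<le> d" for s t
  proof -
    have "((\<lambda>s. f (x + s *\<^sub>R u + t *\<^sub>R v)) has_vector_derivative a (x + \<sigma> *\<^sub>R u + t *\<^sub>R v)) (at \<sigma> within {0..s})"
      if "\<sigma> \<in> {0..s}" for \<sigma>
      using has_vector_derivative_line[OF f, of "x + t *\<^sub>R v" \<sigma> u "{0..s}"] in_S[of \<sigma> t] that \<open>s \<le> d\<close> \<open>\<bar>t\<bar> \<le> d\<close>
      unfolding a_def by (simp add: algebra_simps)
    then have "((\<lambda>\<sigma>. a (x + \<sigma> *\<^sub>R u + t *\<^sub>R v)) has_integral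
        (f (x + s *\<^sub>R u + t *\<^sub>R v) - f (x + 0 *\<^sub>R u + t *\<^sub>R v))) {0..s}"
      using that by (intro fundamental_theorem_of_calculus) auto
    then show ?thesis by (simp add: integral_unique)
  qed
  have key: "D f (x + s *\<^sub>R u) v - D f x v = integral {0..s} c" if s: "0 \<le> s" "s \<le> d" for s
  proof -
    let ?U = "{-d<..<d}"
    have L: "((\<lambda>t. integral (cbox 0 s) (\<lambda>\<sigma>. a (x + \<sigma> *\<^sub>R u + t *\<^sub>R v))) has_vector_derivative
        integral (cbox 0 s) (\<lambda>\<sigma>. D a (x + \<sigma> *\<^sub>R u + 0 *\<^sub>R v) v)) (at 0 within ?U)"
    proof (rule leibniz_rule_vector_derivative)
      show "((\<lambda>t. a (x + \<sigma> *\<^sub>R u + t *\<^sub>R v)) has_vector_derivative D a (x + \<sigma> *\<^sub>R u + t *\<^sub>R v) v) (at t within ?U)"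
        if "t \<in> ?U" "\<sigma> \<in> cbox 0 s" for t \<sigma>
        using that s in_S[of \<sigma> t] by (intro has_vector_derivative_line[OF a]) auto
      show "(\<lambda>\<sigma>. a (x + \<sigma> *\<^sub>R u + t *\<^sub>R v)) integrable_on cbox 0 s" if "t \<in> ?U" for t
        using that s in_S
        by (intro integrable_continuous continuous_on_compose2[OF smooth_on_continuous[OF a]])
          (auto intro!: continuous_intros)
      show "continuous_on (?U \<times> cbox 0 s) (\<lambda>(t, \<sigma>). D a (x + \<sigma> *\<^sub>R u + t *\<^sub>R v) v)"
        unfolding case_prod_unfold using s in_S
        by (intro continuous_on_compose2[OF smooth_on_continuous[OF smooth_on_D[OF a, of v]]])
          (auto intro!: continuous_intros)
    qed (use d in auto)
    have 1: "((\<lambda>t. integral (cbox 0 s) (\<lambda>\<sigma>. a (x + \<sigma> *\<^sub>R u + t *\<^sub>R v))) has_vector_derivative integral {0..s} c) (at 0)"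
    proof -
      have "at (0::real) within ?U = at 0" using at_within_open[of 0 ?U] d by simp
      moreover have "(\<lambda>\<sigma>. D a (x + \<sigma> *\<^sub>R u + 0 *\<^sub>R v) v) = c" by (simp add: c_def)
      ultimately show ?thesis using L by simp
    qed
    have "((\<lambda>t. f (x + s *\<^sub>R u + t *\<^sub>R v) - f (x + t *\<^sub>R v)) has_vector_derivative
        (D f (x + s *\<^sub>R u + 0 *\<^sub>R v) v - D f (x + 0 *\<^sub>R v) v)) (at 0)"
      using in_S[of s 0] in_S[of 0 0] s d
      by (intro has_vector_derivative_diff has_vector_derivative_line[OF f]) auto
    then have "((\<lambda>t. integral (cbox 0 s) (\<lambda>\<sigma>. a (x + \<sigma> *\<^sub>R u + t *\<^sub>R v))) has_vector_derivative
        (D f (x + s *\<^sub>R u + 0 *\<^sub>R v) v - D f (x + 0 *\<^sub>R v) v)) (at 0)"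
      by (rule has_vector_derivative_transform_within_open[of _ _ _ ?U]) (use int s d in auto)
    then show ?thesis using vector_derivative_unique_at[OF 1] by simp
  qed
  \<comment> \<open>\<open>key\<close> holds for nonnegative s only, so the last differentiation is
    one-sided, within \<open>{0..d}\<close>; derivatives are still unique there because 0 is a limit
    point of the interval.\<close>
  have "continuous_on {0..d} c" unfolding c_def using in_S[of _ 0] 
    by (intro continuous_on_compose2[OF smooth_on_continuous[OF smooth_on_D[OF a, of v]]])
      (auto intro!: continuous_intros)
  then have "((\<lambda>s. integral {0..s} c) has_vector_derivative c 0) (at 0 within {0..d})"
    using integral_has_vector_derivative d by fastforce
  then have 1: "((\<lambda>s. D f (x + s *\<^sub>R u) v - D f x v) has_vector_derivative c 0) (at 0 within {0..d})"
    by (rule has_vector_derivative_transform[rotated 2]) (use key d in auto)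
  have "((\<lambda>s. D f (x + s *\<^sub>R u) v - D f x v) has_vector_derivative
      (D (\<lambda>y. D f y v) (x + 0 *\<^sub>R u) u - 0)) (at 0 within {0..d})"
    using x by (intro has_vector_derivative_diff has_vector_derivative_line[OF Dfv] has_vector_derivative_const) auto
  moreover have "at 0 within {0..d} \<noteq> bot" using d by (simp add: at_within_Icc_at_right)
  ultimately have "D (\<lambda>y. D f y v) (x + 0 *\<^sub>R u) u - 0 = c 0"
    using vector_derivative_unique_within 1 by blast
  then show ?thesis by (simp add: c_def a_def)
qed

subsection \<open>Inverses\<close>

text \<open>A product rule with one factor that is merely continuous: its increment is multiplied by
  g, which vanishes at x, and so contributes only o(y - x). It serves for inverses that are not yet
  known to be differentiable.\<close>

lemma has_derivative_mult_vanishing: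
  fixes f :: "'a::real_normed_vector \<Rightarrow> real" and g :: "'a \<Rightarrow> 'b::real_normed_vector"
  assumes f: "isCont f x" and g: "(g has_derivative g') (at x)" "g x = 0"
  shows "((\<lambda>y. f y *\<^sub>R g y) has_derivative (\<lambda>h. f x *\<^sub>R g' h)) (at x)"
proof (rule has_derivativeI)
  show "bounded_linear (\<lambda>h. f x *\<^sub>R g' h)"
    using has_derivative_bounded_linear[OF g(1)] bounded_linear_const_scaleR by blast
  obtain K where K: "\<And>h. norm (g' h) \<le> norm h * K"
    using bounded_linear.bounded[OF has_derivative_bounded_linear[OF g(1)]] by blast
  have 1: "((\<lambda>y. f y *\<^sub>R ((g y - g x - g' (y - x)) /\<^sub>R norm (y - x))) \<longlongrightarrow> f x *\<^sub>R 0) (at x)"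
    using f g(1) unfolding isCont_def has_derivative_iff_norm
    by (intro tendsto_scaleR) (auto simp: has_derivative_def divide_inverse mult.commute g(1) intro: tendsto_norm_zero_cancel)
  have 2: "((\<lambda>y. (f y - f x) *\<^sub>R (g' (y - x) /\<^sub>R norm (y - x))) \<longlongrightarrow> 0) (at x)"
  proof (rule Lim_null_comparison)
    have "norm ((f y - f x) *\<^sub>R (g' (y - x) /\<^sub>R norm (y - x))) \<le> \<bar>f y - f x\<bar> * \<bar>K\<bar>" for y
    proof -
      have "norm (g' (y - x) /\<^sub>R norm (y - x)) \<le> \<bar>K\<bar>"
      proof (cases "y = x")
        case False
        have "norm (g' (y - x)) \<le> norm (y - x) * \<bar>K\<bar>"
          using K[of "y - x"] by (meson abs_ge_self mult_left_mono norm_ge_zero order_trans)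
        then show ?thesis using False by (simp add: field_simps)
      qed simp
      then show ?thesis unfolding norm_scaleR[of "f y - f x"] real_norm_def
        by (rule mult_left_mono) simp
    qed
    then show "\<forall>\<^sub>F y in at x. norm ((f y - f x) *\<^sub>R (g' (y - x) /\<^sub>R norm (y - x))) \<le> \<bar>f y - f x\<bar> * \<bar>K\<bar>"
      by (rule always_eventually[OF allI])
    have "((\<lambda>y. \<bar>f y - f x\<bar> * \<bar>K\<bar>) \<longlongrightarrow> \<bar>f x - f x\<bar> * \<bar>K\<bar>) (at x)"
      using f unfolding isCont_def by (intro tendsto_intros)
    then show "((\<lambda>y. \<bar>f y - f x\<bar> * \<bar>K\<bar>) \<longlongrightarrow> 0) (at x)" by simp
  qed
  have "(f y *\<^sub>R g y - f x *\<^sub>R g x - f x *\<^sub>R g' (y - x)) /\<^sub>R norm (y - x) =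
      f y *\<^sub>R ((g y - g x - g' (y - x)) /\<^sub>R norm (y - x)) + (f y - f x) *\<^sub>R (g' (y - x) /\<^sub>R norm (y - x))" for y
    using g(2) by (simp add: algebra_simps)
  then show "((\<lambda>y. (f y *\<^sub>R g y - f x *\<^sub>R g x - f x *\<^sub>R g' (y - x)) /\<^sub>R norm (y - x)) \<longlongrightarrow> 0) (at x)"
    using tendsto_add[OF 1 2] by simp
qed

lemma linear_of_inverse:
  assumes "linear L" "\<And>v. M (L v) = v" "\<And>v. L (M v) = v"
  shows "linear M"
proof (rule linearI)
  show "M (a + b) = M a + M b" for a b
    using assms linear_add[OF assms(1), of "M a" "M b"] by metis
  show "M (r *\<^sub>R a) = r *\<^sub>R M a" for r a
    using assms linear_scale[OF assms(1), of r "M a"] by metis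
qed

text \<open>For \<open>y(x) = M x u\<close> one has \<open>y(x) - y(a) = - M a ((L x - L a) y(x))\<close>.\<close>

lemma inverse_family_diff:
  fixes e :: "'i \<Rightarrow> 'v::real_normed_vector" and L :: "'a \<Rightarrow> 'v \<Rightarrow> 'v"
  assumes c: "coords I e l" and lin: "linear (L x)" "linear (L a)"
    and inv: "\<And>v. M a (L a v) = v" "\<And>v. L a (M a v) = v" "\<And>v. L x (M x v) = v"
  shows "M x u = M a u - M a (\<Sum>i\<in>I. l i (M x u) *\<^sub>R (L x (e i) - L a (e i)))"
proof -
  have "(\<Sum>i\<in>I. l i (M x u) *\<^sub>R (L x (e i) - L a (e i))) = L x (M x u) - L a (M x u)"
    unfolding coords_linear[OF c lin(1), of "M x u"] coords_linear[OF c lin(2), of "M x u"]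
    by (simp add: scaleR_diff_right sum_subtractf)
  then have "M a (\<Sum>i\<in>I. l i (M x u) *\<^sub>R (L x (e i) - L a (e i))) = M a u - M x u"
    using inv linear_diff[OF linear_of_inverse[OF lin(2) inv(1,2)], of u "L a (M x u)"] by simp
  then show ?thesis by simp
qed

text \<open>By \<open>inverse_family_diff\<close> the increment of \<open>M x u\<close> is bounded
  by N d(x) times the norm of \<open>M x u\<close> itself, where d(x) tends to 0. Once N d(x) < 1/2
  the unknown norm can be absorbed on the left.\<close>

lemma isCont_inverse_family:
  fixes e :: "'i \<Rightarrow> 'v::real_normed_vector" and L :: "'a::real_normed_vector \<Rightarrow> 'v \<Rightarrow> 'v"
  assumes c: "coords I e l" and S: "open S" and a: "a \<in> S"
    and lin: "\<And>x. x \<in> S \<Longrightarrow> linear (L x)"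
    and inv: "\<And>x v. x \<in> S \<Longrightarrow> M x (L x v) = v" "\<And>x v. x \<in> S \<Longrightarrow> L x (M x v) = v"
    and cont: "\<And>v. isCont (\<lambda>x. L x v) a"
  shows "isCont (\<lambda>x. M x u) a"
proof -
  have "bounded_linear (M a)"
    using coords_bounded_linear[OF c linear_of_inverse[OF lin[OF a] inv[OF a]]] .
  then obtain N where N: "N > 0" "\<And>v. norm (M a v) \<le> norm v * N"
    using bounded_linear.pos_bounded by blast
  have "\<forall>i\<in>I. \<exists>K. \<forall>v. norm (l i v) \<le> norm v * K"
    using coords_functional[OF c] bounded_linear.bounded by blast
  then obtain K where K: "\<And>i v. i \<in> I \<Longrightarrow> norm (l i v) \<le> norm v * K i" by metis
  define d where "d x = (\<Sum>i\<in>I. K i * norm (L x (e i) - L a (e i)))" for x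
  have "(d \<longlongrightarrow> (\<Sum>i\<in>I. K i * norm (L a (e i) - L a (e i)))) (at a)"
    unfolding d_def using cont unfolding isCont_def by (intro tendsto_intros) auto
  then have d: "(d \<longlongrightarrow> 0) (at a)" by simp
  have *: "norm (M x u - M a u) \<le> N * d x * norm (M x u)" if "x \<in> S" for x
  proof -
    have "norm (\<Sum>i\<in>I. l i (M x u) *\<^sub>R (L x (e i) - L a (e i))) \<le>
      (\<Sum>i\<in>I. (norm (M x u) * K i) * norm (L x (e i) - L a (e i)))"
      using K by (intro sum_norm_le) (simp add: mult_right_mono)
    also have "\<dots> = d x * norm (M x u)" unfolding d_def sum_distrib_right by (simp add: mult_ac)
    finally have "norm (M a (\<Sum>i\<in>I. l i (M x u) *\<^sub>R (L x (e i) - L a (e i)))) \<le> d x * norm (M x u) * N"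
      using N by (meson mult_right_mono less_imp_le order_trans)
    moreover have "M x u - M a u = - M a (\<Sum>i\<in>I. l i (M x u) *\<^sub>R (L x (e i) - L a (e i)))"
      by (subst (1) inverse_family_diff[where L = L and M = M, OF c lin[OF that] lin[OF a] inv[OF a] inv(2)[OF that]]) simp
    ultimately show ?thesis by (simp add: mult_ac)
  qed
  have "((\<lambda>x. M x u - M a u) \<longlongrightarrow> 0) (at a)"
  proof (rule Lim_null_comparison)
    have "((\<lambda>x. N * d x) \<longlongrightarrow> N * 0) (at a)" using d by (intro tendsto_intros)
    then have "\<forall>\<^sub>F x in at a. N * d x < 1/2" by (rule order_tendstoD) simp
    moreover have "\<forall>\<^sub>F x in at a. x \<in> S" using S a eventually_at_topological by blast
    ultimately show "\<forall>\<^sub>F x in at a. norm (M x u - M a u) \<le> 2 * \<bar>N * d x\<bar> * norm (M a u)"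
    proof eventually_elim
      case (elim x)
      have "norm (M x u - M a u) \<le> \<bar>N * d x\<bar> * norm (M x u)"
        using *[OF elim(2)] by (meson abs_ge_self mult_right_mono norm_ge_zero order_trans)
      also have "\<dots> \<le> \<bar>N * d x\<bar> * (norm (M a u) + norm (M x u - M a u))"
        by (intro mult_left_mono norm_triangle_sub) auto
      finally have 1: "norm (M x u - M a u) \<le> \<bar>N * d x\<bar> * norm (M a u) + \<bar>N * d x\<bar> * norm (M x u - M a u)"
        by (simp add: algebra_simps)
      show ?case
      \<comment> \<open>The constants \<open>K i\<close> are not known to be nonnegative, so neither
        is \<open>N * d x\<close>; if it is negative, the estimate above forces the increment to
        vanish.\<close>
      proof (cases "N * d x \<ge> 0")
        case True
        then have "\<bar>N * d x\<bar> * norm (M x u - M a u) \<le> 1/2 * norm (M x u - M a u)"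
          using elim(1) by (intro mult_right_mono) auto
        with 1 show ?thesis by linarith
      next
        case False
        then have "N * d x * norm (M x u) \<le> 0"
          using mult_nonpos_nonneg[of "N * d x" "norm (M x u)"] by simp
        then have "norm (M x u - M a u) \<le> 0" using *[OF elim(2)] by linarith
        moreover have "0 \<le> 2 * \<bar>N * d x\<bar> * norm (M a u)" by simp
        ultimately show ?thesis by linarith
      qed
    qed
    have "((\<lambda>x. 2 * \<bar>N * d x\<bar> * norm (M a u)) \<longlongrightarrow> 2 * \<bar>N * 0\<bar> * norm (M a u)) (at a)"
      using d by (intro tendsto_intros)
    then show "((\<lambda>x. 2 * \<bar>N * d x\<bar> * norm (M a u)) \<longlongrightarrow> 0) (at a)" by simp
  qed
  then show ?thesis unfolding isCont_def by (rule LIM_zero_cancel)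
qed

text \<open>In the identity of \<open>inverse_family_diff\<close> every summand is a factor
  continuous at a times the factor \<open>L x (e i) - L a (e i)\<close>, which vanishes at a; so
  \<open>has_derivative_mult_vanishing\<close> applies.\<close>

lemma has_derivative_inverse_family:
  fixes e :: "'i \<Rightarrow> 'v::real_normed_vector" and L :: "'a::real_normed_vector \<Rightarrow> 'v \<Rightarrow> 'v"
  assumes c: "coords I e l" and S: "open S" and a: "a \<in> S"
    and lin: "\<And>x. x \<in> S \<Longrightarrow> linear (L x)"
    and inv: "\<And>x v. x \<in> S \<Longrightarrow> M x (L x v) = v" "\<And>x v. x \<in> S \<Longrightarrow> L x (M x v) = v"
    and L': "\<And>v. ((\<lambda>x. L x v) has_derivative L' v) (at a)"
  shows "((\<lambda>x. M x u) has_derivative (\<lambda>h. - M a (\<Sum>i\<in>I. l i (M a u) *\<^sub>R L' (e i) h))) (at a)"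
proof -
  have "isCont (\<lambda>x. M x u) a"
    using has_derivative_continuous[OF L']
    by (intro isCont_inverse_family[where L = L, OF c S a lin inv])
  then have "isCont (\<lambda>x. l i (M x u)) a" if "i \<in> I" for i
    using bounded_linear.isCont[OF coords_functional[OF c that]] by blast
  moreover have "((\<lambda>x. L x (e i) - L a (e i)) has_derivative L' (e i)) (at a)" for i
    using has_derivative_diff[OF L' has_derivative_const] by simp
  ultimately have "((\<lambda>x. \<Sum>i\<in>I. l i (M x u) *\<^sub>R (L x (e i) - L a (e i))) has_derivative
      (\<lambda>h. \<Sum>i\<in>I. l i (M a u) *\<^sub>R L' (e i) h)) (at a)"
    by (intro has_derivative_sum has_derivative_mult_vanishing) auto
  then have "((\<lambda>x. M a u - M a (\<Sum>i\<in>I. l i (M x u) *\<^sub>R (L x (e i) - L a (e i)))) has_derivative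
      (\<lambda>h. 0 - M a (\<Sum>i\<in>I. l i (M a u) *\<^sub>R L' (e i) h))) (at a)"
    by (intro has_derivative_diff has_derivative_const
        bounded_linear.has_derivative[OF coords_bounded_linear[OF c linear_of_inverse[OF lin[OF a] inv[OF a]]]])
  then have "((\<lambda>x. M x u) has_derivative (\<lambda>h. 0 - M a (\<Sum>i\<in>I. l i (M a u) *\<^sub>R L' (e i) h))) (at a)"
    by (rule has_derivative_transform_within_open[OF _ S a])
      (rule inverse_family_diff[where L = L and M = M, OF c lin lin[OF a] inv[OF a] inv(2), symmetric])
  then show ?thesis by simp
qed

text \<open>The derivative of the inverse is an expression in the inverse and the derivatives of L.
  Hence if the inverse is C^k, so is its derivative, and the order rises by one at each
  step.\<close>

lemma smooth_on_inverse_family: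
  fixes e :: "'i \<Rightarrow> 'v::real_normed_vector" and L :: "'a::real_normed_vector \<Rightarrow> 'v \<Rightarrow> 'v"
  assumes c: "coords I e l" and S: "open S"
    and lin: "\<And>x. x \<in> S \<Longrightarrow> linear (L x)"
    and inv: "\<And>x v. x \<in> S \<Longrightarrow> M x (L x v) = v" "\<And>x v. x \<in> S \<Longrightarrow> L x (M x v) = v"
    and L: "\<And>v. smooth_on S (\<lambda>x. L x v)"
  shows "smooth_on S (\<lambda>x. M x u)"
proof -
  have D: "((\<lambda>x. M x u) has_derivative (\<lambda>h. - M a (\<Sum>i\<in>I. l i (M a u) *\<^sub>R D (\<lambda>x. L x (e i)) a h))) (at a)"
    if "a \<in> S" for a u
    by (rule has_derivative_inverse_family[where L = L and L' = "\<lambda>v. D (\<lambda>x. L x v) a",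
          OF c S that lin inv smooth_on_has_derivative[OF L that]])
  have M: "linear (M a)" if "a \<in> S" for a
    by (rule linear_of_inverse[where L = "L a"]) (use lin inv that in auto)
  have "Ck_on k S (\<lambda>x. M x u)" for k u
  proof (induction k arbitrary: u)
    case 0
    show ?case unfolding Ck_on.simps
      using D has_derivative_continuous by (blast intro: continuous_at_imp_continuous_on)
  next
    case (Suc k)
    show ?case
    proof (rule Ck_on_SucI[OF S D])
      fix v
      define G where "G x = (\<Sum>i\<in>I. l i (M x u) *\<^sub>R D (\<lambda>x. L x (e i)) x v)" for x
      have Ll: "Ck_on k S (\<lambda>x. D (\<lambda>x. L x (e i)) x v)" for i
        using smooth_on_D[OF L] unfolding smooth_on_def by blast
      have lM: "Ck_on k S (\<lambda>x. l i (M x u))" if "i \<in> I" for i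
        by (rule Ck_on_bounded_linear_compose[OF S coords_functional[OF c that] Suc.IH])
      have "Ck_on k S G" unfolding G_def
        by (intro Ck_on_sum S Ck_on_bilinear[OF S bounded_bilinear_scaleR] lM Ll)
      then have lG: "Ck_on k S (\<lambda>x. l i (G x))" if "i \<in> I" for i
        by (rule Ck_on_bounded_linear_compose[OF S coords_functional[OF c that]])
      have "Ck_on k S (\<lambda>x. \<Sum>i\<in>I. l i (G x) *\<^sub>R M x (e i))"
        by (intro Ck_on_sum S Ck_on_bilinear[OF S bounded_bilinear_scaleR] lG Suc.IH)
      then have "Ck_on k S (\<lambda>x. - (\<Sum>i\<in>I. l i (G x) *\<^sub>R M x (e i)))"
        by (rule Ck_on_bounded_linear_compose[OF S bounded_linear_minus[OF bounded_linear_ident]])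
      moreover have "- (\<Sum>i\<in>I. l i (G x) *\<^sub>R M x (e i)) = - M x (G x)" if "x \<in> S" for x
        using coords_linear[OF c M[OF that], of "G x"] by simp
      ultimately show "Ck_on k S (\<lambda>x. - M x (\<Sum>i\<in>I. l i (M x u) *\<^sub>R D (\<lambda>x. L x (e i)) x v))"
        unfolding G_def[symmetric]
        using Ck_on_cong[OF S, of "\<lambda>x. - (\<Sum>i\<in>I. l i (G x) *\<^sub>R M x (e i))" "\<lambda>x. - M x (G x)" k]
        by (metis (no_types, lifting))
    qed
  qed
  then show ?thesis unfolding smooth_on_def by blast
qed

text \<open>The derivative of G at y is the inverse of \<open>D F (G y)\<close>, which is of the
  same class C^k as G; the assumed continuity of G starts this bootstrap.\<close>

lemma smooth_on_inverse_function:
  fixes F :: "'a::euclidean_space \<Rightarrow> 'a"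
  assumes S: "open S" and T: "open T" and F: "smooth_on S F"
    and G: "continuous_on T G" "G ` T \<subseteq> S" "\<And>y. y \<in> T \<Longrightarrow> F (G y) = y"
    and bij: "\<And>x. x \<in> S \<Longrightarrow> bij (D F x)"
  shows "smooth_on T G"
proof -
  define M where "M x = inv (D F x)" for x
  have M: "M x (D F x v) = v" "D F x (M x v) = v" if "x \<in> S" for x v
    using bij[OF that] unfolding M_def by (simp_all add: bij_is_inj bij_is_surj surj_f_inv_f)
  have linM: "linear (M x)" if "x \<in> S" for x
    using linear_of_inverse[OF smooth_on_linear_D[OF F that] M[OF that]] .
  have smM: "smooth_on S (\<lambda>x. M x v)" for v
    by (rule smooth_on_inverse_family[OF coords_euclidean S smooth_on_linear_D[OF F] M smooth_on_D[OF F]])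
  have D: "(G has_derivative M (G y)) (at y)" if y: "y \<in> T" for y
  proof (rule has_derivative_inverse_basic[where f = F, OF _ _ _ _ T y G(3)])
    have Gy: "G y \<in> S" using G(2) y by auto
    show "(F has_derivative D F (G y)) (at (G y))" using smooth_on_has_derivative[OF F Gy] .
    show "bounded_linear (M (G y))" using linM[OF Gy] by (simp add: linear_conv_bounded_linear)
    show "M (G y) \<circ> D F (G y) = id" using M[OF Gy] by auto
    show "continuous (at y) G" using G(1) T y continuous_on_eq_continuous_at by blast
  qed
  have "Ck_on k T G" for k
  proof (induction k)
    case 0
    show ?case using G(1) by simp
  next
    case (Suc k)
    show ?case
    proof (rule Ck_on_SucI[OF T D])
      have "Ck_on k S (\<lambda>x. M x v)" for v using smM unfolding smooth_on_def by blast
      then show "Ck_on k T (\<lambda>y. M (G y) v)" for v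
        using Ck_on_compose[OF T S G(2) Suc.IH] by blast
    qed
  qed
  then show ?thesis unfolding smooth_on_def by blast
qed

section \<open>Charts, tangent maps and fields in coordinates\<close>

definition rep :: "('m, 'e) chart \<Rightarrow> ('m, 'e) chart \<Rightarrow> ('m \<Rightarrow> 'm) \<Rightarrow> 'e \<Rightarrow> 'e" where
  "rep c c' \<phi> = snd c' \<circ> \<phi> \<circ> cinv c"

definition rep_dom :: "('m, 'e) chart \<Rightarrow> ('m, 'e) chart \<Rightarrow> ('m \<Rightarrow> 'm) \<Rightarrow> 'e set" where
  "rep_dom c c' \<phi> = {x \<in> cimage c. \<phi> (cinv c x) \<in> fst c'}"

text \<open>Time is an additional coordinate, so that space and time derivatives of a family of maps
  are derivatives of one map in the directions (v, 0) and (0, 1).\<close>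

definition rept :: "('m, 'e) chart \<Rightarrow> ('m, 'e) chart \<Rightarrow> (real \<Rightarrow> 'm \<Rightarrow> 'm) \<Rightarrow> 'e \<times> real \<Rightarrow> 'e" where
  "rept c c' \<Phi> = (\<lambda>(x, t). snd c' (\<Phi> t (cinv c x)))"

definition rept_dom :: "('m, 'e) chart \<Rightarrow> ('m, 'e) chart \<Rightarrow> (real \<Rightarrow> 'm \<Rightarrow> 'm) \<Rightarrow> ('e \<times> real) set" where
  "rept_dom c c' \<Phi> = {(x, t). x \<in> cimage c \<and> \<Phi> t (cinv c x) \<in> fst c'}"

text \<open>The transpose of L, which pulls covectors back. \<open>Blinfun\<close> gives the
  intended operator for linear L only, hence the side conditions on linearity in its rules.\<close>

definition covec_map :: "('e::euclidean_space \<Rightarrow> 'e) \<Rightarrow> 'e covec \<Rightarrow> 'e covec" where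
  "covec_map L \<xi> = \<xi> o\<^sub>L Blinfun L"

lemma covec_map_apply: "linear L \<Longrightarrow> covec_map L \<xi> v = \<xi> (L v)"
  unfolding covec_map_def by (simp add: bounded_linear_Blinfun_apply linear_conv_bounded_linear)

lemma linear_covec_map: "linear (covec_map L)"
  unfolding covec_map_def
  by (intro linearI blinfun_eqI) (simp_all add: blinfun.bilinear_simps)

lemma dual_apply: "dual b v = v \<bullet> b"
  unfolding dual_def by (simp add: bounded_linear_Blinfun_apply bounded_linear_inner_left)

lemma covec_expand: "\<xi> = (\<Sum>b\<in>Basis. \<xi> b *\<^sub>R dual b)" for \<xi> :: "'e::euclidean_space covec"
proof (rule blinfun_eqI)
  fix v :: 'e
  have "blinfun_apply (\<Sum>b\<in>Basis. \<xi> b *\<^sub>R dual b) v = (\<Sum>b\<in>Basis. \<xi> b * (v \<bullet> b))"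
    by (simp add: blinfun.sum_left blinfun.scaleR_left dual_apply)
  also have "\<dots> = \<xi> v"
    using euclidean_linear_sum[OF bounded_linear.linear[OF blinfun.bounded_linear_right], of \<xi> v]
    by (simp add: mult.commute)
  finally show "\<xi> v = blinfun_apply (\<Sum>b\<in>Basis. \<xi> b *\<^sub>R dual b) v" ..
qed

lemma coords_covec: "coords Basis dual (\<lambda>b \<xi>. blinfun_apply \<xi> (b::'e::euclidean_space))"
  unfolding coords_def using covec_expand by (auto intro: blinfun.bounded_linear_left)

lemma smooth_on_covec:
  fixes g :: "'a::real_normed_vector \<Rightarrow> 'e::euclidean_space covec"
  assumes "open S" "\<And>b. smooth_on S (\<lambda>x. blinfun_apply (g x) b)"
  shows "smooth_on S g"
  by (rule smooth_on_eqI[where g = "\<lambda>x. \<Sum>b\<in>Basis. g x b *\<^sub>R dual b"])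
    (use assms in \<open>auto intro!: smooth_on_sum smooth_on_scaleR smooth_on_const covec_expand\<close>)

lemma alternating_multilinear: "alternating k F \<Longrightarrow> multilinear k F"
  unfolding alternating_def multilinear_def by blast

lemma alternating_length: "alternating k F \<Longrightarrow> length vs \<noteq> k \<Longrightarrow> F vs = 0"
  unfolding alternating_def by blast

lemma alternating_map:
  fixes L :: "'v::real_vector \<Rightarrow> 'w::real_vector"
  assumes F: "alternating k F" and L: "linear L"
  shows "alternating k (\<lambda>vs. F (map L vs))"
  unfolding alternating_def
proof (intro conjI allI impI)
  show "F (map L vs) = 0" if "length vs \<noteq> k" for vs
    using alternating_length[OF F, of "map L vs"] that by simp
  show "linear (\<lambda>v. F (map L (us @ v # ws)))" if "length us + 1 + length ws = k" for us ws
  proof -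
    have "linear (\<lambda>v. F (map L us @ v # map L ws))"
      using F that unfolding alternating_def by simp
    then show ?thesis using linear_compose[OF L] by (simp add: o_def)
  qed
  show "F (map L vs) = 0" if "\<not> distinct vs" for vs
    using F that unfolding alternating_def by (metis distinct_map)
qed

locale smooth_manifold =
  fixes A :: "('m::t2_space, 'e::euclidean_space) atlas"
  assumes atlas: "smooth_atlas A"
begin

lemma open_chart_dom: "c \<in> A \<Longrightarrow> open (fst c)"
  and open_cimage: "c \<in> A \<Longrightarrow> open (cimage c)"
  and chart_homeo: "c \<in> A \<Longrightarrow> homeomorphism (fst c) (cimage c) (snd c) (cinv c)"
  using atlas unfolding smooth_atlas_def by blast+

lemma cinv_chart: "c \<in> A \<Longrightarrow> q \<in> fst c \<Longrightarrow> cinv c (snd c q) = q"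
  and chart_cinv: "c \<in> A \<Longrightarrow> x \<in> cimage c \<Longrightarrow> snd c (cinv c x) = x"
  and cinv_in: "c \<in> A \<Longrightarrow> x \<in> cimage c \<Longrightarrow> cinv c x \<in> fst c"
  and continuous_chart: "c \<in> A \<Longrightarrow> continuous_on (fst c) (snd c)"
  and continuous_cinv: "c \<in> A \<Longrightarrow> continuous_on (cimage c) (cinv c)"
  using chart_homeo unfolding homeomorphism_def by blast+

lemma chart_in: "q \<in> fst c \<Longrightarrow> snd c q \<in> cimage c"
  unfolding cimage_def by blast

lemma chart_at_in: "chart_at A p \<in> A" and in_chart_at: "p \<in> fst (chart_at A p)"
proof -
  have "\<exists>c. c \<in> A \<and> p \<in> fst c" using atlas unfolding smooth_atlas_def by blast
  from someI_ex[OF this] show "chart_at A p \<in> A" "p \<in> fst (chart_at A p)"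
    unfolding chart_at_def by auto
qed

lemma coord_in: "coord A p p \<in> cimage (chart_at A p)"
  unfolding coord_def by (intro chart_in in_chart_at)

lemma cinv_coord: "cinv (chart_at A p) (coord A p p) = p"
  unfolding coord_def by (intro cinv_chart chart_at_in in_chart_at)

section \<open>Coordinate expressions of maps, tangent maps and changes of chart\<close>

lemma smooth_map_id: "smooth_map A id"
proof -
  have "continuous_on UNIV (id :: 'm \<Rightarrow> 'm)" unfolding id_def by (rule continuous_on_id)
  then show ?thesis using atlas unfolding smooth_map_def smooth_atlas_def by simp
qed

lemma rep_dom_alt: "c \<in> A \<Longrightarrow> rep_dom c c' \<phi> = snd c ` (fst c \<inter> \<phi> -` fst c')"
proof (intro equalityI subsetI)
  assume c: "c \<in> A"
  show "x \<in> snd c ` (fst c \<inter> \<phi> -` fst c')" if "x \<in> rep_dom c c' \<phi>" for x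
    using that c unfolding rep_dom_def
    by (intro image_eqI[of _ _ "cinv c x"]) (simp_all add: chart_cinv cinv_in)
  show "x \<in> rep_dom c c' \<phi>" if "x \<in> snd c ` (fst c \<inter> \<phi> -` fst c')" for x
    using that c unfolding rep_dom_def by (auto simp: chart_in cinv_chart)
qed

lemma open_rep_dom:
  assumes "smooth_map A \<phi>" "c \<in> A" "c' \<in> A"
  shows "open (rep_dom c c' \<phi>)"
proof -
  have "continuous_on (cimage c) (\<lambda>x. \<phi> (cinv c x))"
    using assms(1) unfolding smooth_map_def
    by (intro continuous_on_compose2[OF _ continuous_cinv[OF assms(2)]]) auto
  then have "open (cimage c \<inter> (\<lambda>x. \<phi> (cinv c x)) -` fst c')"
    by (intro continuous_open_preimage open_cimage open_chart_dom assms)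
  then show ?thesis unfolding rep_dom_def by (simp add: vimage_def Int_def)
qed

lemma smooth_rep:
  assumes "smooth_map A \<phi>" "c \<in> A" "c' \<in> A"
  shows "smooth_on (rep_dom c c' \<phi>) (rep c c' \<phi>)"
  using assms rep_dom_alt[OF assms(2)] unfolding smooth_map_def rep_def by simp

lemma rep_in: "c' \<in> A \<Longrightarrow> x \<in> rep_dom c c' \<phi> \<Longrightarrow> rep c c' \<phi> x \<in> cimage c'"
  unfolding rep_def rep_dom_def by (auto intro: chart_in)

lemma cinv_rep: "c' \<in> A \<Longrightarrow> x \<in> rep_dom c c' \<phi> \<Longrightarrow> cinv c' (rep c c' \<phi> x) = \<phi> (cinv c x)"
  unfolding rep_def rep_dom_def by (simp add: cinv_chart)

lemma linear_D_rep:
  "smooth_map A \<phi> \<Longrightarrow> c \<in> A \<Longrightarrow> c' \<in> A \<Longrightarrow> x \<in> rep_dom c c' \<phi> \<Longrightarrow> linear (D (rep c c' \<phi>) x)"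
  using smooth_on_linear_D[OF smooth_rep] by blast

text \<open>Tangent maps, \<open>from_chart\<close> and \<open>to_chart\<close> are all derivatives
  of coordinate expressions, the latter two of the identity map. So this chain rule, with
  \<open>id\<close> allowed for \<phi> or \<psi>, yields their composition laws.\<close>

lemma D_rep_compose:
  assumes \<phi>: "smooth_map A \<phi>" "smooth_map A \<psi>" and c: "c \<in> A" "c' \<in> A" "c'' \<in> A"
    and x: "x \<in> rep_dom c c' \<phi>" "\<psi> (\<phi> (cinv c x)) \<in> fst c''"
  shows "D (rep c c'' (\<psi> \<circ> \<phi>)) x v = D (rep c' c'' \<psi>) (rep c c' \<phi> x) (D (rep c c' \<phi>) x v)"
proof -
  have x': "rep c c' \<phi> x \<in> rep_dom c' c'' \<psi>"
    using x rep_in[OF c(2) x(1)] cinv_rep[OF c(2) x(1)] by (simp add: rep_dom_def)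
  have "D (rep c c'' (\<psi> \<circ> \<phi>)) x = D (\<lambda>y. rep c' c'' \<psi> (rep c c' \<phi> y)) x"
  proof (rule D_cong[OF open_rep_dom[OF \<phi>(1) c(1,2)] x(1)])
    show "rep c c'' (\<psi> \<circ> \<phi>) y = rep c' c'' \<psi> (rep c c' \<phi> y)" if "y \<in> rep_dom c c' \<phi>" for y
      using cinv_rep[OF c(2) that] by (simp add: rep_def)
  qed
  then show ?thesis
    using D_compose[OF smooth_rep[OF \<phi>(1) c(1,2)] x(1) smooth_rep[OF \<phi>(2) c(2,3)] x'] by simp
qed

lemma D_rep_same: "c \<in> A \<Longrightarrow> x \<in> cimage c \<Longrightarrow> D (rep c c id) x v = v"
  using D_cong[OF open_cimage, of c x "rep c c id" "\<lambda>x. x"] D_eqI[OF has_derivative_ident, of x]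
  by (simp add: rep_def chart_cinv)

lemma from_chart_rep: "from_chart A c q = D (rep c (chart_at A q) id) (snd c q)"
  unfolding from_chart_def rep_def coord_def by simp

lemma to_chart_rep: "to_chart A c q = D (rep (chart_at A q) c id) (coord A q q)"
  unfolding to_chart_def rep_def by simp

lemma tangent_map_rep:
  "tangent_map A \<phi> p = D (rep (chart_at A p) (chart_at A (\<phi> p)) \<phi>) (coord A p p)"
  unfolding tangent_map_def rep_def coord_def by simp

lemma chart_in_rep_dom: "c \<in> A \<Longrightarrow> q \<in> fst c \<Longrightarrow> \<phi> q \<in> fst c' \<Longrightarrow> snd c q \<in> rep_dom c c' \<phi>"
  unfolding rep_dom_def by (simp add: chart_in cinv_chart)

text \<open>Both sides are the derivative of \<phi> read from the chart c to the selected chart at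
  \<open>\<phi> q\<close>, factored once through the selected chart at q and once through
  c'.\<close>

lemma tangent_from_chart:
  assumes "smooth_map A \<phi>" "c \<in> A" "c' \<in> A" "q \<in> fst c" "\<phi> q \<in> fst c'"
  shows "tangent_map A \<phi> q (from_chart A c q v) = from_chart A c' (\<phi> q) (D (rep c c' \<phi>) (snd c q) v)"
proof -
  note [simp] = chart_at_in in_chart_at cinv_chart
  let ?c = "chart_at A (\<phi> q)"
  have "D (rep c ?c (\<phi> \<circ> id)) (snd c q) v = tangent_map A \<phi> q (from_chart A c q v)"
    using assms by (subst D_rep_compose[of id \<phi> c "chart_at A q"])
      (auto simp: smooth_map_id chart_in_rep_dom from_chart_rep tangent_map_rep rep_def coord_def)
  moreover have "D (rep c ?c (id \<circ> \<phi>)) (snd c q) v = from_chart A c' (\<phi> q) (D (rep c c' \<phi>) (snd c q) v)"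
    using assms by (subst D_rep_compose[of \<phi> id c c'])
      (auto simp: smooth_map_id chart_in_rep_dom from_chart_rep rep_def)
  ultimately show ?thesis by simp
qed

lemma tangent_map_id: "tangent_map A id p v = v"
  unfolding tangent_map_rep by (simp add: D_rep_same chart_at_in coord_in)

lemma from_chart_change:
  assumes "c \<in> A" "c' \<in> A" "q \<in> fst c" "q \<in> fst c'"
  shows "from_chart A c q v = from_chart A c' q (D (rep c c' id) (snd c q) v)"
  using tangent_from_chart[OF smooth_map_id assms(1-3)] assms by (simp add: tangent_map_id)

lemma from_chart_at: "from_chart A (chart_at A p) p v = v"
  unfolding from_chart_rep coord_def[symmetric] by (simp add: D_rep_same chart_at_in coord_in)

lemma to_chart_at: "to_chart A (chart_at A p) p v = v"
  unfolding to_chart_rep by (simp add: D_rep_same chart_at_in coord_in)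

lemma from_to_chart: "c \<in> A \<Longrightarrow> q \<in> fst c \<Longrightarrow> from_chart A c q (to_chart A c q v) = v"
  using from_chart_change[of "chart_at A q" c q v] from_chart_at[of q v]
  by (simp add: to_chart_rep chart_at_in in_chart_at coord_def)

lemma to_from_chart:
  assumes "c \<in> A" "q \<in> fst c" shows "to_chart A c q (from_chart A c q v) = v"
proof -
  note [simp] = chart_at_in in_chart_at cinv_chart
  have "D (rep c c (id \<circ> id)) (snd c q) v = to_chart A c q (from_chart A c q v)"
    using assms by (subst D_rep_compose[of id id c "chart_at A q"])
      (auto simp: smooth_map_id chart_in_rep_dom from_chart_rep to_chart_rep rep_def coord_def)
  then show ?thesis using assms by (simp add: D_rep_same chart_in)
qed

lemma linear_from_chart: "c \<in> A \<Longrightarrow> q \<in> fst c \<Longrightarrow> linear (from_chart A c q)"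
  unfolding from_chart_rep
  by (intro linear_D_rep smooth_map_id chart_at_in chart_in_rep_dom) (auto simp: in_chart_at)

lemma linear_to_chart: "c \<in> A \<Longrightarrow> q \<in> fst c \<Longrightarrow> linear (to_chart A c q)"
  unfolding to_chart_rep coord_def
  by (intro linear_D_rep smooth_map_id chart_at_in chart_in_rep_dom) (auto simp: in_chart_at)

lemma linear_tangent_map: "smooth_map A \<phi> \<Longrightarrow> linear (tangent_map A \<phi> p)"
  unfolding tangent_map_rep coord_def
  by (intro linear_D_rep chart_at_in chart_in_rep_dom in_chart_at)

lemma tangent_to_chart:
  assumes "smooth_map A \<phi>" "c \<in> A" "c' \<in> A" "q \<in> fst c" "\<phi> q \<in> fst c'"
  shows "to_chart A c' (\<phi> q) (tangent_map A \<phi> q v) = D (rep c c' \<phi>) (snd c q) (to_chart A c q v)"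
  using tangent_from_chart[OF assms, of "to_chart A c q v"] assms
  by (simp add: from_to_chart to_from_chart)

lemma tangent_map_compose:
  assumes "smooth_map A \<phi>" "smooth_map A \<psi>"
  shows "tangent_map A (\<psi> \<circ> \<phi>) p v = tangent_map A \<psi> (\<phi> p) (tangent_map A \<phi> p v)"
  unfolding tangent_map_rep
  using assms by (subst D_rep_compose[of \<phi> \<psi> _ "chart_at A (\<phi> p)"])
    (auto simp: chart_at_in in_chart_at coord_def chart_in_rep_dom cinv_chart, simp add: rep_def in_chart_at chart_at_in cinv_chart)

lemma tangent_map_inv:
  assumes "diffeo A \<phi>"
  shows "tangent_map A (inv \<phi>) (\<phi> p) (tangent_map A \<phi> p v) = v"
    and "tangent_map A \<phi> p (tangent_map A (inv \<phi>) (\<phi> p) v) = v"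
proof -
  have b: "inv \<phi> \<circ> \<phi> = id" "\<phi> \<circ> inv \<phi> = id" "inv \<phi> (\<phi> p) = p" and s: "smooth_map A \<phi>" "smooth_map A (inv \<phi>)"
    using assms unfolding diffeo_def by (auto simp: bij_is_inj bij_is_surj surj_iff[symmetric])
  show "tangent_map A (inv \<phi>) (\<phi> p) (tangent_map A \<phi> p v) = v"
    using tangent_map_compose[OF s, of p v] b by (simp add: tangent_map_id)
  show "tangent_map A \<phi> p (tangent_map A (inv \<phi>) (\<phi> p) v) = v"
    using tangent_map_compose[OF s(2,1), of "\<phi> p" v] b by (simp add: tangent_map_id)
qed

subsection \<open>Forms and multivector fields in coordinates\<close>

lemma form_in_pullback:
  assumes "smooth_map A \<phi>" "c \<in> A" "c' \<in> A" "x \<in> rep_dom c c' \<phi>"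
  shows "form_in A c (pullback A \<phi> \<omega>) x vs = form_in A c' \<omega> (rep c c' \<phi> x) (map (D (rep c c' \<phi>) x) vs)"
proof -
  have x: "x \<in> cimage c" "\<phi> (cinv c x) \<in> fst c'" using assms(4) unfolding rep_dom_def by auto
  have "tangent_map A \<phi> (cinv c x) (from_chart A c (cinv c x) v) =
      from_chart A c' (\<phi> (cinv c x)) (D (rep c c' \<phi>) x v)" for v
    using tangent_from_chart[OF assms(1-3) cinv_in[OF assms(2) x(1)] x(2)]
    by (simp add: chart_cinv[OF assms(2) x(1)])
  then show ?thesis
    using cinv_rep[OF assms(3,4)] unfolding form_in_def pullback_def by (simp add: o_def)
qed

lemma pullback_id: "pullback A id \<omega> = \<omega>"
  unfolding pullback_def by (auto simp: fun_eq_iff tangent_map_id cong: map_cong)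

lemma form_in_at: "form_in A (chart_at A p) \<omega> (coord A p p) vs = \<omega> p vs"
  unfolding form_in_def by (simp add: cinv_coord from_chart_at cong: map_cong)

lemma mvec_in_covec_map:
  "mvec_in A c P x \<xi>s = P (cinv c x) (map (covec_map (to_chart A c (cinv c x))) \<xi>s)"
  unfolding mvec_in_def covec_map_def by simp

lemma pushforward_covec_map:
  "pushforward A \<phi> P q \<xi>s = P (inv \<phi> q) (map (covec_map (tangent_map A \<phi> (inv \<phi> q))) \<xi>s)"
  unfolding pushforward_def covec_map_def by simp

lemma covec_map_compose:
  "linear L \<Longrightarrow> linear K \<Longrightarrow> covec_map K (covec_map L \<xi>) = covec_map (\<lambda>v. L (K v)) \<xi>"
  using linear_compose[of K L] by (intro blinfun_eqI) (simp add: covec_map_apply o_def)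

lemma covec_map_ident: "(\<And>v. L v = v) \<Longrightarrow> covec_map L \<xi> = \<xi>"
proof -
  assume L: "\<And>v. L v = v"
  then have "L = (\<lambda>v. v)" by auto
  then show ?thesis by (intro blinfun_eqI) (simp add: covec_map_apply linear_ident)
qed

text \<open>The formula is stated at the image point \<open>rep c c' \<phi> x\<close>, because
  covectors are pulled back by the derivative of \<phi> itself and the derivative of the inverse map
  then stays out of it.\<close>

lemma mvec_in_pushforward:
  assumes "diffeo A \<phi>" "c \<in> A" "c' \<in> A" "x \<in> rep_dom c c' \<phi>"
  shows "mvec_in A c' (pushforward A \<phi> P) (rep c c' \<phi> x) \<xi>s =
    mvec_in A c P x (map (covec_map (D (rep c c' \<phi>) x)) \<xi>s)"
proof -
  have s: "smooth_map A \<phi>" and i: "inv \<phi> (\<phi> q) = q" for q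
    using assms(1) unfolding diffeo_def by (auto simp: bij_is_inj)
  define q where "q = cinv c x"
  have x: "x \<in> cimage c" "\<phi> q \<in> fst c'" using assms(4) unfolding rep_dom_def q_def by auto
  have q: "q \<in> fst c" "snd c q = x" "cinv c' (rep c c' \<phi> x) = \<phi> q"
    using x cinv_in assms chart_cinv cinv_rep[OF assms(3,4)] unfolding q_def by auto
  have "covec_map (tangent_map A \<phi> q) (covec_map (to_chart A c' (\<phi> q)) \<xi>) =
      covec_map (to_chart A c q) (covec_map (D (rep c c' \<phi>) x) \<xi>)" for \<xi>
    using tangent_to_chart[OF s assms(2,3) q(1) x(2)] q assms s x(2)
    by (simp add: covec_map_compose linear_to_chart linear_tangent_map linear_D_rep[OF s assms(2-4)])
  then show ?thesis
    unfolding mvec_in_covec_map pushforward_covec_map q i q_def[symmetric] by (simp add: o_def)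
qed

lemma pushforward_id: "pushforward A id P = P"
  unfolding pushforward_covec_map
  by (auto simp: fun_eq_iff tangent_map_id covec_map_ident cong: map_cong)

lemma mvec_in_at: "mvec_in A (chart_at A p) P (coord A p p) \<xi>s = P p \<xi>s"
  unfolding mvec_in_covec_map by (simp add: cinv_coord to_chart_at covec_map_ident cong: map_cong)

lemma alternating_form_in:
  "c \<in> A \<Longrightarrow> x \<in> cimage c \<Longrightarrow> alternating k (\<omega> (cinv c x)) \<Longrightarrow> alternating k (form_in A c \<omega> x)"
  unfolding form_in_def[abs_def] by (rule alternating_map[OF _ linear_from_chart[OF _ cinv_in]])

lemma alternating_mvec_in:
  "alternating k (P (cinv c x)) \<Longrightarrow> alternating k (mvec_in A c P x)"
  unfolding mvec_in_covec_map[abs_def] by (rule alternating_map[OF _ linear_covec_map])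

end

section \<open>Tensor calculus in one chart\<close>

lemma alternating_linear:
  "alternating k F \<Longrightarrow> length us + 1 + length ws = k \<Longrightarrow> linear (\<lambda>v. F (us @ v # ws))"
  unfolding alternating_def by blast

text \<open>Polarization: the vanishing value with a + b in both slots is expanded.\<close>

lemma alternating_swap:
  assumes F: "alternating k F" and k: "length us + length ws + 2 = k"
  shows "F (us @ a # b # ws) = - F (us @ b # a # ws)"
proof -
  have 1: "linear (\<lambda>v. F (us @ v # w # ws))" for w
    using alternating_linear[OF F, of us "w # ws"] k by simp
  have 2: "linear (\<lambda>v. F (us @ w # v # ws))" for w
    using alternating_linear[OF F, of "us @ [w]" ws] k by simp
  have 0: "F (us @ v # v # ws) = 0" for v
    using F unfolding alternating_def by simp
  have "0 = F (us @ (a + b) # (a + b) # ws)" using 0 by simp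
  also have "\<dots> = F (us @ a # b # ws) + F (us @ b # a # ws)"
    using linear_add[OF 1, of a b "a + b"] linear_add[OF 2, of a a b] linear_add[OF 2, of b a b] 0 by simp
  finally show ?thesis by simp
qed

lemma alternating2_swap: "alternating 2 F \<Longrightarrow> F [a, b] = - F [b, a]"
  using alternating_swap[of 2 F "[]" "[]" a b] by simp

lemma alternating3_swap:
  "alternating 3 F \<Longrightarrow> F [a, b, c] = - F [b, a, c]" "alternating 3 F \<Longrightarrow> F [a, b, c] = - F [a, c, b]"
  using alternating_swap[of 3 F "[]" "[c]" a b] alternating_swap[of 3 F "[a]" "[]" b c] by simp_all

lemma alternating2_linear:
  "alternating 2 F \<Longrightarrow> linear (\<lambda>v. F [v, b])" "alternating 2 F \<Longrightarrow> linear (\<lambda>v. F [a, v])"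
  using alternating_linear[of 2 F "[]" "[b]"] alternating_linear[of 2 F "[a]" "[]"] by simp_all

lemma alternating2I:
  assumes "\<And>vs. length vs \<noteq> 2 \<Longrightarrow> F vs = 0" "\<And>b. linear (\<lambda>v. F [v, b])" "\<And>a. linear (\<lambda>v. F [a, v])"
    "\<And>a. F [a, a] = 0"
  shows "alternating 2 F"
  unfolding alternating_def
proof (intro conjI allI impI)
  show "linear (\<lambda>v. F (us @ v # ws))" if "length us + 1 + length ws = 2" for us ws
  proof (cases us)
    case Nil
    then obtain b where "ws = [b]" using \<open>length us + 1 + length ws = 2\<close> by (cases ws) auto
    then show ?thesis using Nil assms(2) by simp
  next
    case (Cons a us')
    then have "us' = []" "ws = []" using \<open>length us + 1 + length ws = 2\<close> by auto
    then show ?thesis using Cons assms(3) by simp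
  qed
  show "F vs = 0" if "\<not> distinct vs" for vs
  proof (cases "length vs = 2")
    case True
    then obtain a b where "vs = [a, b]" by (auto simp: numeral_2_eq_2 length_Suc_conv)
    then show ?thesis using \<open>\<not> distinct vs\<close> assms(4) by auto
  qed (use assms(1) in auto)
qed (use assms(1) in auto)

lemma remove_nth_simps [simp]:
  "remove_nth 0 (v # vs) = vs" "remove_nth (Suc i) (v # vs) = v # remove_nth i vs"
  unfolding remove_nth_def by simp_all

text \<open>Fixes the slots: the first one takes the argument of the sharp map, the second one
  evaluates the result. Equations between anchors reduce to equations between values of P by this
  rule, tested on all covectors.\<close>

lemma vec_sharp_apply:
  assumes "alternating 2 P" shows "blinfun_apply \<eta> (vec (sharp P \<xi>)) = P [\<xi>, \<eta>]"
  using coords_linear[OF coords_covec alternating2_linear(2)[OF assms], of \<xi> \<eta>]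
  unfolding vec_def sharp_def by (simp add: blinfun.bilinear_simps mult.commute)

lemma covec_eq_iff: "v = w \<longleftrightarrow> (\<forall>\<xi>::'e covec. blinfun_apply \<xi> v = blinfun_apply \<xi> (w::'e::euclidean_space))"
proof
  assume *: "\<forall>\<xi>::'e covec. blinfun_apply \<xi> v = blinfun_apply \<xi> w"
  show "v = w"
  proof (rule euclidean_eqI)
    show "v \<bullet> b = w \<bullet> b" for b using *[rule_format, of "dual b"] by (simp add: dual_apply)
  qed
qed simp

lemma flat_apply:
  assumes "alternating 2 B" shows "flat B Y w = B [Y, w]"
  using coords_bounded_linear[OF coords_euclidean alternating2_linear(2)[OF assms]]
  unfolding flat_def by (simp add: bounded_linear_Blinfun_apply)

section \<open>Exterior and Lie derivative of forms in coordinates\<close>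

definition dloc :: "('e::real_normed_vector \<Rightarrow> 'e list \<Rightarrow> real) \<Rightarrow> 'e \<Rightarrow> 'e list \<Rightarrow> real" where
  "dloc w x vs = (\<Sum>i<length vs. (- 1) ^ i * D (\<lambda>y. w y (remove_nth i vs)) x (vs ! i))"

text \<open>The coordinate formula of the Lie derivative of a form along W.\<close>

definition lie_form :: "('e::real_normed_vector \<Rightarrow> 'e list \<Rightarrow> real) \<Rightarrow> ('e \<Rightarrow> 'e) \<Rightarrow> 'e \<Rightarrow> 'e list \<Rightarrow> real" where
  "lie_form w W x vs = D (\<lambda>y. w y vs) x (W x) + (\<Sum>i<length vs. w x (vs[i := D W x (vs ! i)]))"

lemma dloc_eq:
  "dloc w x [a, b, c] = D (\<lambda>y. w y [b, c]) x a - D (\<lambda>y. w y [a, c]) x b + D (\<lambda>y. w y [a, b]) x c"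
  "dloc w x [a, b, c, d] = D (\<lambda>y. w y [b, c, d]) x a - D (\<lambda>y. w y [a, c, d]) x b
    + D (\<lambda>y. w y [a, b, d]) x c - D (\<lambda>y. w y [a, b, c]) x d"
  unfolding dloc_def list.size add_0 plus_nat.simps One_nat_def sum.lessThan_Suc
  by simp_all

lemma dloc_cong:
  assumes "open S" "x \<in> S" "\<And>y vs. y \<in> S \<Longrightarrow> w y vs = w' y vs"
  shows "dloc w x vs = dloc w' x vs"
  unfolding dloc_def using D_cong[OF assms(1,2), of "\<lambda>y. w y _" "\<lambda>y. w' y _"] assms(3) by simp

lemma has_derivative_pullback_form:
  fixes f :: "'e::euclidean_space \<Rightarrow> 'e"
  assumes S: "open S" and T: "open T" and f: "f ` S \<subseteq> T" "smooth_on S f"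
    and w: "\<And>vs. smooth_on T (\<lambda>y. w y vs)" "\<And>y. y \<in> T \<Longrightarrow> alternating (length vs) (w y)" and x: "x \<in> S"
  shows "((\<lambda>x. w (f x) (map (D f x) vs)) has_derivative
    (\<lambda>h. D (\<lambda>y. w y (map (D f x) vs)) (f x) (D f x h) +
      (\<Sum>i<length vs. w (f x) ((map (D f x) vs)[i := D (\<lambda>y. D f y (vs ! i)) x h])))) (at x)"
proof -
  have fx: "f y \<in> T" if "y \<in> S" for y using f(1) that by auto
  have "((\<lambda>x. w (f x) (map (\<lambda>g. g x) (map (\<lambda>v y. D f y v) vs))) has_derivative
     (\<lambda>h. D (\<lambda>y. w y (map (\<lambda>g. g x) (map (\<lambda>v y. D f y v) vs))) (f x) (D f x h) +
      (\<Sum>i<length (map (\<lambda>v y. D f y v) vs). w (f x) ((map (\<lambda>g. g x) (map (\<lambda>v y. D f y v) vs))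
        [i := D (map (\<lambda>v y. D f y v) vs ! i) x h])))) (at x)"
  proof (rule has_derivative_multilinear[OF coords_euclidean S x,
        where F = "\<lambda>x. w (f x)" and F' = "\<lambda>vs h. D (\<lambda>y. w y vs) (f x) (D f x h)" and g' = "\<lambda>g. D g x"])
    show "multilinear (length (map (\<lambda>v y. D f y v) vs)) (w (f y))" if "y \<in> S" for y
      using w(2)[OF fx[OF that]] by (simp add: alternating_multilinear)
    show "((\<lambda>x. w (f x) us) has_derivative (\<lambda>h. D (\<lambda>y. w y us) (f x) (D f x h))) (at x)" for us
      by (rule has_derivative_smooth_compose[OF w(1) fx[OF x] smooth_on_has_derivative[OF f(2) x]])
    show "(g has_derivative D g x) (at x)" if g: "g \<in> set (map (\<lambda>v y. D f y v) vs)" for g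
      using g smooth_on_has_derivative[OF smooth_on_D[OF f(2)] x] by auto
  qed
  then show ?thesis by (simp add: o_def)
qed

text \<open>The second derivatives of \<open>f\<close> cancel in pairs.\<close>

lemma dloc_pullback2:
  fixes f :: "'e::euclidean_space \<Rightarrow> 'e"
  assumes S: "open S" and T: "open T" and f: "f ` S \<subseteq> T" "smooth_on S f"
    and w: "\<And>vs. smooth_on T (\<lambda>y. w y vs)" "\<And>y. y \<in> T \<Longrightarrow> alternating 2 (w y)" and x: "x \<in> S"
  shows "dloc (\<lambda>x vs. w (f x) (map (D f x) vs)) x [a, b, c] = dloc w (f x) (map (D f x) [a, b, c])"
proof -
  have fx: "f x \<in> T" using f(1) x by auto
  note sw = alternating2_swap[OF w(2)[OF fx]]
  note co = D_commute[OF S f(2) x]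
  have 1: "D (\<lambda>x. w (f x) [D f x a, D f x b]) x h = D (\<lambda>y. w y [D f x a, D f x b]) (f x) (D f x h)
      + w (f x) [D (\<lambda>y. D f y a) x h, D f x b] + w (f x) [D f x a, D (\<lambda>y. D f y b) x h]" for a b h
    using D_eqI[OF has_derivative_pullback_form[where w = w and vs = "[a, b]", OF S T f w(1) _ x]] w(2)
    by (simp add: lessThan_Suc numeral_2_eq_2)
  show ?thesis
    unfolding list.map dloc_eq 1
    using sw[of "D f x a"] co[of b a] co[of c a] co[of c b]
    by (simp add: sw[of "D f x b"])
qed

lemma dloc_pullback3:
  fixes f :: "'e::euclidean_space \<Rightarrow> 'e"
  assumes S: "open S" and T: "open T" and f: "f ` S \<subseteq> T" "smooth_on S f"
    and w: "\<And>vs. smooth_on T (\<lambda>y. w y vs)" "\<And>y. y \<in> T \<Longrightarrow> alternating 3 (w y)" and x: "x \<in> S"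
  shows "dloc (\<lambda>x vs. w (f x) (map (D f x) vs)) x [a, b, c, d] = dloc w (f x) (map (D f x) [a, b, c, d])"
proof -
  have fx: "f x \<in> T" using f(1) x by auto
  note sw = alternating3_swap[OF w(2)[OF fx]]
  note co = D_commute[OF S f(2) x]
  \<comment> \<open>The slot holding a second derivative of f is moved to the front at the price of
    signs. In this shape the unwanted terms cancel in pairs, by symmetry of second
    derivatives.\<close>
  have 1: "D (\<lambda>x. w (f x) [D f x a, D f x b, D f x c]) x h =
      D (\<lambda>y. w y [D f x a, D f x b, D f x c]) (f x) (D f x h)
      + w (f x) [D (\<lambda>y. D f y a) x h, D f x b, D f x c]
      - w (f x) [D (\<lambda>y. D f y b) x h, D f x a, D f x c]
      + w (f x) [D (\<lambda>y. D f y c) x h, D f x a, D f x b]" for a b c h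
    using D_eqI[OF has_derivative_pullback_form[where w = w and vs = "[a, b, c]", OF S T f w(1) _ x]] w(2)
      sw(1)[of "D f x a" "D (\<lambda>y. D f y b) x h" "D f x c"]
      sw(2)[of "D f x a" "D f x b" "D (\<lambda>y. D f y c) x h"]
      sw(1)[of "D f x a" "D (\<lambda>y. D f y c) x h" "D f x b"]
    by (simp add: lessThan_Suc numeral_3_eq_3)
  show ?thesis
    unfolding list.map dloc_eq 1
    by (simp add: co[of b a] co[of c a] co[of c b] co[of d a] co[of d b] co[of d c])
qed

text \<open>Every second derivative of a coefficient occurs twice, in opposite orders of
  differentiation and with opposite signs.\<close>

lemma dloc_dloc2:
  fixes w :: "'e::euclidean_space \<Rightarrow> 'e list \<Rightarrow> real"
  assumes S: "open S" and w: "\<And>vs. smooth_on S (\<lambda>y. w y vs)" and x: "x \<in> S"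
  shows "dloc (dloc w) x [a, b, c, d] = 0"
proof -
  have D: "((\<lambda>y. D (\<lambda>z. w z vs) y v) has_derivative D (\<lambda>y. D (\<lambda>z. w z vs) y v) x) (at x)" for v vs
    by (rule smooth_on_has_derivative[OF smooth_on_D[OF w] x])
  have 3: "D (\<lambda>y. dloc w y [a, b, c]) x h = D (\<lambda>y. D (\<lambda>z. w z [b, c]) y a) x h
      - D (\<lambda>y. D (\<lambda>z. w z [a, c]) y b) x h + D (\<lambda>y. D (\<lambda>z. w z [a, b]) y c) x h" for a b c h
    unfolding dloc_eq
    by (subst D_eqI[OF has_derivative_add[OF has_derivative_diff[OF D D] D]]) simp
  note co = D_commute[OF S w x]
  show ?thesis
    unfolding dloc_eq(2) 3
    by (simp add: co[of _ b a] co[of _ c a] co[of _ c b] co[of _ d a] co[of _ d b] co[of _ d c])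
qed

text \<open>Cartan's formula, in which the contraction of dw with W drops out because w is closed.
  Closedness is used on the single list [W x, a, b, c].\<close>

lemma cartan_closed3:
  fixes w :: "'e::euclidean_space \<Rightarrow> 'e list \<Rightarrow> real"
  assumes S: "open S" and w: "\<And>vs. smooth_on S (\<lambda>y. w y vs)" "\<And>y. y \<in> S \<Longrightarrow> alternating 3 (w y)"
    and W: "smooth_on S W" and x: "x \<in> S"
    and closed: "\<And>vs. dloc w x vs = 0"
  shows "lie_form w W x [a, b, c] = dloc (\<lambda>y vs. w y (W y # vs)) x [a, b, c]"
proof -
  have D: "D (\<lambda>y. w y [W y, a, b]) x h = D (\<lambda>y. w y [W x, a, b]) x h + w x [D W x h, a, b]" for a b h
  proof -
    have "linear (\<lambda>v. w y [v, a, b])" if "y \<in> S" for y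
      using alternating_linear[OF w(2)[OF that], of "[]" "[a, b]"] by simp
    then have "((\<lambda>y. w y [W y, a, b]) has_derivative (\<lambda>h. D (\<lambda>y. w y [W x, a, b]) x h + w x [D W x h, a, b])) (at x)"
      by (rule has_derivative_slot[where F = "\<lambda>y v. w y [v, a, b]", OF coords_euclidean S x _
            smooth_on_has_derivative[OF w(1) x] smooth_on_has_derivative[OF W x]])
    then show ?thesis by (simp add: D_eqI)
  qed
  note sw = alternating3_swap[OF w(2)[OF x]]
  have "w x [a, D W x b, c] = - w x [D W x b, a, c]" "w x [a, b, D W x c] = w x [D W x c, a, b]"
    using sw(1)[of a "D W x b" c] sw(2)[of a b "D W x c"] sw(1)[of a "D W x c" b] by simp_all
  then show ?thesis
    using closed[of "[W x, a, b, c]"] unfolding dloc_eq lie_form_def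
    by (simp add: lessThan_Suc D)
qed

lemma has_derivative_imp_has_real_derivative:
  fixes g :: "real \<Rightarrow> real"
  assumes "(g has_derivative g') (at t)" shows "(g has_real_derivative g' 1) (at t)"
proof (rule has_derivative_imp_has_field_derivative[OF assms])
  show "h * g' 1 = g' h" for h
    using linear_scale[OF has_derivative_linear[OF assms], of h 1] by simp
qed

lemma has_derivative_covec:
  fixes g :: "'a::real_normed_vector \<Rightarrow> 'e::euclidean_space covec"
  assumes "\<And>b. ((\<lambda>x. blinfun_apply (g x) b) has_derivative (\<lambda>h. blinfun_apply (g' h) b)) (at x)"
  shows "(g has_derivative g') (at x)"
proof -
  have "((\<lambda>x. \<Sum>b\<in>Basis. g x b *\<^sub>R dual b) has_derivative (\<lambda>h. \<Sum>b\<in>Basis. g' h b *\<^sub>R dual b)) (at x)"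
    by (intro has_derivative_sum has_derivative_scaleR_left assms)
  moreover have "(\<lambda>x. \<Sum>b\<in>Basis. g x b *\<^sub>R dual b) = g" "(\<lambda>h. \<Sum>b\<in>Basis. g' h b *\<^sub>R dual b) = g'"
    by (rule ext, rule covec_expand[symmetric])+
  ultimately show ?thesis by simp
qed

section \<open>Anchors and the Jacobiator\<close>

abbreviation anchor :: "('e::euclidean_space covec list \<Rightarrow> real) \<Rightarrow> 'e covec \<Rightarrow> 'e" where
  "anchor P \<xi> \<equiv> vec (sharp P \<xi>)"

text \<open>Half of the Schouten square in coordinates, see \<open>schouten_self\<close>. For
  functions that are linear in the chart, with these differentials, it is the cyclic sum of the
  iterated brackets.\<close>

definition jacobiator ::
    "('e::euclidean_space \<Rightarrow> 'e covec list \<Rightarrow> real) \<Rightarrow> 'e \<Rightarrow> 'e covec \<Rightarrow> 'e covec \<Rightarrow> 'e covec \<Rightarrow> real" where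
  "jacobiator r x \<xi>1 \<xi>2 \<xi>3 = D (\<lambda>y. r y [\<xi>2, \<xi>3]) x (anchor (r x) \<xi>1)
     + D (\<lambda>y. r y [\<xi>3, \<xi>1]) x (anchor (r x) \<xi>2) + D (\<lambda>y. r y [\<xi>1, \<xi>2]) x (anchor (r x) \<xi>3)"

lemma linear_anchor: "alternating 2 P \<Longrightarrow> linear (anchor P)"
  by (rule linearI; rule covec_eq_iff[THEN iffD2], rule allI)
    (simp_all add: vec_sharp_apply blinfun.bilinear_simps
      linear_add[OF alternating2_linear(1)] linear_scale[OF alternating2_linear(1)])

lemma anchor_pushforward:
  assumes "linear L" "alternating 2 P" "alternating 2 Q"
    "\<And>\<eta>. Q [\<xi>, \<eta>] = P [covec_map L \<xi>, covec_map L \<eta>]"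
  shows "anchor Q \<xi> = L (anchor P (covec_map L \<xi>))"
  by (rule covec_eq_iff[THEN iffD2], rule allI) (simp add: assms vec_sharp_apply covec_map_apply[symmetric])

subsection \<open>Tensors transported by a flow\<close>

context
  fixes f :: "'e::euclidean_space \<times> real \<Rightarrow> 'e" and S T :: "('e \<times> real) set" and W :: "'e \<Rightarrow> 'e"
    and x :: 'e and t :: real
  assumes S: "open S" and T: "open T" and f: "smooth_on S f" and fT: "\<And>z. z \<in> S \<Longrightarrow> (f z, snd z) \<in> T"
    and xt: "(x, t) \<in> S"
    and flow: "\<And>y. (y, t) \<in> S \<Longrightarrow> D f (y, t) (0, 1) = W (f (y, t))"
    and W: "(W has_derivative D W (f (x, t))) (at (f (x, t)))"
begin

lemma D_time_slice:
  fixes g :: "'e \<times> real \<Rightarrow> 'b::real_normed_vector"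
  assumes "smooth_on S g"
  shows "((\<lambda>s. g (x, s)) has_derivative (\<lambda>h. D g (x, t) (0, h))) (at t)"
proof -
  have "((\<lambda>s. (x, s)) has_derivative (\<lambda>h. (0, h))) (at t)"
    by (intro has_derivative_Pair has_derivative_ident has_derivative_const)
  from has_derivative_smooth_compose[OF assms _ this] xt show ?thesis by simp
qed

text \<open>The variational equation: exchanging time and space derivatives turns the time
  derivative of the differential of the flow into the space derivative of the velocity
  \<open>W (f (y, t))\<close>.\<close>

lemma D_flow_D:
  "D (\<lambda>z. D f z (v, 0)) (x, t) (0, h) = h *\<^sub>R D W (f (x, t)) (D f (x, t) (v, 0))"
proof -
  note lin = smooth_on_linear_D[OF smooth_on_D[OF f, of "(v, 0)"] xt]
  have "D (\<lambda>z. D f z (v, 0)) (x, t) (0, 1) = D (\<lambda>z. D f z (0, 1)) (x, t) (v, 0)"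
    by (rule D_commute[OF S f xt])
  also have "\<dots> = D (\<lambda>y. D f (y, t) (0, 1)) x v"
    using D_eqI[OF has_derivative_slice[OF smooth_on_D[OF f] xt]] by simp
  also have "\<dots> = D (\<lambda>y. W (f (y, t))) x v"
  proof -
    have "open {y. (y, t) \<in> S}"
      using open_vimage[OF S, of "\<lambda>y. (y, t)"] by (simp add: vimage_def continuous_intros)
    from D_cong[OF this, of x "\<lambda>y. D f (y, t) (0, 1)" "\<lambda>y. W (f (y, t))"] flow xt
    show ?thesis by simp
  qed
  also have "\<dots> = D W (f (x, t)) (D f (x, t) (v, 0))"
    using D_eqI[OF has_derivative_compose[OF has_derivative_slice[OF f xt] W]] by simp
  finally show ?thesis
    using linear_scale[OF lin, of h "(0, 1)"] by simp
qed

lemma has_derivative_D_flow: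
  "((\<lambda>s. D f (x, s) (v, 0)) has_derivative (\<lambda>h. h *\<^sub>R D W (f (x, t)) (D f (x, t) (v, 0)))) (at t)"
  using D_time_slice[OF smooth_on_D[OF f, of "(v, 0)"]] by (simp add: D_flow_D)

lemma has_derivative_along_flow:
  fixes g :: "'e \<times> real \<Rightarrow> real"
  assumes "smooth_on T g"
  shows "((\<lambda>s. g (f (x, s), s)) has_derivative (\<lambda>h. D g (f (x, t), t) (h *\<^sub>R W (f (x, t)), h))) (at t)"
proof -
  have "D f (x, t) (0, h) = h *\<^sub>R W (f (x, t))" for h
    using linear_scale[OF smooth_on_linear_D[OF f xt], of h "(0, 1)"] flow[OF xt] by simp
  then have "((\<lambda>s. (f (x, s), s)) has_derivative (\<lambda>h. (h *\<^sub>R W (f (x, t)), h))) (at t)"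
    using D_time_slice[OF f] by (intro has_derivative_Pair has_derivative_ident) simp
  then show ?thesis
    using has_derivative_smooth_compose[OF assms, of "\<lambda>s. (f (x, s), s)" t] fT[OF xt] by simp
qed

lemma D_space_time:
  fixes g :: "'e \<times> real \<Rightarrow> real"
  assumes "smooth_on T g" "(y, t) \<in> T"
  shows "D g (y, t) (v, 1) = D g (y, t) (0, 1) + D (\<lambda>y. g (y, t)) y v"
  using linear_add[OF smooth_on_linear_D[OF assms], of "(0, 1)" "(v, 0)"]
    D_eqI[OF has_derivative_slice[OF assms]] by simp

text \<open>The product rule for multilinear expressions produces the explicit time derivative, a
  term from the moving base point, and the variational equation in each slot. The last two together
  make up the Lie derivative along W.\<close>

lemma transport_form:
  assumes w: "\<And>vs. smooth_on T (\<lambda>z. w z vs)" "\<And>z. z \<in> T \<Longrightarrow> alternating (length vs) (w z)"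
  shows "((\<lambda>s. w (f (x, s), s) (map (\<lambda>v. D f (x, s) (v, 0)) vs)) has_real_derivative
    (let y = f (x, t); us = map (\<lambda>v. D f (x, t) (v, 0)) vs
     in D (\<lambda>z. w z us) (y, t) (0, 1) + lie_form (\<lambda>y. w (y, t)) W y us)) (at t)"
proof -
  let ?y = "f (x, t)"
  let ?us = "map (\<lambda>v. D f (x, t) (v, 0)) vs"
  define gs where "gs = map (\<lambda>v s. D f (x, s) (v, 0)) vs"
  define R where "R = {s. (x, s) \<in> S}"
  have R: "open R" unfolding R_def
    using open_vimage[OF S, of "\<lambda>s. (x, s)"] by (simp add: vimage_def continuous_intros)
  have gs: "map (\<lambda>g. g s) gs = map (\<lambda>v. D f (x, s) (v, 0)) vs" "length gs = length vs" for s
    unfolding gs_def by simp_all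
  have g': "(g has_derivative (\<lambda>h. h *\<^sub>R D W ?y (g t))) (at t)" if "g \<in> set gs" for g
    using that has_derivative_D_flow unfolding gs_def by auto
  have "((\<lambda>s. w (f (x, s), s) (map (\<lambda>g. g s) gs)) has_derivative
     (\<lambda>h. D (\<lambda>z. w z (map (\<lambda>g. g t) gs)) (?y, t) (h *\<^sub>R W ?y, h) +
      (\<Sum>i<length gs. w (?y, t) ((map (\<lambda>g. g t) gs)[i := h *\<^sub>R D W ?y ((gs ! i) t)])))) (at t)"
  proof (rule has_derivative_multilinear[OF coords_euclidean R,
        where F = "\<lambda>s. w (f (x, s), s)" and F' = "\<lambda>us h. D (\<lambda>z. w z us) (?y, t) (h *\<^sub>R W ?y, h)"
          and g' = "\<lambda>g h. h *\<^sub>R D W ?y (g t)"])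
    show "t \<in> R" using xt R_def by simp
    show "multilinear (length gs) (w (f (x, s), s))" if "s \<in> R" for s
      using w(2)[OF fT, of "(x, s)"] that unfolding R_def gs by (simp add: alternating_multilinear)
    show "((\<lambda>s. w (f (x, s), s) us) has_derivative (\<lambda>h. D (\<lambda>z. w z us) (?y, t) (h *\<^sub>R W ?y, h))) (at t)" for us
      by (rule has_derivative_along_flow[OF w(1)])
  qed (rule g')
  from has_derivative_imp_has_real_derivative[OF this]
  have "((\<lambda>s. w (f (x, s), s) (map (\<lambda>v. D f (x, s) (v, 0)) vs)) has_real_derivative
     D (\<lambda>z. w z ?us) (?y, t) (W ?y, 1) +
      (\<Sum>i<length vs. w (?y, t) (?us[i := D W ?y ((gs ! i) t)]))) (at t)"
    unfolding gs by simp
  moreover have "(gs ! i) t = ?us ! i" if "i < length vs" for i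
    using that unfolding gs_def by simp
  ultimately show ?thesis
    using D_space_time[OF w(1) fT[OF xt, simplified], of ?us "W ?y"]
    unfolding Let_def lie_form_def by (simp add: add.assoc)
qed

text \<open>q is the pullback of r along the flow, expressed without inverting the differential: r
  on (\<xi>, \<eta>) is q on the pulled back covectors. This relation is differentiated in t and
  solved for the derivative of q; the bracketed terms are the Lie derivative of r along W.\<close>

lemma transport_bivector:
  assumes r: "\<And>\<xi>s. smooth_on T (\<lambda>z. r z \<xi>s)" "\<And>z. z \<in> T \<Longrightarrow> alternating 2 (r z)"
    and q: "\<And>\<xi>s. smooth_on S (\<lambda>z. q z \<xi>s)" "\<And>z. z \<in> S \<Longrightarrow> alternating 2 (q z)"
    and rel: "\<And>z \<xi> \<eta>. z \<in> S \<Longrightarrow>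
      r (f z, snd z) [\<xi>, \<eta>] = q z [covec_map (\<lambda>v. D f z (v, 0)) \<xi>, covec_map (\<lambda>v. D f z (v, 0)) \<eta>]"
  shows "let y = f (x, t); L = \<lambda>v. D f (x, t) (v, 0)
    in D (\<lambda>z. q z [covec_map L \<xi>, covec_map L \<eta>]) (x, t) (0, 1) =
      D (\<lambda>z. r z [\<xi>, \<eta>]) (y, t) (0, 1) + (D (\<lambda>y. r (y, t) [\<xi>, \<eta>]) y (W y)
        - r (y, t) [covec_map (D W y) \<xi>, \<eta>] - r (y, t) [\<xi>, covec_map (D W y) \<eta>])"
proof -
  let ?y = "f (x, t)"
  define L where "L s = (\<lambda>v. D f (x, s) (v, 0))" for s
  define R where "R = {s. (x, s) \<in> S}"
  have R: "open R" unfolding R_def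
    using open_vimage[OF S, of "\<lambda>s. (x, s)"] by (simp add: vimage_def continuous_intros)
  have tR: "t \<in> R" using xt R_def by simp
  have linL: "linear (L s)" if "s \<in> R" for s
    using linear_compose[OF bounded_linear.linear[OF bounded_linear_Pair_left] smooth_on_linear_D[OF f]] that
    unfolding L_def R_def o_def by auto
  have linW: "linear (D W ?y)" using has_derivative_linear[OF W] .
  have cm: "((\<lambda>s. covec_map (L s) \<xi>) has_derivative
      (\<lambda>h. h *\<^sub>R covec_map (L t) (covec_map (D W ?y) \<xi>))) (at t)" for \<xi>
  proof (rule has_derivative_covec)
    fix b
    have "((\<lambda>s. blinfun_apply \<xi> (L s b)) has_derivative (\<lambda>h. blinfun_apply \<xi> (h *\<^sub>R D W ?y (L t b)))) (at t)"
      using bounded_linear.has_derivative[OF blinfun.bounded_linear_right has_derivative_D_flow]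
      unfolding L_def .
    then have "((\<lambda>s. blinfun_apply (covec_map (L s) \<xi>) b) has_derivative
        (\<lambda>h. blinfun_apply \<xi> (h *\<^sub>R D W ?y (L t b)))) (at t)"
      by (rule has_derivative_transform_within_open[OF _ R tR]) (simp add: covec_map_apply linL)
    then show "((\<lambda>s. blinfun_apply (covec_map (L s) \<xi>) b) has_derivative
        (\<lambda>h. blinfun_apply (h *\<^sub>R covec_map (L t) (covec_map (D W ?y) \<xi>)) b)) (at t)"
      by (simp add: blinfun.bilinear_simps covec_map_apply linL[OF tR] linW)
  qed
  define gs where "gs = map (\<lambda>\<xi> s. covec_map (L s) \<xi>) [\<xi>, \<eta>]"
  define g' where "g' i h = h *\<^sub>R covec_map (L t) (covec_map (D W ?y) ([\<xi>, \<eta>] ! i))" for i :: nat and h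
  have linq: "linear (\<lambda>v. q (x, s) [v, \<eta>])" "linear (\<lambda>v. q (x, s) [\<xi>, v])" if "s \<in> R" for s \<xi> \<eta>
    using alternating2_linear[OF q(2), of "(x, s)"] that unfolding R_def by auto
  \<comment> \<open>The two slots are released one after the other: the slot rule for the second
    provides the derivative that the slot rule for the first requires.\<close>
  have inner: "((\<lambda>s. q (x, s) [\<zeta>, covec_map (L s) \<eta>]) has_derivative
     (\<lambda>h. D (\<lambda>z. q z [\<zeta>, covec_map (L t) \<eta>]) (x, t) (0, h) +
        q (x, t) [\<zeta>, h *\<^sub>R covec_map (L t) (covec_map (D W ?y) \<eta>)])) (at t)" for \<zeta>
    by (rule has_derivative_slot[OF coords_covec R tR,
          where F = "\<lambda>s v. q (x, s) [\<zeta>, v]" and F' = "\<lambda>v h. D (\<lambda>z. q z [\<zeta>, v]) (x, t) (0, h)",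
            OF linq(2) D_time_slice[OF q(1)] cm])
  have "linear (\<lambda>v. q (x, s) [v, covec_map (L s) \<eta>])" if "s \<in> R" for s using linq(1)[OF that] .
  note 1 = has_derivative_slot[where F = "\<lambda>s v. q (x, s) [v, covec_map (L s) \<eta>]", OF coords_covec R tR this inner cm]
  have "((\<lambda>s. r (f (x, s), s) [\<xi>, \<eta>]) has_derivative (\<lambda>h. D (\<lambda>z. r z [\<xi>, \<eta>]) (?y, t) (h *\<^sub>R W ?y, h))) (at t)"
    by (rule has_derivative_along_flow[OF r(1)])
  then have "((\<lambda>s. q (x, s) [covec_map (L s) \<xi>, covec_map (L s) \<eta>]) has_derivative
      (\<lambda>h. D (\<lambda>z. r z [\<xi>, \<eta>]) (?y, t) (h *\<^sub>R W ?y, h))) (at t)"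
    by (rule has_derivative_transform_within_open[OF _ R tR])
      (use rel[of "(x, _)"] in \<open>simp add: R_def L_def\<close>)
  from fun_cong[OF has_derivative_unique[OF this 1], of 1]
  have 2: "D (\<lambda>z. r z [\<xi>, \<eta>]) (?y, t) (W ?y, 1) = D (\<lambda>z. q z [covec_map (L t) \<xi>, covec_map (L t) \<eta>]) (x, t) (0, 1) +
        q (x, t) [covec_map (L t) \<xi>, covec_map (L t) (covec_map (D W ?y) \<eta>)]
      + q (x, t) [covec_map (L t) (covec_map (D W ?y) \<xi>), covec_map (L t) \<eta>]" by simp
  have rel': "q (x, t) [covec_map (L t) \<xi>, covec_map (L t) \<eta>] = r (?y, t) [\<xi>, \<eta>]" for \<xi> \<eta>
    using rel[OF xt] unfolding L_def by simp
  show ?thesis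
    using 2 D_space_time[OF r(1) fT[OF xt, simplified], of "[\<xi>, \<eta>]" "W ?y"]
    unfolding Let_def L_def[symmetric] rel' by simp
qed

end

subsection \<open>The Jacobiator of a bivector field\<close>

lemma smooth_on_anchor:
  "open S \<Longrightarrow> (\<And>\<xi>s. smooth_on S (\<lambda>x. r x \<xi>s)) \<Longrightarrow> smooth_on S (\<lambda>x. anchor (r x) \<xi>)"
  unfolding vec_def sharp_def by (intro smooth_on_sum smooth_on_scaleR smooth_on_const)

lemma D_anchor:
  assumes S: "open S" and r: "\<And>\<xi>s. smooth_on S (\<lambda>x. r x \<xi>s)" "\<And>x. x \<in> S \<Longrightarrow> alternating 2 (r x)" and x: "x \<in> S"
  shows "blinfun_apply \<eta> (D (\<lambda>x. anchor (r x) \<xi>) x v) = D (\<lambda>x. r x [\<xi>, \<eta>]) x v"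
proof -
  have "((\<lambda>x. blinfun_apply \<eta> (anchor (r x) \<xi>)) has_derivative
      (\<lambda>v. blinfun_apply \<eta> (D (\<lambda>x. anchor (r x) \<xi>) x v))) (at x)"
    by (rule bounded_linear.has_derivative[OF blinfun.bounded_linear_right
          smooth_on_has_derivative[OF smooth_on_anchor[OF S r(1)] x]])
  then have "((\<lambda>x. r x [\<xi>, \<eta>]) has_derivative
      (\<lambda>v. blinfun_apply \<eta> (D (\<lambda>x. anchor (r x) \<xi>) x v))) (at x)"
    by (rule has_derivative_transform_within_open[OF _ S x]) (simp add: vec_sharp_apply r(2))
  then show ?thesis by (simp add: D_eqI)
qed

text \<open>Differentiating the pulled back covectors produces extra terms, second derivatives of f
  applied to two anchors. In the cyclic sum they cancel in pairs by symmetry.\<close>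

lemma jacobiator_pushforward:
  fixes f :: "'e::euclidean_space \<Rightarrow> 'e"
  assumes S: "open S" and T: "open T" and f: "smooth_on S f" "f ` S \<subseteq> T"
    and r: "\<And>\<xi>s. smooth_on T (\<lambda>z. r z \<xi>s)" "\<And>z. z \<in> T \<Longrightarrow> alternating 2 (r z)"
    and q: "\<And>\<xi>s. smooth_on S (\<lambda>z. q z \<xi>s)" "\<And>z. z \<in> S \<Longrightarrow> alternating 2 (q z)"
    and rel: "\<And>z \<xi> \<eta>. z \<in> S \<Longrightarrow> r (f z) [\<xi>, \<eta>] = q z [covec_map (D f z) \<xi>, covec_map (D f z) \<eta>]"
    and x: "x \<in> S"
  shows "jacobiator r (f x) \<xi>1 \<xi>2 \<xi>3 =
    jacobiator q x (covec_map (D f x) \<xi>1) (covec_map (D f x) \<xi>2) (covec_map (D f x) \<xi>3)"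
proof -
  have fx: "f x \<in> T" using f x by auto
  let ?c = "\<lambda>\<xi>. covec_map (D f x) \<xi>"
  define H where "H u v = D (\<lambda>y. D f y v) x u" for u v
  have linD: "linear (D f z)" if "z \<in> S" for z using smooth_on_linear_D[OF f(1) that] .
  have linH: "linear (H u)" for u
  proof -
    have "H u = D (\<lambda>y. D f y u) x" unfolding H_def by (rule ext) (rule D_commute[OF S f(1) x])
    then show ?thesis using smooth_on_linear_D[OF smooth_on_D[OF f(1)] x] by simp
  qed
  have H_sym: "H u v = H v u" for u v unfolding H_def by (rule D_commute[OF S f(1) x])
  have cm: "((\<lambda>y. covec_map (D f y) \<xi>) has_derivative (\<lambda>u. covec_map (H u) \<xi>)) (at x)" for \<xi>
  proof (rule has_derivative_covec)
    fix b
    have "((\<lambda>y. blinfun_apply \<xi> (D f y b)) has_derivative (\<lambda>u. blinfun_apply \<xi> (H u b))) (at x)"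
      unfolding H_def
      by (rule bounded_linear.has_derivative[OF blinfun.bounded_linear_right
            smooth_on_has_derivative[OF smooth_on_D[OF f(1)] x]])
    then have "((\<lambda>y. blinfun_apply (covec_map (D f y) \<xi>) b) has_derivative (\<lambda>u. blinfun_apply \<xi> (H u b))) (at x)"
      by (rule has_derivative_transform_within_open[OF _ S x]) (simp add: covec_map_apply linD)
    then show "((\<lambda>y. blinfun_apply (covec_map (D f y) \<xi>) b) has_derivative (\<lambda>u. blinfun_apply (covec_map (H u) \<xi>) b)) (at x)"
      by (simp add: covec_map_apply linH)
  qed
  have linq: "linear (\<lambda>v. q z [v, \<eta>])" "linear (\<lambda>v. q z [\<xi>, v])" if "z \<in> S" for z \<xi> \<eta>
    using alternating2_linear[OF q(2)[OF that]] by auto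
  have D1: "D (\<lambda>y. r y [\<xi>, \<eta>]) (f x) (D f x u) =
      D (\<lambda>y. q y [?c \<xi>, ?c \<eta>]) x u - blinfun_apply \<xi> (H u (anchor (q x) (?c \<eta>))) + blinfun_apply \<eta> (H u (anchor (q x) (?c \<xi>)))"
    for \<xi> \<eta> u
  proof -
    have inner: "((\<lambda>y. q y [\<zeta>, covec_map (D f y) \<eta>]) has_derivative
       (\<lambda>u. D (\<lambda>y. q y [\<zeta>, ?c \<eta>]) x u + q x [\<zeta>, covec_map (H u) \<eta>])) (at x)" for \<zeta>
      by (rule has_derivative_slot[OF coords_covec S x,
            where F = "\<lambda>y v. q y [\<zeta>, v]" and F' = "\<lambda>v. D (\<lambda>y. q y [\<zeta>, v]) x",
              OF linq(2) smooth_on_has_derivative[OF q(1) x] cm])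
    have "linear (\<lambda>v. q y [v, covec_map (D f y) \<eta>])" if "y \<in> S" for y using linq(1)[OF that] .
    note 1 = has_derivative_slot[where F = "\<lambda>y v. q y [v, covec_map (D f y) \<eta>]", OF coords_covec S x this inner cm]
    have "((\<lambda>y. r (f y) [\<xi>, \<eta>]) has_derivative (\<lambda>u. D (\<lambda>y. r y [\<xi>, \<eta>]) (f x) (D f x u))) (at x)"
      by (rule has_derivative_smooth_compose[OF r(1) fx smooth_on_has_derivative[OF f(1) x]])
    then have "((\<lambda>y. q y [covec_map (D f y) \<xi>, covec_map (D f y) \<eta>]) has_derivative
        (\<lambda>u. D (\<lambda>y. r y [\<xi>, \<eta>]) (f x) (D f x u))) (at x)"
      by (rule has_derivative_transform_within_open[OF _ S x]) (rule rel)
    from fun_cong[OF has_derivative_unique[OF this 1], of u]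
    show ?thesis
      using alternating2_swap[OF q(2)[OF x], of "covec_map (H u) \<xi>" "?c \<eta>"]
      by (simp add: vec_sharp_apply[OF q(2)[OF x], symmetric] covec_map_apply linH)
  qed
  have an: "anchor (r (f x)) \<xi> = D f x (anchor (q x) (?c \<xi>))" for \<xi>
    by (rule anchor_pushforward[OF linD[OF x] q(2)[OF x] r(2)[OF fx] rel[OF x]])
  show ?thesis
    unfolding jacobiator_def an D1
    using H_sym[of "anchor (q x) (?c \<xi>1)" "anchor (q x) (?c \<xi>2)"]
      H_sym[of "anchor (q x) (?c \<xi>1)" "anchor (q x) (?c \<xi>3)"]
      H_sym[of "anchor (q x) (?c \<xi>2)" "anchor (q x) (?c \<xi>3)"] by simp
qed

text \<open>Here \<open>q = e\<^sup>b r\<close>.\<close>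

lemma jacobiator_gauge:
  fixes r q :: "'e::euclidean_space \<Rightarrow> 'e covec list \<Rightarrow> real" and b :: "'e \<Rightarrow> 'e list \<Rightarrow> real"
  assumes S: "open S" and x: "x \<in> S"
    and r: "\<And>\<xi>s. smooth_on S (\<lambda>z. r z \<xi>s)" "\<And>z. z \<in> S \<Longrightarrow> alternating 2 (r z)"
    and q: "\<And>\<xi>s. smooth_on S (\<lambda>z. q z \<xi>s)" "\<And>z. z \<in> S \<Longrightarrow> alternating 2 (q z)"
    and b: "\<And>vs. smooth_on S (\<lambda>z. b z vs)" "\<And>z. z \<in> S \<Longrightarrow> alternating 2 (b z)"
    and rel: "\<And>z \<xi>. z \<in> S \<Longrightarrow> anchor (q z) (\<xi> + flat (b z) (anchor (r z) \<xi>)) = anchor (r z) \<xi>"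
  defines "\<theta> \<equiv> \<lambda>\<xi>. \<xi> + flat (b x) (anchor (r x) \<xi>)"
  shows "jacobiator q x (\<theta> \<xi>1) (\<theta> \<xi>2) (\<theta> \<xi>3) = jacobiator r x \<xi>1 \<xi>2 \<xi>3
    + dloc b x [anchor (r x) \<xi>1, anchor (r x) \<xi>2, anchor (r x) \<xi>3]"
proof -
  define G where "G y \<xi> = \<xi> + flat (b y) (anchor (r y) \<xi>)" for y \<xi>
  have G: "G y \<xi> v = \<xi> v + b y [anchor (r y) \<xi>, v]" if "y \<in> S" for y \<xi> v
    unfolding G_def by (simp add: blinfun.bilinear_simps flat_apply b(2)[OF that])
  have linb: "linear (\<lambda>v. b y [v, w])" "linear (\<lambda>w. b y [v, w])" if "y \<in> S" for y v w
    using alternating2_linear[OF b(2)[OF that]] by auto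
  define G' where "G' u \<xi> = Blinfun (\<lambda>v. D (\<lambda>y. b y [anchor (r x) \<xi>, v]) x u + b x [D (\<lambda>y. anchor (r y) \<xi>) x u, v])" for u \<xi>
  have DG: "((\<lambda>y. G y \<xi> v) has_derivative
      (\<lambda>u. D (\<lambda>y. b y [anchor (r x) \<xi>, v]) x u + b x [D (\<lambda>y. anchor (r y) \<xi>) x u, v])) (at x)" for \<xi> v
  proof -
    have "((\<lambda>y. \<xi> v + b y [anchor (r y) \<xi>, v]) has_derivative
      (\<lambda>u. 0 + (D (\<lambda>y. b y [anchor (r x) \<xi>, v]) x u + b x [D (\<lambda>y. anchor (r y) \<xi>) x u, v]))) (at x)"
      by (intro has_derivative_add has_derivative_const has_derivative_slot[OF coords_euclidean S x,
            where F = "\<lambda>y w. b y [w, v]" and F' = "\<lambda>w. D (\<lambda>y. b y [w, v]) x"] linb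
            smooth_on_has_derivative[OF b(1) x] smooth_on_has_derivative[OF smooth_on_anchor[OF S r(1)] x])
    then have "((\<lambda>y. G y \<xi> v) has_derivative
      (\<lambda>u. 0 + (D (\<lambda>y. b y [anchor (r x) \<xi>, v]) x u + b x [D (\<lambda>y. anchor (r y) \<xi>) x u, v]))) (at x)"
      by (rule has_derivative_transform_within_open[OF _ S x]) (simp add: G)
    then show ?thesis by simp
  qed
  have G': "G' u \<xi> v = D (\<lambda>y. b y [anchor (r x) \<xi>, v]) x u + b x [D (\<lambda>y. anchor (r y) \<xi>) x u, v]" for u \<xi> v
  proof -
    have "linear (\<lambda>v. D (\<lambda>y. b y [w, v]) x u)" for w
    proof (rule linearI)
      fix v v' c
      have "((\<lambda>y. b y [w, v] + b y [w, v']) has_derivative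
          (\<lambda>u. D (\<lambda>y. b y [w, v]) x u + D (\<lambda>y. b y [w, v']) x u)) (at x)"
        by (intro has_derivative_add smooth_on_has_derivative[OF b(1) x])
      then have "((\<lambda>y. b y [w, v + v']) has_derivative
          (\<lambda>u. D (\<lambda>y. b y [w, v]) x u + D (\<lambda>y. b y [w, v']) x u)) (at x)"
        by (rule has_derivative_transform_within_open[OF _ S x]) (simp add: linear_add[OF linb(2)])
      then show "D (\<lambda>y. b y [w, v + v']) x u = D (\<lambda>y. b y [w, v]) x u + D (\<lambda>y. b y [w, v']) x u"
        by (simp add: D_eqI)
      have "((\<lambda>y. c * b y [w, v]) has_derivative (\<lambda>u. c * D (\<lambda>y. b y [w, v]) x u)) (at x)"
        by (intro has_derivative_mult_right smooth_on_has_derivative[OF b(1) x])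
      then have "((\<lambda>y. b y [w, c *\<^sub>R v]) has_derivative (\<lambda>u. c * D (\<lambda>y. b y [w, v]) x u)) (at x)"
        by (rule has_derivative_transform_within_open[OF _ S x]) (simp add: linear_scale[OF linb(2)])
      then show "D (\<lambda>y. b y [w, c *\<^sub>R v]) x u = c *\<^sub>R D (\<lambda>y. b y [w, v]) x u"
        by (simp add: D_eqI)
    qed
    then have "linear (\<lambda>v. D (\<lambda>y. b y [anchor (r x) \<xi>, v]) x u + b x [D (\<lambda>y. anchor (r y) \<xi>) x u, v])"
      by (intro linear_compose_add linb x)
    then show ?thesis unfolding G'_def
      by (simp add: bounded_linear_Blinfun_apply linear_conv_bounded_linear)
  qed
  have cG: "((\<lambda>y. G y \<xi>) has_derivative (\<lambda>u. G' u \<xi>)) (at x)" for \<xi>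
    by (rule has_derivative_covec) (use DG in \<open>simp add: G'\<close>)
  have an: "anchor (q y) (G y \<xi>) = anchor (r y) \<xi>" if "y \<in> S" for y \<xi>
    using rel[OF that] unfolding G_def .
  have qr: "q y [G y \<xi>, \<eta>] = r y [\<xi>, \<eta>]" if "y \<in> S" for y \<xi> \<eta>
    using an[OF that, of \<xi>] vec_sharp_apply[OF q(2)[OF that], of \<eta> "G y \<xi>"]
      vec_sharp_apply[OF r(2)[OF that], of \<eta> \<xi>] by simp
  \<comment> \<open>The arguments \<open>G x \<xi>\<close> and \<open>G x \<eta>\<close> are frozen
    at x, so \<open>qr\<close> cannot be differentiated directly. Letting the first one move gives a
    correction by \<open>G' u \<xi>\<close>; its part with the derivative of the anchor cancels, by
    skew-symmetry of b, the one that \<open>G x \<eta>\<close> produces on the side of r.\<close>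
  have key: "D (\<lambda>y. q y [G x \<xi>, G x \<eta>]) x u = D (\<lambda>y. r y [\<xi>, \<eta>]) x u
      + D (\<lambda>y. b y [anchor (r x) \<xi>, anchor (r x) \<eta>]) x u" for \<xi> \<eta> u
  proof -
    note slot = has_derivative_slot[OF coords_covec S x,
          where F = "\<lambda>y v. q y [v, G x \<eta>]" and F' = "\<lambda>v. D (\<lambda>y. q y [v, G x \<eta>]) x",
              OF alternating2_linear(1)[OF q(2)] smooth_on_has_derivative[OF q(1) x] cG]
    have "((\<lambda>y. q y [G y \<xi>, G x \<eta>]) has_derivative D (\<lambda>y. r y [\<xi>, G x \<eta>]) x) (at x)"
      by (rule has_derivative_transform_within_open[OF smooth_on_has_derivative[OF r(1) x] S x])
        (simp add: qr)
    from fun_cong[OF has_derivative_unique[OF this slot], of u]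
    have "D (\<lambda>y. r y [\<xi>, G x \<eta>]) x u = D (\<lambda>y. q y [G x \<xi>, G x \<eta>]) x u + q x [G' u \<xi>, G x \<eta>]" .
    moreover have "q x [G' u \<xi>, G x \<eta>] = - G' u \<xi> (anchor (r x) \<eta>)"
      using alternating2_swap[OF q(2)[OF x], of "G' u \<xi>" "G x \<eta>"] vec_sharp_apply[OF q(2)[OF x], of "G' u \<xi>" "G x \<eta>"]
        an[OF x] by simp
    moreover have "D (\<lambda>y. r y [\<xi>, G x \<eta>]) x u = D (\<lambda>y. r y [\<xi>, \<eta>]) x u
        + b x [anchor (r x) \<eta>, D (\<lambda>y. anchor (r y) \<xi>) x u]"
      using D_anchor[OF S r x, of "G x \<eta>" \<xi> u] D_anchor[OF S r x, of \<eta> \<xi> u] G[OF x, of \<eta>] by simp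
    ultimately show ?thesis
      using alternating2_swap[OF b(2)[OF x], of "anchor (r x) \<eta>" "D (\<lambda>y. anchor (r y) \<xi>) x u"]
      by (simp add: G')
  qed
  have sw: "D (\<lambda>y. b y [v, w]) x u = - D (\<lambda>y. b y [w, v]) x u" for u v w
  proof -
    have "((\<lambda>y. b y [v, w]) has_derivative (\<lambda>u. - D (\<lambda>y. b y [w, v]) x u)) (at x)"
      by (rule has_derivative_transform_within_open[OF has_derivative_minus[OF smooth_on_has_derivative[OF b(1) x]] S x])
        (simp add: alternating2_swap[OF b(2), of _ v w])
    then show ?thesis by (simp add: D_eqI)
  qed
  \<comment> \<open>By \<open>an\<close> the anchors of q at the transformed covectors are those of
    r, so the cyclic sum of the terms with b is the exterior derivative of b.\<close>
  show ?thesis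
    unfolding jacobiator_def \<theta>_def G_def[symmetric] an[OF x] key dloc_eq
    using sw[of "anchor (r x) \<xi>1" "anchor (r x) \<xi>3" "anchor (r x) \<xi>2"] by simp
qed

section \<open>Smooth families\<close>

lemma open_slice1: "open S \<Longrightarrow> open {y. (y, t) \<in> S}"
  using open_vimage[of S "\<lambda>y. (y, t)"] by (simp add: vimage_def continuous_intros)

lemma open_slice2: "open S \<Longrightarrow> open {s. (x, s) \<in> S}"
  using open_vimage[of S "\<lambda>s. (x, s)"] by (simp add: vimage_def continuous_intros)

lemma smooth_on_slice:
  fixes g :: "'a::euclidean_space \<times> real \<Rightarrow> 'b::real_normed_vector"
  assumes "smooth_on S g" "open S" "open T" "\<And>x. x \<in> T \<Longrightarrow> (x, t) \<in> S"
  shows "smooth_on T (\<lambda>x. g (x, t))"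
  using assms by (intro smooth_on_compose[OF _ _ _ smooth_on_Pair[OF _ smooth_on_id smooth_on_const]]) auto

lemma smooth_on_slice2:
  fixes g :: "'a::euclidean_space \<times> real \<Rightarrow> 'b::real_normed_vector"
  assumes "smooth_on S g" "open S" "open T" "\<And>s. s \<in> T \<Longrightarrow> (x, s) \<in> S"
  shows "smooth_on T (\<lambda>s. g (x, s))"
  using assms by (intro smooth_on_compose[OF _ _ _ smooth_on_Pair[OF _ smooth_on_const smooth_on_id]]) auto

context smooth_manifold
begin

section \<open>Families of maps in charts and their inverses\<close>

lemma open_rept_dom:
  assumes "smooth_map_family A \<Phi>" "c \<in> A" "c' \<in> A"
  shows "open (rept_dom c c' \<Phi>)"
proof -
  have "continuous_on UNIV (\<lambda>z. \<Phi> (snd z) (fst z))"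
    using assms(1) unfolding smooth_map_family_def by (simp add: case_prod_unfold)
  moreover have "continuous_on (cimage c \<times> UNIV) (\<lambda>z::'e \<times> real. (cinv c (fst z), snd z))"
    by (intro continuous_on_Pair continuous_on_compose2[OF continuous_cinv[OF assms(2)]] continuous_on_fst continuous_on_snd continuous_on_id) auto
  ultimately have "continuous_on (cimage c \<times> UNIV) (\<lambda>z. \<Phi> (snd z) (cinv c (fst z)))"
    using continuous_on_compose2[of UNIV "\<lambda>z. \<Phi> (snd z) (fst z)"] by fastforce
  then have "open ((cimage c \<times> UNIV) \<inter> (\<lambda>z. \<Phi> (snd z) (cinv c (fst z))) -` fst c')"
    by (intro continuous_open_preimage open_Times open_UNIV open_cimage open_chart_dom assms)
  moreover have "(cimage c \<times> UNIV) \<inter> (\<lambda>z. \<Phi> (snd z) (cinv c (fst z))) -` fst c' = rept_dom c c' \<Phi>"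
    unfolding rept_dom_def by auto
  ultimately show ?thesis by simp
qed

lemma smooth_rept:
  "smooth_map_family A \<Phi> \<Longrightarrow> c \<in> A \<Longrightarrow> c' \<in> A \<Longrightarrow> smooth_on (rept_dom c c' \<Phi>) (rept c c' \<Phi>)"
  unfolding smooth_map_family_def rept_dom_def rept_def by blast

lemma rept_rep: "rept c c' \<Phi> (x, t) = rep c c' (\<Phi> t) x"
  unfolding rept_def rep_def by simp

lemma rept_dom_iff: "(x, t) \<in> rept_dom c c' \<Phi> \<longleftrightarrow> x \<in> rep_dom c c' (\<Phi> t)"
  unfolding rept_dom_def rep_dom_def by simp

lemma smooth_map_family_slice:
  assumes "smooth_map_family A \<Phi>" shows "smooth_map A (\<Phi> t)"
  unfolding smooth_map_def
proof (intro conjI ballI)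
  have "continuous_on UNIV (\<lambda>z. \<Phi> (snd z) (fst z))"
    using assms unfolding smooth_map_family_def by (simp add: case_prod_unfold)
  moreover have "continuous_on UNIV (\<lambda>p::'m. (p, t))"
    by (intro continuous_on_Pair continuous_on_id continuous_on_const)
  ultimately show "continuous_on UNIV (\<Phi> t)"
    using continuous_on_compose2[of UNIV "\<lambda>z. \<Phi> (snd z) (fst z)" UNIV "\<lambda>p. (p, t)"] by simp
  fix c c' assume c: "c \<in> A" "c' \<in> A"
  have "rep_dom c c' (\<Phi> t) = {x. (x, t) \<in> rept_dom c c' \<Phi>}" by (rule set_eqI) (simp add: rept_dom_iff)
  then have "open (rep_dom c c' (\<Phi> t))" using open_slice1[OF open_rept_dom[OF assms c]] by simp
  then have "smooth_on (rep_dom c c' (\<Phi> t)) (\<lambda>x. rept c c' \<Phi> (x, t))"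
    by (intro smooth_on_slice[OF smooth_rept[OF assms c] open_rept_dom[OF assms c]]) (auto simp: rept_dom_iff)
  then show "smooth_on (snd c ` (fst c \<inter> \<Phi> t -` fst c')) (snd c' \<circ> \<Phi> t \<circ> cinv c)"
    unfolding rept_rep rep_dom_alt[OF c(1)] by (simp add: rep_def o_def)
qed

lemma D_rept:
  assumes "smooth_map_family A \<Phi>" "c \<in> A" "c' \<in> A" "(x, t) \<in> rept_dom c c' \<Phi>"
  shows "D (rep c c' (\<Phi> t)) x = (\<lambda>v. D (rept c c' \<Phi>) (x, t) (v, 0))"
  using D_eqI[OF has_derivative_slice[OF smooth_rept[OF assms(1-3)] assms(4)]] unfolding rept_rep .

text \<open>The continuity of the inverses follows from invariance of domain, applied to \<open>(x, t) \<mapsto> (\<Phi>\<^sub>t(x), t)\<close>.\<close>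

lemma inverse_family_chart:
  assumes \<Phi>: "smooth_map_family A \<Phi>" "\<And>t. diffeo A (\<Phi> t)" and c: "c \<in> A" "c' \<in> A"
  defines "\<Psi> \<equiv> \<lambda>t. inv (\<Phi> t)"
  shows "open (rept_dom c' c \<Psi>)" "smooth_on (rept_dom c' c \<Psi>) (rept c' c \<Psi>)"
proof -
  have bij: "bij (\<Phi> t)" and inv: "smooth_map A (\<Psi> t)" for t
    using \<Phi>(2) unfolding diffeo_def \<Psi>_def by auto
  have \<Psi>\<Phi>: "\<Psi> t (\<Phi> t p) = p" "\<Phi> t (\<Psi> t p) = p" for t p
    using bij[of t] unfolding \<Psi>_def by (simp_all add: bij_is_inj bij_is_surj surj_f_inv_f)
  let ?S = "rept_dom c c' \<Phi>" and ?T = "rept_dom c' c \<Psi>"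
  define F where "F z = (rept c c' \<Phi> z, snd z)" for z
  define G where "G z = (rept c' c \<Psi> z, snd z)" for z
  note S = open_rept_dom[OF \<Phi>(1) c]
  have F: "smooth_on ?S F" unfolding F_def by (intro smooth_on_Pair S smooth_on_snd smooth_rept[OF \<Phi>(1) c])
  have GF: "F z \<in> ?T \<and> G (F z) = z" if "z \<in> ?S" for z
    using that c unfolding F_def G_def rept_dom_def rept_def
    by (auto simp: cinv_chart chart_in \<Psi>\<Phi> cinv_in chart_cinv)
  have FG: "G z \<in> ?S \<and> F (G z) = z" if "z \<in> ?T" for z
    using that c unfolding F_def G_def rept_dom_def rept_def
    by (auto simp: cinv_chart chart_in \<Psi>\<Phi> cinv_in chart_cinv)
  have im: "F ` ?S = ?T" using GF FG by (metis (no_types, lifting) image_eqI subsetI subset_antisym image_subset_iff)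
  have inj: "inj_on F ?S" using GF by (metis inj_onI)
  show T: "open ?T"
    using invariance_of_domain[OF smooth_on_continuous[OF F] S inj] im by simp
  obtain g where "homeomorphism ?S (F ` ?S) F g"
    using invariance_of_domain_homeomorphism[OF S smooth_on_continuous[OF F] _ inj] by blast
  then have "continuous_on ?T g" "\<And>z. z \<in> ?S \<Longrightarrow> g (F z) = z"
    unfolding homeomorphism_def im by auto
  then have G: "continuous_on ?T G" using FG by (metis (no_types, lifting) continuous_on_cong)
  have "smooth_on ?T G"
  proof (rule smooth_on_inverse_function[OF S T F G])
    show "G ` ?T \<subseteq> ?S" and "\<And>y. y \<in> ?T \<Longrightarrow> F (G y) = y" using FG by auto
    fix z assume z: "z \<in> ?S"
    obtain x t where xt: "z = (x, t)" by (cases z)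
    have DF: "D F z v = (D (rept c c' \<Phi>) z v, snd v)" for v
    proof -
      have "(F has_derivative (\<lambda>v. (D (rept c c' \<Phi>) z v, snd v))) (at z)"
        unfolding F_def by (intro has_derivative_Pair smooth_on_has_derivative[OF smooth_rept[OF \<Phi>(1) c] z] has_derivative_snd has_derivative_ident)
      then show ?thesis by (simp add: D_eqI)
    qed
    have lin: "linear (D F z)" using smooth_on_linear_D[OF F z] .
    \<comment> \<open>The second component of \<open>F\<close> is time itself, which kills the time
      part of v; on the space part \<open>D F z\<close> is the differential of \<Phi>_t, with the
      differential of \<Psi>_t as left inverse.\<close>
    have "v = 0" if "D F z v = 0" for v
    proof -
      obtain u s where v: "v = (u, s)" by (cases v)
      have s: "s = 0" using that unfolding DF v by (simp add: zero_prod_def)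
      have "D (rept c c' \<Phi>) z v = 0" using that unfolding DF zero_prod_def by simp
      then have "D (rep c c' (\<Phi> t)) x u = 0"
        using z s unfolding v xt by (simp add: D_rept[OF \<Phi>(1) c])
      moreover have "D (rep c' c (\<Psi> t)) (rep c c' (\<Phi> t) x) (D (rep c c' (\<Phi> t)) x u) = u"
      proof -
        have x: "x \<in> rep_dom c c' (\<Phi> t)" using z unfolding xt rept_dom_iff .
        then have "x \<in> cimage c" unfolding rep_dom_def by simp
        moreover have "\<Psi> t \<circ> \<Phi> t = id" using \<Psi>\<Phi> by auto
        ultimately show ?thesis
          using D_rep_compose[OF smooth_map_family_slice[OF \<Phi>(1), of t] inv[of t] c c(1) x, of u] D_rep_same[OF c(1), of x u]
          by (simp add: \<Psi>\<Phi> cinv_in c)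
      qed
      moreover have "rep c c' (\<Phi> t) x \<in> rep_dom c' c (\<Psi> t)"
        using GF[OF z] unfolding xt F_def rept_rep by (simp add: rept_dom_iff)
      ultimately have "u = 0" using linear_0[OF linear_D_rep[OF inv c(2,1)]] by metis
      then show "v = 0" using s v by (simp add: zero_prod_def)
    qed
    then have "inj (D F z)" using lin by (simp add: linear_injective_0)
    then show "bij (D F z)" using linear_injective_imp_surjective[OF lin] by (simp add: bij_def)
  qed
  then have "smooth_on ?T (\<lambda>z. fst (G z))"
    by (rule smooth_on_bounded_linear_compose[OF T bounded_linear_fst])
  then show "smooth_on ?T (rept c' c \<Psi>)" unfolding G_def by simp
qed

lemma smooth_map_family_inverse:
  assumes \<Phi>: "smooth_map_family A \<Phi>" "\<And>t. diffeo A (\<Phi> t)"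
  shows "smooth_map_family A (\<lambda>t. inv (\<Phi> t))"
proof -
  define \<Psi> where "\<Psi> = (\<lambda>t. inv (\<Phi> t))"
  note ch = inverse_family_chart[OF \<Phi>, folded \<Psi>_def]
  have "isCont (\<lambda>z. \<Psi> (snd z) (fst z)) (q, t)" for q t
  proof -
    define c where "c = chart_at A (\<Psi> t q)"
    define c' where "c' = chart_at A q"
    have c: "c \<in> A" "c' \<in> A" "\<Psi> t q \<in> fst c" "q \<in> fst c'"
      unfolding c_def c'_def by (simp_all add: chart_at_in in_chart_at)
    let ?h = "\<lambda>z::'m \<times> real. (snd c' (fst z), snd z)"
    let ?U = "fst c' \<times> UNIV \<inter> ?h -` rept_dom c' c \<Psi>"
    have h: "continuous_on (fst c' \<times> UNIV) ?h"
      by (intro continuous_on_Pair continuous_on_compose2[OF continuous_chart[OF c(2)]] continuous_on_fst continuous_on_snd continuous_on_id) auto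
    have U: "open ?U"
      by (intro continuous_open_preimage h ch(1) open_Times open_chart_dom open_UNIV c)
    have "continuous_on ?U (\<lambda>z. cinv c (rept c' c \<Psi> (?h z)))"
    proof (intro continuous_on_compose2[OF continuous_cinv[OF c(1)]] continuous_on_compose2[OF smooth_on_continuous[OF ch(2)[OF c(1,2)]]])
      show "continuous_on ?U ?h" by (rule continuous_on_subset[OF h]) auto
      show "(\<lambda>z. rept c' c \<Psi> (?h z)) ` ?U \<subseteq> cimage c"
        unfolding rept_def rept_dom_def by (auto intro: chart_in)
    qed auto
    then have "continuous_on ?U (\<lambda>z. \<Psi> (snd z) (fst z))"
      by (rule continuous_on_eq) (auto simp: rept_def rept_dom_def cinv_chart c)
    moreover have "(q, t) \<in> ?U" using c by (auto simp: rept_dom_def chart_in cinv_chart)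
    ultimately show ?thesis using U continuous_on_eq_continuous_at by blast
  qed
  then have "continuous_on UNIV (\<lambda>(q, t). \<Psi> t q)"
    by (auto simp: case_prod_unfold intro!: continuous_at_imp_continuous_on)
  then show ?thesis
    unfolding smooth_map_family_def \<Psi>_def[symmetric]
    using ch(2) unfolding rept_dom_def rept_def by auto
qed

subsection \<open>Families of forms and multivector fields\<close>

abbreviation form_chart :: "('m, 'e) chart \<Rightarrow> (real \<Rightarrow> ('m, 'e) form_field) \<Rightarrow> 'e \<times> real \<Rightarrow> 'e list \<Rightarrow> real" where
  "form_chart c \<omega> z vs \<equiv> form_in A c (\<omega> (snd z)) (fst z) vs"

abbreviation mvec_chart :: "('m, 'e) chart \<Rightarrow> (real \<Rightarrow> ('m, 'e) mvec_field) \<Rightarrow> 'e \<times> real \<Rightarrow> 'e covec list \<Rightarrow> real" where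
  "mvec_chart c P z \<xi>s \<equiv> mvec_in A c (P (snd z)) (fst z) \<xi>s"

lemma open_cyl: "c \<in> A \<Longrightarrow> open (cimage c \<times> (UNIV::real set))"
  by (intro open_Times open_cimage open_UNIV)

lemma smooth_form_family_chart:
  "smooth_form_family A k \<omega> \<Longrightarrow> c \<in> A \<Longrightarrow> smooth_on (cimage c \<times> UNIV) (\<lambda>z. form_chart c \<omega> z vs)"
  unfolding smooth_form_family_def by (simp add: case_prod_unfold)

lemma smooth_mvec_family_chart:
  "smooth_mvec_family A k P \<Longrightarrow> c \<in> A \<Longrightarrow> smooth_on (cimage c \<times> UNIV) (\<lambda>z. mvec_chart c P z vs)"
  unfolding smooth_mvec_family_def by (simp add: case_prod_unfold)

lemma smooth_form_familyI:
  assumes "\<And>t p. alternating k (\<omega> t p)"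
    "\<And>c vs. c \<in> A \<Longrightarrow> smooth_on (cimage c \<times> UNIV) (\<lambda>z. form_chart c \<omega> z vs)"
  shows "smooth_form_family A k \<omega>"
  unfolding smooth_form_family_def forms_def
  using assms smooth_on_slice[OF assms(2) open_cyl open_cimage] by (simp add: case_prod_unfold)

lemma smooth_mvec_familyI:
  assumes "\<And>t p. alternating k (P t p)"
    "\<And>c vs. c \<in> A \<Longrightarrow> smooth_on (cimage c \<times> UNIV) (\<lambda>z. mvec_chart c P z vs)"
  shows "smooth_mvec_family A k P"
  unfolding smooth_mvec_family_def mvecs_def
  using assms smooth_on_slice[OF assms(2) open_cyl open_cimage] by (simp add: case_prod_unfold)

lemma smooth_form_family_alternating: "smooth_form_family A k \<omega> \<Longrightarrow> alternating k (\<omega> t p)"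
  unfolding smooth_form_family_def forms_def by blast

lemma smooth_mvec_family_alternating: "smooth_mvec_family A k P \<Longrightarrow> alternating k (P t p)"
  unfolding smooth_mvec_family_def mvecs_def by blast

lemma smooth_form_family_chart_alternating:
  "smooth_form_family A k \<omega> \<Longrightarrow> c \<in> A \<Longrightarrow> z \<in> cimage c \<times> UNIV \<Longrightarrow> alternating k (form_chart c \<omega> z)"
  by (intro alternating_form_in smooth_form_family_alternating) auto

lemma smooth_mvec_family_chart_alternating:
  "smooth_mvec_family A k P \<Longrightarrow> alternating k (mvec_chart c P z)"
  by (intro alternating_mvec_in smooth_mvec_family_alternating)

lemma smooth_form_family_const: "\<omega> \<in> forms A k \<Longrightarrow> smooth_form_family A k (\<lambda>t. \<omega>)"
  by (rule smooth_form_familyI)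
    (auto simp: forms_def intro!: smooth_on_compose[OF open_cyl open_cimage _ smooth_on_fst[OF open_cyl]])

lemma smooth_mvec_family_const: "P \<in> mvecs A k \<Longrightarrow> smooth_mvec_family A k (\<lambda>t. P)"
  by (rule smooth_mvec_familyI)
    (auto simp: mvecs_def intro!: smooth_on_compose[OF open_cyl open_cimage _ smooth_on_fst[OF open_cyl]])

lemma smooth_form_family_slice: "smooth_form_family A k \<omega> \<Longrightarrow> \<omega> t \<in> forms A k"
  unfolding smooth_form_family_def by blast

lemma smooth_mvec_family_slice: "smooth_mvec_family A k P \<Longrightarrow> P t \<in> mvecs A k"
  unfolding smooth_mvec_family_def by blast

text \<open>Near a given point and time the images lie in one chart c'. There the coordinate
  expression is a multilinear expression in smooth data, the form along \<open>rept\<close> and the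
  space derivatives of \<open>rept\<close>; the rest is locality.\<close>

lemma smooth_form_family_pullback:
  assumes \<Psi>: "smooth_map_family A \<Psi>" and \<omega>: "smooth_form_family A k \<omega>"
  shows "smooth_form_family A k (\<lambda>t. pullback A (\<Psi> t) (\<omega> t))"
proof (rule smooth_form_familyI)
  show alt: "alternating k (pullback A (\<Psi> t) (\<omega> t) p)" for t p
    unfolding pullback_def[abs_def]
    by (rule alternating_map[OF smooth_form_family_alternating[OF \<omega>] linear_tangent_map[OF smooth_map_family_slice[OF \<Psi>]]])
  fix c vs assume c: "c \<in> A"
  show "smooth_on (cimage c \<times> UNIV) (\<lambda>z. form_chart c (\<lambda>t. pullback A (\<Psi> t) (\<omega> t)) z vs)"
  \<comment> \<open>Slotwise linearity is available for lists of length k only; all other values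
    vanish.\<close>
  proof (cases "length vs = k")
    case False
    then have "form_chart c (\<lambda>t. pullback A (\<Psi> t) (\<omega> t)) z vs = 0" for z
      using alternating_length[OF alt] unfolding form_in_def by simp
    then show ?thesis using smooth_on_const[OF open_cyl[OF c]] by simp
  next
    case True
    show ?thesis
    proof (rule smooth_on_local)
      fix z assume z: "z \<in> cimage c \<times> (UNIV::real set)"
      define c' where "c' = chart_at A (\<Psi> (snd z) (cinv c (fst z)))"
      let ?U = "rept_dom c c' \<Psi>" and ?f = "rept c c' \<Psi>"
      have c': "c' \<in> A" unfolding c'_def by (rule chart_at_in)
      note U = open_rept_dom[OF \<Psi> c c'] and f = smooth_rept[OF \<Psi> c c']
      have "z \<in> ?U" using z in_chart_at unfolding rept_dom_def c'_def by auto
      have fU: "?f y \<in> cimage c'" if "y \<in> ?U" for y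
        using that rep_in[OF c'] by (cases y) (simp add: rept_rep rept_dom_iff)
      have "smooth_on ?U (\<lambda>y. form_chart c' \<omega> (?f y, snd y) (map (\<lambda>g. g y) (map (\<lambda>v y. D ?f y (v, 0)) vs)))"
      proof (rule smooth_on_multilinear[OF coords_euclidean U])
        show "multilinear (length (map (\<lambda>v y. D ?f y (v, 0)) vs)) (form_chart c' \<omega> (?f y, snd y))" if "y \<in> ?U" for y
          using fU[OF that] True smooth_form_family_chart_alternating[OF \<omega> c', of "(?f y, snd y)"]
          by (simp add: alternating_multilinear)
        show "smooth_on ?U (\<lambda>y. form_chart c' \<omega> (?f y, snd y) us)" for us
          by (rule smooth_on_compose[OF U open_cyl[OF c'] _ smooth_on_Pair[OF U f smooth_on_snd[OF U]] smooth_form_family_chart[OF \<omega> c']])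
            (use fU in auto)
        show "smooth_on ?U g" if "g \<in> set (map (\<lambda>v y. D ?f y (v, 0)) vs)" for g
          using that smooth_on_D[OF f] by auto
      qed
      then have "smooth_on ?U (\<lambda>z. form_chart c (\<lambda>t. pullback A (\<Psi> t) (\<omega> t)) z vs)"
      proof (rule smooth_on_eqI[OF U])
        fix y assume y: "y \<in> ?U"
        obtain x t where xt: "y = (x, t)" by (cases y)
        have x: "x \<in> rep_dom c c' (\<Psi> t)" using y unfolding xt rept_dom_iff .
        show "form_chart c (\<lambda>t. pullback A (\<Psi> t) (\<omega> t)) y vs =
            form_chart c' \<omega> (?f y, snd y) (map (\<lambda>g. g y) (map (\<lambda>v y. D ?f y (v, 0)) vs))"
          using form_in_pullback[OF smooth_map_family_slice[OF \<Psi>] c c' x] D_rept[OF \<Psi> c c', of x t] y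
          unfolding xt by (simp add: rept_rep o_def)
      qed
      then show "\<exists>U. open U \<and> z \<in> U \<and> smooth_on U (\<lambda>z. form_chart c (\<lambda>t. pullback A (\<Psi> t) (\<omega> t)) z vs)"
        using U \<open>z \<in> ?U\<close> by blast
    qed
  qed
qed

text \<open>The pushforward at y evaluates P and the differential of \<Phi>_t at the preimage of y,
  so joint smoothness in y and t rests on that of the inverse family.\<close>

lemma smooth_mvec_family_pushforward:
  assumes \<Phi>: "smooth_map_family A \<Phi>" "\<And>t. diffeo A (\<Phi> t)" and P: "smooth_mvec_family A k P"
  shows "smooth_mvec_family A k (\<lambda>t. pushforward A (\<Phi> t) (P t))"
proof (rule smooth_mvec_familyI)
  show alt: "alternating k (pushforward A (\<Phi> t) (P t) p)" for t p
    unfolding pushforward_covec_map[abs_def]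
    by (rule alternating_map[OF smooth_mvec_family_alternating[OF P] linear_covec_map])
  define \<Psi> where "\<Psi> = (\<lambda>t. inv (\<Phi> t))"
  have \<Psi>: "smooth_map_family A \<Psi>" unfolding \<Psi>_def by (rule smooth_map_family_inverse[OF \<Phi>])
  have \<Phi>\<Psi>: "\<Phi> t (\<Psi> t p) = p" for t p
    using \<Phi>(2)[of t] unfolding \<Psi>_def diffeo_def by (simp add: bij_is_surj surj_f_inv_f)
  fix c \<xi>s assume c: "c \<in> A"
  show "smooth_on (cimage c \<times> UNIV) (\<lambda>z. mvec_chart c (\<lambda>t. pushforward A (\<Phi> t) (P t)) z \<xi>s)"
  proof (cases "length \<xi>s = k")
    case False
    then have "mvec_chart c (\<lambda>t. pushforward A (\<Phi> t) (P t)) z \<xi>s = 0" for z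
      using alternating_length[OF alt] unfolding mvec_in_def by simp
    then show ?thesis using smooth_on_const[OF open_cyl[OF c]] by simp
  next
    case True
    show ?thesis
    proof (rule smooth_on_local)
      fix z assume z: "z \<in> cimage c \<times> (UNIV::real set)"
      define c' where "c' = chart_at A (\<Psi> (snd z) (cinv c (fst z)))"
      let ?U = "rept_dom c c' \<Psi>" and ?g = "rept c c' \<Psi>" and ?f = "rept c' c \<Phi>"
      have c': "c' \<in> A" unfolding c'_def by (rule chart_at_in)
      note U = open_rept_dom[OF \<Psi> c c'] and g = smooth_rept[OF \<Psi> c c']
        and V = open_rept_dom[OF \<Phi>(1) c' c] and f = smooth_rept[OF \<Phi>(1) c' c]
      have "z \<in> ?U" using z in_chart_at unfolding rept_dom_def c'_def by auto
      have gU: "(?g y, snd y) \<in> rept_dom c' c \<Phi>" "rep c' c (\<Phi> (snd y)) (?g y) = fst y" "?g y \<in> cimage c'" if "y \<in> ?U" for y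
        using that c c' unfolding rept_dom_def rept_def rep_def
        by (auto simp: cinv_chart chart_in \<Phi>\<Psi> cinv_in chart_cinv)
      let ?G = "\<lambda>y. (?g y, snd y)"
      have G: "smooth_on ?U ?G" by (intro smooth_on_Pair U g smooth_on_snd)
      let ?L = "\<lambda>y v. D ?f (?G y) (v, 0)"
      have L: "linear (?L y)" if "y \<in> ?U" for y
        using linear_compose[OF bounded_linear.linear[OF bounded_linear_Pair_left] smooth_on_linear_D[OF f gU(1)[OF that]]]
        by (simp add: o_def)
      have "smooth_on ?U (\<lambda>y. mvec_chart c' P (?G y) (map (\<lambda>h. h y) (map (\<lambda>\<xi> y. covec_map (?L y) \<xi>) \<xi>s)))"
      proof (rule smooth_on_multilinear[OF coords_covec U])
        show "multilinear (length (map (\<lambda>\<xi> y. covec_map (?L y) \<xi>) \<xi>s)) (mvec_chart c' P (?G y))" for y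
          using True smooth_mvec_family_chart_alternating[OF P, of c' "?G y"] by (simp add: alternating_multilinear)
        show "smooth_on ?U (\<lambda>y. mvec_chart c' P (?G y) us)" for us
          by (rule smooth_on_compose[OF U open_cyl[OF c'] _ G smooth_mvec_family_chart[OF P c']])
            (use gU in auto)
        have "smooth_on ?U (\<lambda>y. covec_map (?L y) \<xi>)" for \<xi>
        proof (rule smooth_on_covec[OF U])
          fix b
          have "smooth_on ?U (\<lambda>y. D ?f (?G y) (b, 0))"
            by (rule smooth_on_D_apply[OF U V _ G f smooth_on_const[OF U]]) (use gU in auto)
          then have "smooth_on ?U (\<lambda>y. blinfun_apply \<xi> (?L y b))"
            by (rule smooth_on_bounded_linear_compose[OF U blinfun.bounded_linear_right])
          then show "smooth_on ?U (\<lambda>y. blinfun_apply (covec_map (?L y) \<xi>) b)"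
            by (rule smooth_on_eqI[OF U]) (simp add: covec_map_apply L)
        qed
        then show "smooth_on ?U h" if "h \<in> set (map (\<lambda>\<xi> y. covec_map (?L y) \<xi>) \<xi>s)" for h
          using that by auto
      qed
      then have "smooth_on ?U (\<lambda>z. mvec_chart c (\<lambda>t. pushforward A (\<Phi> t) (P t)) z \<xi>s)"
      proof (rule smooth_on_eqI[OF U])
        fix y assume y: "y \<in> ?U"
        have "?g y \<in> rep_dom c' c (\<Phi> (snd y))" using gU(1)[OF y] unfolding rept_dom_iff .
        from mvec_in_pushforward[OF \<Phi>(2) c' c this]
        show "mvec_chart c (\<lambda>t. pushforward A (\<Phi> t) (P t)) y \<xi>s =
            mvec_chart c' P (?G y) (map (\<lambda>h. h y) (map (\<lambda>\<xi> y. covec_map (?L y) \<xi>) \<xi>s))"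
          using D_rept[OF \<Phi>(1) c' c gU(1)[OF y]] gU(2)[OF y] by (simp add: o_def)
      qed
      then show "\<exists>U. open U \<and> z \<in> U \<and> smooth_on U (\<lambda>z. mvec_chart c (\<lambda>t. pushforward A (\<Phi> t) (P t)) z \<xi>s)"
        using U \<open>z \<in> ?U\<close> by blast
    qed
  qed
qed

end

subsection \<open>Operations on forms and multivector fields\<close>

definition contract :: "('m, 'e::euclidean_space) mvec_field \<Rightarrow> ('m, 'e) form_field \<Rightarrow> ('m, 'e) form_field" where
  "contract X \<omega> p vs = \<omega> p (vec (X p) # vs)"

definition tderiv :: "(real \<Rightarrow> 'm \<Rightarrow> 'v list \<Rightarrow> real) \<Rightarrow> real \<Rightarrow> 'm \<Rightarrow> 'v list \<Rightarrow> real" where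
  "tderiv F t p vs = D (\<lambda>s. F s p vs) t 1"

text \<open>The integral over \<open>[0, t]\<close> after a substitution, which is also meaningful for \<open>t < 0\<close>.\<close>

definition tint :: "(real \<Rightarrow> 'm \<Rightarrow> 'v list \<Rightarrow> real) \<Rightarrow> real \<Rightarrow> 'm \<Rightarrow> 'v list \<Rightarrow> real" where
  "tint F t p vs = t * integral {0..1} (\<lambda>s. F (t * s) p vs)"

lemma vec_apply: "alternating 1 F \<Longrightarrow> blinfun_apply \<xi> (vec F) = F [\<xi>]"
  using coords_linear[OF coords_covec alternating_linear[of 1 F "[]" "[]"], of \<xi>]
  unfolding vec_def by (simp add: blinfun.bilinear_simps mult.commute)

lemma alternating_contract:
  assumes F: "alternating (Suc k) F" shows "alternating k (\<lambda>vs. F (v # vs))"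
  unfolding alternating_def
proof (intro conjI allI impI)
  show "linear (\<lambda>w. F (v # us @ w # ws))" if "length us + 1 + length ws = k" for us ws
    using alternating_linear[OF F, of "v # us" ws] that by simp
  show "F (v # vs) = 0" if "\<not> distinct vs" for vs
    using F that unfolding alternating_def by simp
qed (simp add: alternating_length[OF F])

lemma alternating_lincomb:
  assumes "alternating k F" "alternating k G" shows "alternating k (\<lambda>vs. a * F vs + b * G vs)"
  unfolding alternating_def
proof (intro conjI allI impI)
  fix us ws :: "'a list" assume "length us + 1 + length ws = k"
  then have 1: "linear (\<lambda>v. F (us @ v # ws))" "linear (\<lambda>v. G (us @ v # ws))"
    using assms unfolding alternating_def by auto
  show "linear (\<lambda>v. a * F (us @ v # ws) + b * G (us @ v # ws))"
    using linear_compose_add[OF linear_compose_scale_right[OF 1(1), of a] linear_compose_scale_right[OF 1(2), of b]]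
    by simp
qed (use assms in \<open>auto simp: alternating_def\<close>)

text \<open>Each clause of \<open>alternating\<close> amounts to equations between values, and these
  pass to the derivatives because real derivatives are unique.\<close>

lemma alternating_derivative:
  assumes F: "\<And>s. alternating k (F s)" and G: "\<And>vs. ((\<lambda>s. F s vs) has_real_derivative G vs) (at t)"
  shows "alternating k G"
  unfolding alternating_def
proof (intro conjI allI impI)
  have z: "G vs = 0" if "\<And>s. F s vs = 0" for vs
    using DERIV_unique[OF G[of vs], of 0] that by simp
  show "G vs = 0" if "length vs \<noteq> k" for vs using z F that unfolding alternating_def by blast
  show "G vs = 0" if "\<not> distinct vs" for vs using z F that unfolding alternating_def by blast
  show "linear (\<lambda>v. G (us @ v # ws))" if "length us + 1 + length ws = k" for us ws
  proof (rule linearI)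
    note lin = alternating_linear[OF F that]
    show "G (us @ (v + w) # ws) = G (us @ v # ws) + G (us @ w # ws)" for v w
    proof (rule DERIV_unique)
      show "((\<lambda>s. F s (us @ v # ws) + F s (us @ w # ws)) has_real_derivative G (us @ (v + w) # ws)) (at t)"
        using G[of "us @ (v + w) # ws"] by (simp add: linear_add[OF lin])
    qed (rule DERIV_add[OF G G])
    show "G (us @ (r *\<^sub>R v) # ws) = r *\<^sub>R G (us @ v # ws)" for r v
    proof (rule DERIV_unique)
      show "((\<lambda>s. r * F s (us @ v # ws)) has_real_derivative G (us @ (r *\<^sub>R v) # ws)) (at t)"
        using G[of "us @ (r *\<^sub>R v) # ws"] by (simp add: linear_scale[OF lin])
    qed (simp add: DERIV_cmult[OF G])
  qed
qed

lemma linear_D_param: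
  assumes S: "open S" "x \<in> S" and lin: "\<And>y. y \<in> S \<Longrightarrow> linear (\<lambda>v. F y v)"
    and F: "\<And>v. smooth_on S (\<lambda>y. F y v)"
  shows "linear (\<lambda>v. D (\<lambda>y. F y v) x u)"
proof (rule linearI)
  note der = smooth_on_has_derivative[OF F S(2)]
  show "D (\<lambda>y. F y (v + w)) x u = D (\<lambda>y. F y v) x u + D (\<lambda>y. F y w) x u" for v w
    using D_eqI[OF has_derivative_transform_within_open[OF has_derivative_add[OF der[of v] der[of w]] S,
          of "\<lambda>y. F y (v + w)"]] linear_add[OF lin] by simp
  show "D (\<lambda>y. F y (r *\<^sub>R v)) x u = r *\<^sub>R D (\<lambda>y. F y v) x u" for r v
    using D_eqI[OF has_derivative_transform_within_open[OF has_derivative_scaleR_right[OF der[of v], of r] S,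
          of "\<lambda>y. F y (r *\<^sub>R v)"]] linear_scale[OF lin] by simp
qed

lemma alternating3I:
  assumes 0: "\<And>vs. length vs \<noteq> 3 \<Longrightarrow> F vs = 0"
    and lin: "\<And>b c. linear (\<lambda>v. F [v, b, c])" "\<And>a c. linear (\<lambda>v. F [a, v, c])" "\<And>a b. linear (\<lambda>v. F [a, b, v])"
    and alt: "\<And>a b. F [a, a, b] = 0" "\<And>a b. F [a, b, a] = 0" "\<And>a b. F [a, b, b] = 0"
  shows "alternating 3 F"
  unfolding alternating_def
proof (intro conjI allI impI)
  show "linear (\<lambda>v. F (us @ v # ws))" if l: "length us + 1 + length ws = 3" for us ws
  proof -
    consider "length us = 0" "length ws = 2" | "length us = 1" "length ws = 1" | "length us = 2" "length ws = 0"
      using l by linarith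
    then show ?thesis
      by cases (auto simp: numeral_2_eq_2 length_Suc_conv lin)
  qed
  show "F vs = 0" if d: "\<not> distinct vs" for vs
  proof (cases "length vs = 3")
    case True
    then obtain a b c where "vs = [a, b, c]" by (auto simp: numeral_3_eq_3 length_Suc_conv)
    then show ?thesis using d alt by auto
  qed (use 0 in auto)
qed (use 0 in auto)

lemma dloc_length:
  assumes "open S" "x \<in> S" "\<And>y vs. y \<in> S \<Longrightarrow> length vs \<noteq> k \<Longrightarrow> w y vs = 0" "length vs \<noteq> Suc k"
  shows "dloc w x vs = 0"
proof -
  have "D (\<lambda>y. w y (remove_nth i vs)) x v = 0" if "i < length vs" for i v
  proof -
    have "length (remove_nth i vs) \<noteq> k" using that assms(4) unfolding remove_nth_def by auto
    then have "D (\<lambda>y. w y (remove_nth i vs)) x = D (\<lambda>y. 0) x"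
      using assms(3) by (intro D_cong[OF assms(1,2)])
    then show ?thesis by simp
  qed
  then show ?thesis unfolding dloc_def by simp
qed

lemma alternating_dloc:
  assumes S: "open S" "x \<in> S" and w: "\<And>y. y \<in> S \<Longrightarrow> alternating 2 (w y)" "\<And>vs. smooth_on S (\<lambda>y. w y vs)"
  shows "alternating 3 (dloc w x)"
proof (rule alternating3I)
  show "dloc w x vs = 0" if "length vs \<noteq> 3" for vs
    using that by (intro dloc_length[OF S, of 2]) (auto intro: alternating_length[OF w(1)])
  have 1: "linear (D (\<lambda>y. w y vs) x)" for vs using smooth_on_linear_D[OF w(2) S(2)] .
  have 2: "linear (\<lambda>v. D (\<lambda>y. w y [v, b]) x u)" "linear (\<lambda>v. D (\<lambda>y. w y [b, v]) x u)" for b u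
    by (intro linear_D_param[OF S _ w(2)] alternating2_linear w(1); assumption)+
  have 3: "D (\<lambda>y. w y [a, b]) x u = - D (\<lambda>y. w y [b, a]) x u" for a b u
    using D_eqI[OF has_derivative_transform_within_open[OF has_derivative_minus[OF smooth_on_has_derivative[OF w(2) S(2), of "[b, a]"]] S,
          of "\<lambda>y. w y [a, b]"]] alternating2_swap[OF w(1), of _ a b] by simp
  then have 4: "D (\<lambda>y. w y [a, a]) x u = 0" for a u by (metis neg_equal_zero)
  show "linear (\<lambda>v. dloc w x [v, b, c])" "linear (\<lambda>v. dloc w x [b, v, c])" "linear (\<lambda>v. dloc w x [b, c, v])" for b c
    unfolding dloc_eq by (intro linear_compose_add linear_compose_sub 1 2)+
  show "dloc w x [a, a, b] = 0" "dloc w x [a, b, a] = 0" "dloc w x [a, b, b] = 0" for a b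
    using 3[of a b] by (simp_all add: dloc_eq 4)
qed

text \<open>Degrees 2 and 3 are those of B and H. For lists of the wrong length both sides vanish,
  so the identity holds for all lists.\<close>

lemma dloc_pullback:
  fixes f :: "'e::euclidean_space \<Rightarrow> 'e"
  assumes "k = 2 \<or> k = 3" and S: "open S" and T: "open T" and f: "f ` S \<subseteq> T" "smooth_on S f"
    and w: "\<And>vs. smooth_on T (\<lambda>y. w y vs)" "\<And>y. y \<in> T \<Longrightarrow> alternating k (w y)" and x: "x \<in> S"
  shows "dloc (\<lambda>x vs. w (f x) (map (D f x) vs)) x vs = dloc w (f x) (map (D f x) vs)"
proof (cases "length vs = Suc k")
  case True
  show ?thesis
    using assms(1)
  proof
    assume k: "k = 2"
    then obtain a b c where "vs = [a, b, c]" using True by (auto simp: numeral_2_eq_2 length_Suc_conv)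
    then show ?thesis using dloc_pullback2[OF S T f w(1) w(2)[unfolded k] x] by simp
  next
    assume k: "k = 3"
    then obtain a b c d where "vs = [a, b, c, d]" using True by (auto simp: numeral_3_eq_3 length_Suc_conv)
    then show ?thesis using dloc_pullback3[OF S T f w(1) w(2)[unfolded k] x] by simp
  qed
next
  case False
  have "dloc (\<lambda>x vs. w (f x) (map (D f x) vs)) x vs = 0"
    using False f(1) by (intro dloc_length[OF S x, of k]) (auto intro!: alternating_length[OF w(2)])
  moreover have "dloc w (f x) (map (D f x) vs) = 0"
    using False f(1) x by (intro dloc_length[OF T, of _ k]) (auto intro!: alternating_length[OF w(2)])
  ultimately show ?thesis by simp
qed

context smooth_manifold
begin

section \<open>Contraction, time derivative and time integral of families\<close>

lemma forms_alternating: "\<omega> \<in> forms A k \<Longrightarrow> alternating k (\<omega> p)"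
  and mvecs_alternating: "P \<in> mvecs A k \<Longrightarrow> alternating k (P p)"
  unfolding forms_def mvecs_def by auto

lemma forms_chart: "\<omega> \<in> forms A k \<Longrightarrow> c \<in> A \<Longrightarrow> smooth_on (cimage c) (\<lambda>x. form_in A c \<omega> x vs)"
  and mvecs_chart: "P \<in> mvecs A k \<Longrightarrow> c \<in> A \<Longrightarrow> smooth_on (cimage c) (\<lambda>x. mvec_in A c P x \<xi>s)"
  unfolding forms_def mvecs_def by auto

text \<open>\<open>vec\<close> is built from the standard basis; that it commutes with changes of
  coordinates is seen by testing against covectors.\<close>

lemma from_chart_vec:
  assumes "c \<in> A" "x \<in> cimage c" "alternating 1 (X (cinv c x))"
  shows "from_chart A c (cinv c x) (vec (mvec_in A c X x)) = vec (X (cinv c x))"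
proof (rule covec_eq_iff[THEN iffD2], rule allI)
  fix \<xi> :: "'e covec"
  have q: "cinv c x \<in> fst c" using cinv_in assms by simp
  have "blinfun_apply \<xi> (from_chart A c (cinv c x) (vec (mvec_in A c X x))) =
      mvec_in A c X x [covec_map (from_chart A c (cinv c x)) \<xi>]"
    using vec_apply[OF alternating_mvec_in[where P = X, OF assms(3)], of "covec_map (from_chart A c (cinv c x)) \<xi>"]
    by (simp add: covec_map_apply linear_from_chart assms(1) q)
  also have "\<dots> = X (cinv c x) [\<xi>]"
    unfolding mvec_in_covec_map
    by (simp add: covec_map_compose linear_from_chart linear_to_chart assms(1) q from_to_chart covec_map_ident)
  finally show "blinfun_apply \<xi> (from_chart A c (cinv c x) (vec (mvec_in A c X x))) = blinfun_apply \<xi> (vec (X (cinv c x)))"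
    using vec_apply[OF assms(3)] by simp
qed

lemma form_in_contract:
  assumes "c \<in> A" "x \<in> cimage c" "alternating 1 (X (cinv c x))"
  shows "form_in A c (contract X \<omega>) x vs = form_in A c \<omega> x (vec (mvec_in A c X x) # vs)"
  using from_chart_vec[where X = X, OF assms] unfolding form_in_def contract_def by simp

lemma smooth_on_vec_mvec:
  "smooth_mvec_family A k X \<Longrightarrow> c \<in> A \<Longrightarrow> smooth_on (cimage c \<times> UNIV) (\<lambda>z. vec (mvec_chart c X z))"
  unfolding vec_def
  by (intro smooth_on_sum smooth_on_scaleR smooth_on_const open_cyl smooth_mvec_family_chart)

lemma smooth_form_family_contract:
  assumes X: "smooth_mvec_family A 1 X" and \<omega>: "smooth_form_family A (Suc k) \<omega>"
  shows "smooth_form_family A k (\<lambda>t. contract (X t) (\<omega> t))"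
proof (rule smooth_form_familyI)
  show alt: "alternating k (contract (X t) (\<omega> t) p)" for t p
    unfolding contract_def[abs_def] by (rule alternating_contract[OF smooth_form_family_alternating[OF \<omega>]])
  fix c vs assume c: "c \<in> A"
  show "smooth_on (cimage c \<times> UNIV) (\<lambda>z. form_chart c (\<lambda>t. contract (X t) (\<omega> t)) z vs)"
  proof (cases "length vs = k")
    case False
    then have "form_chart c (\<lambda>t. contract (X t) (\<omega> t)) z vs = 0" for z
      using alternating_length[OF alt] unfolding form_in_def by simp
    then show ?thesis using smooth_on_const[OF open_cyl[OF c]] by simp
  next
    case True
    have "smooth_on (cimage c \<times> UNIV) (\<lambda>z. form_chart c \<omega> z (vec (mvec_chart c X z) # vs))"
    proof (rule smooth_on_slot[OF coords_euclidean open_cyl[OF c] _ _ smooth_on_vec_mvec[OF X c],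
          where F = "\<lambda>z v. form_chart c \<omega> z (v # vs)"])
      show "linear (\<lambda>v. form_chart c \<omega> z (v # vs))" if "z \<in> cimage c \<times> UNIV" for z
        using alternating_linear[OF smooth_form_family_chart_alternating[OF \<omega> c that], of "[]" vs] True by simp
    qed (rule smooth_form_family_chart[OF \<omega> c])
    then show ?thesis
      by (rule smooth_on_eqI[OF open_cyl[OF c]])
        (auto intro: form_in_contract[OF c _ smooth_mvec_family_alternating[OF X]])
  qed
qed

lemma smooth_form_family_lincomb:
  assumes "smooth_form_family A k \<omega>" "smooth_form_family A k \<omega>'"
  shows "smooth_form_family A k (\<lambda>t p vs. a * \<omega> t p vs + b * \<omega>' t p vs)"
proof (rule smooth_form_familyI)
  fix c vs assume c: "c \<in> A"
  show "smooth_on (cimage c \<times> UNIV) (\<lambda>z. form_chart c (\<lambda>t p vs. a * \<omega> t p vs + b * \<omega>' t p vs) z vs)"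
    using smooth_form_family_chart[OF assms(1) c, of vs] smooth_form_family_chart[OF assms(2) c, of vs]
    unfolding form_in_def by (intro smooth_on_add smooth_on_mult smooth_on_const open_cyl c)
qed (intro alternating_lincomb smooth_form_family_alternating[OF assms(1)] smooth_form_family_alternating[OF assms(2)])

lemma smooth_form_family_add:
  "smooth_form_family A k \<omega> \<Longrightarrow> smooth_form_family A k \<omega>' \<Longrightarrow> smooth_form_family A k (\<lambda>t p vs. \<omega> t p vs + \<omega>' t p vs)"
  using smooth_form_family_lincomb[of k \<omega> \<omega>' 1 1] by simp

lemma smooth_form_family_diff:
  "smooth_form_family A k \<omega> \<Longrightarrow> smooth_form_family A k \<omega>' \<Longrightarrow> smooth_form_family A k (\<lambda>t p vs. \<omega> t p vs - \<omega>' t p vs)"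
  using smooth_form_family_lincomb[of k \<omega> \<omega>' 1 "-1"] by simp

lemma smooth_form_family_time:
  assumes "smooth_form_family A k \<omega>" shows "smooth_on UNIV (\<lambda>s. \<omega> s p vs)"
  using smooth_on_slice2[OF smooth_form_family_chart[OF assms chart_at_in] open_cyl[OF chart_at_in], of UNIV "coord A p p" p vs]
  by (simp add: coord_in form_in_at)

lemma smooth_mvec_family_time:
  assumes "smooth_mvec_family A k P" shows "smooth_on UNIV (\<lambda>s. P s p \<xi>s)"
  using smooth_on_slice2[OF smooth_mvec_family_chart[OF assms chart_at_in] open_cyl[OF chart_at_in], of UNIV "coord A p p" p \<xi>s]
  by (simp add: coord_in mvec_in_at)

lemma tderivI: "smooth_on UNIV (\<lambda>s. F s p vs) \<Longrightarrow> ((\<lambda>s. F s p vs) has_real_derivative tderiv F t p vs) (at t)"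
  unfolding tderiv_def by (intro has_derivative_imp_has_real_derivative smooth_on_has_derivative) auto

lemma tderiv_unique: "((\<lambda>s. F s p vs) has_real_derivative d) (at t) \<Longrightarrow> tderiv F t p vs = d"
  unfolding tderiv_def has_field_derivative_def by (simp add: D_eqI)

lemma form_tderiv:
  "smooth_form_family A k \<omega> \<Longrightarrow> ((\<lambda>s. \<omega> s p vs) has_real_derivative tderiv \<omega> t p vs) (at t)"
  by (intro tderivI smooth_form_family_time)

lemma mvec_tderiv:
  "smooth_mvec_family A k P \<Longrightarrow> ((\<lambda>s. P s p \<xi>s) has_real_derivative tderiv P t p \<xi>s) (at t)"
  by (intro tderivI smooth_mvec_family_time)

lemma D_time:
  assumes "smooth_on S g" "(x, t) \<in> S" shows "D (\<lambda>s. g (x, s)) t h = D g (x, t) (0, h)"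
proof -
  have "((\<lambda>s. (x, s)) has_derivative (\<lambda>h. (0, h))) (at t)"
    by (intro has_derivative_Pair has_derivative_ident has_derivative_const)
  from D_eqI[OF has_derivative_smooth_compose[OF assms(1) _ this]] assms(2) show ?thesis by simp
qed

lemma form_chart_tderiv:
  assumes "smooth_form_family A k \<omega>" "c \<in> A" "x \<in> cimage c"
  shows "form_in A c (tderiv \<omega> t) x vs = D (\<lambda>z. form_chart c \<omega> z vs) (x, t) (0, 1)"
  using D_time[OF smooth_form_family_chart[OF assms(1,2)], of x t vs 1] assms(3)
  by (simp add: form_in_def tderiv_def)

lemma mvec_chart_tderiv:
  assumes "smooth_mvec_family A k P" "c \<in> A" "x \<in> cimage c"
  shows "mvec_in A c (tderiv P t) x \<xi>s = D (\<lambda>z. mvec_chart c P z \<xi>s) (x, t) (0, 1)"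
  using D_time[OF smooth_mvec_family_chart[OF assms(1,2)], of x t \<xi>s 1] assms(3)
  by (simp add: mvec_in_def tderiv_def)

lemma smooth_form_family_tderiv:
  assumes \<omega>: "smooth_form_family A k \<omega>" shows "smooth_form_family A k (tderiv \<omega>)"
proof (rule smooth_form_familyI)
  show "alternating k (tderiv \<omega> t p)" for t p
    by (rule alternating_derivative[OF smooth_form_family_alternating[OF \<omega>] form_tderiv[OF \<omega>]])
  fix c vs assume c: "c \<in> A"
  show "smooth_on (cimage c \<times> UNIV) (\<lambda>z. form_chart c (tderiv \<omega>) z vs)"
    by (rule smooth_on_eqI[OF open_cyl[OF c] smooth_on_D[OF smooth_form_family_chart[OF \<omega> c, of vs], of "(0, 1)"]])
      (auto simp: form_chart_tderiv[OF \<omega> c])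
qed

lemma smooth_form_family_tint:
  assumes \<omega>: "smooth_form_family A k \<omega>" shows "smooth_form_family A k (tint \<omega>)"
proof (rule smooth_form_familyI)
  have int: "(\<lambda>s. \<omega> (t * s) p vs) integrable_on {0..1}" for t p vs
    by (intro integrable_continuous_interval continuous_on_compose2[OF smooth_on_continuous[OF smooth_form_family_time[OF \<omega>]]] continuous_intros) auto
  note alt = smooth_form_family_alternating[OF \<omega>]
  show "alternating k (tint \<omega> t p)" for t p
    unfolding alternating_def
  proof (intro conjI allI impI)
    show "tint \<omega> t p vs = 0" if "length vs \<noteq> k" for vs
      using alternating_length[OF alt that] unfolding tint_def by simp
    show "tint \<omega> t p vs = 0" if "\<not> distinct vs" for vs
      using alt that unfolding tint_def alternating_def by simp
    show "linear (\<lambda>v. tint \<omega> t p (us @ v # ws))" if l: "length us + 1 + length ws = k" for us ws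
      by (rule linearI)
        (simp_all only: tint_def linear_add[OF alternating_linear[OF alt l]] linear_scale[OF alternating_linear[OF alt l]]
          integral_add[OF int int] distrib_left real_scaleR_def integral_mult_right mult.left_commute)
  qed
  fix c vs assume c: "c \<in> A"
  \<comment> \<open>Chart point and time together form the parameter. The rescaled time t s is
    inserted before the integration over s, so the rule for integrals with a parameter applies to
    the pair (x, t).\<close>
  define g where "g z = form_chart c \<omega> (fst (fst z), snd (fst z) * snd z) vs" for z :: "('e \<times> real) \<times> real"
  note o = open_Times[OF open_cyl[OF c] open_UNIV]
  have "smooth_on ((cimage c \<times> UNIV) \<times> UNIV) (\<lambda>z::('e \<times> real) \<times> real. (fst (fst z), snd (fst z) * snd z))"
    by (intro smooth_on_Pair smooth_on_mult smooth_on_bounded_linear_compose[OF _ bounded_linear_fst]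
        smooth_on_bounded_linear_compose[OF _ bounded_linear_snd] smooth_on_fst smooth_on_snd o)
  then have "smooth_on ((cimage c \<times> UNIV) \<times> UNIV) g"
    unfolding g_def
    by (rule smooth_on_compose[OF o open_cyl[OF c] _ _ smooth_form_family_chart[OF \<omega> c], rotated]) auto
  then have "smooth_on (cimage c \<times> UNIV) (\<lambda>z. snd z * integral {0..1} (\<lambda>s. g (z, s)))"
    by (intro smooth_on_mult smooth_on_snd smooth_on_integral_param open_cyl[OF c])
  then show "smooth_on (cimage c \<times> UNIV) (\<lambda>z. form_chart c (tint \<omega>) z vs)"
    unfolding g_def form_in_def tint_def by simp
qed

lemma tint_derivative:
  assumes "smooth_form_family A k \<omega>"
  shows "((\<lambda>s. tint \<omega> s p vs) has_real_derivative \<omega> t p vs) (at t)"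
  unfolding tint_def by (rule has_real_derivative_scaled_integral[OF smooth_form_family_time[OF assms]])

subsection \<open>The de Rham differential in arbitrary charts\<close>

lemma de_rham_dloc: "de_rham A \<omega> p vs = dloc (form_in A (chart_at A p) \<omega>) (coord A p p) vs"
  unfolding de_rham_def dloc_def ..

lemma dloc_form_in_pullback:
  assumes k: "k = 2 \<or> k = 3" and \<omega>: "\<omega> \<in> forms A k" and \<phi>: "smooth_map A \<phi>"
    and c: "c \<in> A" "c' \<in> A" and x: "x \<in> rep_dom c c' \<phi>"
  shows "dloc (form_in A c (pullback A \<phi> \<omega>)) x vs =
    dloc (form_in A c' \<omega>) (rep c c' \<phi> x) (map (D (rep c c' \<phi>) x) vs)"
proof -
  note o = open_rep_dom[OF \<phi> c]
  have "dloc (form_in A c (pullback A \<phi> \<omega>)) x vs =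
      dloc (\<lambda>x vs. form_in A c' \<omega> (rep c c' \<phi> x) (map (D (rep c c' \<phi>) x) vs)) x vs"
    by (rule dloc_cong[OF o x form_in_pullback[OF \<phi> c]])
  also have "\<dots> = dloc (form_in A c' \<omega>) (rep c c' \<phi> x) (map (D (rep c c' \<phi>) x) vs)"
    by (rule dloc_pullback[OF k o open_cimage[OF c(2)] _ smooth_rep[OF \<phi> c] forms_chart[OF \<omega> c(2)] _ x])
      (auto simp: rep_in c intro: alternating_form_in forms_alternating[OF \<omega>])
  finally show ?thesis .
qed

lemma coord_in_rep_dom: "\<phi> p \<in> fst c' \<Longrightarrow> coord A p p \<in> rep_dom (chart_at A p) c' \<phi>"
  unfolding rep_dom_def by (simp add: coord_in cinv_coord)

lemma rep_coord: "rep (chart_at A p) c' \<phi> (coord A p p) = snd c' (\<phi> p)"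
  unfolding rep_def by (simp add: cinv_coord)

text \<open>\<open>de_rham\<close> uses the selected chart of each point. Passing to the chart c is
  pullback along the identity, with which the coordinate exterior derivative commutes.\<close>

lemma form_in_de_rham:
  assumes k: "k = 2 \<or> k = 3" and \<omega>: "\<omega> \<in> forms A k" and c: "c \<in> A" and x: "x \<in> cimage c"
  shows "form_in A c (de_rham A \<omega>) x vs = dloc (form_in A c \<omega>) x vs"
proof -
  let ?q = "cinv c x"
  have q: "x \<in> rep_dom c (chart_at A ?q) id" using x unfolding rep_dom_def by (simp add: in_chart_at)
  have "form_in A c (de_rham A \<omega>) x vs = dloc (form_in A (chart_at A ?q) \<omega>) (coord A ?q ?q) (map (from_chart A c ?q) vs)"
    unfolding form_in_def[of A c] de_rham_dloc ..
  also have "\<dots> = dloc (form_in A c (pullback A id \<omega>)) x vs"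
    using dloc_form_in_pullback[OF k \<omega> smooth_map_id c chart_at_in q]
    by (simp add: from_chart_rep chart_cinv[OF c x]) (simp add: rep_def coord_def)
  finally show ?thesis unfolding pullback_id .
qed

lemma de_rham_pullback:
  assumes k: "k = 2 \<or> k = 3" and \<omega>: "\<omega> \<in> forms A k" and \<phi>: "smooth_map A \<phi>"
  shows "de_rham A (pullback A \<phi> \<omega>) p vs = pullback A \<phi> (de_rham A \<omega>) p vs"
  using dloc_form_in_pullback[OF k \<omega> \<phi> chart_at_in chart_at_in coord_in_rep_dom[OF in_chart_at]]
  unfolding de_rham_dloc pullback_def[of A \<phi> "de_rham A \<omega>"] tangent_map_rep rep_coord by (simp add: coord_def)

lemma smooth_form_family_de_rham:
  assumes \<omega>: "smooth_form_family A 2 \<omega>" shows "smooth_form_family A 3 (\<lambda>t. de_rham A (\<omega> t))"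
proof (rule smooth_form_familyI)
  note \<omega>' = smooth_form_family_slice[OF \<omega>]
  show "alternating 3 (de_rham A (\<omega> t) p)" for t p
    unfolding de_rham_dloc[abs_def]
    by (rule alternating_dloc[OF open_cimage[OF chart_at_in] coord_in])
      (auto intro: alternating_form_in chart_at_in forms_alternating[OF \<omega>'] forms_chart[OF \<omega>'])
  fix c vs assume c: "c \<in> A"
  have "smooth_on (cimage c \<times> UNIV) (\<lambda>z. \<Sum>i<length vs. (- 1) ^ i *
      D (\<lambda>z. form_chart c \<omega> z (remove_nth i vs)) z (vs ! i, 0))"
    by (intro smooth_on_sum smooth_on_mult smooth_on_const open_cyl[OF c] smooth_on_D smooth_form_family_chart[OF \<omega> c])
  then show "smooth_on (cimage c \<times> UNIV) (\<lambda>z. form_chart c (\<lambda>t. de_rham A (\<omega> t)) z vs)"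
  proof (rule smooth_on_eqI[OF open_cyl[OF c]])
    fix z assume z: "z \<in> cimage c \<times> (UNIV::real set)"
    then show "form_chart c (\<lambda>t. de_rham A (\<omega> t)) z vs = (\<Sum>i<length vs. (- 1) ^ i *
      D (\<lambda>z. form_chart c \<omega> z (remove_nth i vs)) z (vs ! i, 0))"
      using form_in_de_rham[OF _ \<omega>' c, of "fst z" "snd z" vs]
        D_eqI[OF has_derivative_slice[OF smooth_form_family_chart[OF \<omega> c], of "fst z" "snd z"]]
      unfolding dloc_def by auto
  qed
qed

text \<open>The outer derivative needs the inner one near p in a single chart, whereas by definition
  its values are computed in charts that vary with the point. \<open>form_in_de_rham\<close> bridges
  this, and the coordinate identity finishes.\<close>

lemma de_rham_de_rham:
  assumes \<omega>: "\<omega> \<in> forms A 2" shows "de_rham A (de_rham A \<omega>) p vs = 0"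
proof -
  note o = open_cimage[OF chart_at_in]
  let ?w = "form_in A (chart_at A p) \<omega>"
  have w: "smooth_on (cimage (chart_at A p)) (\<lambda>y. ?w y vs)" for vs
    by (rule forms_chart[OF \<omega> chart_at_in])
  have alt: "alternating 3 (dloc ?w y)" if "y \<in> cimage (chart_at A p)" for y
    by (rule alternating_dloc[OF o that])
      (auto intro: alternating_form_in chart_at_in forms_alternating[OF \<omega>] w)
  have 1: "de_rham A (de_rham A \<omega>) p vs = dloc (dloc ?w) (coord A p p) vs"
    unfolding de_rham_dloc[of "de_rham A \<omega>"]
    by (rule dloc_cong[OF o coord_in]) (rule form_in_de_rham[OF _ \<omega> chart_at_in], auto)
  show ?thesis
  proof (cases "length vs = 4")
    case True
    then obtain a b c d where "vs = [a, b, c, d]" by (auto simp: numeral_eq_Suc length_Suc_conv)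
    then show ?thesis using 1 dloc_dloc2[OF o w coord_in] by simp
  next
    case False
    then show ?thesis unfolding 1
      by (intro dloc_length[where k = 3, OF o coord_in]) (auto intro: alternating_length[OF alt])
  qed
qed

text \<open>Chart and time are coordinates of one space, so time and space derivatives of the
  coefficients commute.\<close>

lemma de_rham_tderiv:
  assumes \<omega>: "smooth_form_family A k \<omega>"
  shows "((\<lambda>s. de_rham A (\<omega> s) p vs) has_real_derivative de_rham A (tderiv \<omega> t) p vs) (at t)"
proof -
  let ?c = "chart_at A p" and ?x = "coord A p p"
  note c = chart_at_in[of p] and x = coord_in[of p]
  have g: "smooth_on (cimage ?c \<times> UNIV) (\<lambda>z. form_chart ?c \<omega> z us)" for us
    by (rule smooth_form_family_chart[OF \<omega> c])
  have 1: "D (\<lambda>y. form_in A ?c (\<omega> s) y us) ?x v = D (\<lambda>z. form_chart ?c \<omega> z us) (?x, s) (v, 0)" for s us v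
    using D_eqI[OF has_derivative_slice[OF g, of ?x s]] x by simp
  have 2: "D (\<lambda>y. form_in A ?c (tderiv \<omega> t) y us) ?x v =
      D (\<lambda>z. D (\<lambda>z. form_chart ?c \<omega> z us) z (v, 0)) (?x, t) (0, 1)" for us v
  proof -
    have "D (\<lambda>y. form_in A ?c (tderiv \<omega> t) y us) ?x v = D (\<lambda>y. D (\<lambda>z. form_chart ?c \<omega> z us) (y, t) (0, 1)) ?x v"
      using D_cong[OF open_cimage[OF c] x form_chart_tderiv[OF \<omega> c]] by simp
    also have "\<dots> = D (\<lambda>z. D (\<lambda>z. form_chart ?c \<omega> z us) z (0, 1)) (?x, t) (v, 0)"
      using D_eqI[OF has_derivative_slice[OF smooth_on_D[OF g], of ?x t]] x by simp
    finally show ?thesis using D_commute[OF open_cyl[OF c] g, of "(?x, t)"] x by simp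
  qed
  have 3: "((\<lambda>s. D (\<lambda>z. form_chart ?c \<omega> z us) (?x, s) (v, 0)) has_real_derivative
      D (\<lambda>z. D (\<lambda>z. form_chart ?c \<omega> z us) z (v, 0)) (?x, t) (0, 1)) (at t)" for us v
  proof -
    have "smooth_on UNIV (\<lambda>s. D (\<lambda>z. form_chart ?c \<omega> z us) (?x, s) (v, 0))"
      by (rule smooth_on_slice2[OF smooth_on_D[OF g] open_cyl[OF c]]) (use x in auto)
    from has_derivative_imp_has_real_derivative[OF smooth_on_has_derivative[OF this, of t]]
      D_time[OF smooth_on_D[OF g], of ?x t us "(v, 0)" 1] x
    show ?thesis by simp
  qed
  show ?thesis
    unfolding de_rham_dloc dloc_def 1 2 by (intro DERIV_sum DERIV_cmult 3)
qed

end

context smooth_manifold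
begin

subsection \<open>Transport along an isotopy\<close>

lemma diffeo_smooth: "diffeo A \<phi> \<Longrightarrow> smooth_map A \<phi>" "diffeo A \<phi> \<Longrightarrow> smooth_map A (inv \<phi>)"
  unfolding diffeo_def by auto

lemma diffeo_inv_apply: "diffeo A \<phi> \<Longrightarrow> inv \<phi> (\<phi> p) = p" "diffeo A \<phi> \<Longrightarrow> \<phi> (inv \<phi> p) = p"
  unfolding diffeo_def by (auto simp: bij_is_inj bij_is_surj surj_f_inv_f)

lemma diffeo_inv: "diffeo A \<phi> \<Longrightarrow> diffeo A (inv \<phi>)"
  unfolding diffeo_def by (simp add: bij_imp_bij_inv inv_inv_eq)

lemma inv_inv_diffeo: "diffeo A \<phi> \<Longrightarrow> inv (inv \<phi>) = \<phi>"
  unfolding diffeo_def by (simp add: inv_inv_eq)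

lemma pullback_inv: "diffeo A \<phi> \<Longrightarrow> pullback A \<phi> (pullback A (inv \<phi>) \<omega>) = \<omega>"
  unfolding pullback_def by (intro ext) (simp add: diffeo_inv_apply tangent_map_inv o_def)

lemma pullback_inv': "diffeo A \<phi> \<Longrightarrow> pullback A (inv \<phi>) (pullback A \<phi> \<omega>) = \<omega>"
  using pullback_inv[OF diffeo_inv] by (simp add: inv_inv_diffeo)

lemma pushforward_apply:
  "diffeo A \<phi> \<Longrightarrow> pushforward A \<phi> P (\<phi> p) \<xi>s = P p (map (covec_map (tangent_map A \<phi> p)) \<xi>s)"
  unfolding pushforward_covec_map by (simp add: diffeo_inv_apply)

lemma pushforward_inv:
  assumes \<phi>: "diffeo A \<phi>" shows "pushforward A \<phi> (pushforward A (inv \<phi>) P) = P"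
proof (intro ext)
  fix q \<xi>s
  define p where "p = inv \<phi> q"
  have q: "q = \<phi> p" using diffeo_inv_apply(2)[OF \<phi>] unfolding p_def by simp
  have "covec_map (tangent_map A (inv \<phi>) (\<phi> p)) (covec_map (tangent_map A \<phi> p) \<xi>) = \<xi>" for \<xi>
    using diffeo_smooth[OF \<phi>]
    by (simp add: covec_map_compose linear_tangent_map tangent_map_inv[OF \<phi>] covec_map_ident)
  then show "pushforward A \<phi> (pushforward A (inv \<phi>) P) q \<xi>s = P q \<xi>s"
    unfolding pushforward_covec_map p_def[symmetric] inv_inv_diffeo[OF \<phi>] q[symmetric]
    by (simp add: o_def q[symmetric])
qed

lemma pushforward_inv':
  "diffeo A \<phi> \<Longrightarrow> pushforward A (inv \<phi>) (pushforward A \<phi> P) = P"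
  using pushforward_inv[OF diffeo_inv] by (simp add: inv_inv_diffeo)

lemma to_chart_vec:
  assumes "c \<in> A" "x \<in> cimage c" "alternating 1 (X (cinv c x))"
  shows "to_chart A c (cinv c x) (vec (X (cinv c x))) = vec (mvec_in A c X x)"
  unfolding from_chart_vec[where X = X, OF assms, symmetric]
  by (rule to_from_chart[OF assms(1) cinv_in[OF assms(1,2)]])

text \<open>The Lie derivative of P along X on two covectors, by its coordinate formula in the
  selected chart; \<open>schouten_vec\<close> identifies it with [X, P].\<close>

definition lie_mvec :: "('m, 'e) mvec_field \<Rightarrow> ('m, 'e) mvec_field \<Rightarrow> 'm \<Rightarrow> 'e covec \<Rightarrow> 'e covec \<Rightarrow> real" where
  "lie_mvec X P q \<xi> \<eta> =
    (let c = chart_at A q; y = coord A q q; L = D (\<lambda>y. vec (mvec_in A c X y)) y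
     in D (\<lambda>y. mvec_in A c P y [\<xi>, \<eta>]) y (vec (X q)) - P q [covec_map L \<xi>, \<eta>] - P q [\<xi>, covec_map L \<eta>])"

text \<open>The velocity is given in the selected chart at the current point, the family in the
  chart c'. Both describe the same curve near t, and the differential of the change of charts is
  \<open>to_chart\<close>.\<close>

lemma rept_velocity:
  assumes \<Phi>: "smooth_map_family A \<Phi>" and c: "c \<in> A" "c' \<in> A" and xt: "(x, t) \<in> rept_dom c c' \<Phi>"
  defines "p \<equiv> cinv c x"
  assumes v: "((\<lambda>s. coord A (\<Phi> t p) (\<Phi> s p)) has_vector_derivative v) (at t)"
  shows "D (rept c c' \<Phi>) (x, t) (0, 1) = to_chart A c' (\<Phi> t p) v"
proof -
  define q where "q = \<Phi> t p"
  define c0 where "c0 = chart_at A q"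
  have c0: "c0 \<in> A" "q \<in> fst c0" unfolding c0_def by (simp_all add: chart_at_in in_chart_at)
  have x: "x \<in> cimage c" "q \<in> fst c'" using xt unfolding rept_dom_def p_def q_def by auto
  have cd: "coord A q q \<in> rep_dom c0 c' id"
    unfolding c0_def by (intro coord_in_rep_dom) (simp add: x)
  have f: "((\<lambda>s. coord A q (\<Phi> s p)) has_derivative (\<lambda>h. h *\<^sub>R v)) (at t)"
    using v unfolding q_def[symmetric] has_vector_derivative_def .
  have "((\<lambda>s. rep c0 c' id (coord A q (\<Phi> s p))) has_derivative
      (\<lambda>h. D (rep c0 c' id) (coord A q q) (h *\<^sub>R v))) (at t)"
    using has_derivative_smooth_compose[OF smooth_rep[OF smooth_map_id c0(1) c(2)] _ f] cd
    by (simp add: q_def)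
  then have 1: "((\<lambda>s. rept c c' \<Phi> (x, s)) has_derivative
      (\<lambda>h. D (rep c0 c' id) (coord A q q) (h *\<^sub>R v))) (at t)"
  proof (rule has_derivative_transform_within_open[OF _ open_slice2[OF open_rept_dom[OF \<Phi> c(1) c0(1)], of x]])
    show "t \<in> {s. (x, s) \<in> rept_dom c c0 \<Phi>}"
      using x c0 unfolding rept_dom_def p_def q_def by auto
    show "rep c0 c' id (coord A q (\<Phi> s p)) = rept c c' \<Phi> (x, s)" if "s \<in> {s. (x, s) \<in> rept_dom c c0 \<Phi>}" for s
    proof -
      have "\<Phi> s p \<in> fst c0" using that unfolding rept_dom_def p_def by auto
      then show ?thesis unfolding rep_def rept_def coord_def c0_def[symmetric] p_def by (simp add: cinv_chart c0)
    qed
  qed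
  have "D (rept c c' \<Phi>) (x, t) (0, 1) = D (\<lambda>s. rept c c' \<Phi> (x, s)) t 1"
    using D_time[OF smooth_rept[OF \<Phi> c] xt, of 1] by simp
  also have "\<dots> = to_chart A c' q v"
    using D_eqI[OF 1] unfolding to_chart_rep c0_def by simp
  finally show ?thesis unfolding q_def .
qed

context
  fixes \<Phi> :: "real \<Rightarrow> 'm \<Rightarrow> 'm" and X :: "real \<Rightarrow> ('m, 'e) mvec_field"
  assumes \<Phi>: "smooth_map_family A \<Phi>" and diffeo: "\<And>t. diffeo A (\<Phi> t)"
    and X: "smooth_mvec_family A 1 X"
    and flow: "\<And>t p. ((\<lambda>s. coord A (\<Phi> t p) (\<Phi> s p)) has_vector_derivative - vec (X t (\<Phi> t p))) (at t)"
begin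

lemma flow_chart:
  assumes c: "c \<in> A" "c' \<in> A" and xt: "(x, t) \<in> rept_dom c c' \<Phi>"
  shows "D (rept c c' \<Phi>) (x, t) (0, 1) = - vec (mvec_in A c' (X t) (rept c c' \<Phi> (x, t)))"
proof -
  define q where "q = \<Phi> t (cinv c x)"
  have q: "q \<in> fst c'" using xt unfolding rept_dom_def q_def by auto
  have y: "rept c c' \<Phi> (x, t) = snd c' q" unfolding rept_def q_def by simp
  have "D (rept c c' \<Phi>) (x, t) (0, 1) = to_chart A c' q (- vec (X t q))"
    unfolding q_def by (rule rept_velocity[OF \<Phi> c xt flow])
  also have "\<dots> = - to_chart A c' q (vec (X t q))" by (rule linear_neg[OF linear_to_chart[OF c(2) q]])
  also have "to_chart A c' q (vec (X t q)) = vec (mvec_in A c' (X t) (snd c' q))"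
    using to_chart_vec[OF c(2) chart_in[OF q], of "X t"] smooth_mvec_family_alternating[OF X]
    by (simp add: cinv_chart c q)
  finally show ?thesis unfolding y .
qed

lemma flow_at:
  fixes p :: 'm and t :: real
  defines "c \<equiv> chart_at A p" and "x \<equiv> coord A p p" and "c' \<equiv> chart_at A (\<Phi> t p)"
  shows "c \<in> A" "c' \<in> A" "(x, t) \<in> rept_dom c c' \<Phi>" "rept c c' \<Phi> (x, t) = coord A (\<Phi> t p) (\<Phi> t p)"
    "(\<lambda>v. D (rept c c' \<Phi>) (x, t) (v, 0)) = tangent_map A (\<Phi> t) p"
proof -
  show c: "c \<in> A" "c' \<in> A" unfolding c_def c'_def by (simp_all add: chart_at_in)
  show xt: "(x, t) \<in> rept_dom c c' \<Phi>"
    unfolding rept_dom_iff x_def c_def c'_def by (intro coord_in_rep_dom in_chart_at)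
  show "rept c c' \<Phi> (x, t) = coord A (\<Phi> t p) (\<Phi> t p)"
    unfolding rept_rep x_def c_def rep_coord c'_def by (simp add: coord_def)
  show "(\<lambda>v. D (rept c c' \<Phi>) (x, t) (v, 0)) = tangent_map A (\<Phi> t) p"
    using D_rept[OF \<Phi> c xt] unfolding tangent_map_rep x_def c_def c'_def by simp
qed

lemma smooth_vec_chart:
  assumes "c \<in> A" shows "smooth_on (cimage c) (\<lambda>y. vec (mvec_in A c (X t) y))"
  using smooth_on_slice[OF smooth_on_vec_mvec[OF X assms] open_cyl[OF assms] open_cimage[OF assms], of t] by simp

text \<open>The transport formula for the flow of -X, combined with Cartan's formula for a closed
  form: the Lie derivative along -X is minus the differential of the contraction with X.\<close>

lemma path_form:
  assumes H: "smooth_form_family A 3 H" and closed: "\<And>p vs. de_rham A (H t) p vs = 0" and len: "length vs = 3"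
  shows "((\<lambda>s. pullback A (\<Phi> s) (H s) p vs) has_real_derivative
    pullback A (\<Phi> t) (\<lambda>q us. tderiv H t q us - de_rham A (contract (X t) (H t)) q us) p vs) (at t)"
proof -
  define c where "c = chart_at A p"
  define x where "x = coord A p p"
  define q where "q = \<Phi> t p"
  define c' where "c' = chart_at A q"
  define y where "y = coord A q q"
  define us where "us = map (tangent_map A (\<Phi> t) p) vs"
  define W where "W = (\<lambda>y. - vec (mvec_in A c' (X t) y))"
  note at = flow_at(1)[of p, folded c_def] flow_at(2)[where p = p and t = t, folded q_def, folded c'_def]
    flow_at(3-5)[where p = p and t = t, folded c_def x_def q_def, folded c'_def y_def]
  note c = at(1,2) and xt = at(3)
  have y: "y \<in> cimage c'" unfolding y_def c'_def by (rule coord_in)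
  have W: "smooth_on (cimage c') W"
    unfolding W_def by (intro smooth_on_minus open_cimage c smooth_vec_chart)
  have alt: "alternating 3 (form_in A c' (H t) y)" if "y \<in> cimage c'" for y t
    using that by (intro alternating_form_in c smooth_form_family_alternating[OF H])
  have chart: "smooth_on (cimage c') (\<lambda>y. form_in A c' (H t) y vs)" for vs
    by (rule forms_chart[OF smooth_form_family_slice[OF H] c(2)])
  have "((\<lambda>s. form_chart c' H (rept c c' \<Phi> (x, s), s) (map (\<lambda>v. D (rept c c' \<Phi>) (x, s) (v, 0)) vs)) has_real_derivative
    (let y = rept c c' \<Phi> (x, t); us = map (\<lambda>v. D (rept c c' \<Phi>) (x, t) (v, 0)) vs
     in D (\<lambda>z. form_chart c' H z us) (y, t) (0, 1) + lie_form (\<lambda>y. form_chart c' H (y, t)) W y us)) (at t)"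
  proof (rule transport_form[OF open_rept_dom[OF \<Phi> c] open_cyl[OF c(2)] smooth_rept[OF \<Phi> c] _ xt])
    show "(rept c c' \<Phi> z, snd z) \<in> cimage c' \<times> UNIV" if "z \<in> rept_dom c c' \<Phi>" for z
      using that by (cases z) (auto simp: rept_rep rept_dom_iff rep_in c)
    show "D (rept c c' \<Phi>) (y, t) (0, 1) = W (rept c c' \<Phi> (y, t))" if "(y, t) \<in> rept_dom c c' \<Phi>" for y
      using flow_chart[OF c that] unfolding W_def .
    show "(W has_derivative D W (rept c c' \<Phi> (x, t))) (at (rept c c' \<Phi> (x, t)))"
      using smooth_on_has_derivative[OF W y] at(4) by simp
    show "smooth_on (cimage c' \<times> UNIV) (\<lambda>z. form_chart c' H z vs)" for vs
      by (rule smooth_form_family_chart[OF H c(2)])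
    show "alternating (length vs) (form_chart c' H z)" if "z \<in> cimage c' \<times> UNIV" for z
      using alt that len by auto
  qed
  then have 1: "((\<lambda>s. form_chart c' H (rept c c' \<Phi> (x, s), s) (map (\<lambda>v. D (rept c c' \<Phi>) (x, s) (v, 0)) vs)) has_real_derivative
      D (\<lambda>z. form_chart c' H z us) (y, t) (0, 1) + lie_form (form_in A c' (H t)) W y us) (at t)"
    unfolding Let_def at(4,5) us_def by simp
  have 2: "D (\<lambda>z. form_chart c' H z us) (y, t) (0, 1) = tderiv H t q us"
    unfolding form_chart_tderiv[OF H c(2) y, symmetric] unfolding c'_def y_def by (rule form_in_at)
  have 3: "lie_form (form_in A c' (H t)) W y us = - de_rham A (contract (X t) (H t)) q us"
  proof -
    obtain u1 u2 u3 where us: "us = [u1, u2, u3]"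
      using len unfolding us_def by (auto simp: numeral_3_eq_3 length_Suc_conv)
    have "lie_form (form_in A c' (H t)) W y us = dloc (\<lambda>y vs. form_in A c' (H t) y (W y # vs)) y us"
      unfolding us
    proof (rule cartan_closed3[OF open_cimage[OF c(2)] chart alt W y])
      show "dloc (form_in A c' (H t)) y vs = 0" for vs
        using closed[of q vs] unfolding de_rham_dloc c'_def y_def .
    qed
    moreover have "form_in A c' (H t) z (W z # vs) = - form_in A c' (contract (X t) (H t)) z vs"
      if z: "z \<in> cimage c'" and l: "length vs = 2" for z vs
      using linear_neg[OF alternating_linear[OF alt[OF z], of "[]" vs t]] l
        form_in_contract[where X = "X t", OF c(2) z smooth_mvec_family_alternating[OF X]]
      unfolding W_def by simp
    then have "D (\<lambda>z. form_in A c' (H t) z [W z, a, b]) y v = - D (\<lambda>z. form_in A c' (contract (X t) (H t)) z [a, b]) y v" for a b v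
    proof -
      assume *: "\<And>z vs. z \<in> cimage c' \<Longrightarrow> length vs = 2 \<Longrightarrow>
        form_in A c' (H t) z (W z # vs) = - form_in A c' (contract (X t) (H t)) z vs"
      have "contract (X t) (H t) \<in> forms A 2"
        using smooth_form_family_slice[OF smooth_form_family_contract[OF X, of 2 H]] H
        by (simp add: numeral_3_eq_3 numeral_2_eq_2)
      then have "((\<lambda>z. - form_in A c' (contract (X t) (H t)) z [a, b]) has_derivative
          (\<lambda>v. - D (\<lambda>z. form_in A c' (contract (X t) (H t)) z [a, b]) y v)) (at y)"
        by (intro has_derivative_minus smooth_on_has_derivative[OF forms_chart[OF _ c(2)] y])
      then have "((\<lambda>z. form_in A c' (H t) z [W z, a, b]) has_derivative
          (\<lambda>v. - D (\<lambda>z. form_in A c' (contract (X t) (H t)) z [a, b]) y v)) (at y)"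
        by (rule has_derivative_transform_within_open[OF _ open_cimage[OF c(2)] y]) (simp add: *)
      then show ?thesis by (simp add: D_eqI)
    qed
    ultimately have "lie_form (form_in A c' (H t)) W y us = - dloc (form_in A c' (contract (X t) (H t))) y us"
      unfolding us dloc_eq by simp
    then show ?thesis unfolding de_rham_dloc c'_def y_def .
  qed
  have "((\<lambda>s. pullback A (\<Phi> s) (H s) p vs) has_real_derivative
      tderiv H t q us - de_rham A (contract (X t) (H t)) q us) (at t)"
  proof (rule has_field_derivative_transform_within_open[OF 1[unfolded 2 3, simplified]])
    show "open {s. (x, s) \<in> rept_dom c c' \<Phi>}" by (rule open_slice2[OF open_rept_dom[OF \<Phi> c]])
    show "t \<in> {s. (x, s) \<in> rept_dom c c' \<Phi>}" using xt by simp
    show "form_in A c' (H s) (rept c c' \<Phi> (x, s)) (map (\<lambda>v. D (rept c c' \<Phi>) (x, s) (v, 0)) vs) = pullback A (\<Phi> s) (H s) p vs"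
      if "s \<in> {s. (x, s) \<in> rept_dom c c' \<Phi>}" for s
    proof -
      have s: "(x, s) \<in> rept_dom c c' \<Phi>" using that by simp
      have "pullback A (\<Phi> s) (H s) p vs = form_in A c (pullback A (\<Phi> s) (H s)) x vs"
        unfolding c_def x_def by (rule form_in_at[symmetric])
      then show ?thesis
        using form_in_pullback[OF smooth_map_family_slice[OF \<Phi>] c s[unfolded rept_dom_iff]] D_rept[OF \<Phi> c s]
        by (simp add: rept_rep)
    qed
  qed
  then show ?thesis unfolding pullback_def us_def q_def .
qed

text \<open>The transport formula with W = -X, which explains the sign of the Lie derivative. The
  result is evaluated on covectors pulled back from \<open>\<Phi> t p\<close>; as the tangent map is
  invertible, these are all covectors at p.\<close>

lemma path_mvec:
  assumes P: "smooth_mvec_family A 2 P"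
  defines "Q \<equiv> \<lambda>t. pushforward A (inv (\<Phi> t)) (P t)"
  shows "tderiv Q t p [covec_map (tangent_map A (\<Phi> t) p) \<xi>, covec_map (tangent_map A (\<Phi> t) p) \<eta>] =
    tderiv P t (\<Phi> t p) [\<xi>, \<eta>] - lie_mvec (X t) (P t) (\<Phi> t p) \<xi> \<eta>"
proof -
  have Q: "smooth_mvec_family A 2 Q"
    using smooth_mvec_family_pushforward[OF smooth_map_family_inverse[OF \<Phi> diffeo] diffeo_inv[OF diffeo] P]
    unfolding Q_def .
  define c where "c = chart_at A p"
  define x where "x = coord A p p"
  define q where "q = \<Phi> t p"
  define c' where "c' = chart_at A q"
  define y where "y = coord A q q"
  define V where "V = (\<lambda>y. vec (mvec_in A c' (X t) y))"
  define W where "W = (\<lambda>y. - V y)"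
  note at = flow_at(1)[of p, folded c_def] flow_at(2)[where p = p and t = t, folded q_def, folded c'_def]
    flow_at(3-5)[where p = p and t = t, folded c_def x_def q_def, folded c'_def y_def]
  note c = at(1,2) and xt = at(3)
  have y: "y \<in> cimage c'" unfolding y_def c'_def by (rule coord_in)
  have x: "x \<in> cimage c" unfolding x_def c_def by (rule coord_in)
  have V: "smooth_on (cimage c') V" unfolding V_def by (intro smooth_vec_chart c)
  have W: "smooth_on (cimage c') W" unfolding W_def by (intro smooth_on_minus open_cimage c V)
  have tr: "let y = rept c c' \<Phi> (x, t); L = \<lambda>v. D (rept c c' \<Phi>) (x, t) (v, 0)
    in D (\<lambda>z. mvec_chart c Q z [covec_map L \<xi>, covec_map L \<eta>]) (x, t) (0, 1) =
      D (\<lambda>z. mvec_chart c' P z [\<xi>, \<eta>]) (y, t) (0, 1) + (D (\<lambda>y. mvec_chart c' P (y, t) [\<xi>, \<eta>]) y (W y)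
        - mvec_chart c' P (y, t) [covec_map (D W y) \<xi>, \<eta>] - mvec_chart c' P (y, t) [\<xi>, covec_map (D W y) \<eta>])"
  proof (rule transport_bivector[OF open_rept_dom[OF \<Phi> c] open_cyl[OF c(2)] smooth_rept[OF \<Phi> c] _ xt])
    show "(rept c c' \<Phi> z, snd z) \<in> cimage c' \<times> UNIV" if "z \<in> rept_dom c c' \<Phi>" for z
      using that by (cases z) (auto simp: rept_rep rept_dom_iff rep_in c)
    show "D (rept c c' \<Phi>) (y, t) (0, 1) = W (rept c c' \<Phi> (y, t))" if "(y, t) \<in> rept_dom c c' \<Phi>" for y
      using flow_chart[OF c that] unfolding W_def V_def .
    show "(W has_derivative D W (rept c c' \<Phi> (x, t))) (at (rept c c' \<Phi> (x, t)))"
      using smooth_on_has_derivative[OF W y] at(4) by simp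
    show "smooth_on (cimage c' \<times> UNIV) (\<lambda>z. mvec_chart c' P z \<xi>s)" for \<xi>s
      by (rule smooth_mvec_family_chart[OF P c(2)])
    show "alternating 2 (mvec_chart c' P z)" for z
      by (rule smooth_mvec_family_chart_alternating[OF P])
    show "smooth_on (rept_dom c c' \<Phi>) (\<lambda>z. mvec_chart c Q z \<xi>s)" for \<xi>s
      by (rule smooth_on_subset[OF smooth_mvec_family_chart[OF Q c(1)]]) (auto simp: rept_dom_def)
    show "alternating 2 (mvec_chart c Q z)" for z
      by (rule smooth_mvec_family_chart_alternating[OF Q])
    fix z \<xi> \<eta> assume z: "z \<in> rept_dom c c' \<Phi>"
    obtain x s where xs: "z = (x, s)" by (cases z)
    have "pushforward A (\<Phi> s) (Q s) = P s" unfolding Q_def by (rule pushforward_inv[OF diffeo])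
    then show "mvec_chart c' P (rept c c' \<Phi> z, snd z) [\<xi>, \<eta>] = mvec_chart c Q z
        [covec_map (\<lambda>v. D (rept c c' \<Phi>) z (v, 0)) \<xi>, covec_map (\<lambda>v. D (rept c c' \<Phi>) z (v, 0)) \<eta>]"
      using mvec_in_pushforward[OF diffeo c, of x s "Q s" "[\<xi>, \<eta>]"] z D_rept[OF \<Phi> c, of x s]
      unfolding xs rept_dom_iff rept_rep by simp
  qed
  note alt = alternating_mvec_in[where P = "P t" and c = c' and x = y, OF smooth_mvec_family_alternating[OF P]]
  have DW: "D W y = (\<lambda>v. - D V y v)"
    unfolding W_def by (rule D_eqI[OF has_derivative_minus[OF smooth_on_has_derivative[OF V y]]])
  have cm: "covec_map (D W y) \<xi> = - covec_map (D V y) \<xi>" for \<xi>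
    using smooth_on_linear_D[OF V y] smooth_on_linear_D[OF W y]
    by (intro blinfun_eqI) (simp add: covec_map_apply DW blinfun.bilinear_simps)
  have Vy: "V y = vec (X t q)"
    unfolding V_def c'_def y_def vec_def by (simp add: mvec_in_at)
  have lin: "linear (D (\<lambda>y. mvec_in A c' (P t) y [\<xi>, \<eta>]) y)"
    by (rule smooth_on_linear_D[OF mvecs_chart[OF smooth_mvec_family_slice[OF P] c(2)] y])
  have "D (\<lambda>z. mvec_chart c Q z [covec_map (tangent_map A (\<Phi> t) p) \<xi>, covec_map (tangent_map A (\<Phi> t) p) \<eta>]) (x, t) (0, 1)
    = tderiv Q t p [covec_map (tangent_map A (\<Phi> t) p) \<xi>, covec_map (tangent_map A (\<Phi> t) p) \<eta>]"
    unfolding mvec_chart_tderiv[OF Q c(1) x, symmetric] unfolding c_def x_def by (rule mvec_in_at)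
  moreover have "D (\<lambda>z. mvec_chart c' P z [\<xi>, \<eta>]) (y, t) (0, 1) = tderiv P t q [\<xi>, \<eta>]"
    unfolding mvec_chart_tderiv[OF P c(2) y, symmetric] unfolding c'_def y_def by (rule mvec_in_at)
  moreover have "mvec_in A c' (P t) y = P t q" unfolding c'_def y_def by (intro ext mvec_in_at)
  ultimately show ?thesis
    using tr linear_neg[OF lin, of "V y"] linear_neg[OF alternating2_linear(1)[OF alt]] linear_neg[OF alternating2_linear(2)[OF alt]]
    unfolding Let_def at(4,5) cm lie_mvec_def q_def[symmetric] c'_def[symmetric] y_def[symmetric] V_def[symmetric]
    by (simp add: W_def Vy)
qed

end

end

section \<open>Evaluation of the brackets\<close>

text \<open>Sums over unshuffles run over all subsets; when a factor takes exactly one argument,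
  only the subsets with one element contribute.\<close>

lemma sum_Pow_singletons:
  fixes f :: "nat set \<Rightarrow> real"
  assumes "\<And>I. I \<subseteq> {..<n} \<Longrightarrow> card I \<noteq> 1 \<Longrightarrow> f I = 0"
  shows "(\<Sum>I\<in>Pow {..<n}. f I) = (\<Sum>i<n. f {i})"
proof -
  have "(\<Sum>I\<in>Pow {..<n}. f I) = (\<Sum>I\<in>(\<lambda>i. {i}) ` {..<n}. f I)"
    by (rule sum.mono_neutral_right) (auto simp: card_1_singleton_iff intro!: assms)
  also have "\<dots> = (\<Sum>i<n. f {i})" by (subst sum.reindex) auto
  finally show ?thesis .
qed

lemma sum_Pow_cosingletons:
  fixes f :: "nat set \<Rightarrow> real"
  assumes "\<And>I. I \<subseteq> {..<n} \<Longrightarrow> card ({..<n} - I) \<noteq> 1 \<Longrightarrow> f I = 0"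
  shows "(\<Sum>I\<in>Pow {..<n}. f I) = (\<Sum>i<n. f ({..<n} - {i}))"
proof -
  have "(\<Sum>I\<in>Pow {..<n}. f I) = (\<Sum>I\<in>Pow {..<n}. f ({..<n} - I))"
    by (rule sum.reindex_bij_witness[of _ "\<lambda>I. {..<n} - I" "\<lambda>I. {..<n} - I"]) (auto simp: double_diff)
  also have "\<dots> = (\<Sum>i<n. f ({..<n} - {i}))"
    by (rule sum_Pow_singletons) (auto simp: double_diff intro!: assms)
  finally show ?thesis .
qed

lemma nths_compl: "nths vs (- I) = nths vs ({..<length vs} - I)"
  unfolding nths_def by (intro arg_cong[of _ _ "map fst"] filter_cong refl) (auto dest: set_zip_rightD)

lemma nths_single: "i < length vs \<Longrightarrow> nths vs {i} = [vs ! i]"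
proof (induction vs arbitrary: i)
  case (Cons v vs)
  then show ?case by (cases i) (auto simp: nths_Cons)
qed simp

lemma nths_remove: "i < length vs \<Longrightarrow> nths vs (- {i}) = remove_nth i vs"
proof (induction vs arbitrary: i)
  case (Cons v vs)
  show ?case
  proof (cases i)
    case 0
    have "{j. Suc j \<in> - {0::nat}} = UNIV" by auto
    then show ?thesis using 0 by (simp add: nths_Cons nths_all)
  next
    case (Suc j)
    have "{k. Suc k \<in> - {Suc j}} = - {j}" by auto
    then show ?thesis using Suc Cons by (simp add: nths_Cons)
  qed
qed simp

lemma length_nths_subset: "I \<subseteq> {..<length vs} \<Longrightarrow> length (nths vs I) = card I"
  unfolding length_nths by (rule arg_cong[of _ _ card]) auto

lemma length_nths_compl: "length (nths vs (- I)) = card ({..<length vs} - I)"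
  unfolding nths_compl by (rule length_nths_subset) auto

lemma unshuffle_sign_single: "i < n \<Longrightarrow> unshuffle_sign n {i} = (- 1) ^ i"
proof -
  assume i: "i < n"
  have "{(i', j). i' \<in> {i} \<and> j \<in> {..<n} - {i} \<and> j < i'} = {i} \<times> {..<i}" using i by auto
  then show ?thesis unfolding unshuffle_sign_def by (simp add: card_cartesian_product)
qed

lemma unshuffle_sign_cosingle: "i < n \<Longrightarrow> unshuffle_sign n ({..<n} - {i}) = (- 1) ^ (n - Suc i)"
proof -
  assume i: "i < n"
  have "{(i', j). i' \<in> {..<n} - {i} \<and> j \<in> {..<n} - ({..<n} - {i}) \<and> j < i'} = {Suc i..<n} \<times> {i}" using i by auto
  then show ?thesis unfolding unshuffle_sign_def by (simp add: card_cartesian_product)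
qed

subsection \<open>Wedge products\<close>

lemma wedge_degree1:
  assumes "\<And>vs. length vs \<noteq> 1 \<Longrightarrow> F vs = 0"
  shows "wedge F G vs = (\<Sum>i<length vs. (- 1) ^ i * F [vs ! i] * G (remove_nth i vs))"
proof -
  have "wedge F G vs = (\<Sum>i<length vs. unshuffle_sign (length vs) {i} * F (nths vs {i}) * G (nths vs (- {i})))"
    unfolding wedge_def by (rule sum_Pow_singletons) (simp add: assms length_nths_subset)
  then show ?thesis by (simp add: unshuffle_sign_single nths_single nths_remove)
qed

lemma wedge_degree0:
  assumes "\<And>vs. vs \<noteq> [] \<Longrightarrow> F vs = 0"
  shows "wedge F G vs = F [] * G vs"
proof -
  have "wedge F G vs = (\<Sum>I\<in>{{}}. unshuffle_sign (length vs) I * F (nths vs I) * G (nths vs (- I)))"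
    unfolding wedge_def
  proof (rule sum.mono_neutral_right)
    show "\<forall>I\<in>Pow {..<length vs} - {{}}. unshuffle_sign (length vs) I * F (nths vs I) * G (nths vs (- I)) = 0"
    proof
      fix I assume "I \<in> Pow {..<length vs} - {{}}"
      then have "length (nths vs I) \<noteq> 0" by (auto simp: length_nths_subset finite_subset)
      then have "nths vs I \<noteq> []" by (metis list.size(3))
      then show "unshuffle_sign (length vs) I * F (nths vs I) * G (nths vs (- I)) = 0" by (simp add: assms)
    qed
  qed auto
  then show ?thesis by (simp add: unshuffle_sign_def nths_all)
qed

lemma wedge_zero_left: "wedge (\<lambda>vs. 0) G vs = 0" and wedge_zero_right: "wedge F (\<lambda>vs. 0) vs = 0"
  unfolding wedge_def by simp_all

lemma wedge_list_zero: "(\<lambda>vs. 0) \<in> set Fs \<Longrightarrow> wedge_list Fs = (\<lambda>vs. 0)"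
proof (induction Fs)
  case (Cons F Fs)
  show ?case
  proof (cases "F = (\<lambda>vs. 0)")
    case False
    then have "wedge_list Fs = (\<lambda>vs. 0)" using Cons by auto
    moreover have "wedge_list (F # Fs) = wedge F (wedge_list Fs)" unfolding wedge_list_def by simp
    ultimately have "wedge_list (F # Fs) = wedge F (\<lambda>vs. 0)" by simp
    then show ?thesis using wedge_zero_right by metis
  next
    case True
    then have "wedge_list (F # Fs) = wedge (\<lambda>vs. 0) (wedge_list Fs)" unfolding wedge_list_def by simp
    then show ?thesis using wedge_zero_left by metis
  qed
qed simp

lemma wedge_list2:
  assumes "\<And>vs. length vs \<noteq> 1 \<Longrightarrow> F vs = 0" "\<And>vs. length vs \<noteq> 1 \<Longrightarrow> G vs = 0"
  shows "wedge_list [F, G] [a, b] = F [a] * G [b] - F [b] * G [a]"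
    and "length vs \<noteq> 2 \<Longrightarrow> wedge_list [F, G] vs = 0"
proof -
  have G: "wedge_list [G] vs = G vs" for vs
  proof (cases vs)
    case (Cons a vs')
    then show ?thesis
      using assms(2)[of vs] unfolding wedge_list_def
      by (cases vs') (auto simp: wedge_degree1[OF assms(2)] remove_nth_def lessThan_Suc intro!: sum.neutral)
  qed (simp add: wedge_list_def wedge_degree1[OF assms(2)] assms(2))
  have "wedge_list [G] = G" using G by (rule ext)
  moreover have "wedge_list [F, G] = wedge F (wedge_list [G])" unfolding wedge_list_def by simp
  ultimately have F: "wedge_list [F, G] vs = wedge F G vs" for vs by simp
  show "wedge_list [F, G] [a, b] = F [a] * G [b] - F [b] * G [a]"
    unfolding F by (simp add: wedge_degree1[OF assms(1)] lessThan_Suc)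
  show "wedge_list [F, G] vs = 0" if "length vs \<noteq> 2"
  proof -
    have "wedge F G vs = (\<Sum>i<length vs. (- 1) ^ i * F [vs ! i] * G (remove_nth i vs))"
      by (rule wedge_degree1) (rule assms(1))
    also have "\<dots> = 0"
      using that by (intro sum.neutral ballI) (simp add: assms(2) remove_nth_def)
    finally show ?thesis unfolding F .
  qed
qed

lemma wedge_list3:
  assumes "\<And>vs. length vs \<noteq> 1 \<Longrightarrow> F vs = 0" "\<And>vs. length vs \<noteq> 1 \<Longrightarrow> G vs = 0" "\<And>vs. length vs \<noteq> 1 \<Longrightarrow> K vs = 0"
  shows "wedge_list [F, G, K] [a, b, c] = F [a] * (G [b] * K [c] - G [c] * K [b])
      - F [b] * (G [a] * K [c] - G [c] * K [a]) + F [c] * (G [a] * K [b] - G [b] * K [a])"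
    and "length vs \<noteq> 3 \<Longrightarrow> wedge_list [F, G, K] vs = 0"
proof -
  have F: "wedge_list [F, G, K] vs = wedge F (wedge_list [G, K]) vs" for vs
    unfolding wedge_list_def by simp
  show "wedge_list [F, G, K] [a, b, c] = F [a] * (G [b] * K [c] - G [c] * K [b])
      - F [b] * (G [a] * K [c] - G [c] * K [a]) + F [c] * (G [a] * K [b] - G [b] * K [a])"
    unfolding F by (simp add: wedge_degree1[OF assms(1)] lessThan_Suc wedge_list2[OF assms(2,3)])
  show "wedge_list [F, G, K] vs = 0" if "length vs \<noteq> 3"
  proof -
    have "wedge F (wedge_list [G, K]) vs = (\<Sum>i<length vs. (- 1) ^ i * F [vs ! i] * wedge_list [G, K] (remove_nth i vs))"
      by (rule wedge_degree1) (rule assms(1))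
    also have "\<dots> = 0"
      using that by (intro sum.neutral ballI) (simp add: wedge_list2(2)[OF assms(2,3)] remove_nth_def)
    finally show ?thesis unfolding F .
  qed
qed

subsection \<open>The linear extension of wedge products of sharp maps\<close>

lemma alternating_transpose:
  assumes F: "alternating k F" and k: "length us + length vs + length ws + 2 = k"
  shows "F (us @ a # vs @ b # ws) = - F (us @ b # vs @ a # ws)"
proof -
  have 1: "linear (\<lambda>v. F (us @ v # vs @ w # ws))" for w
    using alternating_linear[OF F, of us "vs @ w # ws"] k by simp
  have 2: "linear (\<lambda>v. F (us @ w # vs @ v # ws))" for w
    using alternating_linear[OF F, of "us @ w # vs" ws] k by simp
  have 0: "F (us @ v # vs @ v # ws) = 0" for v
    using F unfolding alternating_def by simp
  have "0 = F (us @ (a + b) # vs @ (a + b) # ws)" using 0 by simp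
  also have "\<dots> = F (us @ a # vs @ b # ws) + F (us @ b # vs @ a # ws)"
    using linear_add[OF 1, of a b "a + b"] linear_add[OF 2, of a a b] linear_add[OF 2, of b a b] 0 by simp
  finally show ?thesis by simp
qed

lemma alternating_permute_transpose:
  assumes F: "alternating (length xs) F" and ij: "i < j" "j < length xs"
  shows "F (permute_list (Transposition.transpose i j) xs) = - F xs"
proof -
  define us vs ws where "us = take i xs" and "vs = take (j - Suc i) (drop (Suc i) xs)" and "ws = drop (Suc j) xs"
  have xs: "xs = us @ xs ! i # vs @ xs ! j # ws"
  proof -
    have "drop (Suc i) xs = vs @ drop (j - Suc i) (drop (Suc i) xs)" unfolding vs_def by (rule append_take_drop_id[symmetric])
    also have "drop (j - Suc i) (drop (Suc i) xs) = xs ! j # ws"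
      using ij unfolding ws_def by (simp add: Cons_nth_drop_Suc)
    finally show ?thesis using ij unfolding us_def by (metis append_take_drop_id Cons_nth_drop_Suc dual_order.strict_trans)
  qed
  have l: "length us = i" "length vs = j - Suc i" "length us + length vs + length ws + 2 = length xs"
    using ij unfolding us_def vs_def ws_def by auto
  have "permute_list (Transposition.transpose i j) xs = us @ xs ! j # vs @ xs ! i # ws"
  proof (rule nth_equalityI)
    show "length (permute_list (Transposition.transpose i j) xs) = length (us @ xs ! j # vs @ xs ! i # ws)"
      using l by simp
    fix m assume "m < length (permute_list (Transposition.transpose i j) xs)"
    then have m: "m < length xs" by simp
    have perm: "Transposition.transpose i j permutes {..<length xs}" using ij by (intro permutes_swap_id) auto
    have nth: "(us @ a # vs @ b # ws) ! m = (if m < i then us ! m else if m = i then a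
        else if m < j then vs ! (m - Suc i) else if m = j then b else ws ! (m - Suc j))" for a b
    proof -
      consider "m < i" | "m = i" | "i < m" "m < j" | "m = j" | "j < m" by linarith
      then show ?thesis
      proof cases
        case 3
        then have "m - i = Suc (m - Suc i)" "m - Suc i < length vs" using l by auto
        then show ?thesis using 3 l by (simp add: nth_append)
      next
        case 4
        then have "m - i = Suc (m - Suc i)" "m - Suc i = length vs" using l ij by auto
        then show ?thesis using 4 l ij by (simp add: nth_append)
      next
        case 5
        then have "m - i = Suc (m - Suc i)" "\<not> m - Suc i < length vs" "m - Suc i - length vs = Suc (m - Suc j)"
          using l ij by auto
        then show ?thesis using 5 l ij by (simp add: nth_append)
      qed (use l ij in \<open>simp_all add: nth_append\<close>)
    qed
    have nth': "xs ! m = (us @ xs ! i # vs @ xs ! j # ws) ! m" by (rule arg_cong[OF xs])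
    have "xs ! Transposition.transpose i j m = (us @ xs ! j # vs @ xs ! i # ws) ! m"
      using ij nth'[unfolded nth] unfolding nth by (simp add: Transposition.transpose_def)
    then show "permute_list (Transposition.transpose i j) xs ! m = (us @ xs ! j # vs @ xs ! i # ws) ! m"
      by (simp only: permute_list_nth[OF perm m])
  qed
  then show ?thesis
    using alternating_transpose[OF F l(3), of "xs ! j" "xs ! i"] by (simp only: xs[symmetric])
qed

text \<open>Induction over a factorization of \<sigma> into transpositions. The claim is generalized
  to all lists of the given length, because the remaining factor acts on a list that is already
  transposed.\<close>

lemma alternating_permute:
  fixes F :: "'a::real_vector list \<Rightarrow> real"
  assumes "alternating (length xs) F" "\<sigma> permutes {..<length xs}"
  shows "F (permute_list \<sigma> xs) = of_int (sign \<sigma>) * F xs"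
proof -
  have "\<forall>ys. length ys = length xs \<longrightarrow> F (permute_list \<sigma> ys) = of_int (sign \<sigma>) * F ys"
    using assms(2) finite_lessThan
  proof (induction \<sigma> rule: permutes_induct)
    case id
    show ?case by simp
  next
    case (swap a b p)
    show ?case
    proof (intro allI impI)
      fix ys :: "'a list" assume ys: "length ys = length xs"
      have tr: "F (permute_list (Transposition.transpose a b) ys) = - F ys"
      proof (cases "a < b")
        case True
        then show ?thesis using alternating_permute_transpose[of ys F a b] assms(1) swap ys by auto
      next
        case False
        then have "b < a" using swap by simp
        then show ?thesis using alternating_permute_transpose[of ys F b a] assms(1) swap ys
          by (auto simp: transpose_commute)
      qed
      have "permute_list (Transposition.transpose a b \<circ> p) ys = permute_list p (permute_list (Transposition.transpose a b) ys)"
        using swap ys by (intro permute_list_compose) auto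
      then have "F (permute_list (Transposition.transpose a b \<circ> p) ys) = of_int (sign p) * - F ys"
        using swap tr ys by simp
      moreover have "sign (Transposition.transpose a b \<circ> p) = - sign p"
      proof -
        have "permutation p" using swap permutation_permutes by blast
        then show ?thesis
          using swap sign_compose[OF permutation_swap_id, of p a b] by (simp add: sign_swap_id)
      qed
      ultimately show "F (permute_list (Transposition.transpose a b \<circ> p) ys) = of_int (sign (Transposition.transpose a b \<circ> p)) * F ys"
        by simp
    qed
  qed
  then show ?thesis by simp
qed

definition basis_lists :: "nat \<Rightarrow> 'e::euclidean_space list set" where
  "basis_lists n = {bs. length bs = n \<and> set bs \<subseteq> Basis}"

lemma basis_lists_0: "basis_lists 0 = {[]}"
  unfolding basis_lists_def by auto

lemma sum_basis_lists_Suc: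
  fixes f :: "'e::euclidean_space list \<Rightarrow> real"
  shows "(\<Sum>bs\<in>basis_lists (Suc n). f bs) = (\<Sum>b\<in>Basis. \<Sum>bs\<in>basis_lists n. f (b # bs))"
proof -
  have "basis_lists (Suc n) = (\<lambda>(b, bs). b # bs) ` ((Basis :: 'e set) \<times> basis_lists n)"
    unfolding basis_lists_def by (auto simp: length_Suc_conv image_iff)
  moreover have inj: "inj_on (\<lambda>(b, bs). b # bs) ((Basis :: 'e set) \<times> basis_lists n)" by (auto simp: inj_on_def)
  ultimately have "(\<Sum>bs\<in>basis_lists (Suc n). f bs) = (\<Sum>x\<in>Basis \<times> basis_lists n. f (case x of (b, bs) \<Rightarrow> b # bs))"
    using sum.reindex[OF inj, of f] by (simp only: o_def)
  also have "\<dots> = (\<Sum>(b, bs)\<in>Basis \<times> basis_lists n. f (b # bs))"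
    by (rule sum.cong) auto
  finally show ?thesis by (simp only: sum.cartesian_product)
qed

text \<open>Reindexing the basis lists by \<sigma> absorbs the sign into a value of h, as h is
  alternating. So each of the n! permutations contributes the same sum, which cancels the factor 1 /
  n!.\<close>

lemma sharp_wedge_eq:
  assumes h: "alternating (length Ps) h"
  shows "sharp_wedge Ps h \<eta>s = (\<Sum>bs\<in>basis_lists (length Ps).
    h bs * wedge_list (map (\<lambda>i. sharp (Ps ! i) (dual (bs ! i))) [0..<length Ps]) \<eta>s)"
proof -
  define n where "n = length Ps"
  define W where "W bs = wedge_list (map (\<lambda>i. sharp (Ps ! i) (dual (bs ! i))) [0..<n]) \<eta>s" for bs
  let ?S = "{\<sigma>. \<sigma> permutes {..<n}}"
  have "sharp_wedge_dec Ps (map dual bs) \<eta>s = (\<Sum>\<sigma>\<in>?S. of_int (sign \<sigma>) * W (permute_list \<sigma> bs))" if "length bs = n" for bs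
    unfolding sharp_wedge_dec_def n_def[symmetric]
  proof (rule sum.cong[OF refl])
    fix \<sigma> assume "\<sigma> \<in> ?S"
    then have \<sigma>: "\<sigma> permutes {..<n}" by simp
    then have "map dual bs ! \<sigma> i = dual (permute_list \<sigma> bs ! i)" if "i < n" for i
      using that \<open>length bs = n\<close> permutes_in_image[OF \<sigma>, of i] permute_list_nth[of \<sigma> bs i] by simp
    then have "map (\<lambda>i. sharp (Ps ! i) (map dual bs ! \<sigma> i)) [0..<n] = map (\<lambda>i. sharp (Ps ! i) (dual (permute_list \<sigma> bs ! i))) [0..<n]"
      by (intro map_cong) simp_all
    then show "of_int (sign \<sigma>) * wedge_list (map (\<lambda>i. sharp (Ps ! i) (map dual bs ! \<sigma> i)) [0..<n]) \<eta>s =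
        of_int (sign \<sigma>) * W (permute_list \<sigma> bs)"
      by (simp only: W_def)
  qed
  then have "sharp_wedge Ps h \<eta>s = 1 / fact n * (\<Sum>bs\<in>basis_lists n. h bs * (\<Sum>\<sigma>\<in>?S. of_int (sign \<sigma>) * W (permute_list \<sigma> bs)))"
    unfolding sharp_wedge_def n_def[symmetric] basis_lists_def by simp
  also have "(\<Sum>bs\<in>basis_lists n. h bs * (\<Sum>\<sigma>\<in>?S. of_int (sign \<sigma>) * W (permute_list \<sigma> bs))) =
      (\<Sum>\<sigma>\<in>?S. \<Sum>bs\<in>basis_lists n. h bs * (of_int (sign \<sigma>) * W (permute_list \<sigma> bs)))"
    unfolding sum_distrib_left by (rule sum.swap)
  also have "\<dots> = (\<Sum>\<sigma>\<in>?S. \<Sum>bs\<in>basis_lists n. h bs * W bs)"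
  proof (rule sum.cong[OF refl])
    fix \<sigma> assume "\<sigma> \<in> ?S"
    then have \<sigma>: "\<sigma> permutes {..<n}" by simp
    have inv: "inv \<sigma> permutes {..<n}" by (rule permutes_inv[OF \<sigma>])
    have pl: "permute_list \<sigma> bs \<in> basis_lists n" "permute_list (inv \<sigma>) bs \<in> basis_lists n"
      "permute_list (inv \<sigma>) (permute_list \<sigma> bs) = bs" "permute_list \<sigma> (permute_list (inv \<sigma>) bs) = bs"
      "h bs * of_int (sign \<sigma>) = h (permute_list \<sigma> bs)" if "bs \<in> basis_lists n" for bs
      using that \<sigma> inv permutes_inv_o[OF \<sigma>] alternating_permute[of bs h \<sigma>] h permute_list_compose[of _ bs, symmetric]
      unfolding basis_lists_def n_def by (auto simp: mult.commute)
    show "(\<Sum>bs\<in>basis_lists n. h bs * (of_int (sign \<sigma>) * W (permute_list \<sigma> bs))) = (\<Sum>bs\<in>basis_lists n. h bs * W bs)"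
      by (rule sum.reindex_bij_witness[of _ "permute_list (inv \<sigma>)" "permute_list \<sigma>"])
        (use pl in \<open>auto simp: mult.assoc[symmetric]\<close>)
  qed
  also have "\<dots> = fact n * (\<Sum>bs\<in>basis_lists n. h bs * W bs)"
    using card_permutations[of "{..<n}" n] by simp
  finally show ?thesis unfolding W_def n_def by simp
qed

lemma expand2:
  assumes "alternating 2 h"
  shows "(\<Sum>a\<in>Basis. \<Sum>b\<in>Basis. (u \<bullet> a) * (v \<bullet> b) * h [a, b]) = h [u, v]"
proof -
  have "h [u, v] = (\<Sum>a\<in>Basis. (u \<bullet> a) * h [a, v])"
    using euclidean_linear_sum[OF alternating2_linear(1)[OF assms], of u v] by simp
  also have "\<dots> = (\<Sum>a\<in>Basis. (u \<bullet> a) * (\<Sum>b\<in>Basis. (v \<bullet> b) * h [a, b]))"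
    using euclidean_linear_sum[OF alternating2_linear(2)[OF assms], of _ v] by simp
  finally show ?thesis by (simp add: sum_distrib_left mult.assoc)
qed

lemma expand3:
  assumes "alternating 3 h"
  shows "(\<Sum>a\<in>Basis. \<Sum>b\<in>Basis. \<Sum>c\<in>Basis. (u \<bullet> a) * (v \<bullet> b) * (w \<bullet> c) * h [a, b, c]) = h [u, v, w]"
proof -
  have "alternating 2 (\<lambda>vs. h (a # vs))" for a
    using alternating_contract[of 2 h a] assms by (simp add: numeral_3_eq_3 numeral_2_eq_2)
  note e = expand2[OF this, of v w]
  have "h [u, v, w] = (\<Sum>a\<in>Basis. (u \<bullet> a) * h [a, v, w])"
    using euclidean_linear_sum[OF alternating_linear[OF assms, of "[]" "[v, w]"], of u] by simp
  also have "\<dots> = (\<Sum>a\<in>Basis. (u \<bullet> a) * (\<Sum>b\<in>Basis. \<Sum>c\<in>Basis. (v \<bullet> b) * (w \<bullet> c) * h [a, b, c]))"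
    by (simp add: e)
  finally show ?thesis by (simp add: sum_distrib_left mult.assoc)
qed

text \<open>The basis covector sits in the first slot of P; moving it to the second produces the
  minus sign. In the evaluations below every bivector factor contributes one such sign.\<close>

lemma sharp_dual: "alternating 2 P \<Longrightarrow> sharp P (dual b) [\<eta>] = - (anchor P \<eta> \<bullet> b)"
  using alternating2_swap[of P "dual b" \<eta>] vec_sharp_apply[of P "dual b" \<eta>]
  unfolding sharp_def by (simp add: dual_apply)

lemma sharp_degree:
  "alternating 2 P \<Longrightarrow> length vs \<noteq> 1 \<Longrightarrow> sharp P \<xi> vs = 0" "alternating 1 X \<Longrightarrow> vs \<noteq> [] \<Longrightarrow> sharp X \<xi> vs = 0"
  unfolding sharp_def by (auto intro!: alternating_length)

lemma wedge_sharp2: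
  assumes P: "alternating 2 P"
  shows "wedge_list [sharp P \<xi>, sharp P \<eta>] [a, b] = sharp P \<xi> [a] * sharp P \<eta> [b] - sharp P \<xi> [b] * sharp P \<eta> [a]"
    and "length vs \<noteq> 2 \<Longrightarrow> wedge_list [sharp P \<xi>, sharp P \<eta>] vs = 0"
  by (intro wedge_list2 sharp_degree(1)[OF P]; assumption)+

lemma wedge_sharp3:
  assumes P: "alternating 2 P"
  shows "wedge_list [sharp P \<xi>, sharp P \<eta>, sharp P \<zeta>] [a, b, c] =
      sharp P \<xi> [a] * (sharp P \<eta> [b] * sharp P \<zeta> [c] - sharp P \<eta> [c] * sharp P \<zeta> [b])
      - sharp P \<xi> [b] * (sharp P \<eta> [a] * sharp P \<zeta> [c] - sharp P \<eta> [c] * sharp P \<zeta> [a])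
      + sharp P \<xi> [c] * (sharp P \<eta> [a] * sharp P \<zeta> [b] - sharp P \<eta> [b] * sharp P \<zeta> [a])"
    and "length vs \<noteq> 3 \<Longrightarrow> wedge_list [sharp P \<xi>, sharp P \<eta>, sharp P \<zeta>] vs = 0"
  by (intro wedge_list3 sharp_degree(1)[OF P]; assumption)+

text \<open>The two signs from \<open>sharp_dual\<close> cancel, and the two terms of the wedge
  product agree because h is alternating.\<close>

lemma sharp_wedge_2:
  assumes P: "alternating 2 P" and h: "alternating 2 h"
  shows "sharp_wedge [P, P] h [\<xi>, \<eta>] = 2 * h [anchor P \<xi>, anchor P \<eta>]"
    and "length \<eta>s \<noteq> 2 \<Longrightarrow> sharp_wedge [P, P] h \<eta>s = 0"
proof -
  note w = wedge_sharp2[OF P]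
  have 1: "sharp_wedge [P, P] h \<eta>s = (\<Sum>a\<in>Basis. \<Sum>b\<in>Basis. h [a, b] * wedge_list [sharp P (dual a), sharp P (dual b)] \<eta>s)" for \<eta>s
    using sharp_wedge_eq[of "[P, P]" h \<eta>s] h
    by (simp add: numeral_2_eq_2 sum_basis_lists_Suc basis_lists_0 upt_conv_Cons)
  show "sharp_wedge [P, P] h \<eta>s = 0" if "length \<eta>s \<noteq> 2" unfolding 1 w(2)[OF that] by simp
  have "sharp_wedge [P, P] h [\<xi>, \<eta>] =
      (\<Sum>a\<in>Basis. \<Sum>b\<in>Basis. (anchor P \<xi> \<bullet> a) * (anchor P \<eta> \<bullet> b) * h [a, b]) -
      (\<Sum>a\<in>Basis. \<Sum>b\<in>Basis. (anchor P \<eta> \<bullet> a) * (anchor P \<xi> \<bullet> b) * h [a, b])"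
    unfolding 1 w(1) sharp_dual[OF P] by (simp add: sum_subtractf algebra_simps)
  then show "sharp_wedge [P, P] h [\<xi>, \<eta>] = 2 * h [anchor P \<xi>, anchor P \<eta>]"
    unfolding expand2[OF h] using alternating2_swap[OF h, of "anchor P \<eta>"] by simp
qed

text \<open>The vector field contributes the number \<open>vec X \<bullet> a\<close>, a factor of
  degree 0. It contracts h in the first slot and leaves the computation for two bivectors.\<close>

lemma sharp_wedge_X:
  assumes X: "alternating 1 X" and P: "alternating 2 P" and h: "alternating 3 h"
  shows "sharp_wedge [X, P, P] h [\<xi>, \<eta>] = 2 * h [vec X, anchor P \<xi>, anchor P \<eta>]"
    and "length \<eta>s \<noteq> 2 \<Longrightarrow> sharp_wedge [X, P, P] h \<eta>s = 0"
proof -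
  note w = wedge_sharp2[OF P]
  have w0: "wedge_list [sharp X (dual a), G, K] \<eta>s = (vec X \<bullet> a) * wedge_list [G, K] \<eta>s" for a G K \<eta>s
    using wedge_degree0[where F = "sharp X (dual a)", OF sharp_degree(2)[OF X]] vec_apply[OF X, of "dual a"]
    unfolding wedge_list_def by (simp add: sharp_def dual_apply)
  have 1: "sharp_wedge [X, P, P] h \<eta>s = (\<Sum>a\<in>Basis. \<Sum>b\<in>Basis. \<Sum>c\<in>Basis. h [a, b, c] *
      ((vec X \<bullet> a) * wedge_list [sharp P (dual b), sharp P (dual c)] \<eta>s))" for \<eta>s
    using sharp_wedge_eq[of "[X, P, P]" h \<eta>s] h
    by (simp add: numeral_3_eq_3 sum_basis_lists_Suc basis_lists_0 upt_conv_Cons w0)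
  show "sharp_wedge [X, P, P] h \<eta>s = 0" if "length \<eta>s \<noteq> 2" unfolding 1 w(2)[OF that] by simp
  have "sharp_wedge [X, P, P] h [\<xi>, \<eta>] =
      (\<Sum>a\<in>Basis. \<Sum>b\<in>Basis. \<Sum>c\<in>Basis. (vec X \<bullet> a) * (anchor P \<xi> \<bullet> b) * (anchor P \<eta> \<bullet> c) * h [a, b, c]) -
      (\<Sum>a\<in>Basis. \<Sum>b\<in>Basis. \<Sum>c\<in>Basis. (vec X \<bullet> a) * (anchor P \<eta> \<bullet> b) * (anchor P \<xi> \<bullet> c) * h [a, b, c])"
    unfolding 1 w(1) sharp_dual[OF P] by (simp add: sum_subtractf algebra_simps)
  then show "sharp_wedge [X, P, P] h [\<xi>, \<eta>] = 2 * h [vec X, anchor P \<xi>, anchor P \<eta>]"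
    unfolding expand3[OF h] using alternating3_swap(2)[OF h, of "vec X" "anchor P \<eta>"] by simp
qed

text \<open>Three signs from \<open>sharp_dual\<close> give the minus, and the six terms of the
  wedge product, equal because h is alternating, give the 6.\<close>

lemma sharp_wedge_3:
  assumes P: "alternating 2 P" and h: "alternating 3 h"
  shows "sharp_wedge [P, P, P] h [\<xi>1, \<xi>2, \<xi>3] = - 6 * h [anchor P \<xi>1, anchor P \<xi>2, anchor P \<xi>3]"
    and "length \<eta>s \<noteq> 3 \<Longrightarrow> sharp_wedge [P, P, P] h \<eta>s = 0"
proof -
  note w = wedge_sharp3[OF P]
  have 1: "sharp_wedge [P, P, P] h \<eta>s = (\<Sum>a\<in>Basis. \<Sum>b\<in>Basis. \<Sum>c\<in>Basis. h [a, b, c] *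
      wedge_list [sharp P (dual a), sharp P (dual b), sharp P (dual c)] \<eta>s)" for \<eta>s
    using sharp_wedge_eq[of "[P, P, P]" h \<eta>s] h
    by (simp add: numeral_3_eq_3 sum_basis_lists_Suc basis_lists_0 upt_conv_Cons)
  show "sharp_wedge [P, P, P] h \<eta>s = 0" if "length \<eta>s \<noteq> 3" unfolding 1 w(2)[OF that] by simp
  define y1 y2 y3 where "y1 = anchor P \<xi>1" and "y2 = anchor P \<xi>2" and "y3 = anchor P \<xi>3"
  define E where "E u v w = (\<Sum>a\<in>Basis. \<Sum>b\<in>Basis. \<Sum>c\<in>Basis. (u \<bullet> a) * (v \<bullet> b) * (w \<bullet> c) * h [a, b, c])" for u v w
  have "sharp_wedge [P, P, P] h [\<xi>1, \<xi>2, \<xi>3] =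
      - (E y1 y2 y3 - E y1 y3 y2 - E y2 y1 y3 + E y2 y3 y1 + E y3 y1 y2 - E y3 y2 y1)"
    unfolding 1 w(1) sharp_dual[OF P] E_def y1_def[symmetric] y2_def[symmetric] y3_def[symmetric]
      sum_subtractf[symmetric] sum.distrib[symmetric] sum_negf[symmetric]
    by (intro sum.cong refl) (simp add: algebra_simps)
  then show "sharp_wedge [P, P, P] h [\<xi>1, \<xi>2, \<xi>3] = - 6 * h [anchor P \<xi>1, anchor P \<xi>2, anchor P \<xi>3]"
    unfolding E_def expand3[OF h] y1_def[symmetric] y2_def[symmetric] y3_def[symmetric]
    using alternating3_swap(2)[OF h, of y1 y3 y2] alternating3_swap(1)[OF h, of y2 y1 y3]
      alternating3_swap(2)[OF h, of y2 y3 y1] alternating3_swap(1)[OF h, of y3 y1 y2] alternating3_swap(2)[OF h, of y3 y2 y1]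
    by simp
qed

subsection \<open>Vanishing above the dimension\<close>

lemma multilinear_zero:
  assumes c: "coords I e l" and F: "multilinear k F"
    and 0: "\<And>is. length is = k \<Longrightarrow> set is \<subseteq> I \<Longrightarrow> F (map e is) = 0"
  shows "length us + length is = k \<Longrightarrow> set is \<subseteq> I \<Longrightarrow> F (map e is @ us) = 0"
proof (induction us arbitrary: "is")
  case Nil
  then show ?case using 0 by simp
next
  case (Cons u us)
  have "linear (\<lambda>v. F (map e is @ v # us))" using F Cons.prems unfolding multilinear_def by simp
  then have "F (map e is @ u # us) = (\<Sum>i\<in>I. l i u *\<^sub>R F (map e is @ e i # us))"
    by (rule coords_linear[OF c])
  also have "\<dots> = 0"
    using Cons.IH[of "is @ [_]"] Cons.prems by (intro sum.neutral) auto
  finally show ?case .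
qed

text \<open>A multilinear map is determined by its values on lists of basis vectors, and a list
  longer than the basis repeats an element.\<close>

lemma alternating_dim:
  fixes e :: "'i \<Rightarrow> 'v::real_normed_vector" and F :: "'v list \<Rightarrow> real"
  assumes c: "coords I e l" and F: "alternating k F" and k: "card I < k"
  shows "F = (\<lambda>vs. 0)"
proof
  fix vs :: "'v list"
  show "F vs = 0"
  proof (cases "length vs = k")
    case True
    have "F (map e is) = 0" if "length is = k" "set is \<subseteq> I" for "is"
    proof -
      have "card (set is) < length is"
        using card_mono[of I "set is"] c that k unfolding coords_def by simp
      then have "\<not> distinct (map e is)" using distinct_card[of "is"] by (auto simp: distinct_map)
      then show ?thesis using F unfolding alternating_def by blast
    qed
    then show ?thesis
      using multilinear_zero[OF c alternating_multilinear[OF F], of vs "[]"] True by simp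
  qed (rule alternating_length[OF F])
qed

lemma form_dim:
  fixes F :: "'e::euclidean_space list \<Rightarrow> real"
  shows "alternating k F \<Longrightarrow> DIM('e) < k \<Longrightarrow> F = (\<lambda>vs. 0)"
  using alternating_dim[OF coords_euclidean] by blast

lemma mvec_dim:
  fixes F :: "'e::euclidean_space covec list \<Rightarrow> real"
  shows "alternating k F \<Longrightarrow> DIM('e) < k \<Longrightarrow> F = (\<lambda>vs. 0)"
  using alternating_dim[OF coords_covec] by blast

lemma alternating_Cons_zero: "alternating k F \<Longrightarrow> F (0 # vs) = 0"
  using linear_0[OF alternating_linear[of k F "[]" vs]]
  by (cases "Suc (length vs) = k") (auto simp: alternating_length)

lemma Blinfun_zero: "Blinfun (\<lambda>v. 0) = 0"
  by (rule blinfun_eqI) (simp add: bounded_linear_Blinfun_apply)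

lemma comp_alternating: "alternating k (F p) \<Longrightarrow> comp j F p = (if j = k then F p else (\<lambda>vs. 0))"
  unfolding comp_def by (auto simp: fun_eq_iff alternating_length)

lemma sharp_wedge_zero_form: "sharp_wedge Ps (\<lambda>vs. 0) \<eta>s = 0"
  unfolding sharp_wedge_def by simp

lemma sharp_wedge_zero_mvec:
  assumes "(\<lambda>vs. 0) \<in> set Ps" shows "sharp_wedge Ps h \<eta>s = 0"
proof -
  obtain j where j: "j < length Ps" "Ps ! j = (\<lambda>vs. 0)" using assms by (metis in_set_conv_nth)
  have "wedge_list (map (\<lambda>i. sharp (Ps ! i) (\<xi>s i)) [0..<length Ps]) = (\<lambda>vs. 0)" for \<xi>s
  proof (rule wedge_list_zero)
    have "sharp (Ps ! j) (\<xi>s j) = (\<lambda>vs. 0)" unfolding j sharp_def ..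
    then show "(\<lambda>vs. 0) \<in> set (map (\<lambda>i. sharp (Ps ! i) (\<xi>s i)) [0..<length Ps])"
      using j(1) by (metis (no_types, lifting) atLeastLessThan_iff image_eqI le0 set_map set_upt)
  qed
  then show ?thesis unfolding sharp_wedge_def sharp_wedge_dec_def by simp
qed

lemma mixed_bracket_zero:
  assumes "comp (length vs - 1) (fst (vs ! i)) p = (\<lambda>ws. 0)"
  shows "mixed_bracket i vs p \<eta>s = 0"
  unfolding mixed_bracket_def Let_def assms by (simp add: sharp_wedge_zero_form)

text \<open>The sum over degree tuples collapses to the tuple d of the actual degrees, since any
  other tuple selects a zero component. If a degree exceeds the dimension, d is not in the range of
  the sum, but then that multivector is zero and both sides vanish.\<close>

lemma mixed_bracket_eq:
  fixes vs :: "('m, 'e::euclidean_space) Lelem list"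
  assumes Ps: "\<And>j. j < length d \<Longrightarrow> alternating (d ! j) (snd (remove_nth i vs ! j) p)"
    and n: "length d = length vs - 1" "length (remove_nth i vs) = length d" and d: "\<And>j. j < length d \<Longrightarrow> 1 \<le> d ! j"
  shows "mixed_bracket i vs p \<eta>s = (- 1) ^ ((length d + 1) * (\<Sum>j<i. d ! j)) *
    (- 1) ^ (\<Sum>j<length d. d ! j * (length d - Suc j)) *
    sharp_wedge (map (\<lambda>v. snd v p) (remove_nth i vs)) (comp (length d) (fst (vs ! i)) p) \<eta>s"
proof -
  define N where "N = length d"
  define Qs where "Qs = map snd (remove_nth i vs)"
  define h where "h = comp N (fst (vs ! i)) p"
  define f where "f as = (- 1) ^ ((N + 1) * (\<Sum>j<i. as ! j)) * (- 1) ^ (\<Sum>j<N. as ! j * (N - Suc j)) *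
        sharp_wedge (map (\<lambda>j. comp (as ! j) (Qs ! j) p) [0..<N]) h \<eta>s" for as
  let ?L = "{as. length as = N \<and> set as \<subseteq> {1..DIM('e)}}"
  have m: "mixed_bracket i vs p \<eta>s = (\<Sum>as\<in>?L. f as)"
    unfolding mixed_bracket_def Let_def f_def h_def Qs_def N_def n(1)[symmetric] ..
  have Qs: "Qs ! j = snd (remove_nth i vs ! j)" if "j < N" for j
    using that n unfolding Qs_def N_def by simp
  have comp: "comp a (Qs ! j) p = (if a = d ! j then (Qs ! j) p else (\<lambda>vs. 0))" if "j < N" for a j
    using comp_alternating[of "d ! j" "Qs ! j" p a] Ps[of j] that unfolding N_def Qs[unfolded N_def, OF that[unfolded N_def]] by simp
  have eq: "map (\<lambda>v. snd v p) (remove_nth i vs) = map (\<lambda>j. (Qs ! j) p) [0..<N]"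
    using n Qs unfolding N_def by (intro nth_equalityI) auto
  have 0: "f as = 0" if as: "length as = N" "as \<noteq> d" for as
  proof -
    obtain j where j: "j < N" "as ! j \<noteq> d ! j" using as nth_equalityI[of as d] unfolding N_def by metis
    have "(\<lambda>vs. 0) \<in> set (map (\<lambda>j. comp (as ! j) (Qs ! j) p) [0..<N])"
      using comp[OF j(1), of "as ! j"] j by (force simp: image_iff)
    then show ?thesis unfolding f_def by (simp add: sharp_wedge_zero_mvec)
  qed
  have fd: "f d = (- 1) ^ ((N + 1) * (\<Sum>j<i. d ! j)) * (- 1) ^ (\<Sum>j<N. d ! j * (N - Suc j)) *
      sharp_wedge (map (\<lambda>v. snd v p) (remove_nth i vs)) h \<eta>s"
  proof -
    have "map (\<lambda>j. comp (d ! j) (Qs ! j) p) [0..<N] = map (\<lambda>j. (Qs ! j) p) [0..<N]"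
      by (rule map_cong[OF refl]) (simp add: comp)
    then show ?thesis unfolding f_def eq by (simp only:)
  qed
  have fin: "finite ?L" using finite_lists_length_eq[of "{1..DIM('e)}" N] by (simp add: conj_commute)
  have "(\<Sum>as\<in>?L. f as) = f d"
  proof (cases "d \<in> ?L")
    case True
    then have "(\<Sum>as\<in>?L. f as) = (\<Sum>as\<in>{d}. f as)"
      by (intro sum.mono_neutral_right fin) (auto intro: 0)
    then show ?thesis by simp
  next
    case False
    then obtain j where j: "j < N" "d ! j \<notin> {1..DIM('e)}" unfolding N_def by (auto simp: subset_iff in_set_conv_nth)
    then have "(Qs ! j) p = (\<lambda>vs. 0)"
      using mvec_dim[of "d ! j" "(Qs ! j) p"] Ps[of j] d[of j] Qs unfolding N_def by auto
    then have "(\<lambda>vs. 0) \<in> set (map (\<lambda>v. snd v p) (remove_nth i vs))"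
      unfolding eq using j(1) by (force simp: image_iff)
    then have "f d = 0" unfolding fd by (simp add: sharp_wedge_zero_mvec)
    moreover have "(\<Sum>as\<in>?L. f as) = 0" using False by (intro sum.neutral ballI 0) auto
    ultimately show ?thesis by simp
  qed
  then show ?thesis unfolding m fd N_def h_def .
qed

section \<open>Schouten brackets with a vector field and of a bivector field with itself\<close>

context smooth_manifold
begin

lemma bounded_linear_D: "smooth_on S f \<Longrightarrow> x \<in> S \<Longrightarrow> bounded_linear (D f x)"
  using smooth_on_has_derivative has_derivative_bounded_linear by blast

text \<open>X takes a single argument, so only the unshuffle that feeds all covectors to P survives;
  what remains is the derivative of P along X.\<close>

lemma insertion_vec:
  assumes X: "X \<in> mvecs A 1" and P: "P \<in> mvecs A k"
  shows "insertion A X P q \<xi>s = D (\<lambda>y. mvec_in A (chart_at A q) P y \<xi>s) (coord A q q) (vec (X q))"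
proof -
  let ?n = "length \<xi>s"
  define f where "f I = unshuffle_sign ?n I * X q (Blinfun (D (\<lambda>y. mvec_in A (chart_at A q) P y (nths \<xi>s I)) (coord A q q)) # nths \<xi>s (- I))" for I
  have "(\<Sum>I\<in>Pow {..<?n}. f I) = (\<Sum>I\<in>{{..<?n}}. f I)"
  proof (rule sum.mono_neutral_right)
    show "\<forall>I\<in>Pow {..<?n} - {{..<?n}}. f I = 0"
    proof
      fix I assume "I \<in> Pow {..<?n} - {{..<?n}}"
      then have "card ({..<?n} - I) \<noteq> 0" by auto
      then show "f I = 0" unfolding f_def
        by (simp add: alternating_length[OF mvecs_alternating[OF X]] length_nths_compl)
    qed
  qed auto
  moreover have "f {..<?n} = X q [Blinfun (D (\<lambda>y. mvec_in A (chart_at A q) P y \<xi>s) (coord A q q))]"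
  proof -
    have "nths \<xi>s {..<?n} = \<xi>s" by (rule nths_all) simp
    moreover have "nths \<xi>s (- {..<?n}) = []" unfolding nths_compl by simp
    moreover have "unshuffle_sign ?n {..<?n} = 1" unfolding unshuffle_sign_def by simp
    ultimately show ?thesis unfolding f_def by simp
  qed
  moreover have "X q [Blinfun (D (\<lambda>y. mvec_in A (chart_at A q) P y \<xi>s) (coord A q q))] =
      D (\<lambda>y. mvec_in A (chart_at A q) P y \<xi>s) (coord A q q) (vec (X q))"
    using vec_apply[OF mvecs_alternating[OF X], of _ q]
    by (simp add: vec_apply[OF mvecs_alternating[OF X], symmetric] bounded_linear_Blinfun_apply
        bounded_linear_D[OF mvecs_chart[OF P chart_at_in] coord_in])
  ultimately show ?thesis unfolding insertion_def f_def by simp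
qed

lemma smooth_on_vec_mvec_in:
  "X \<in> mvecs A k \<Longrightarrow> c \<in> A \<Longrightarrow> smooth_on (cimage c) (\<lambda>y. vec (mvec_in A c X y))"
  unfolding vec_def by (intro smooth_on_sum smooth_on_scaleR smooth_on_const open_cimage mvecs_chart)

lemma Blinfun_D_vec:
  assumes X: "X \<in> mvecs A 1"
  shows "Blinfun (D (\<lambda>y. mvec_in A (chart_at A q) X y [\<xi>]) (coord A q q)) =
    covec_map (D (\<lambda>y. vec (mvec_in A (chart_at A q) X y)) (coord A q q)) \<xi>"
proof (rule blinfun_eqI)
  fix v
  let ?c = "chart_at A q"
  note V = smooth_on_vec_mvec_in[OF X chart_at_in[of q]]
  have 1: "blinfun_apply \<xi> (vec (mvec_in A ?c X y)) = mvec_in A ?c X y [\<xi>]" for y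
    by (rule vec_apply[OF alternating_mvec_in[where P = X, OF mvecs_alternating[OF X]]])
  have "((\<lambda>y. blinfun_apply \<xi> (vec (mvec_in A ?c X y))) has_derivative
      (\<lambda>v. blinfun_apply \<xi> (D (\<lambda>y. vec (mvec_in A ?c X y)) (coord A q q) v))) (at (coord A q q))"
    by (rule bounded_linear.has_derivative[OF blinfun.bounded_linear_right smooth_on_has_derivative[OF V coord_in]])
  then show "blinfun_apply (Blinfun (D (\<lambda>y. mvec_in A ?c X y [\<xi>]) (coord A q q))) v =
      blinfun_apply (covec_map (D (\<lambda>y. vec (mvec_in A ?c X y)) (coord A q q)) \<xi>) v"
    unfolding 1 using smooth_on_linear_D[OF V coord_in]
    by (simp add: D_eqI bounded_linear_Blinfun_apply has_derivative_bounded_linear covec_map_apply)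
qed

text \<open>The exponent (1 + 1)(2 + 1) is even, so [X, P] is the derivative of P along X minus the
  insertion of X into P. In the latter the transposed differential of X appears, by
  \<open>Blinfun_D_vec\<close>.\<close>

lemma schouten_vec:
  assumes X: "X \<in> mvecs A 1" and P: "P \<in> mvecs A 2"
  shows "schouten A 1 2 X P q [\<xi>, \<eta>] = lie_mvec X P q \<xi> \<eta>"
    and "length \<xi>s \<noteq> 2 \<Longrightarrow> schouten A 1 2 X P q \<xi>s = 0"
proof -
  note Pq = mvecs_alternating[OF P, of q]
  have D0: "D (\<lambda>y. mvec_in A c Q y \<xi>s) x = (\<lambda>v. 0)" if "Q \<in> mvecs A k" "length \<xi>s \<noteq> k" for c x \<xi>s Q k
  proof -
    have "mvec_in A c Q y \<xi>s = 0" for y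
      by (rule alternating_length[OF alternating_mvec_in[where P = Q, OF mvecs_alternating[OF that(1)]] that(2)])
    then show ?thesis by simp
  qed
  have 1: "insertion A P X q \<xi>s = (\<Sum>i<length \<xi>s. (- 1) ^ i *
      P q (covec_map (D (\<lambda>y. vec (mvec_in A (chart_at A q) X y)) (coord A q q)) (\<xi>s ! i) # remove_nth i \<xi>s))" for \<xi>s
    unfolding insertion_def
    by (subst sum_Pow_singletons)
      (auto simp: D0[OF X] length_nths_subset Blinfun_zero alternating_Cons_zero[OF Pq]
        unshuffle_sign_single nths_single nths_remove Blinfun_D_vec[OF X])
  show "schouten A 1 2 X P q [\<xi>, \<eta>] = lie_mvec X P q \<xi> \<eta>"
    unfolding schouten_def insertion_vec[OF X P] 1 lie_mvec_def Let_def
    using alternating2_swap[OF Pq, of \<xi>] by (simp add: lessThan_Suc)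
  show "schouten A 1 2 X P q \<xi>s = 0" if "length \<xi>s \<noteq> 2"
  proof -
    have "P q (\<zeta> # remove_nth i \<xi>s) = 0" if "i < length \<xi>s" for \<zeta> i
      using \<open>length \<xi>s \<noteq> 2\<close> that by (intro alternating_length[OF Pq]) (auto simp: remove_nth_def)
    then show ?thesis
      unfolding schouten_def insertion_vec[OF X P] 1 D0[OF P that] by simp
  qed
qed

text \<open>The exponent (2 + 1)(2 + 1) is odd, so [P, P] is -2 times the insertion of P into
  itself. Each term of the insertion carries another minus sign, because the differential enters P
  in the first slot.\<close>

lemma schouten_self:
  assumes P: "P \<in> mvecs A 2"
  shows "schouten A 2 2 P P q [\<xi>1, \<xi>2, \<xi>3] = 2 * jacobiator (mvec_in A (chart_at A q) P) (coord A q q) \<xi>1 \<xi>2 \<xi>3"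
    and "length \<xi>s \<noteq> 3 \<Longrightarrow> schouten A 2 2 P P q \<xi>s = 0"
proof -
  let ?c = "chart_at A q" and ?y = "coord A q q"
  note Pq = mvecs_alternating[OF P, of q]
  have P0: "mvec_in A ?c P y \<xi>s = 0" if "length \<xi>s \<noteq> 2" for y \<xi>s
    by (rule alternating_length[OF alternating_mvec_in[where P = P, OF mvecs_alternating[OF P]] that])
  have b: "P q [Blinfun (D (\<lambda>y. mvec_in A ?c P y \<xi>s) ?y), \<xi>] = - D (\<lambda>y. mvec_in A ?c P y \<xi>s) ?y (anchor (P q) \<xi>)" for \<xi>s \<xi>
    using alternating2_swap[OF Pq, of _ \<xi>] vec_sharp_apply[OF Pq, symmetric]
    by (simp add: bounded_linear_Blinfun_apply bounded_linear_D[OF mvecs_chart[OF P chart_at_in] coord_in])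
  have 1: "insertion A P P q \<xi>s = (\<Sum>i<length \<xi>s. (- 1) ^ (length \<xi>s - Suc i) *
      - D (\<lambda>y. mvec_in A ?c P y (remove_nth i \<xi>s)) ?y (anchor (P q) (\<xi>s ! i)))" for \<xi>s
  proof -
    have "insertion A P P q \<xi>s = (\<Sum>i<length \<xi>s. unshuffle_sign (length \<xi>s) ({..<length \<xi>s} - {i}) *
        P q (Blinfun (D (\<lambda>y. mvec_in A ?c P y (nths \<xi>s ({..<length \<xi>s} - {i}))) ?y) # nths \<xi>s (- ({..<length \<xi>s} - {i}))))"
      unfolding insertion_def
      by (rule sum_Pow_cosingletons) (simp add: alternating_length[OF Pq] length_nths_compl)
    also have "\<dots> = (\<Sum>i<length \<xi>s. (- 1) ^ (length \<xi>s - Suc i) *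
      - D (\<lambda>y. mvec_in A ?c P y (remove_nth i \<xi>s)) ?y (anchor (P q) (\<xi>s ! i)))"
    proof (rule sum.cong[OF refl])
      fix i assume "i \<in> {..<length \<xi>s}"
      then have i: "i < length \<xi>s" by simp
      have "nths \<xi>s ({..<length \<xi>s} - {i}) = remove_nth i \<xi>s"
        using nths_compl[of \<xi>s "{i}"] nths_remove[OF i] by simp
      moreover have "nths \<xi>s (- ({..<length \<xi>s} - {i})) = [\<xi>s ! i]"
        using nths_compl[of \<xi>s "{..<length \<xi>s} - {i}"] nths_single[OF i] i by (simp add: double_diff)
      ultimately show "unshuffle_sign (length \<xi>s) ({..<length \<xi>s} - {i}) *
        P q (Blinfun (D (\<lambda>y. mvec_in A ?c P y (nths \<xi>s ({..<length \<xi>s} - {i}))) ?y) # nths \<xi>s (- ({..<length \<xi>s} - {i}))) =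
        (- 1) ^ (length \<xi>s - Suc i) * - D (\<lambda>y. mvec_in A ?c P y (remove_nth i \<xi>s)) ?y (anchor (P q) (\<xi>s ! i))"
        using unshuffle_sign_cosingle[OF i] by (simp add: b)
    qed
    finally show ?thesis .
  qed
  have sw: "D (\<lambda>y. mvec_in A ?c P y [\<xi>1, \<xi>3]) ?y v = - D (\<lambda>y. mvec_in A ?c P y [\<xi>3, \<xi>1]) ?y v" for v
  proof -
    have "(\<lambda>y. mvec_in A ?c P y [\<xi>1, \<xi>3]) = (\<lambda>y. - mvec_in A ?c P y [\<xi>3, \<xi>1])"
      by (rule ext) (rule alternating2_swap[OF alternating_mvec_in[where P = P, OF mvecs_alternating[OF P]]])
    then show ?thesis
      using D_eqI[OF has_derivative_minus[OF smooth_on_has_derivative[OF mvecs_chart[OF P chart_at_in[of q], of "[\<xi>3, \<xi>1]"] coord_in]]]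
      by simp
  qed
  have Py: "mvec_in A ?c P ?y = P q" by (rule ext) (rule mvec_in_at)
  show "schouten A 2 2 P P q [\<xi>1, \<xi>2, \<xi>3] = 2 * jacobiator (mvec_in A ?c P) ?y \<xi>1 \<xi>2 \<xi>3"
    unfolding schouten_def 1 jacobiator_def Py by (simp add: lessThan_Suc sw)
  show "schouten A 2 2 P P q \<xi>s = 0" if "length \<xi>s \<noteq> 3"
  proof -
    have "D (\<lambda>y. mvec_in A ?c P y (remove_nth i \<xi>s)) ?y v = 0" if "i < length \<xi>s" for i v
    proof -
      have "length (remove_nth i \<xi>s) \<noteq> 2" using that \<open>length \<xi>s \<noteq> 3\<close> unfolding remove_nth_def by auto
      then show ?thesis using P0 by simp
    qed
    then show ?thesis unfolding schouten_def 1 by simp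
  qed
qed

text \<open>[P, P] is twice the Jacobiator and a third of the triple sharp map is -2 H on the
  anchors, hence the factor -1. Lists of length other than 3 give zero on both sides.\<close>

lemma twisted_poisson_iff:
  assumes H: "\<And>p. alternating 3 (H p)" and P: "P \<in> mvecs A 2"
  shows "twisted_poisson A H P \<longleftrightarrow> (\<forall>p \<xi>1 \<xi>2 \<xi>3.
    jacobiator (mvec_in A (chart_at A p) P) (coord A p p) \<xi>1 \<xi>2 \<xi>3 = - H p [anchor (P p) \<xi>1, anchor (P p) \<xi>2, anchor (P p) \<xi>3])"
    (is "_ \<longleftrightarrow> ?R")
proof
  note sw = sharp_wedge_3[OF mvecs_alternating[OF P] H]
  assume t: "twisted_poisson A H P"
  show ?R
  proof (intro allI)
    fix p \<xi>1 \<xi>2 \<xi>3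
    have "schouten A 2 2 P P p [\<xi>1, \<xi>2, \<xi>3] = 1 / 3 * sharp_wedge [P p, P p, P p] (H p) [\<xi>1, \<xi>2, \<xi>3]"
      using t unfolding twisted_poisson_def by blast
    then show "jacobiator (mvec_in A (chart_at A p) P) (coord A p p) \<xi>1 \<xi>2 \<xi>3 = - H p [anchor (P p) \<xi>1, anchor (P p) \<xi>2, anchor (P p) \<xi>3]"
      unfolding schouten_self(1)[OF P] sw(1) by simp
  qed
next
  note sw = sharp_wedge_3[OF mvecs_alternating[OF P] H]
  assume R: ?R
  show "twisted_poisson A H P"
    unfolding twisted_poisson_def
  proof (intro allI)
    fix p \<eta>s
    show "schouten A 2 2 P P p \<eta>s = 1 / 3 * sharp_wedge [P p, P p, P p] (H p) \<eta>s"
    proof (cases "length \<eta>s = 3")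
      case True
      then obtain \<xi>1 \<xi>2 \<xi>3 where \<eta>s: "\<eta>s = [\<xi>1, \<xi>2, \<xi>3]" by (auto simp: numeral_3_eq_3 length_Suc_conv)
      show ?thesis unfolding \<eta>s schouten_self(1)[OF P] sw(1) using R by simp
    next
      case False
      then show ?thesis using schouten_self(2)[OF P] sw(2) by simp
    qed
  qed
qed

section \<open>The vector field of the distribution in explicit form\<close>

lemma schouten_zero:
  "schouten A a b (\<lambda>p \<xi>s. 0) Q q \<xi>s = 0" if "alternating k (Q q)" for Q
  using that unfolding schouten_def insertion_def mvec_in_def
  by (simp add: Blinfun_zero alternating_Cons_zero)

lemma schouten_zero':
  "schouten A a b Q (\<lambda>p \<xi>s. 0) q \<xi>s = 0" if "alternating k (Q q)" for Q
  using that unfolding schouten_def insertion_def mvec_in_def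
  by (simp add: Blinfun_zero alternating_Cons_zero)

lemma alternating_zero: "alternating k (\<lambda>vs. 0)"
  unfolding alternating_def by (simp add: module_hom_zero)

lemma gauge_field_form:
  "fst (gauge_field A (B, X) (H, P)) p vs = - de_rham A B p vs"
proof -
  have "fst (gauge_field A (B, X) (H, P)) p vs = (\<Sum>k\<in>{0}. 1 / fact k * fst (multibracket A ((B, X) # replicate k (H, P))) p vs)"
    unfolding gauge_field_def fst_conv
    by (rule sum.mono_neutral_right) (auto simp: multibracket_def)
  then show ?thesis by (simp add: multibracket_def)
qed

text \<open>By degrees only three brackets survive: {X, P}, {B, P, P}, and the brackets of X, P, P
  with H taken from one of the copies of m.\<close>

lemma gauge_field_mvec:
  assumes B: "B \<in> forms A 2" and X: "X \<in> mvecs A 1" and H: "H \<in> forms A 3" and P: "P \<in> mvecs A 2"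
  shows "snd (gauge_field A (B, X) (H, P)) p \<eta>s = schouten A 1 2 X P p \<eta>s
    + 1 / 2 * sharp_wedge [P p, P p] (B p) \<eta>s + 1 / 2 * sharp_wedge [X p, P p, P p] (H p) \<eta>s"
proof -
  define T where "T k = snd (multibracket A ((B, X) # replicate k (H, P))) p \<eta>s" for k
  note Bp = forms_alternating[OF B] and Hp = forms_alternating[OF H]
    and Xp = mvecs_alternating[OF X] and Pp = mvecs_alternating[OF P]
  have cB: "comp k B p = (if k = 2 then B p else (\<lambda>vs. 0))" for k by (rule comp_alternating[where F = B, OF Bp])
  have cH: "comp k H p = (if k = 3 then H p else (\<lambda>vs. 0))" for k by (rule comp_alternating[where F = H, OF Hp])
  have mixed0: "(\<Sum>i<Suc k. mixed_bracket i ((B, X) # replicate k (H, P)) p \<eta>s) = 0" if "k \<noteq> 2" "k \<noteq> 3" for k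
  proof (rule sum.neutral, rule ballI)
    fix i assume "i \<in> {..<Suc k}"
    then show "mixed_bracket i ((B, X) # replicate k (H, P)) p \<eta>s = 0"
      using that by (intro mixed_bracket_zero) (auto simp: nth_Cons cB cH split: nat.split)
  qed
  have T: "T k = (if k = 1 then \<Sum>a\<le>DIM('e). \<Sum>b\<le>DIM('e). (- 1) ^ (a + 1) * schouten A a b (comp a X) (comp b P) p \<eta>s else 0)
      + (if k \<ge> 1 then \<Sum>i<Suc k. mixed_bracket i ((B, X) # replicate k (H, P)) p \<eta>s else 0)" for k
    unfolding T_def multibracket_def by (auto simp: numeral_2_eq_2)
  have T0: "T k = 0" if "k \<notin> {1, 2, 3}" for k
    using that mixed0[of k] unfolding T by simp
  have T1: "T 1 = schouten A 1 2 X P p \<eta>s"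
  proof -
    have cX: "comp a X = (if a = 1 then X else (\<lambda>p vs. 0))" for a
      using comp_alternating[where F = X, OF Xp] by (auto simp: fun_eq_iff)
    have cP: "comp b P = (if b = 2 then P else (\<lambda>p vs. 0))" for b
      using comp_alternating[where F = P, OF Pp] by (auto simp: fun_eq_iff)
    define S where "S a b = (- 1) ^ (a + 1) * schouten A a b (comp a X) (comp b P) p \<eta>s" for a b
    have S0: "S a b = 0" if "(a, b) \<noteq> (1, 2)" for a b
      using that schouten_zero[where Q = P, OF Pp] schouten_zero'[where Q = X, OF Xp]
        schouten_zero[where Q = "\<lambda>p vs. 0", OF alternating_zero]
      unfolding S_def cX cP by auto
    have S12: "S 1 2 = schouten A 1 2 X P p \<eta>s" unfolding S_def cX cP by simp
    have "T 1 = (\<Sum>a\<le>DIM('e). \<Sum>b\<le>DIM('e). S a b)"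
      unfolding T S_def using mixed0[of 1] by simp
    also have "\<dots> = (\<Sum>b\<le>DIM('e). S 1 b)"
      using S0 by (subst sum.mono_neutral_right[of "{..DIM('e)}" "{1}"]) (auto simp: Suc_le_eq)
    also have "\<dots> = S 1 2"
    \<comment> \<open>In dimension 1 the sum over b does not reach degree 2, but then P
      vanishes.\<close>
    proof (cases "2 \<le> DIM('e)")
      case True
      then show ?thesis using S0 by (subst sum.mono_neutral_right[of "{..DIM('e)}" "{2}"]) auto
    next
      case False
      then have "P = (\<lambda>p vs. 0)" using mvec_dim[OF Pp] by (auto simp: fun_eq_iff)
      then have "S 1 2 = 0" unfolding S12 using schouten_zero'[where Q = X, OF Xp] by simp
      moreover have "(\<Sum>b\<le>DIM('e). S 1 b) = 0" using False S0 by (intro sum.neutral ballI) auto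
      ultimately show ?thesis by simp
    qed
    finally show ?thesis using S12 by simp
  qed
  have T2: "T 2 = sharp_wedge [P p, P p] (B p) \<eta>s"
  proof -
    have r: "replicate 2 (H, P) = [(H, P), (H, P)]" by (simp add: numeral_2_eq_2)
    have "mixed_bracket i [(B, X), (H, P), (H, P)] p \<eta>s = 0" if "i = 1 \<or> i = 2" for i
      using that by (intro mixed_bracket_zero) (auto simp: cH)
    moreover have "mixed_bracket 0 [(B, X), (H, P), (H, P)] p \<eta>s = sharp_wedge [P p, P p] (B p) \<eta>s"
      using Pp by (subst mixed_bracket_eq[where d = "[2, 2]"]) (auto simp: less_Suc_eq cB[unfolded numeral_2_eq_2] numeral_2_eq_2)
    ultimately show ?thesis unfolding T r by (simp add: lessThan_Suc numeral_3_eq_3 numeral_2_eq_2)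
  qed
  \<comment> \<open>H may come from any of the three copies of m, and the sign exponents are even in
    all three positions; with the coefficient 1 / 3! the factor 3 becomes 1 / 2.\<close>
  have T3: "T 3 = 3 * sharp_wedge [X p, P p, P p] (H p) \<eta>s"
  proof -
    let ?v = "[(B, X), (H, P), (H, P), (H, P)]"
    have r: "replicate 3 (H, P) = [(H, P), (H, P), (H, P)]" by (simp add: numeral_3_eq_3)
    have "mixed_bracket 0 ?v p \<eta>s = 0"
      by (intro mixed_bracket_zero) (auto simp: cB)
    moreover have "mixed_bracket i ?v p \<eta>s = sharp_wedge [X p, P p, P p] (H p) \<eta>s" if i: "i = 1 \<or> i = 2 \<or> i = 3" for i
    proof -
      have rem: "remove_nth i ?v = [(B, X), (H, P), (H, P)]" and hi: "fst (?v ! i) = H"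
        using i by (auto simp: remove_nth_def numeral_2_eq_2 numeral_3_eq_3)
      have "mixed_bracket i ?v p \<eta>s = (- 1) ^ ((length [1, 2, 2::nat] + 1) * (\<Sum>j<i. [1, 2, 2] ! j)) *
        (- 1) ^ (\<Sum>j<length [1, 2, 2::nat]. [1, 2, 2] ! j * (length [1, 2, 2::nat] - Suc j)) *
        sharp_wedge (map (\<lambda>v. snd v p) (remove_nth i ?v)) (comp (length [1, 2, 2::nat]) (fst (?v ! i)) p) \<eta>s"
        by (rule mixed_bracket_eq) (use Pp Xp in \<open>auto simp: rem less_Suc_eq\<close>)
      also have "\<dots> = sharp_wedge [X p, P p, P p] (H p) \<eta>s"
        unfolding rem hi by (simp add: cH lessThan_Suc power_mult)
      finally show ?thesis .
    qed
    moreover have "(\<Sum>i<Suc 3. f i) = f 0 + f 1 + f 2 + f 3" for f :: "nat \<Rightarrow> real"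
      by (simp add: eval_nat_numeral)
    ultimately show ?thesis unfolding T r by simp
  qed
  \<comment> \<open>The sum in \<open>gauge_field\<close> stops at the dimension, which may be less
    than 3. The terms cut off vanish along with B or H, so the sum can be taken over 1, 2, 3 in
    every dimension.\<close>
  have dim: "T k = 0" if "DIM('e) < k" for k
  proof -
    have k1: "k \<noteq> 1" using that DIM_positive[where 'a = 'e] by linarith
    consider "k = 2" | "k = 3" | "k \<notin> {1, 2, 3}" using k1 by auto
    then show ?thesis
    proof cases
      case 1
      then have "B p = (\<lambda>vs. 0)" using form_dim[OF Bp] that by simp
      then show ?thesis unfolding 1 T2 by (simp add: sharp_wedge_zero_form)
    next
      case 2
      then have "H p = (\<lambda>vs. 0)" using form_dim[OF Hp] that by simp
      then show ?thesis unfolding 2 T3 by (simp add: sharp_wedge_zero_form)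
    qed (rule T0)
  qed
  have "snd (gauge_field A (B, X) (H, P)) p \<eta>s = (\<Sum>k\<le>DIM('e). 1 / fact k * T k)"
    unfolding gauge_field_def T_def by simp
  also have "\<dots> = (\<Sum>k\<in>{..DIM('e)} \<union> {1, 2, 3}. 1 / fact k * T k)"
    by (rule sum.mono_neutral_left) (use dim in \<open>auto simp: not_le\<close>)
  also have "\<dots> = (\<Sum>k\<in>{1, 2, 3}. 1 / fact k * T k)"
    by (rule sum.mono_neutral_right) (use T0 in auto)
  also have "\<dots> = T 1 + T 2 / 2 + T 3 / 6" by (simp add: fact_numeral)
  finally show ?thesis unfolding T1 T2 T3 by simp
qed

text \<open>The factors 1 / 2 cancel against those of \<open>sharp_wedge_2\<close> and
  \<open>sharp_wedge_X\<close>. The last two terms are \<beta> on the anchors, for \<beta> = B +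
  \<iota>_X H.\<close>

lemma gauge_field_mvec_eq:
  assumes "B \<in> forms A 2" "X \<in> mvecs A 1" "H \<in> forms A 3" "P \<in> mvecs A 2"
  shows "snd (gauge_field A (B, X) (H, P)) p [\<xi>, \<eta>] = lie_mvec X P p \<xi> \<eta>
      + B p [anchor (P p) \<xi>, anchor (P p) \<eta>] + H p [vec (X p), anchor (P p) \<xi>, anchor (P p) \<eta>]"
    and "length \<eta>s \<noteq> 2 \<Longrightarrow> snd (gauge_field A (B, X) (H, P)) p \<eta>s = 0"
  using sharp_wedge_2[OF mvecs_alternating[OF assms(4), of p] forms_alternating[OF assms(1), of p]]
    sharp_wedge_X[OF mvecs_alternating[OF assms(2), of p] mvecs_alternating[OF assms(4), of p] forms_alternating[OF assms(3), of p]]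
  unfolding gauge_field_mvec[OF assms] schouten_vec(1)[OF assms(2,4)]
  using schouten_vec(2)[OF assms(2,4), of \<eta>s p] by simp_all

end

section \<open>Gauge transformations\<close>

definition gauge_map :: "('e::euclidean_space list \<Rightarrow> real) \<Rightarrow> ('e covec list \<Rightarrow> real) \<Rightarrow> 'e covec \<Rightarrow> 'e covec" where
  "gauge_map b P \<xi> = \<xi> + flat b (anchor P \<xi>)"

text \<open>The explicit e^b P: its sharp map is that of P after the inverse of 1 + b^flat P^sharp.
  It stands in for the definite description in \<open>gauge_transform\<close>; \<open>act_eq\<close>
  makes the link.\<close>

definition gauge_bivector :: "('m, 'e::euclidean_space) form_field \<Rightarrow> ('m, 'e) mvec_field \<Rightarrow> ('m, 'e) mvec_field" where
  "gauge_bivector b P p \<xi>s = (if length \<xi>s = 2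
     then P p (inv (gauge_map (b p) (P p)) (\<xi>s ! 0) # tl \<xi>s) else 0)"

lemma gauge_bivector_apply: "gauge_bivector b P p [\<xi>, \<eta>] = P p [inv (gauge_map (b p) (P p)) \<xi>, \<eta>]"
  unfolding gauge_bivector_def by simp

lemma gauge_invertible_iff: "gauge_invertible b P \<longleftrightarrow> (\<forall>p. bij (gauge_map (b p) (P p)))"
  unfolding gauge_invertible_def gauge_map_def[abs_def] ..

lemma gauge_map_apply: "alternating 2 b \<Longrightarrow> gauge_map b P \<xi> v = \<xi> v + b [anchor P \<xi>, v]"
  unfolding gauge_map_def by (simp add: blinfun.bilinear_simps flat_apply)

lemma linear_gauge_map:
  assumes "alternating 2 b" "alternating 2 P" shows "linear (gauge_map b P)"
proof (rule linearI)
  note lin = linear_add[OF alternating2_linear(1)[OF assms(1)]] linear_scale[OF alternating2_linear(1)[OF assms(1)]]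
    linear_add[OF linear_anchor[OF assms(2)]] linear_scale[OF linear_anchor[OF assms(2)]]
  show "gauge_map b P (\<xi> + \<eta>) = gauge_map b P \<xi> + gauge_map b P \<eta>" for \<xi> \<eta>
    by (rule blinfun_eqI) (simp add: gauge_map_apply[OF assms(1)] blinfun.bilinear_simps lin)
  show "gauge_map b P (r *\<^sub>R \<xi>) = r *\<^sub>R gauge_map b P \<xi>" for r \<xi>
    by (rule blinfun_eqI) (simp add: gauge_map_apply[OF assms(1)] blinfun.bilinear_simps lin algebra_simps)
qed

lemma alternating2_eqI:
  assumes "alternating 2 P" "alternating 2 Q" "\<And>\<xi> \<eta>. P [\<xi>, \<eta>] = Q [\<xi>, \<eta>]" shows "P = Q"
proof
  fix vs
  show "P vs = Q vs"
  proof (cases "length vs = 2")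
    case True
    then obtain \<xi> \<eta> where "vs = [\<xi>, \<eta>]" by (auto simp: numeral_2_eq_2 length_Suc_conv)
    then show ?thesis using assms(3) by simp
  qed (simp add: alternating_length[OF assms(1)] alternating_length[OF assms(2)])
qed

lemma anchor_eq_iff:
  "alternating 2 P \<Longrightarrow> alternating 2 Q \<Longrightarrow> anchor P \<xi> = anchor Q \<zeta> \<longleftrightarrow> (\<forall>\<eta>. P [\<xi>, \<eta>] = Q [\<zeta>, \<eta>])"
  using covec_eq_iff[of "anchor P \<xi>" "anchor Q \<zeta>"] by (simp add: vec_sharp_apply)

text \<open>The transformed graph consists of the pairs of \<open>anchor P \<xi>\<close> and
  \<open>gauge_map b P \<xi>\<close>. By surjectivity the second entries exhaust the covectors, so
  nothing of the graph of Q is missed.\<close>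

lemma graph_gauge_iff:
  assumes "surj (gauge_map b P)"
  shows "graph Q = exp_form b ` graph P \<longleftrightarrow> (\<forall>\<xi>. anchor Q (gauge_map b P \<xi>) = anchor P \<xi>)"
proof -
  have im: "exp_form b ` graph P = {(anchor P \<xi>, gauge_map b P \<xi>) |\<xi>. True}"
    unfolding graph_def exp_form_def gauge_map_def by (auto simp: image_iff)
  show ?thesis
  proof
    assume *: "graph Q = exp_form b ` graph P"
    have "(anchor P \<xi>, gauge_map b P \<xi>) \<in> graph Q" for \<xi> unfolding * im by blast
    then show "\<forall>\<xi>. anchor Q (gauge_map b P \<xi>) = anchor P \<xi>" unfolding graph_def by auto
  next
    assume *: "\<forall>\<xi>. anchor Q (gauge_map b P \<xi>) = anchor P \<xi>"
    show "graph Q = exp_form b ` graph P"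
      unfolding im
    proof (intro equalityI subsetI)
      fix z assume "z \<in> graph Q"
      then obtain \<eta> where "z = (anchor Q \<eta>, \<eta>)" unfolding graph_def by blast
      moreover obtain \<xi> where "\<eta> = gauge_map b P \<xi>" using assms by (meson surjD)
      ultimately show "z \<in> {(anchor P \<xi>, gauge_map b P \<xi>) |\<xi>. True}" using * by auto
    next
      fix z assume "z \<in> {(anchor P \<xi>, gauge_map b P \<xi>) |\<xi>. True}"
      then obtain \<xi> where "z = (anchor P \<xi>, gauge_map b P \<xi>)" by blast
      then have "z = (anchor Q (gauge_map b P \<xi>), gauge_map b P \<xi>)" using * by simp
      then show "z \<in> graph Q" unfolding graph_def by blast
    qed
  qed
qed

lemma gauge_unique:
  assumes "surj (gauge_map b P)" "alternating 2 Q" "alternating 2 Q'"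
    and "\<And>\<xi>. anchor Q (gauge_map b P \<xi>) = anchor P \<xi>" "\<And>\<xi>. anchor Q' (gauge_map b P \<xi>) = anchor P \<xi>"
  shows "Q = Q'"
proof (rule alternating2_eqI[OF assms(2,3)])
  fix \<xi> \<eta>
  obtain \<zeta> where "\<xi> = gauge_map b P \<zeta>" using assms(1) by (meson surjD)
  then have "anchor Q \<xi> = anchor Q' \<xi>" using assms(4,5) by simp
  then show "Q [\<xi>, \<eta>] = Q' [\<xi>, \<eta>]" using anchor_eq_iff[OF assms(2,3)] by blast
qed

text \<open>The point is skew-symmetry: with \<xi> = G \<zeta> the value on (\<xi>, \<xi>) is P on
  (\<zeta>, \<zeta>) plus b on the anchor of \<zeta> taken twice, and both vanish.\<close>

lemma alternating_gauge_bivector: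
  assumes b: "alternating 2 (b p)" and P: "alternating 2 (P p)" and bij: "bij (gauge_map (b p) (P p))"
  shows "alternating 2 (gauge_bivector b P p)"
proof (rule alternating2I)
  let ?G = "gauge_map (b p) (P p)"
  have inv: "inv ?G (?G \<xi>) = \<xi>" "?G (inv ?G \<xi>) = \<xi>" for \<xi>
    using bij by (simp_all add: bij_is_inj bij_is_surj surj_f_inv_f)
  have lin: "linear (inv ?G)" by (rule linear_of_inverse[OF linear_gauge_map[OF b P] inv])
  show "gauge_bivector b P p vs = 0" if "length vs \<noteq> 2" for vs using that unfolding gauge_bivector_def by simp
  show "linear (\<lambda>v. gauge_bivector b P p [v, \<eta>])" for \<eta>
    unfolding gauge_bivector_apply using linear_compose[OF lin alternating2_linear(1)[OF P]] by (simp add: o_def)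
  show "linear (\<lambda>v. gauge_bivector b P p [\<xi>, v])" for \<xi>
    unfolding gauge_bivector_apply by (rule alternating2_linear(2)[OF P])
  show "gauge_bivector b P p [\<xi>, \<xi>] = 0" for \<xi>
  proof -
    define \<zeta> where "\<zeta> = inv ?G \<xi>"
    have \<xi>: "\<xi> = ?G \<zeta>" unfolding \<zeta>_def inv ..
    have "gauge_bivector b P p [\<xi>, \<xi>] = blinfun_apply (?G \<zeta>) (anchor (P p) \<zeta>)"
      unfolding gauge_bivector_apply \<zeta>_def[symmetric] using vec_sharp_apply[OF P, of \<xi> \<zeta>] \<xi> by simp
    also have "\<dots> = P p [\<zeta>, \<zeta>] + b p [anchor (P p) \<zeta>, anchor (P p) \<zeta>]"
      by (simp only: gauge_map_apply[OF b] vec_sharp_apply[OF P, of \<zeta> \<zeta>])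
    finally show ?thesis using P b by (simp add: alternating_def)
  qed
qed

lemma anchor_gauge_bivector:
  assumes b: "alternating 2 (b p)" and P: "alternating 2 (P p)" and bij: "bij (gauge_map (b p) (P p))"
  shows "anchor (gauge_bivector b P p) (gauge_map (b p) (P p) \<xi>) = anchor (P p) \<xi>"
  unfolding anchor_eq_iff[OF alternating_gauge_bivector[where b = b and P = P, OF assms] P] gauge_bivector_apply
  using bij by (simp add: bij_is_inj)

context smooth_manifold
begin

lemma bij_intertwine:
  assumes K: "bij K" and eq: "\<And>\<xi>. K (G \<xi>) = G' (K \<xi>)" shows "bij G \<longleftrightarrow> bij G'"
proof -
  have "K \<circ> G = G' \<circ> K" using eq by auto
  then show ?thesis using K by (metis bij_betw_comp_iff bij_betw_comp_iff2 bij_comp bij_is_surj subset_UNIV)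
qed

text \<open>Here b' is the pullback of b by L and R the pushforward of P, so R^sharp is P^sharp
  between the transpose of L and L. It serves both changes of chart and diffeomorphisms.\<close>

lemma gauge_map_transport:
  assumes L: "linear L" and b: "alternating 2 b" "alternating 2 b'" and P: "alternating 2 P" "alternating 2 R"
    and rel: "\<And>v w. b' [v, w] = b [L v, L w]" "\<And>\<xi> \<eta>. R [\<xi>, \<eta>] = P [covec_map L \<xi>, covec_map L \<eta>]"
  shows "covec_map L (gauge_map b R \<xi>) = gauge_map b' P (covec_map L \<xi>)"
  by (rule blinfun_eqI)
    (simp add: covec_map_apply L gauge_map_apply b rel(1) anchor_pushforward[OF L P rel(2)])

lemma covec_map_inverse:
  assumes "linear L" "linear K" "\<And>v. L (K v) = v"
  shows "covec_map K (covec_map L \<xi>) = \<xi>"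
  using assms by (simp add: covec_map_compose covec_map_ident)

lemma gauge_map_chart:
  assumes c: "c \<in> A" and x: "x \<in> cimage c"
    and b: "alternating 2 (b (cinv c x))" and P: "alternating 2 (P (cinv c x))"
  shows "covec_map (to_chart A c (cinv c x)) (gauge_map (form_in A c b x) (mvec_in A c P x) \<xi>) =
    gauge_map (b (cinv c x)) (P (cinv c x)) (covec_map (to_chart A c (cinv c x)) \<xi>)"
proof -
  let ?q = "cinv c x"
  have q: "?q \<in> fst c" using cinv_in[OF c x] .
  note lin = linear_to_chart[OF c q] linear_from_chart[OF c q]
  have f: "form_in A c b x [v, w] = b ?q [from_chart A c ?q v, from_chart A c ?q w]" for v w
    unfolding form_in_def by simp
  have b': "alternating 2 (form_in A c b x)" by (rule alternating_form_in[OF c x]) (rule b)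
  have P': "alternating 2 (mvec_in A c P x)" by (rule alternating_mvec_in) (rule P)
  show ?thesis
  proof (rule gauge_map_transport[OF lin(1) b' b P P'])
    show "b ?q [v, w] = form_in A c b x [to_chart A c ?q v, to_chart A c ?q w]" for v w
      unfolding f by (simp add: from_to_chart c q)
    show "mvec_in A c P x [\<xi>, \<eta>] = P ?q [covec_map (to_chart A c ?q) \<xi>, covec_map (to_chart A c ?q) \<eta>]" for \<xi> \<eta>
      unfolding mvec_in_covec_map by simp
  qed
qed

lemma gauge_chart:
  assumes c: "c \<in> A" and x: "x \<in> cimage c"
    and b: "alternating 2 (b (cinv c x))" and P: "alternating 2 (P (cinv c x))"
    and bij: "bij (gauge_map (b (cinv c x)) (P (cinv c x)))"
  shows "bij (gauge_map (form_in A c b x) (mvec_in A c P x))"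
    and "mvec_in A c (gauge_bivector b P) x [\<xi>, \<eta>] =
      mvec_in A c P x [inv (gauge_map (form_in A c b x) (mvec_in A c P x)) \<xi>, \<eta>]"
proof -
  let ?q = "cinv c x"
  have q: "?q \<in> fst c" using cinv_in[OF c x] .
  let ?K = "covec_map (to_chart A c ?q)" and ?J = "covec_map (from_chart A c ?q)"
  let ?G = "gauge_map (b ?q) (P ?q)" and ?L = "gauge_map (form_in A c b x) (mvec_in A c P x)"
  note lin = linear_to_chart[OF c q] linear_from_chart[OF c q]
  have KJ: "?K (?J \<xi>) = \<xi>" "?J (?K \<xi>) = \<xi>" for \<xi>
    by (simp_all add: covec_map_inverse lin from_to_chart to_from_chart c q)
  then have K: "bij ?K" by (metis bijI')
  have KL: "?K (?L \<xi>) = ?G (?K \<xi>)" for \<xi> by (rule gauge_map_chart[where b = b and P = P, OF c x b P])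
  show L: "bij ?L" using bij_intertwine[OF K, of ?L ?G] KL bij by simp
  have "inv ?G (?K \<xi>) = ?K (inv ?L \<xi>)"
  proof -
    have "?G (?K (inv ?L \<xi>)) = ?K \<xi>" using KL[of "inv ?L \<xi>"] L by (simp add: bij_is_surj surj_f_inv_f)
    then show ?thesis using bij by (metis bij_inv_eq_iff)
  qed
  then show "mvec_in A c (gauge_bivector b P) x [\<xi>, \<eta>] = mvec_in A c P x [inv ?L \<xi>, \<eta>]"
    unfolding mvec_in_covec_map by (simp add: gauge_bivector_apply)
qed

text \<open>In a chart 1 + b^flat P^sharp is a smooth family of invertible operators on covectors,
  so the family of inverses is smooth as well.\<close>

lemma smooth_mvec_family_gauge:
  assumes b: "smooth_form_family A 2 b" and P: "smooth_mvec_family A 2 P"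
    and inv: "\<And>t. gauge_invertible (b t) (P t)"
  shows "smooth_mvec_family A 2 (\<lambda>t. gauge_bivector (b t) (P t))"
proof (rule smooth_mvec_familyI)
  note bij = inv[unfolded gauge_invertible_iff, rule_format]
  note ba = smooth_form_family_alternating[OF b] and Pa = smooth_mvec_family_alternating[OF P]
  show alt: "alternating 2 (gauge_bivector (b t) (P t) p)" for t p
    by (rule alternating_gauge_bivector[OF ba Pa bij])
  fix c \<xi>s assume c: "c \<in> A"
  let ?S = "cimage c \<times> (UNIV::real set)"
  define L where "L z = gauge_map (form_chart c b z) (mvec_chart c P z)" for z
  note S = open_cyl[OF c]
  have bz: "alternating 2 (form_chart c b z)" if "z \<in> ?S" for z
    by (rule smooth_form_family_chart_alternating[OF b c that])
  have Pz: "alternating 2 (mvec_chart c P z)" for z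
    by (rule smooth_mvec_family_chart_alternating[OF P])
  have G: "bij (L z)" "mvec_chart c (\<lambda>t. gauge_bivector (b t) (P t)) z [\<xi>, \<eta>] = mvec_chart c P z [inv (L z) \<xi>, \<eta>]"
    if "z \<in> ?S" for z \<xi> \<eta>
    using gauge_chart[where b = "b (snd z)" and P = "P (snd z)" and x = "fst z", OF c _ ba Pa bij] that
    unfolding L_def by auto
  have L: "smooth_on ?S (\<lambda>z. L z \<xi>)" for \<xi>
  proof (rule smooth_on_covec[OF S])
    fix v
    have "smooth_on ?S (\<lambda>z. anchor (mvec_chart c P z) \<xi>)"
      by (rule smooth_on_anchor[OF S smooth_mvec_family_chart[OF P c]])
    then have "smooth_on ?S (\<lambda>z. form_chart c b z [anchor (mvec_chart c P z) \<xi>, v])"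
      by (intro smooth_on_slot[where F = "\<lambda>z y. form_chart c b z [y, v]" and g = "\<lambda>z. anchor (mvec_chart c P z) \<xi>",
            OF coords_euclidean S] alternating2_linear(1)[OF bz] smooth_form_family_chart[OF b c])
    then have "smooth_on ?S (\<lambda>z. \<xi> v + form_chart c b z [anchor (mvec_chart c P z) \<xi>, v])"
      by (intro smooth_on_add S smooth_on_const)
    then show "smooth_on ?S (\<lambda>z. blinfun_apply (L z \<xi>) v)"
      by (rule smooth_on_eqI[OF S]) (simp add: L_def gauge_map_apply[OF bz])
  qed
  have M: "smooth_on ?S (\<lambda>z. inv (L z) \<xi>)" for \<xi>
  proof (rule smooth_on_inverse_family[OF coords_covec S _ _ _ L])
    show "linear (L z)" if "z \<in> ?S" for z unfolding L_def by (rule linear_gauge_map[OF bz[OF that] Pz])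
    show "inv (L z) (L z v) = v" "L z (inv (L z) v) = v" if "z \<in> ?S" for z v
      using G(1)[OF that] by (simp_all add: bij_is_inj bij_is_surj surj_f_inv_f)
  qed
  show "smooth_on ?S (\<lambda>z. mvec_chart c (\<lambda>t. gauge_bivector (b t) (P t)) z \<xi>s)"
  proof (cases "length \<xi>s = 2")
    case False
    then have "mvec_chart c (\<lambda>t. gauge_bivector (b t) (P t)) z \<xi>s = 0" for z
      using alternating_length[OF alt] unfolding mvec_in_def by simp
    then show ?thesis using smooth_on_const[OF S] by simp
  next
    case True
    then obtain \<xi> \<eta> where \<xi>s: "\<xi>s = [\<xi>, \<eta>]" by (auto simp: numeral_2_eq_2 length_Suc_conv)
    have "smooth_on ?S (\<lambda>z. mvec_chart c P z [inv (L z) \<xi>, \<eta>])"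
      by (intro smooth_on_slot[where F = "\<lambda>z y. mvec_chart c P z [y, \<eta>]" and g = "\<lambda>z. inv (L z) \<xi>",
            OF coords_covec S] alternating2_linear(1)[OF Pz] smooth_mvec_family_chart[OF P c] M)
    then show ?thesis unfolding \<xi>s by (rule smooth_on_eqI[OF S]) (rule G(2))
  qed
qed

section \<open>Invariance of the Maurer-Cartan set\<close>

lemma de_rham_diff:
  assumes "\<omega> \<in> forms A k" "\<omega>' \<in> forms A k"
  shows "de_rham A (\<lambda>p vs. \<omega> p vs - \<omega>' p vs) p vs = de_rham A \<omega> p vs - de_rham A \<omega>' p vs"
proof -
  have "D (\<lambda>y. form_in A (chart_at A p) (\<lambda>p vs. \<omega> p vs - \<omega>' p vs) y us) (coord A p p) v =
      D (\<lambda>y. form_in A (chart_at A p) \<omega> y us) (coord A p p) v - D (\<lambda>y. form_in A (chart_at A p) \<omega>' y us) (coord A p p) v" for us v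
    using D_eqI[OF has_derivative_diff[OF
          smooth_on_has_derivative[OF forms_chart[OF assms(1) chart_at_in] coord_in]
          smooth_on_has_derivative[OF forms_chart[OF assms(2) chart_at_in] coord_in], of p us us]]
    unfolding form_in_def by simp
  then show ?thesis unfolding de_rham_dloc dloc_def by (simp add: right_diff_distrib sum_subtractf)
qed

lemma de_rham_add:
  assumes "\<omega> \<in> forms A k" "\<omega>' \<in> forms A k"
  shows "de_rham A (\<lambda>p vs. \<omega> p vs + \<omega>' p vs) p vs = de_rham A \<omega> p vs + de_rham A \<omega>' p vs"
proof -
  have "D (\<lambda>y. form_in A (chart_at A p) (\<lambda>p vs. \<omega> p vs + \<omega>' p vs) y us) (coord A p p) v =
      D (\<lambda>y. form_in A (chart_at A p) \<omega> y us) (coord A p p) v + D (\<lambda>y. form_in A (chart_at A p) \<omega>' y us) (coord A p p) v" for us v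
    using D_eqI[OF has_derivative_add[OF
          smooth_on_has_derivative[OF forms_chart[OF assms(1) chart_at_in] coord_in]
          smooth_on_has_derivative[OF forms_chart[OF assms(2) chart_at_in] coord_in], of p us us]]
    unfolding form_in_def by simp
  then show ?thesis unfolding de_rham_dloc dloc_def by (simp add: distrib_left sum.distrib)
qed

lemma de_rham_zero: "de_rham A (\<lambda>p vs. 0) p vs = 0"
  unfolding de_rham_dloc dloc_def form_in_def by simp

lemma MC_iff:
  "(H, P) \<in> MC A \<longleftrightarrow> H \<in> forms A 3 \<and> (\<forall>p vs. de_rham A H p vs = 0) \<and> P \<in> mvecs A 2 \<and> (\<forall>p \<xi>1 \<xi>2 \<xi>3.
    jacobiator (mvec_in A (chart_at A p) P) (coord A p p) \<xi>1 \<xi>2 \<xi>3 = - H p [anchor (P p) \<xi>1, anchor (P p) \<xi>2, anchor (P p) \<xi>3])"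
  unfolding MC_def using twisted_poisson_iff[of H P] forms_alternating by auto

text \<open>On transformed covectors the Jacobiator grows by db on the anchors, and the anchors of
  e^b P there are those of P. So -H turns into -(H - db), and surjectivity of the gauge map reaches
  all covectors.\<close>

lemma gauge_MC:
  assumes m: "(H, P) \<in> MC A" and b: "b \<in> forms A 2" and inv: "gauge_invertible b P"
  shows "(\<lambda>p vs. H p vs - de_rham A b p vs, gauge_bivector b P) \<in> MC A"
proof -
  define Q where "Q = gauge_bivector b P"
  have H: "H \<in> forms A 3" "\<And>p vs. de_rham A H p vs = 0" and P: "P \<in> mvecs A 2"
    and tw: "\<And>p \<xi>1 \<xi>2 \<xi>3. jacobiator (mvec_in A (chart_at A p) P) (coord A p p) \<xi>1 \<xi>2 \<xi>3 =
      - H p [anchor (P p) \<xi>1, anchor (P p) \<xi>2, anchor (P p) \<xi>3]"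
    using m unfolding MC_iff by auto
  have db: "de_rham A b \<in> forms A 3"
    using smooth_form_family_slice[OF smooth_form_family_de_rham[OF smooth_form_family_const[OF b]]] .
  have H': "(\<lambda>p vs. H p vs - de_rham A b p vs) \<in> forms A 3"
    using smooth_form_family_slice[OF smooth_form_family_diff[OF smooth_form_family_const[OF H(1)] smooth_form_family_const[OF db]]] .
  have Q: "Q \<in> mvecs A 2"
    unfolding Q_def
    using smooth_mvec_family_slice[OF smooth_mvec_family_gauge[OF smooth_form_family_const[OF b] smooth_mvec_family_const[OF P] inv]] .
  note ba = forms_alternating[OF b] and Pa = mvecs_alternating[OF P] and Qa = mvecs_alternating[OF Q]
  note bij = inv[unfolded gauge_invertible_iff, rule_format]
  have "jacobiator (mvec_in A (chart_at A p) Q) (coord A p p) \<eta>1 \<eta>2 \<eta>3 =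
      - (H p [anchor (Q p) \<eta>1, anchor (Q p) \<eta>2, anchor (Q p) \<eta>3] - de_rham A b p [anchor (Q p) \<eta>1, anchor (Q p) \<eta>2, anchor (Q p) \<eta>3])"
    for p \<eta>1 \<eta>2 \<eta>3
  proof -
    let ?c = "chart_at A p" and ?x = "coord A p p"
    let ?G = "gauge_map (b p) (P p)"
    note c = chart_at_in[of p] and x = coord_in[of p]
    have at: "form_in A ?c b ?x = b p" "mvec_in A ?c P ?x = P p" "mvec_in A ?c Q ?x = Q p"
      by (intro ext form_in_at mvec_in_at)+
    have rel: "anchor (mvec_in A ?c Q z) (\<xi> + flat (form_in A ?c b z) (anchor (mvec_in A ?c P z) \<xi>)) = anchor (mvec_in A ?c P z) \<xi>"
      if z: "z \<in> cimage ?c" for z \<xi>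
    proof -
      note g = gauge_chart[where b = b and P = P, OF c z ba Pa bij]
      show ?thesis
        unfolding gauge_map_def[symmetric] Q_def
        using g(1) by (subst anchor_eq_iff) (auto simp: g(2) bij_is_inj alternating_mvec_in Pa Qa[unfolded Q_def])
    qed
    have "surj ?G" using bij by (simp add: bij_is_surj)
    then obtain \<xi>1 \<xi>2 \<xi>3 where \<xi>: "\<eta>1 = ?G \<xi>1" "\<eta>2 = ?G \<xi>2" "\<eta>3 = ?G \<xi>3" by (meson surjD)
    have "jacobiator (mvec_in A ?c Q) ?x (?G \<xi>1) (?G \<xi>2) (?G \<xi>3) = jacobiator (mvec_in A ?c P) ?x \<xi>1 \<xi>2 \<xi>3
        + dloc (form_in A ?c b) ?x [anchor (P p) \<xi>1, anchor (P p) \<xi>2, anchor (P p) \<xi>3]"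
      using jacobiator_gauge[where b = "form_in A ?c b" and r = "mvec_in A ?c P" and q = "mvec_in A ?c Q",
          OF open_cimage[OF c] x mvecs_chart[OF P c] alternating_mvec_in[where P = P, OF Pa]
            mvecs_chart[OF Q c] alternating_mvec_in[where P = Q, OF Qa] forms_chart[OF b c]
            alternating_form_in[where \<omega> = b, OF c _ ba] rel, of \<xi>1 \<xi>2 \<xi>3]
      unfolding gauge_map_def at by simp
    moreover have "anchor (Q p) (?G \<xi>) = anchor (P p) \<xi>" for \<xi>
      unfolding Q_def by (rule anchor_gauge_bivector[OF ba Pa bij])
    ultimately show ?thesis unfolding \<xi> tw de_rham_dloc by simp
  qed
  then show ?thesis
    unfolding MC_iff Q_def[symmetric] using H' Q H de_rham_diff[OF H(1) db] de_rham_de_rham[OF b] by simp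
qed

text \<open>Naturality of the Jacobiator and of d. Smoothness of the transported fields is a
  hypothesis; where the lemma is applied, they are slices of smooth families.\<close>

lemma diffeo_MC:
  assumes m: "(H, P) \<in> MC A" and \<phi>: "diffeo A \<phi>"
    and H': "pullback A (inv \<phi>) H \<in> forms A 3" and P': "pushforward A \<phi> P \<in> mvecs A 2"
  shows "(pullback A (inv \<phi>) H, pushforward A \<phi> P) \<in> MC A"
proof -
  define R where "R = pushforward A \<phi> P"
  have H: "H \<in> forms A 3" "\<And>p vs. de_rham A H p vs = 0" and P: "P \<in> mvecs A 2"
    and tw: "\<And>p \<xi>1 \<xi>2 \<xi>3. jacobiator (mvec_in A (chart_at A p) P) (coord A p p) \<xi>1 \<xi>2 \<xi>3 =
      - H p [anchor (P p) \<xi>1, anchor (P p) \<xi>2, anchor (P p) \<xi>3]"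
    using m unfolding MC_iff by auto
  note R = P'[folded R_def]
  note s = diffeo_smooth[OF \<phi>]
  have d: "de_rham A (pullback A (inv \<phi>) H) q vs = 0" for q vs
    using de_rham_pullback[OF _ H(1) s(2)] H(2) unfolding pullback_def by simp
  have "jacobiator (mvec_in A (chart_at A q) R) (coord A q q) \<xi>1 \<xi>2 \<xi>3 =
      - pullback A (inv \<phi>) H q [anchor (R q) \<xi>1, anchor (R q) \<xi>2, anchor (R q) \<xi>3]" for q \<xi>1 \<xi>2 \<xi>3
  proof -
    define p where "p = inv \<phi> q"
    have q: "q = \<phi> p" unfolding p_def by (simp add: diffeo_inv_apply[OF \<phi>])
    let ?c = "chart_at A p" and ?c' = "chart_at A q" and ?x = "coord A p p"
    let ?T = "tangent_map A \<phi> p"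
    note c = chart_at_in[of p] chart_at_in[of q]
    have x: "?x \<in> rep_dom ?c ?c' \<phi>" unfolding q by (intro coord_in_rep_dom in_chart_at)
    have y: "rep ?c ?c' \<phi> ?x = coord A q q" unfolding rep_coord q by (simp add: coord_def)
    have T: "D (rep ?c ?c' \<phi>) ?x = ?T" unfolding tangent_map_rep q ..
    have "jacobiator (mvec_in A ?c' R) (rep ?c ?c' \<phi> ?x) \<xi>1 \<xi>2 \<xi>3 = jacobiator (mvec_in A ?c P) ?x
        (covec_map (D (rep ?c ?c' \<phi>) ?x) \<xi>1) (covec_map (D (rep ?c ?c' \<phi>) ?x) \<xi>2) (covec_map (D (rep ?c ?c' \<phi>) ?x) \<xi>3)"
    proof (rule jacobiator_pushforward[OF open_rep_dom[OF s(1) c] open_cimage[OF c(2)] smooth_rep[OF s(1) c] _ mvecs_chart[OF R c(2)]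
          alternating_mvec_in[where P = R, OF mvecs_alternating[OF R]] _ alternating_mvec_in[where P = P, OF mvecs_alternating[OF P]] _ x])
      show "rep ?c ?c' \<phi> ` rep_dom ?c ?c' \<phi> \<subseteq> cimage ?c'" by (intro image_subsetI rep_in[OF c(2)])
      show "smooth_on (rep_dom ?c ?c' \<phi>) (\<lambda>z. mvec_in A ?c P z \<xi>s)" for \<xi>s
        by (rule smooth_on_subset[OF mvecs_chart[OF P c(1)]]) (auto simp: rep_dom_def)
      show "mvec_in A ?c' R (rep ?c ?c' \<phi> z) [\<xi>, \<eta>] = mvec_in A ?c P z [covec_map (D (rep ?c ?c' \<phi>) z) \<xi>, covec_map (D (rep ?c ?c' \<phi>) z) \<eta>]"
        if "z \<in> rep_dom ?c ?c' \<phi>" for z \<xi> \<eta>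
        using mvec_in_pushforward[OF \<phi> c that] unfolding R_def by simp
    qed
    then have "jacobiator (mvec_in A ?c' R) (coord A q q) \<xi>1 \<xi>2 \<xi>3 =
        - H p [anchor (P p) (covec_map ?T \<xi>1), anchor (P p) (covec_map ?T \<xi>2), anchor (P p) (covec_map ?T \<xi>3)]"
      unfolding y T tw .
    moreover have "anchor (P p) (covec_map ?T \<xi>) = tangent_map A (inv \<phi>) q (anchor (R q) \<xi>)" for \<xi>
    proof -
      have "anchor (R q) \<xi> = ?T (anchor (P p) (covec_map ?T \<xi>))"
        by (rule anchor_pushforward[OF linear_tangent_map[OF s(1)] mvecs_alternating[OF P] mvecs_alternating[OF R]])
          (simp add: R_def q pushforward_apply[OF \<phi>])
      then show ?thesis unfolding q by (simp add: tangent_map_inv[OF \<phi>])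
    qed
    ultimately show ?thesis unfolding pullback_def p_def by simp
  qed
  then show ?thesis unfolding MC_iff R_def[symmetric] using H' R d by simp
qed

section \<open>The partial action in explicit form\<close>

lemma bij_covec_tangent: "diffeo A \<phi> \<Longrightarrow> bij (covec_map (tangent_map A \<phi> p))"
proof -
  assume \<phi>: "diffeo A \<phi>"
  let ?T = "tangent_map A \<phi> p" and ?S = "tangent_map A (inv \<phi>) (\<phi> p)"
  note lin = linear_tangent_map[OF diffeo_smooth(1)[OF \<phi>]] linear_tangent_map[OF diffeo_smooth(2)[OF \<phi>]]
  have "covec_map ?S (covec_map ?T \<xi>) = \<xi>" "covec_map ?T (covec_map ?S \<xi>) = \<xi>" for \<xi>
    by (simp_all add: covec_map_inverse lin tangent_map_inv[OF \<phi>])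
  then show ?thesis by (metis bijI')
qed

text \<open>The action of \<open>(B, \<phi>)\<close> is the gauge transformation by \<open>\<phi>\<^sup>*B\<close> followed by the action of \<open>\<phi>\<close>.\<close>

context
  fixes b :: "('m, 'e) form_field" and \<phi> :: "'m \<Rightarrow> 'm" and H :: "('m, 'e) form_field" and P :: "('m, 'e) mvec_field"
  assumes \<phi>: "diffeo A \<phi>" and b: "b \<in> forms A 2" and b': "pullback A \<phi> b \<in> forms A 2" and P: "P \<in> mvecs A 2"
    and R: "pushforward A \<phi> P \<in> mvecs A 2"
begin

lemma gauge_map_tangent:
  "covec_map (tangent_map A \<phi> p) (gauge_map (b (\<phi> p)) (pushforward A \<phi> P (\<phi> p)) \<xi>) =
    gauge_map (pullback A \<phi> b p) (P p) (covec_map (tangent_map A \<phi> p) \<xi>)"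
proof (rule gauge_map_transport[OF linear_tangent_map[OF diffeo_smooth(1)[OF \<phi>]] forms_alternating[OF b]
        forms_alternating[OF b'] mvecs_alternating[OF P] mvecs_alternating[OF R]])
  show "pullback A \<phi> b p [v, w] = b (\<phi> p) [tangent_map A \<phi> p v, tangent_map A \<phi> p w]" for v w
    unfolding pullback_def by simp
  show "pushforward A \<phi> P (\<phi> p) [\<xi>, \<eta>] =
      P p [covec_map (tangent_map A \<phi> p) \<xi>, covec_map (tangent_map A \<phi> p) \<eta>]" for \<xi> \<eta>
    by (simp add: pushforward_apply[OF \<phi>, of P p "[\<xi>, \<eta>]"])
qed

lemma act_defined_iff: "act_defined A (b, \<phi>) (H, P) \<longleftrightarrow> gauge_invertible (pullback A \<phi> b) P"
proof -
  have "bij (gauge_map (b (\<phi> p)) (pushforward A \<phi> P (\<phi> p))) \<longleftrightarrow> bij (gauge_map (pullback A \<phi> b p) (P p))" for p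
    by (rule bij_intertwine[where G = "gauge_map (b (\<phi> p)) (pushforward A \<phi> P (\<phi> p))" and
          G' = "gauge_map (pullback A \<phi> b p) (P p)", OF bij_covec_tangent[OF \<phi>] gauge_map_tangent])
  then have "(\<forall>p. bij (gauge_map (pullback A \<phi> b p) (P p))) \<longleftrightarrow> (\<forall>q. bij (gauge_map (b q) (pushforward A \<phi> P q)))"
    by (metis diffeo_inv_apply(2)[OF \<phi>])
  then show ?thesis unfolding act_defined_def gauge_invertible_iff by simp
qed

text \<open>The definite description in \<open>gauge_transform\<close> is resolved: the transported
  bivector field has the required anchors, hence the required graphs, and a bivector is determined
  by its anchors on the range of a surjective gauge map.\<close>

lemma act_eq:
  assumes inv: "gauge_invertible (pullback A \<phi> b) P"
    and Q: "pushforward A \<phi> (gauge_bivector (pullback A \<phi> b) P) \<in> mvecs A 2"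
  shows "act A (b, \<phi>) (H, P) = (\<lambda>p vs. pullback A (inv \<phi>) H p vs - de_rham A b p vs,
    pushforward A \<phi> (gauge_bivector (pullback A \<phi> b) P))"
proof -
  let ?Q = "gauge_bivector (pullback A \<phi> b) P" and ?R = "pushforward A \<phi> P"
  have surj: "surj (gauge_map (b q) (?R q))" for q
    using act_defined_iff inv unfolding act_defined_def gauge_invertible_iff by (simp add: bij_is_surj)
  note bij = inv[unfolded gauge_invertible_iff, rule_format]
  have an: "anchor (pushforward A \<phi> ?Q q) (gauge_map (b q) (?R q) \<xi>) = anchor (?R q) \<xi>" for q \<xi>
  proof -
    define p where "p = inv \<phi> q"
    have q: "q = \<phi> p" unfolding p_def by (simp add: diffeo_inv_apply[OF \<phi>])
    have "pushforward A \<phi> ?Q (\<phi> p) [gauge_map (b (\<phi> p)) (?R (\<phi> p)) \<xi>, \<eta>] = ?R (\<phi> p) [\<xi>, \<eta>]" for \<eta>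
      using bij[of p] pushforward_apply[OF \<phi>, of P p "[\<xi>, \<eta>]"]
        pushforward_apply[OF \<phi>, of ?Q p "[gauge_map (b (\<phi> p)) (?R (\<phi> p)) \<xi>, \<eta>]"]
      by (simp add: gauge_map_tangent gauge_bivector_apply bij_is_inj)
    then show ?thesis
      unfolding anchor_eq_iff[OF mvecs_alternating[OF Q] mvecs_alternating[OF R]] q by blast
  qed
  have "gauge_transform A b ?R = pushforward A \<phi> ?Q"
    unfolding gauge_transform_def graph_gauge_iff[OF surj]
  proof (rule the_equality)
    show "pushforward A \<phi> ?Q \<in> mvecs A 2 \<and>
        (\<forall>p \<xi>. anchor (pushforward A \<phi> ?Q p) (gauge_map (b p) (?R p) \<xi>) = anchor (?R p) \<xi>)"
      using Q an by blast
    fix P' assume "P' \<in> mvecs A 2 \<and> (\<forall>p \<xi>. anchor (P' p) (gauge_map (b p) (?R p) \<xi>) = anchor (?R p) \<xi>)"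
    then show "P' = pushforward A \<phi> ?Q"
      by (intro ext fun_cong[OF gauge_unique[OF surj mvecs_alternating mvecs_alternating[OF Q] _ an]]) auto
  qed
  then show ?thesis unfolding act_def by simp
qed

end

end

section \<open>Gauge transformations along a path\<close>

lemma has_derivative_gauge_map:
  assumes b: "\<And>s. alternating 2 (b s)" and \<beta>: "alternating 2 \<beta>"
    and der: "\<And>vs. ((\<lambda>s. b s vs) has_real_derivative \<beta> vs) (at t)"
  shows "((\<lambda>s. gauge_map (b s) P \<xi>) has_derivative (\<lambda>h. h *\<^sub>R flat \<beta> (anchor P \<xi>))) (at t)"
proof (rule has_derivative_covec)
  fix v
  have "((\<lambda>s. \<xi> v + b s [anchor P \<xi>, v]) has_derivative (\<lambda>h. 0 + \<beta> [anchor P \<xi>, v] * h)) (at t)"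
    using der[of "[anchor P \<xi>, v]"] unfolding has_field_derivative_def
    by (intro has_derivative_add has_derivative_const)
  then show "((\<lambda>s. blinfun_apply (gauge_map (b s) P \<xi>) v) has_derivative
      (\<lambda>h. blinfun_apply (h *\<^sub>R flat \<beta> (anchor P \<xi>)) v)) (at t)"
    by (simp add: gauge_map_apply[OF b] flat_apply[OF \<beta>] blinfun.bilinear_simps mult.commute)
qed

text \<open>The derivative of the gauge map is \<beta>^flat P^sharp. Skew-symmetry of Q rewrites the
  value of Q on this covector as minus \<beta> on two anchors.\<close>

lemma derivative_along_gauge_map:
  fixes Q :: "real \<Rightarrow> 'e::euclidean_space covec list \<Rightarrow> real"
  assumes b: "\<And>s. alternating 2 (b s)" and Q: "\<And>s. alternating 2 (Q s)"
    and bder: "\<And>vs. ((\<lambda>s. b s vs) has_real_derivative \<beta> vs) (at t)"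
    and Qder: "\<And>\<xi> \<eta>. ((\<lambda>s. Q s [\<xi>, \<eta>]) has_real_derivative Q' [\<xi>, \<eta>]) (at t)"
  shows "((\<lambda>s. Q s [gauge_map (b s) P \<xi>, \<eta>]) has_real_derivative
    Q' [gauge_map (b t) P \<xi>, \<eta>] - \<beta> [anchor P \<xi>, anchor (Q t) \<eta>]) (at t)"
proof -
  have \<beta>: "alternating 2 \<beta>" by (rule alternating_derivative[OF b bder])
  have "((\<lambda>s. Q s [v, \<eta>]) has_derivative (*) (Q' [v, \<eta>])) (at t)" for v
    using Qder unfolding has_field_derivative_def .
  then have "((\<lambda>s. Q s [gauge_map (b s) P \<xi>, \<eta>]) has_derivative (\<lambda>h. Q' [gauge_map (b t) P \<xi>, \<eta>] * h
      + Q t [h *\<^sub>R flat \<beta> (anchor P \<xi>), \<eta>])) (at t)"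
    by (intro has_derivative_slot[where S = UNIV and F = "\<lambda>s v. Q s [v, \<eta>]" and F' = "\<lambda>v h. Q' [v, \<eta>] * h",
          OF coords_covec open_UNIV UNIV_I alternating2_linear(1)[OF Q] _ has_derivative_gauge_map[OF b \<beta> bder]])
  from has_derivative_imp_has_real_derivative[OF this]
  have "((\<lambda>s. Q s [gauge_map (b s) P \<xi>, \<eta>]) has_real_derivative Q' [gauge_map (b t) P \<xi>, \<eta>]
      + Q t [flat \<beta> (anchor P \<xi>), \<eta>]) (at t)" by simp
  moreover have "Q t [flat \<beta> (anchor P \<xi>), \<eta>] = - \<beta> [anchor P \<xi>, anchor (Q t) \<eta>]"
    using alternating2_swap[OF Q, of t _ \<eta>] vec_sharp_apply[OF Q, of "flat \<beta> (anchor P \<xi>)" t \<eta>]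
    by (simp add: flat_apply[OF \<beta>])
  ultimately show ?thesis by simp
qed

text \<open>\<open>Q s [gauge_map (b s) P \<zeta>, \<eta>]\<close> does not depend on s because of
  the assumed relation, so its derivative vanishes.\<close>

lemma gauge_path_derivative:
  fixes Q :: "real \<Rightarrow> 'e::euclidean_space covec list \<Rightarrow> real"
  assumes b: "\<And>s. alternating 2 (b s)" and Q: "\<And>s. alternating 2 (Q s)" and P: "alternating 2 P"
    and bder: "\<And>vs. ((\<lambda>s. b s vs) has_real_derivative \<beta> vs) (at t)"
    and Qder: "\<And>\<xi> \<eta>. ((\<lambda>s. Q s [\<xi>, \<eta>]) has_real_derivative Q' [\<xi>, \<eta>]) (at t)"
    and rel: "\<And>s \<xi>. anchor (Q s) (gauge_map (b s) P \<xi>) = anchor P \<xi>"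
    and surj: "surj (gauge_map (b t) P)"
  shows "Q' [\<xi>, \<eta>] = \<beta> [anchor (Q t) \<xi>, anchor (Q t) \<eta>]"
proof -
  obtain \<zeta> where \<zeta>: "\<xi> = gauge_map (b t) P \<zeta>" using surj by (meson surjD)
  have "Q s [gauge_map (b s) P \<zeta>, \<eta>] = P [\<zeta>, \<eta>]" for s
    using rel anchor_eq_iff[OF Q P] by blast
  then have "Q' [\<xi>, \<eta>] - \<beta> [anchor P \<zeta>, anchor (Q t) \<eta>] = 0"
    using derivative_along_gauge_map[where b = b and Q = Q and P = P and \<xi> = \<zeta> and \<eta> = \<eta>, OF b Q bder Qder]
    unfolding \<zeta> by (auto dest: DERIV_unique[OF _ DERIV_const])
  then show ?thesis unfolding \<zeta> rel by simp
qed

text \<open>For t >= 0 the function u exp(-K s) does not increase on [0, t], for t < 0 the function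
  u exp(K s) does not decrease on [t, 0]. Both are nonnegative and vanish at 0. Negative times occur
  because paths are indexed by all reals.\<close>

lemma gronwall_zero:
  fixes u :: "real \<Rightarrow> real"
  assumes u: "u 0 = 0" "\<And>s. 0 \<le> u s" and der: "\<And>s. (u has_real_derivative u' s) (at s)"
    and bound: "\<And>s. \<bar>s\<bar> \<le> R \<Longrightarrow> \<bar>u' s\<bar> \<le> K * u s" and t: "\<bar>t\<bar> \<le> R"
  shows "u t = 0"
proof (cases "0 \<le> t")
  case True
  have d: "((\<lambda>s. u s * exp (- K * s)) has_real_derivative (u' s - K * u s) * exp (- K * s)) (at s)" for s
    by (auto intro!: derivative_eq_intros der simp: algebra_simps)
  have "u t * exp (- K * t) \<le> u 0 * exp (- K * 0)"
  proof (rule DERIV_nonpos_imp_nonincreasing[OF True])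
    fix s assume "0 \<le> s" "s \<le> t"
    then have "u' s - K * u s \<le> 0" using bound[of s] t by auto
    then show "\<exists>y. ((\<lambda>s. u s * exp (- K * s)) has_real_derivative y) (at s) \<and> y \<le> 0"
      using d mult_nonpos_nonneg[OF _ exp_ge_zero] by blast
  qed
  then show ?thesis using u by (simp add: mult_le_0_iff order_antisym)
next
  case False
  then have t0: "t \<le> 0" by simp
  have d: "((\<lambda>s. u s * exp (K * s)) has_real_derivative (u' s + K * u s) * exp (K * s)) (at s)" for s
    by (auto intro!: derivative_eq_intros der simp: algebra_simps)
  have "u t * exp (K * t) \<le> u 0 * exp (K * 0)"
  proof (rule DERIV_nonneg_imp_nondecreasing[OF t0])
    fix s assume "t \<le> s" "s \<le> 0"
    then have "u' s + K * u s \<ge> 0" using bound[of s] t by auto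
    then show "\<exists>y. ((\<lambda>s. u s * exp (K * s)) has_real_derivative y) (at s) \<and> 0 \<le> y"
      using d mult_nonneg_nonneg[OF _ exp_ge_zero] by blast
  qed
  then show ?thesis using u by (simp add: mult_le_0_iff order_antisym)
qed

text \<open>The difference \<open>n\<close> of the two sides of the conclusion satisfies the linear equation
  \<open>\<eta>(n') = \<beta>(n, Q \<eta>)\<close>.\<close>

lemma gauge_path_unique:
  fixes Q :: "real \<Rightarrow> 'e::euclidean_space covec list \<Rightarrow> real"
  assumes b: "\<And>s. alternating 2 (b s)" and Q: "\<And>s. alternating 2 (Q s)"
    and bder: "\<And>s vs. ((\<lambda>s. b s vs) has_real_derivative \<beta> s vs) (at s)"
    and Qder: "\<And>s \<xi> \<eta>. ((\<lambda>s. Q s [\<xi>, \<eta>]) has_real_derivative \<beta> s [anchor (Q s) \<xi>, anchor (Q s) \<eta>]) (at s)"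
    and cont: "\<And>vs. continuous_on UNIV (\<lambda>s. \<beta> s vs)"
    and b0: "b 0 = (\<lambda>vs. 0)" and Q0: "Q 0 = P"
  shows "anchor (Q t) (gauge_map (b t) P \<xi>) = anchor P \<xi>"
proof -
  have P: "alternating 2 P" using Q[of 0] Q0 by simp
  have \<beta>: "alternating 2 (\<beta> s)" for s by (rule alternating_derivative[OF b bder])
  define n where "n s = anchor (Q s) (gauge_map (b s) P \<xi>) - anchor P \<xi>" for s
  have n_apply: "blinfun_apply \<eta> (n s) = Q s [gauge_map (b s) P \<xi>, \<eta>] - P [\<xi>, \<eta>]" for s \<eta>
    unfolding n_def by (simp add: blinfun.bilinear_simps vec_sharp_apply Q P)
  \<comment> \<open>The two terms with \<beta> combine by linearity in the first slot. Q is a given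
    curve here, so the equation for n is linear, although the one for Q is quadratic.\<close>
  have n_der: "((\<lambda>s. n s \<bullet> a) has_real_derivative \<beta> s [n s, anchor (Q s) (dual a)]) (at s)" for s a
  proof -
    have "((\<lambda>s. Q s [gauge_map (b s) P \<xi>, dual a] - P [\<xi>, dual a]) has_real_derivative
        \<beta> s [anchor (Q s) (gauge_map (b s) P \<xi>), anchor (Q s) (dual a)] - \<beta> s [anchor P \<xi>, anchor (Q s) (dual a)] - 0) (at s)"
      by (intro DERIV_diff DERIV_const derivative_along_gauge_map[where b = b and Q = Q and P = P and
            Q' = "\<lambda>\<zeta>s. \<beta> s [anchor (Q s) (\<zeta>s ! 0), anchor (Q s) (\<zeta>s ! 1)]", OF b Q bder, simplified] Qder)
    moreover have "n s \<bullet> a = Q s [gauge_map (b s) P \<xi>, dual a] - P [\<xi>, dual a]" for s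
      using n_apply[of "dual a" s] by (simp add: dual_apply)
    ultimately show ?thesis
      unfolding n_def[of s] linear_diff[OF alternating2_linear(1)[OF \<beta>]] by simp
  qed
  \<comment> \<open>m bounds the coefficients of the linear equation; the 2 comes from
    differentiating the squares in \<open>u\<close>. Its bound on a compact interval is the constant
    K of Gronwall's estimate.\<close>
  define m where "m s = (\<Sum>a\<in>Basis. \<Sum>c\<in>Basis. 2 * \<bar>\<beta> s [c, anchor (Q s) (dual a)]\<bar>)" for s
  define u where "u s = (\<Sum>a\<in>Basis. (n s \<bullet> a)\<^sup>2)" for s
  define u' where "u' s = (\<Sum>a\<in>Basis. 2 * (n s \<bullet> a) * \<beta> s [n s, anchor (Q s) (dual a)])" for s
  have "isCont (\<lambda>s. \<beta> s [c, anchor (Q s) (dual a)]) s" for s a c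
  proof -
    have "\<beta> s [c, anchor (Q s) (dual a)] = (\<Sum>d\<in>Basis. Q s [dual a, dual d] * \<beta> s [c, d])" for s
      using euclidean_linear_sum[OF alternating2_linear(2)[OF \<beta>], of s c "anchor (Q s) (dual a)"]
        vec_sharp_apply[OF Q, of "dual _" s "dual a"] by (simp add: dual_apply)
    moreover have "isCont (\<lambda>s. Q s [\<xi>, \<eta>]) s" for \<xi> \<eta> using DERIV_isCont[OF Qder] .
    moreover have "isCont (\<lambda>s. \<beta> s vs) s" for vs
      using cont[of vs] by (simp add: continuous_on_eq_continuous_at)
    ultimately show ?thesis by (simp add: continuous_intros)
  qed
  then have "continuous_on {-\<bar>t\<bar>..\<bar>t\<bar>} m"
    unfolding m_def by (intro continuous_at_imp_continuous_on ballI continuous_intros) auto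
  then obtain K where K: "\<And>s. s \<in> {-\<bar>t\<bar>..\<bar>t\<bar>} \<Longrightarrow> m s \<le> K"
    using compact_continuous_image[of "{-\<bar>t\<bar>..\<bar>t\<bar>}" m] compact_Icc compact_imp_bounded bounded_has_Sup(1)
    by (metis (no_types, lifting) bounded_real abs_le_D1 image_eqI)
  have "u t = 0"
  proof (rule gronwall_zero[where u = u and t = t and u' = u' and R = "\<bar>t\<bar>" and K = K])
    show "u 0 = 0"
    proof -
      have "gauge_map (\<lambda>vs. 0) P \<xi> = \<xi>"
        unfolding gauge_map_def flat_def by (simp add: Blinfun_zero)
      then have "n 0 = 0" unfolding n_def b0 Q0 by simp
      then show ?thesis unfolding u_def by simp
    qed
    show "0 \<le> u s" for s unfolding u_def by (intro sum_nonneg) simp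
    show "(u has_real_derivative u' s) (at s)" for s
      unfolding u_def u'_def by (intro DERIV_sum) (auto intro!: derivative_eq_intros n_der)
    show "\<bar>u' s\<bar> \<le> K * u s" if "\<bar>s\<bar> \<le> \<bar>t\<bar>" for s
    proof -
      have le: "\<bar>n s \<bullet> a\<bar> * \<bar>n s \<bullet> c\<bar> \<le> u s" if "a \<in> Basis" "c \<in> Basis" for a c
      proof -
        have "(n s \<bullet> d)\<^sup>2 \<le> u s" if "d \<in> Basis" for d
          unfolding u_def using that by (intro member_le_sum) auto
        then have "\<bar>n s \<bullet> a\<bar> \<le> sqrt (u s)" "\<bar>n s \<bullet> c\<bar> \<le> sqrt (u s)"
          using that by (auto intro: real_le_rsqrt)
        moreover have "0 \<le> u s" unfolding u_def by (intro sum_nonneg) simp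
        ultimately show ?thesis
          using mult_mono[of "\<bar>n s \<bullet> a\<bar>" "sqrt (u s)" "\<bar>n s \<bullet> c\<bar>" "sqrt (u s)"] by simp
      qed
      have "u' s = (\<Sum>a\<in>Basis. \<Sum>c\<in>Basis. 2 * (n s \<bullet> a) * ((n s \<bullet> c) * \<beta> s [c, anchor (Q s) (dual a)]))"
        unfolding u'_def using euclidean_linear_sum[OF alternating2_linear(1)[OF \<beta>], of s "n s"]
        by (simp add: sum_distrib_left)
      then have "\<bar>u' s\<bar> \<le> (\<Sum>a\<in>Basis. \<Sum>c\<in>Basis. \<bar>2 * (n s \<bullet> a) * ((n s \<bullet> c) * \<beta> s [c, anchor (Q s) (dual a)])\<bar>)"
        by (auto intro!: order_trans[OF sum_abs] sum_mono)
      also have "\<dots> \<le> (\<Sum>a\<in>Basis. \<Sum>c\<in>Basis. (2 * \<bar>\<beta> s [c, anchor (Q s) (dual a)]\<bar>) * u s)"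
      proof (intro sum_mono)
        fix a c :: 'e assume "a \<in> Basis" "c \<in> Basis"
        from mult_left_mono[OF le[OF this], of "2 * \<bar>\<beta> s [c, anchor (Q s) (dual a)]\<bar>"]
        show "\<bar>2 * (n s \<bullet> a) * ((n s \<bullet> c) * \<beta> s [c, anchor (Q s) (dual a)])\<bar> \<le> (2 * \<bar>\<beta> s [c, anchor (Q s) (dual a)]\<bar>) * u s"
          by (simp add: abs_mult mult_ac)
      qed
      also have "\<dots> = m s * u s" unfolding m_def sum_distrib_right ..
      also have "\<dots> \<le> K * u s"
        using K[of s] that by (intro mult_right_mono) (auto simp: abs_le_iff u_def intro: sum_nonneg)
      finally show ?thesis .
    qed
  qed simp
  then have "(n t \<bullet> a)\<^sup>2 = 0" if "a \<in> Basis" for a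
    using that unfolding u_def by (simp add: sum_nonneg_eq_0_iff)
  then have "n t = 0" by (auto simp: euclidean_eq_iff[where x = "n t"])
  then show ?thesis unfolding n_def by simp
qed

text \<open>The inverse is explicit, 1 - b^flat Q^sharp: skew-symmetry of P, Q and b turns the
  relation into P^sharp (\<eta> - b^flat Q^sharp \<eta>) = Q^sharp \<eta>. For injectivity, the
  relation makes the anchor of a kernel element vanish, and then the element itself.\<close>

lemma bij_gauge_map:
  assumes b: "alternating 2 b" and P: "alternating 2 P" and Q: "alternating 2 Q"
    and rel: "\<And>\<xi>. anchor Q (gauge_map b P \<xi>) = anchor P \<xi>"
  shows "bij (gauge_map b P)"
proof (rule bijI)
  have lin: "linear (gauge_map b P)" by (rule linear_gauge_map[OF b P])
  show "inj (gauge_map b P)"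
    unfolding linear_injective_0[OF lin]
  proof (intro allI impI)
    fix \<xi> assume 0: "gauge_map b P \<xi> = 0"
    then have "anchor P \<xi> = 0" using rel[of \<xi>] linear_0[OF linear_anchor[OF Q]] by simp
    then show "\<xi> = 0" using 0 linear_0[OF alternating2_linear(1)[OF b]] gauge_map_apply[OF b, of P \<xi>]
      by (intro blinfun_eqI) simp
  qed
  show "surj (gauge_map b P)"
  proof (rule surjI)
    fix \<eta>
    define \<zeta> where "\<zeta> = \<eta> - flat b (anchor Q \<eta>)"
    have "anchor P \<zeta> = anchor Q \<eta>"
      unfolding anchor_eq_iff[OF P Q]
    proof
      fix \<xi>
      have "P [\<xi>, \<eta>] = Q [gauge_map b P \<xi>, \<eta>]"
        using rel[of \<xi>] anchor_eq_iff[OF Q P] by metis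
      also have "\<dots> = - blinfun_apply (gauge_map b P \<xi>) (anchor Q \<eta>)"
        using alternating2_swap[OF Q] vec_sharp_apply[OF Q] by metis
      finally have "P [\<xi>, \<eta>] = - Q [\<eta>, \<xi>] - b [anchor P \<xi>, anchor Q \<eta>]"
        unfolding gauge_map_apply[OF b] by (simp add: vec_sharp_apply[OF Q])
      moreover have "P [\<zeta>, \<xi>] = - blinfun_apply \<zeta> (anchor P \<xi>)"
        using alternating2_swap[OF P] vec_sharp_apply[OF P] by metis
      moreover have "blinfun_apply \<zeta> (anchor P \<xi>) = P [\<xi>, \<eta>] - b [anchor Q \<eta>, anchor P \<xi>]"
        unfolding \<zeta>_def blinfun.diff_left flat_apply[OF b] by (simp add: vec_sharp_apply[OF P])
      ultimately show "P [\<zeta>, \<xi>] = Q [\<eta>, \<xi>]"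
        using alternating2_swap[OF b, of "anchor Q \<eta>" "anchor P \<xi>"] by simp
    qed
    then show "gauge_map b P (\<eta> - flat b (anchor Q \<eta>)) = \<eta>"
      unfolding \<zeta>_def[symmetric] gauge_map_def by (simp add: \<zeta>_def)
  qed
qed

context smooth_manifold
begin

section \<open>The velocity of an isotopy\<close>

definition velocity :: "(real \<Rightarrow> 'm \<Rightarrow> 'm) \<Rightarrow> real \<Rightarrow> 'm \<Rightarrow> 'e" where
  "velocity \<Phi> t q = D (\<lambda>s. coord A q (\<Phi> s (inv (\<Phi> t) q))) t 1"

text \<open>The sign is chosen such that \<open>\<Phi>\<close> is the flow of the negative of this field.\<close>

definition velocity_field :: "(real \<Rightarrow> 'm \<Rightarrow> 'm) \<Rightarrow> real \<Rightarrow> ('m, 'e) mvec_field" where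
  "velocity_field \<Phi> t q \<xi>s = (if length \<xi>s = 1 then - blinfun_apply (\<xi>s ! 0) (velocity \<Phi> t q) else 0)"

lemma alternating_velocity_field: "alternating 1 (velocity_field \<Phi> t q)"
  unfolding alternating_def
proof (intro conjI allI impI)
  show "linear (\<lambda>v. velocity_field \<Phi> t q (us @ v # ws))" if "length us + 1 + length ws = 1" for us ws
    using that by (intro linearI) (auto simp: velocity_field_def blinfun.bilinear_simps)
  show "velocity_field \<Phi> t q vs = 0" if "\<not> distinct vs" for vs
    using that by (cases vs) (auto simp: velocity_field_def)
qed (simp add: velocity_field_def)

lemma vec_velocity_field: "vec (velocity_field \<Phi> t q) = - velocity \<Phi> t q"
  by (rule covec_eq_iff[THEN iffD2], rule allI)
    (simp add: vec_apply[OF alternating_velocity_field] velocity_field_def blinfun.bilinear_simps)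

context
  fixes \<Phi> :: "real \<Rightarrow> 'm \<Rightarrow> 'm"
  assumes \<Phi>: "smooth_map_family A \<Phi>" and diffeo: "\<And>t. diffeo A (\<Phi> t)"
begin

lemma velocity_derivative:
  "((\<lambda>s. coord A (\<Phi> t p) (\<Phi> s p)) has_vector_derivative velocity \<Phi> t (\<Phi> t p)) (at t)"
proof -
  define c where "c = chart_at A p"
  define c' where "c' = chart_at A (\<Phi> t p)"
  have c: "c \<in> A" "c' \<in> A" unfolding c_def c'_def by (simp_all add: chart_at_in)
  have xt: "(coord A p p, t) \<in> rept_dom c c' \<Phi>"
    unfolding rept_dom_iff c_def c'_def by (intro coord_in_rep_dom in_chart_at)
  have eq: "(\<lambda>s. coord A (\<Phi> t p) (\<Phi> s p)) = (\<lambda>s. rept c c' \<Phi> (coord A p p, s))"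
    unfolding rept_def c_def c'_def by (simp add: cinv_coord coord_def[of A "\<Phi> t p"])
  have "((\<lambda>s. (coord A p p, s)) has_derivative (\<lambda>h. (0, h))) (at t)"
    by (intro has_derivative_Pair has_derivative_ident has_derivative_const)
  from has_derivative_smooth_compose[OF smooth_rept[OF \<Phi> c] _ this] xt
  have d: "((\<lambda>s. coord A (\<Phi> t p) (\<Phi> s p)) has_derivative (\<lambda>h. D (rept c c' \<Phi>) (coord A p p, t) (0, h))) (at t)"
    unfolding eq by simp
  then have e: "velocity \<Phi> t (\<Phi> t p) = D (rept c c' \<Phi>) (coord A p p, t) (0, 1)"
    unfolding velocity_def diffeo_inv_apply(1)[OF diffeo] by (simp add: D_eqI)
  have e': "D (rept c c' \<Phi>) (coord A p p, t) (0, h) = h *\<^sub>R D (rept c c' \<Phi>) (coord A p p, t) (0, 1)" for h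
    using linear_scale[OF smooth_on_linear_D[OF smooth_rept[OF \<Phi> c] xt], of h "(0, 1)"] by simp
  show ?thesis unfolding has_vector_derivative_def e e'[symmetric] by (rule d)
qed

lemma velocity_flow:
  "((\<lambda>s. coord A (\<Phi> t p) (\<Phi> s p)) has_vector_derivative - vec (velocity_field \<Phi> t (\<Phi> t p))) (at t)"
  unfolding vec_velocity_field using velocity_derivative by simp

text \<open>In charts the velocity at y is the time derivative of \<open>rept\<close> at the
  preimage of y under \<Phi>_t, so smoothness in y and t again rests on the inverse family.\<close>

lemma smooth_velocity_field: "smooth_mvec_family A 1 (velocity_field \<Phi>)"
proof (rule smooth_mvec_familyI[OF alternating_velocity_field])
  define \<Psi> where "\<Psi> = (\<lambda>t. inv (\<Phi> t))"
  have \<Psi>: "smooth_map_family A \<Psi>" unfolding \<Psi>_def by (rule smooth_map_family_inverse[OF \<Phi> diffeo])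
  have \<Phi>\<Psi>: "\<Phi> t (\<Psi> t p) = p" for t p unfolding \<Psi>_def by (rule diffeo_inv_apply(2)[OF diffeo])
  fix c \<xi>s assume c: "c \<in> A"
  show "smooth_on (cimage c \<times> UNIV) (\<lambda>z. mvec_chart c (velocity_field \<Phi>) z \<xi>s)"
  proof (cases "length \<xi>s = 1")
    case False
    then have "mvec_chart c (velocity_field \<Phi>) z \<xi>s = 0" for z
      unfolding mvec_in_def velocity_field_def by simp
    then show ?thesis using smooth_on_const[OF open_cyl[OF c]] by simp
  next
    case True
    then obtain \<xi> where \<xi>s: "\<xi>s = [\<xi>]" by (auto simp: length_Suc_conv)
    show ?thesis
    proof (rule smooth_on_local)
      fix z assume z: "z \<in> cimage c \<times> (UNIV::real set)"
      define c' where "c' = chart_at A (\<Psi> (snd z) (cinv c (fst z)))"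
      let ?U = "rept_dom c c' \<Psi>" and ?g = "rept c c' \<Psi>" and ?f = "rept c' c \<Phi>"
      have c': "c' \<in> A" unfolding c'_def by (rule chart_at_in)
      note U = open_rept_dom[OF \<Psi> c c'] and g = smooth_rept[OF \<Psi> c c']
        and V = open_rept_dom[OF \<Phi> c' c] and f = smooth_rept[OF \<Phi> c' c]
      have zU: "z \<in> ?U" using z in_chart_at unfolding rept_dom_def c'_def by auto
      let ?G = "\<lambda>y. (?g y, snd y)"
      have G: "smooth_on ?U ?G" by (intro smooth_on_Pair U g smooth_on_snd)
      have GV: "?G y \<in> rept_dom c' c \<Phi>" "cinv c' (?g y) = \<Psi> (snd y) (cinv c (fst y))" if "y \<in> ?U" for y
        using that c c' unfolding rept_dom_def rept_def
        by (auto simp: cinv_chart chart_in \<Phi>\<Psi> cinv_in)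
      have "smooth_on ?U (\<lambda>y. D ?f (?G y) (0, 1))"
        by (rule smooth_on_D_apply[OF U V _ G f smooth_on_const[OF U]]) (use GV in auto)
      then have "smooth_on ?U (\<lambda>y. - blinfun_apply \<xi> (D ?f (?G y) (0, 1)))"
        by (intro smooth_on_minus U smooth_on_bounded_linear_compose[OF U blinfun.bounded_linear_right])
      then have "smooth_on ?U (\<lambda>z. mvec_chart c (velocity_field \<Phi>) z \<xi>s)"
      proof (rule smooth_on_eqI[OF U])
        fix y assume y: "y \<in> ?U"
        define q where "q = cinv c (fst y)"
        define t where "t = snd y"
        have q: "q \<in> fst c" using y cinv_in[OF c] unfolding q_def rept_dom_def by auto
        have p: "\<Phi> t (cinv c' (?g y)) = q" unfolding GV(2)[OF y] q_def t_def by (rule \<Phi>\<Psi>)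
        have "(?g y, t) \<in> rept_dom c' c \<Phi>" using GV(1)[OF y] unfolding t_def .
        from rept_velocity[OF \<Phi> c' c this velocity_derivative]
        have "D ?f (?G y) (0, 1) = to_chart A c q (velocity \<Phi> t q)"
          unfolding p by (simp add: t_def)
        then show "mvec_chart c (velocity_field \<Phi>) y \<xi>s = - blinfun_apply \<xi> (D ?f (?G y) (0, 1))"
          unfolding \<xi>s mvec_in_covec_map q_def[symmetric] t_def[symmetric]
          by (simp add: velocity_field_def covec_map_apply linear_to_chart c q)
      qed
      then show "\<exists>U. open U \<and> z \<in> U \<and> smooth_on U (\<lambda>z. mvec_chart c (velocity_field \<Phi>) z \<xi>s)"
        using U zU by blast
    qed
  qed
qed

end

section \<open>Leaves and orbits\<close>

text \<open>Rescaled time joins the identity to any \<Phi>_t within a unit of time, which puts every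
  member of an isotopy into \<open>Diff0\<close>.\<close>

lemma smooth_map_family_rescale:
  assumes "smooth_map_family A \<Phi>" shows "smooth_map_family A (\<lambda>s. \<Phi> (s * r))"
  unfolding smooth_map_family_def
proof (intro conjI ballI)
  have "continuous_on UNIV (\<lambda>z. \<Phi> (snd z) (fst z))"
    using assms unfolding smooth_map_family_def by (simp add: case_prod_unfold)
  moreover have "continuous_on UNIV (\<lambda>z::'m \<times> real. (fst z, snd z * r))"
    by (intro continuous_on_Pair continuous_on_mult continuous_on_fst continuous_on_snd continuous_on_id continuous_on_const)
  ultimately have "continuous_on UNIV (\<lambda>z. \<Phi> (snd z * r) (fst z))"
    using continuous_on_compose2[of UNIV "\<lambda>z. \<Phi> (snd z) (fst z)" UNIV "\<lambda>z. (fst z, snd z * r)"] by simp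
  then show "continuous_on UNIV (\<lambda>(p, s). \<Phi> (s * r) p)" by (simp add: case_prod_unfold)
  fix c c' assume c: "c \<in> A" "c' \<in> A"
  let ?S = "{(x, t). x \<in> cimage c \<and> \<Phi> (t * r) (cinv c x) \<in> fst c'}"
  let ?h = "\<lambda>z::'e \<times> real. (fst z, snd z * r)"
  have S: "?S = ?h -` rept_dom c c' \<Phi>" unfolding rept_dom_def by auto
  have "continuous_on UNIV ?h"
    by (intro continuous_on_Pair continuous_on_mult continuous_on_fst continuous_on_snd continuous_on_id continuous_on_const)
  then have o: "open ?S" unfolding S using open_vimage[OF open_rept_dom[OF assms c]] by blast
  have h: "smooth_on ?S ?h"
    by (intro smooth_on_Pair smooth_on_bounded_linear_compose[OF o bounded_linear_mult_left] smooth_on_fst smooth_on_snd o)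
  have "smooth_on ?S (\<lambda>z. rept c c' \<Phi> (?h z))"
    by (rule smooth_on_compose[OF o open_rept_dom[OF assms c] _ h smooth_rept[OF assms c]]) (auto simp: S)
  then show "smooth_on ?S (\<lambda>(x, t). snd c' (\<Phi> (t * r) (cinv c x)))"
    unfolding rept_def by (simp add: case_prod_unfold)
qed

lemma isotopy_Diff0: "isotopy A \<Phi> \<Longrightarrow> \<Phi> t \<in> Diff0 A"
  unfolding Diff0_def isotopy_def
  using smooth_map_family_rescale[of \<Phi> t] by (intro CollectI exI[of _ "\<lambda>s. \<Phi> (s * t)"]) auto

lemma Diff0_diffeo: "\<phi> \<in> Diff0 A \<Longrightarrow> diffeo A \<phi>"
  unfolding Diff0_def isotopy_def by auto

text \<open>The tangent maps of a diffeomorphism are bijective, so every list of vectors at q is the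
  image of one at the preimage of q, and pullback loses no information.\<close>

lemma pullback_surj:
  assumes \<phi>: "diffeo A \<phi>" and eq: "\<And>p vs. length vs = k \<Longrightarrow> pullback A \<phi> \<omega> p vs = pullback A \<phi> \<omega>' p vs"
    and len: "length us = k"
  shows "\<omega> q us = \<omega>' q us"
proof -
  define p where "p = inv \<phi> q"
  have q: "\<phi> p = q" unfolding p_def by (rule diffeo_inv_apply(2)[OF \<phi>])
  define vs where "vs = map (tangent_map A (inv \<phi>) (\<phi> p)) us"
  have "map (tangent_map A \<phi> p) vs = us"
    unfolding vs_def by (simp add: o_def tangent_map_inv[OF \<phi>])
  then show ?thesis using eq[of vs p] len unfolding pullback_def q vs_def by simp
qed

section \<open>The two inclusions\<close>

context
  fixes H :: "('m, 'e) form_field" and P :: "('m, 'e) mvec_field"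
  assumes m: "(H, P) \<in> MC A"
begin

text \<open>The orbit curve of the group path is itself the tangent path: X_t is minus the velocity
  of \<Phi>_t, and B_t is what remains of the derivative of the gauge part once \<iota>_X H is taken
  off.\<close>

lemma orbit_subset_leaf: "orbit A (H, P) \<subseteq> leaf A (H, P)"
proof
  fix x assume "x \<in> orbit A (H, P)"
  then obtain g where x: "x = act A (g 1) (H, P)" and g: "group_path A g" and act: "\<And>t. act_defined A (g t) (H, P)"
    unfolding orbit_def by auto
  define b where "b t = fst (g t)" for t
  define \<Phi> where "\<Phi> t = snd (g t)" for t
  define \<Psi> where "\<Psi> t = inv (\<Phi> t)" for t
  have gt: "g t = (b t, \<Phi> t)" for t unfolding b_def \<Phi>_def by simp
  have b: "smooth_form_family A 2 b" and \<Phi>: "smooth_map_family A \<Phi>" and \<Phi>0: "\<Phi> 0 = id" and b0: "b 0 = (\<lambda>p vs. 0)"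
    and diffeo: "diffeo A (\<Phi> t)" for t
    using g Diff0_diffeo unfolding group_path_def gauge_group_def b_def[abs_def] \<Phi>_def[abs_def] by (auto simp: mem_Times_iff)
  have \<Psi>: "smooth_map_family A \<Psi>" unfolding \<Psi>_def[abs_def] by (rule smooth_map_family_inverse[OF \<Phi> diffeo])
  have H: "H \<in> forms A 3" "\<And>p vs. de_rham A H p vs = 0" and P: "P \<in> mvecs A 2"
    using m unfolding MC_iff by auto
  \<comment> \<open>The form moved back to the start of the isotopy: acting by (b_t, \<Phi>_t) is
    the gauge transformation by b'_t of the fixed pair (H, P), followed by transport along
    \<Phi>_t.\<close>
  define b' where "b' t = pullback A (\<Phi> t) (b t)" for t
  have b': "smooth_form_family A 2 b'" unfolding b'_def[abs_def] by (rule smooth_form_family_pullback[OF \<Phi> b])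
  note bt = smooth_form_family_slice[OF b] and b't = smooth_form_family_slice[OF b']
  have R: "pushforward A (\<Phi> t) P \<in> mvecs A 2" for t
    using smooth_mvec_family_slice[OF smooth_mvec_family_pushforward[OF \<Phi> diffeo smooth_mvec_family_const[OF P]]] .
  have inv: "gauge_invertible (b' t) P" for t
    using act[of t] act_defined_iff[OF diffeo bt b't[unfolded b'_def] P R] unfolding gt b'_def by simp
  note bij = inv[unfolded gauge_invertible_iff, rule_format]
  define Q where "Q t = gauge_bivector (b' t) P" for t
  have Q: "smooth_mvec_family A 2 Q"
    unfolding Q_def[abs_def] by (rule smooth_mvec_family_gauge[OF b' smooth_mvec_family_const[OF P] inv])
  define K where "K t = (\<lambda>p vs. H p vs - de_rham A (b' t) p vs)" for t
  note db' = smooth_form_family_de_rham[OF b']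
  have K: "smooth_form_family A 3 K"
    unfolding K_def[abs_def] by (rule smooth_form_family_diff[OF smooth_form_family_const[OF H(1)] db'])
  define Hc where "Hc t = pullback A (\<Psi> t) (K t)" for t
  define Pc where "Pc t = pushforward A (\<Phi> t) (Q t)" for t
  have Hc: "smooth_form_family A 3 Hc" unfolding Hc_def[abs_def] by (rule smooth_form_family_pullback[OF \<Psi> K])
  have Pc: "smooth_mvec_family A 2 Pc" unfolding Pc_def[abs_def] by (rule smooth_mvec_family_pushforward[OF \<Phi> diffeo Q])
  note Hct = smooth_form_family_slice[OF Hc] and Pct = smooth_mvec_family_slice[OF Pc]
  define c where "c t = (Hc t, Pc t)" for t
  have MC: "(Hc t, Pc t) \<in> MC A" for t
  proof -
    have "(K t, Q t) \<in> MC A" unfolding K_def Q_def by (rule gauge_MC[OF m b't inv])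
    from diffeo_MC[OF this diffeo] show ?thesis
      using Hct[of t] Pct[of t] unfolding Hc_def Pc_def \<Psi>_def by blast
  qed
  then have closed: "de_rham A (Hc t) p vs = 0" for t p vs unfolding MC_iff by auto
  have \<Psi>b': "pullback A (\<Psi> t) (b' t) = b t" for t
    unfolding \<Psi>_def b'_def by (rule pullback_inv'[OF diffeo])
  have act_c: "act A (g t) (H, P) = c t" for t
  proof -
    have "pullback A (\<Psi> t) (K t) = (\<lambda>p vs. pullback A (\<Psi> t) H p vs - de_rham A (b t) p vs)"
      using de_rham_pullback[OF _ b't smooth_map_family_slice[OF \<Psi>], of t t] unfolding \<Psi>b' K_def
      by (auto simp: fun_eq_iff) (simp add: pullback_def)
    then show ?thesis
      using act_eq[OF diffeo bt b't[unfolded b'_def] P R inv[unfolded b'_def], of t H] Pct[of t]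
      unfolding gt c_def Hc_def Pc_def Q_def b'_def \<Psi>_def by simp
  qed
  have c0: "c 0 = (H, P)"
  proof -
    have b'0: "b' 0 = (\<lambda>p vs. 0)" unfolding b'_def b0 \<Phi>0 pullback_id ..
    have "gauge_map (\<lambda>vs. 0) (P p) \<xi> = \<xi>" for p \<xi>
      unfolding gauge_map_def flat_def by (simp add: Blinfun_zero)
    then have "gauge_map (\<lambda>vs. 0) (P p) = id" for p by (simp add: fun_eq_iff)
    then have "Q 0 p [\<xi>, \<eta>] = P p [\<xi>, \<eta>]" for p \<xi> \<eta>
      unfolding Q_def b'0 gauge_bivector_apply by simp
    then have "Q 0 p = P p" for p
      by (intro alternating2_eqI smooth_mvec_family_alternating[OF Q] mvecs_alternating[OF P])
    then have "Q 0 = P" by (rule ext)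
    moreover have "K 0 = H" unfolding K_def b'0 de_rham_zero by simp
    ultimately show ?thesis
      unfolding c_def Hc_def Pc_def \<Psi>_def \<Phi>0 by (simp add: pullback_id pushforward_id)
  qed
  define X where "X = velocity_field \<Phi>"
  have X: "smooth_mvec_family A 1 X" unfolding X_def by (rule smooth_velocity_field[OF \<Phi> diffeo])
  have flow: "((\<lambda>s. coord A (\<Phi> t p) (\<Phi> s p)) has_vector_derivative - vec (X t (\<Phi> t p))) (at t)" for t p
    unfolding X_def by (rule velocity_flow[OF \<Phi> diffeo])
  define \<beta>' where "\<beta>' = tderiv b'"
  have \<beta>': "smooth_form_family A 2 \<beta>'" unfolding \<beta>'_def by (rule smooth_form_family_tderiv[OF b'])
  define \<beta> where "\<beta> t = pullback A (\<Psi> t) (\<beta>' t)" for t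
  have \<beta>: "smooth_form_family A 2 \<beta>" unfolding \<beta>_def[abs_def] by (rule smooth_form_family_pullback[OF \<Psi> \<beta>'])
  have \<Phi>\<beta>: "pullback A (\<Phi> t) (\<beta> t) = \<beta>' t" for t unfolding \<beta>_def \<Psi>_def by (rule pullback_inv[OF diffeo])
  have \<iota>: "smooth_form_family A 2 (\<lambda>t. contract (X t) (Hc t))"
    using smooth_form_family_contract[OF X, of 2 Hc] Hc by (simp add: numeral_3_eq_3 numeral_2_eq_2)
  \<comment> \<open>The explicit vector field contains B only through \<beta> = B + \<iota>_X H.
    Here \<beta> is prescribed as the time derivative of b' carried to time t, and B is solved
    for.\<close>
  define B where "B t = (\<lambda>p vs. \<beta> t p vs - contract (X t) (Hc t) p vs)" for t
  have B: "smooth_form_family A 2 B" unfolding B_def[abs_def] by (rule smooth_form_family_diff[OF \<beta> \<iota>])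
  note Xt = smooth_mvec_family_slice[OF X] and Bt = smooth_form_family_slice[OF B]
    and \<beta>t = smooth_form_family_slice[OF \<beta>] and \<iota>t = smooth_form_family_slice[OF \<iota>]
  have dB: "de_rham A (B t) p vs = de_rham A (\<beta> t) p vs - de_rham A (contract (X t) (Hc t)) p vs" for t p vs
    unfolding B_def by (rule de_rham_diff[OF \<beta>t \<iota>t])
  have Hder: "tderiv Hc t q us = - de_rham A (B t) q us" for t q us
  proof (cases "length us = 3")
    case True
    show ?thesis
    proof (rule pullback_surj[OF diffeo _ True, where \<omega>' = "\<lambda>q us. - de_rham A (B t) q us"])
      fix p vs assume len: "length (vs :: 'e list) = 3"
      have "pullback A (\<Phi> s) (Hc s) p vs = H p vs - de_rham A (b' s) p vs" for s
        unfolding Hc_def \<Psi>_def pullback_inv[OF diffeo] K_def ..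
      moreover have "((\<lambda>s. H p vs - de_rham A (b' s) p vs) has_real_derivative 0 - de_rham A (\<beta>' t) p vs) (at t)"
        unfolding \<beta>'_def by (intro DERIV_diff DERIV_const de_rham_tderiv[OF b'])
      ultimately have "pullback A (\<Phi> t) (\<lambda>q us. tderiv Hc t q us - de_rham A (contract (X t) (Hc t)) q us) p vs
          = - de_rham A (\<beta>' t) p vs"
        using DERIV_unique[OF path_form[OF \<Phi> diffeo X flow Hc closed len]] by simp
      moreover have "de_rham A (\<beta>' t) p vs = pullback A (\<Phi> t) (de_rham A (\<beta> t)) p vs"
        using de_rham_pullback[OF _ \<beta>t smooth_map_family_slice[OF \<Phi>], of t t] unfolding \<Phi>\<beta> by simp
      ultimately show "pullback A (\<Phi> t) (tderiv Hc t) p vs = pullback A (\<Phi> t) (\<lambda>q us. - de_rham A (B t) q us) p vs"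
        unfolding pullback_def dB by simp
    qed
  next
    case False
    then show ?thesis
      using alternating_length[OF smooth_form_family_alternating[OF smooth_form_family_tderiv[OF Hc]]]
        alternating_length[OF smooth_form_family_alternating[OF smooth_form_family_de_rham[OF B]]] by simp
  qed
  have Qder: "tderiv Q t p [\<xi>, \<eta>] = \<beta>' t p [anchor (Q t p) \<xi>, anchor (Q t p) \<eta>]" for t p \<xi> \<eta>
  proof (rule gauge_path_derivative[where b = "\<lambda>s. b' s p" and P = "P p" and Q = "\<lambda>s. Q s p" and \<beta> = "\<beta>' t p" and Q' = "tderiv Q t p"])
    show "((\<lambda>s. b' s p vs) has_real_derivative \<beta>' t p vs) (at t)" for vs
      unfolding \<beta>'_def by (rule form_tderiv[OF b'])
    show "((\<lambda>s. Q s p [\<xi>, \<eta>]) has_real_derivative tderiv Q t p [\<xi>, \<eta>]) (at t)" for \<xi> \<eta>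
      by (rule mvec_tderiv[OF Q])
    show "anchor (Q s p) (gauge_map (b' s p) (P p) \<xi>) = anchor (P p) \<xi>" for s \<xi>
      unfolding Q_def by (rule anchor_gauge_bivector[OF forms_alternating[OF b't] mvecs_alternating[OF P] bij])
    show "surj (gauge_map (b' t p) (P p))" using bij by (simp add: bij_is_surj)
  qed (auto intro: smooth_form_family_alternating[OF b'] smooth_mvec_family_alternating[OF Q] mvecs_alternating[OF P])
  \<comment> \<open>The equation is moved back to p, where the derivative of \<open>Q\<close> is
    known. The transport formula supplies the Lie derivative, and the contraction with H cancels
    against the one subtracted in \<open>B\<close>.\<close>
  have Pder: "tderiv Pc t q [\<xi>, \<eta>] = snd (gauge_field A (B t, X t) (Hc t, Pc t)) q [\<xi>, \<eta>]" for t q \<xi> \<eta>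
  proof -
    define p where "p = \<Psi> t q"
    have q: "q = \<Phi> t p" unfolding p_def \<Psi>_def by (simp add: diffeo_inv_apply[OF diffeo])
    let ?T = "tangent_map A (\<Phi> t) p"
    have QP: "(\<lambda>t. pushforward A (inv (\<Phi> t)) (Pc t)) = Q"
      unfolding Pc_def pushforward_inv'[OF diffeo] ..
    have an: "?T (anchor (Q t p) (covec_map ?T \<xi>)) = anchor (Pc t q) \<xi>" for \<xi>
      by (rule anchor_pushforward[OF linear_tangent_map[OF smooth_map_family_slice[OF \<Phi>]]
            smooth_mvec_family_alternating[OF Q] smooth_mvec_family_alternating[OF Pc], symmetric])
        (simp add: Pc_def q pushforward_apply[OF diffeo])
    have "tderiv Q t p [covec_map ?T \<xi>, covec_map ?T \<eta>] = tderiv Pc t q [\<xi>, \<eta>] - lie_mvec (X t) (Pc t) q \<xi> \<eta>"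
      using path_mvec[OF \<Phi> diffeo X flow Pc, of t p \<xi> \<eta>] unfolding QP q .
    moreover have "tderiv Q t p [covec_map ?T \<xi>, covec_map ?T \<eta>] = \<beta> t q [anchor (Pc t q) \<xi>, anchor (Pc t q) \<eta>]"
      unfolding Qder \<Phi>\<beta>[symmetric] pullback_def by (simp add: an q[symmetric])
    ultimately show ?thesis
      unfolding gauge_field_mvec_eq(1)[OF Bt Xt Hct Pct] by (simp add: B_def contract_def)
  qed
  have "tangent_path A c"
    unfolding tangent_path_def
  proof (intro conjI allI exI[of _ B] exI[of _ X])
    show "c t \<in> MC A" for t unfolding c_def by (rule MC)
    show "smooth_form_family A 3 (\<lambda>t. fst (c t))" unfolding c_def using Hc by simp
    show "smooth_mvec_family A 2 (\<lambda>t. snd (c t))" unfolding c_def using Pc by simp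
    show "smooth_form_family A 2 B" "smooth_mvec_family A 1 X" by (rule B, rule X)
    have "isotopy A \<Phi>" unfolding isotopy_def using \<Phi> \<Phi>0 diffeo by blast
    moreover have "vec (\<lambda>\<eta>s. - X t p \<eta>s) = - vec (X t p)" for t p
      unfolding vec_def by (simp add: sum_negf)
    ultimately show "complete_vf A (\<lambda>t p \<eta>s. - X t p \<eta>s)"
      unfolding complete_vf_def using flow by auto
    show "((\<lambda>s. fst (c s) p vs) has_real_derivative fst (gauge_field A (B t, X t) (c t)) p vs) (at t)" for t p vs
      using form_tderiv[OF Hc, of p vs t] unfolding c_def fst_conv gauge_field_form Hder .
    show "((\<lambda>s. snd (c s) p \<eta>s) has_real_derivative snd (gauge_field A (B t, X t) (c t)) p \<eta>s) (at t)" for t p \<eta>s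
    proof (cases "length \<eta>s = 2")
      case True
      then obtain \<xi> \<eta> where "\<eta>s = [\<xi>, \<eta>]" by (auto simp: numeral_2_eq_2 length_Suc_conv)
      then show ?thesis using mvec_tderiv[OF Pc, of p \<eta>s t] unfolding c_def snd_conv by (simp add: Pder)
    next
      case False
      then show ?thesis
        unfolding c_def snd_conv gauge_field_mvec_eq(2)[OF Bt Xt Hct Pct False]
        by (simp add: alternating_length[OF smooth_mvec_family_alternating[OF Pc]])
    qed
  qed
  then show "x \<in> leaf A (H, P)" unfolding leaf_def using c0 x act_c by auto
qed

text \<open>The group path is read off from the tangent path: \<Phi> is the flow of -X provided by
  completeness, and b' is the time integral of the pulled back \<beta>. That the action is defined
  at all times is a result, deduced from the bivector path that already exists.\<close>

lemma leaf_subset_orbit: "leaf A (H, P) \<subseteq> orbit A (H, P)"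
proof
  fix x assume "x \<in> leaf A (H, P)"
  then obtain c where x: "x = c 1" and tp: "tangent_path A c" and c0: "c 0 = (H, P)" unfolding leaf_def by auto
  define Hc where "Hc t = fst (c t)" for t
  define Pc where "Pc t = snd (c t)" for t
  have ct: "c t = (Hc t, Pc t)" for t unfolding Hc_def Pc_def by simp
  have H0: "Hc 0 = H" "Pc 0 = P" unfolding Hc_def Pc_def c0 by simp_all
  obtain B X where MC: "\<And>t. (Hc t, Pc t) \<in> MC A" and Hc: "smooth_form_family A 3 Hc" and Pc: "smooth_mvec_family A 2 Pc"
    and B: "smooth_form_family A 2 B" and X: "smooth_mvec_family A 1 X" and cv: "complete_vf A (\<lambda>t p \<eta>s. - X t p \<eta>s)"
    and Hder': "\<And>t p vs. ((\<lambda>s. Hc s p vs) has_real_derivative fst (gauge_field A (B t, X t) (Hc t, Pc t)) p vs) (at t)"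
    and Pder': "\<And>t p \<eta>s. ((\<lambda>s. Pc s p \<eta>s) has_real_derivative snd (gauge_field A (B t, X t) (Hc t, Pc t)) p \<eta>s) (at t)"
    using tp unfolding tangent_path_def ct fst_conv snd_conv by auto
  have "vec (\<lambda>\<eta>s. - X t p \<eta>s) = - vec (X t p)" for t p
    unfolding vec_def by (simp add: sum_negf)
  then obtain \<Phi> where iso: "isotopy A \<Phi>"
    and flow: "\<And>t p. ((\<lambda>s. coord A (\<Phi> t p) (\<Phi> s p)) has_vector_derivative - vec (X t (\<Phi> t p))) (at t)"
    using cv unfolding complete_vf_def by auto
  have \<Phi>: "smooth_map_family A \<Phi>" and diffeo: "diffeo A (\<Phi> t)" and \<Phi>0: "\<Phi> 0 = id" for t
    using iso unfolding isotopy_def by auto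
  define \<Psi> where "\<Psi> t = inv (\<Phi> t)" for t
  have \<Psi>: "smooth_map_family A \<Psi>" unfolding \<Psi>_def[abs_def] by (rule smooth_map_family_inverse[OF \<Phi> diffeo])
  have H: "H \<in> forms A 3" and P: "P \<in> mvecs A 2" using m unfolding MC_iff by auto
  have closed: "de_rham A (Hc t) p vs = 0" for t p vs using MC[of t] unfolding MC_iff by auto
  have \<iota>: "smooth_form_family A 2 (\<lambda>t. contract (X t) (Hc t))"
    using smooth_form_family_contract[OF X, of 2 Hc] Hc by (simp add: numeral_3_eq_3 numeral_2_eq_2)
  define \<beta> where "\<beta> t = (\<lambda>p vs. B t p vs + contract (X t) (Hc t) p vs)" for t
  have \<beta>: "smooth_form_family A 2 \<beta>" unfolding \<beta>_def[abs_def] by (rule smooth_form_family_add[OF B \<iota>])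
  note Xt = smooth_mvec_family_slice[OF X] and Bt = smooth_form_family_slice[OF B]
    and \<beta>t = smooth_form_family_slice[OF \<beta>] and \<iota>t = smooth_form_family_slice[OF \<iota>]
    and Hct = smooth_form_family_slice[OF Hc] and Pct = smooth_mvec_family_slice[OF Pc]
  define \<beta>' where "\<beta>' t = pullback A (\<Phi> t) (\<beta> t)" for t
  have \<beta>': "smooth_form_family A 2 \<beta>'" unfolding \<beta>'_def[abs_def] by (rule smooth_form_family_pullback[OF \<Phi> \<beta>])
  define b' where "b' = tint \<beta>'"
  have b': "smooth_form_family A 2 b'" unfolding b'_def by (rule smooth_form_family_tint[OF \<beta>'])
  have b'der: "((\<lambda>s. b' s p vs) has_real_derivative \<beta>' t p vs) (at t)" for t p vs
    unfolding b'_def by (rule tint_derivative[OF \<beta>'])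
  have b'0: "b' 0 = (\<lambda>p vs. 0)" unfolding b'_def by (simp add: tint_def[abs_def])
  define b where "b t = pullback A (\<Psi> t) (b' t)" for t
  have b: "smooth_form_family A 2 b" unfolding b_def[abs_def] by (rule smooth_form_family_pullback[OF \<Psi> b'])
  have \<Phi>b: "pullback A (\<Phi> t) (b t) = b' t" for t unfolding b_def \<Psi>_def by (rule pullback_inv[OF diffeo])
  note bt = smooth_form_family_slice[OF b] and b't = smooth_form_family_slice[OF b']
  \<comment> \<open>The sum of the pulled back form and db' has zero derivative in time, hence keeps
    its value H at t = 0.\<close>
  have K: "pullback A (\<Phi> t) (Hc t) p vs = H p vs - de_rham A (b' t) p vs" for t p vs
  proof (cases "length vs = 3")
    case True
    have "((\<lambda>s. pullback A (\<Phi> s) (Hc s) p vs) has_real_derivative - de_rham A (\<beta>' t) p vs) (at t)" for t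
    proof -
      have "tderiv Hc t q us = - de_rham A (B t) q us" for q us
        using tderiv_unique[OF Hder'] unfolding gauge_field_form .
      then have "tderiv Hc t q us - de_rham A (contract (X t) (Hc t)) q us = - de_rham A (\<beta> t) q us" for q us
        unfolding \<beta>_def de_rham_add[OF Bt \<iota>t] by simp
      moreover have "de_rham A (\<beta>' t) p vs = pullback A (\<Phi> t) (de_rham A (\<beta> t)) p vs"
        using de_rham_pullback[OF _ \<beta>t smooth_map_family_slice[OF \<Phi>], of t t] unfolding \<beta>'_def by simp
      ultimately show ?thesis
        using path_form[OF \<Phi> diffeo X flow Hc closed True, of p t] unfolding pullback_def by simp
    qed
    moreover have "((\<lambda>s. de_rham A (b' s) p vs) has_real_derivative de_rham A (\<beta>' t) p vs) (at t)" for t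
    proof -
      have "tderiv b' t = \<beta>' t" using tderiv_unique[OF b'der] by (intro ext)
      then show ?thesis using de_rham_tderiv[OF b', of p vs t] by simp
    qed
    ultimately have "((\<lambda>s. pullback A (\<Phi> s) (Hc s) p vs + de_rham A (b' s) p vs) has_real_derivative
        - de_rham A (\<beta>' t) p vs + de_rham A (\<beta>' t) p vs) (at t)" for t
      by (intro DERIV_add)
    then have "pullback A (\<Phi> t) (Hc t) p vs + de_rham A (b' t) p vs = pullback A (\<Phi> 0) (Hc 0) p vs + de_rham A (b' 0) p vs"
      by (intro DERIV_isconst_all) simp
    then show ?thesis unfolding \<Phi>0 H0 b'0 pullback_id de_rham_zero by simp
  next
    case False
    then show ?thesis
      using alternating_length[OF smooth_form_family_alternating[OF smooth_form_family_pullback[OF \<Phi> Hc]]]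
        alternating_length[OF forms_alternating[OF H]]
        alternating_length[OF smooth_form_family_alternating[OF smooth_form_family_de_rham[OF b']]] by simp
  qed
  define Q where "Q t = pushforward A (inv (\<Phi> t)) (Pc t)" for t
  have Q: "smooth_mvec_family A 2 Q"
    unfolding Q_def[abs_def]
    by (rule smooth_mvec_family_pushforward[OF \<Psi>[unfolded \<Psi>_def[abs_def]] diffeo_inv[OF diffeo] Pc])
  have PcQ: "Pc t = pushforward A (\<Phi> t) (Q t)" for t unfolding Q_def by (simp add: pushforward_inv[OF diffeo])
  have Qder: "((\<lambda>s. Q s p [\<xi>, \<eta>]) has_real_derivative \<beta>' t p [anchor (Q t p) \<xi>, anchor (Q t p) \<eta>]) (at t)" for t p \<xi> \<eta>
  proof -
    define q where "q = \<Phi> t p"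
    let ?T = "tangent_map A (\<Phi> t) p"
    \<comment> \<open>The transport formula speaks of covectors pulled back from q; by surjectivity
      these are all covectors at p.\<close>
    have "surj (covec_map ?T)" using bij_covec_tangent[OF diffeo] by (simp add: bij_is_surj)
    then obtain \<xi>' \<eta>' where \<xi>: "\<xi> = covec_map ?T \<xi>'" "\<eta> = covec_map ?T \<eta>'" by (meson surjD)
    have an: "?T (anchor (Q t p) (covec_map ?T \<xi>)) = anchor (Pc t q) \<xi>" for \<xi>
      by (rule anchor_pushforward[OF linear_tangent_map[OF smooth_map_family_slice[OF \<Phi>]]
            smooth_mvec_family_alternating[OF Q] smooth_mvec_family_alternating[OF Pc], symmetric])
        (simp add: PcQ q_def pushforward_apply[OF diffeo])
    have "tderiv Q t p [\<xi>, \<eta>] = tderiv Pc t q [\<xi>', \<eta>'] - lie_mvec (X t) (Pc t) q \<xi>' \<eta>'"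
      using path_mvec[OF \<Phi> diffeo X flow Pc, of t p \<xi>' \<eta>'] unfolding Q_def[abs_def] q_def \<xi> .
    also have "\<dots> = \<beta> t q [anchor (Pc t q) \<xi>', anchor (Pc t q) \<eta>']"
      using tderiv_unique[where F = Pc and t = t and p = q and vs = "[\<xi>', \<eta>']", OF Pder'] unfolding gauge_field_mvec_eq(1)[OF Bt Xt Hct Pct]
      by (simp add: \<beta>_def contract_def)
    also have "\<dots> = \<beta>' t p [anchor (Q t p) \<xi>, anchor (Q t p) \<eta>]"
      unfolding \<beta>'_def pullback_def \<xi> by (simp add: an q_def[symmetric])
    finally show ?thesis using mvec_tderiv[OF Q, of p "[\<xi>, \<eta>]" t] by simp
  qed
  have Q0: "Q 0 = P" unfolding Q_def \<Phi>0 H0 by (simp add: pushforward_id)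
  note b'a = smooth_form_family_alternating[OF b'] and Qa = smooth_mvec_family_alternating[OF Q]
    and Pa = mvecs_alternating[OF P]
  \<comment> \<open>\<open>Q\<close> starts at P and b' at 0, so the defect of this relation, which
    obeys a linear equation, stays zero. Invertibility of the gauge map then follows from the
    existence of \<open>Q\<close>.\<close>
  have rel: "anchor (Q t p) (gauge_map (b' t p) (P p) \<xi>) = anchor (P p) \<xi>" for t p \<xi>
    by (rule gauge_path_unique[where b = "\<lambda>t. b' t p" and Q = "\<lambda>t. Q t p" and \<beta> = "\<lambda>t. \<beta>' t p" and P = "P p",
          OF b'a Qa b'der Qder smooth_on_continuous[OF smooth_form_family_time[OF \<beta>']]])
      (simp_all add: b'0 Q0)
  have bij: "bij (gauge_map (b' t p) (P p))" for t p by (rule bij_gauge_map[OF b'a Pa Qa rel])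
  then have inv: "gauge_invertible (b' t) P" for t unfolding gauge_invertible_iff by blast
  have Q_eq: "gauge_bivector (b' t) P = Q t" for t
  proof
    fix p
    show "gauge_bivector (b' t) P p = Q t p"
      by (rule gauge_unique[OF bij_is_surj[OF bij] alternating_gauge_bivector[where b = "b' t" and P = P, OF b'a Pa bij] Qa
            anchor_gauge_bivector[where b = "b' t" and P = P, OF b'a Pa bij] rel])
  qed
  have R: "pushforward A (\<Phi> t) P \<in> mvecs A 2" for t
    using smooth_mvec_family_slice[OF smooth_mvec_family_pushforward[OF \<Phi> diffeo smooth_mvec_family_const[OF P]]] .
  define g where "g t = (b t, \<Phi> t)" for t
  have "act_defined A (g t) (H, P)" for t
    unfolding g_def act_defined_iff[OF diffeo bt b't[folded \<Phi>b] P R] \<Phi>b by (rule inv)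
  moreover have "act A (g t) (H, P) = c t" for t
  proof -
    have "pullback A (\<Psi> t) (\<lambda>p vs. H p vs - de_rham A (b' t) p vs) = Hc t"
      unfolding K[symmetric] \<Psi>_def using pullback_inv'[OF diffeo, of t "Hc t"] by simp
    moreover have "pullback A (\<Psi> t) (\<lambda>p vs. H p vs - de_rham A (b' t) p vs) = (\<lambda>p vs. pullback A (\<Psi> t) H p vs - de_rham A (b t) p vs)"
      unfolding b_def using de_rham_pullback[OF _ b't smooth_map_family_slice[OF \<Psi>], of t t]
      by (auto simp: fun_eq_iff) (simp add: pullback_def)
    ultimately show ?thesis
      using act_eq[OF diffeo bt b't[folded \<Phi>b] P R, of t H] inv[of t] Pct[of t]
      unfolding g_def ct \<Phi>b Q_eq PcQ \<Psi>_def by simp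
  qed
  moreover have "group_path A g"
  proof -
    have "b 0 = (\<lambda>p vs. 0)" unfolding b_def b'0 by (simp add: pullback_def[abs_def])
    then show ?thesis
      unfolding group_path_def gauge_group_def g_def
      using bt isotopy_Diff0[OF iso] b \<Phi> \<Phi>0 by simp
  qed
  ultimately show "x \<in> orbit A (H, P)" unfolding orbit_def x by (auto intro!: exI[of _ g])
qed

end

end

theorem proposition2p16:
  fixes A :: "('m::{t2_space,second_countable_topology}, 'e::euclidean_space) atlas"
  assumes "smooth_atlas A"
  shows "\<forall>m\<in>MC A. leaf A m = orbit A m"
proof
  interpret smooth_manifold A by unfold_locales (rule assms)
  fix m assume "m \<in> MC A"
  moreover obtain H P where "m = (H, P)" by (cases m)
  ultimately show "leaf A m = orbit A m"
    using orbit_subset_leaf leaf_subset_orbit by blast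
qed

end
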